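(* Let $\hat{\mathbb Z}=\mathbb Z\cup\{u,v\}$ and consider the functions on $M_0\times\mathbb C^\times$, holomorphic in $\zeta$ near $\zeta=0$, $$\theta_\alpha(\zeta)=-\frac1{2\pi i}\oint_{|z|=1}\frac{(\lambda+\bar\lambda)^{\alpha+1}}{\alpha+1}e^{\frac{\bar\lambda-\lambda}{2}\zeta}\frac{dz}z\qquad(\alpha\in\mathbb Z,\ \alpha\ne-1),$$ $$\theta_{-1}(\zeta)=-\frac1{2\pi i}\oint_{|z|=1}\Big[e^{-\lambda\zeta}\Big(\log\big(1+\tfrac{\bar\lambda}\lambda\big)+\mathrm{Ein}(-\lambda\zeta)-1\Big)+e^{\frac{\bar\lambda-\lambda}2\zeta}\Big]\frac{dz}z,$$ $$\theta_v(\zeta)=\frac1{2\pi i}\oint_{|z|=1}\Big[-e^{-\lambda\zeta}\Big(\log\big(1+\tfrac{\bar\lambda}\lambda\big)+\mathrm{Ein}(-\lambda\zeta)-1\Big)+e^{\bar\lambda\zeta}\Big(\log(\bar\lambda(\lambda+\bar\lambda))-\mathrm{Ein}(\bar\lambda\zeta)-1\Big)\Big]\frac{dz}z,$$ $$\theta_u(\zeta)=\frac1{2\pi i}\oint_{|z|=1}\frac{e^{\bar\lambda\zeta}-1}\zeta\frac{dz}z,$$ and the functions, multivalued in $\zeta\in\mathbb C^\times$, $$y_\alpha(\zeta)=\zeta^{\alpha+\frac12}\theta_\alpha(\zeta)\ (\alpha\in\mathbb Z),\quad y_v(\zeta)=\zeta^{\frac12}\big(\zeta^{-1}\theta_v(\zeta)+2\log(\zeta)\,\theta_u(\zeta)\big),\quad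 y_u(\zeta)=\zeta^{\frac12}\theta_u(\zeta).$$ Then the family $\{y_{\hat\alpha}(\zeta)\}_{\hat\alpha\in\hat{\mathbb Z}}$ on $M_0\times\mathbb C^\times$ forms a Levelt basis of deformed flat coordinates for $M_0$.
   Context: **Manifold.** $D_0$ is the closed unit disc, $D_\infty$ the closure of its complement in $\mathbb C\cup\{\infty\}$, $\mathbb S^1$ the unit circle, $\mathcal H(K)$ the functions holomorphic near $K$. For $f=\sum f_kz^k\in\mathcal H(\mathbb S^1)$, $(f)_k=f_k$ and $(f)_{\ge0},(f)_{<0}$, etc. (also written as subscripts) are the truncations of the Laurent series. $M_0$ is the set of pairs $(\lambda,\bar\lambda)\in z\mathcal H(D_\infty)\oplus\frac1z\mathcal H(D_0)$, $\lambda=z+O(1)$ at $\infty$, $\bar\lambda=\bar u_{-1}z^{-1}+\bar u_0+\cdots$ at $0$ ($\bar\lambda$ is not a complex conjugate), such that, with $w=\lambda+\bar\lambda$: (i) $\bar u_{-1}\ne0$ and $w'\neq0$ on $\mathbb S^1$; (ii) the closed curve parametrized by $w|_{\mathbb S^1}$ is positively oriented, non-selfintersecting and encircles $0$; (iii) $\lambda$, $\bar\lambda$ do not vanish on $D_\infty$, $D_0$ respectively. Coordinates: $(w(z),v,u)$, $v=\bar u_0$, $e^u=\bar u_{-1}$. A vector is a triple $X=(X(z),X_v,X_u)=(\partial_Xw(z),\partial_Xv,\partial_Xu)\in\mathcal H(\mathbb S^1)\oplus\mathbb C^2$; a $1$-form is a triple $\alpha=(\alpha(z),\alpha_v,\alpha_u)\in\mathcal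 H(\mathbb S^1)\oplus\mathbb C^2$, with $\langle\alpha,X\rangle=\frac1{2\pi i}\oint_{|z|=1}\alpha(z)X(z)\frac{dz}z+\alpha_vX_v+\alpha_uX_u$. **Special functions.** $\mathrm{Ein}(z)=-\sum_{n\ge1}\frac{(-z)^n}{n!\,n}$. $\log(1+\bar\lambda/\lambda):=\log\frac{w}{z}-\log\frac\lambda z$, $\log(\bar\lambda(\lambda+\bar\lambda)):=\log(z\bar\lambda)+\log\frac wz$; these are holomorphic near $\mathbb S^1$, with $\log\frac\lambda z\in\frac1z\mathcal H(D_\infty)$, $\log(z\bar\lambda)\in\mathcal H(D_0)$ equal to $u$ at $z=0$, and the branch of $\log\frac wz$ fixed continuously. **Frobenius structure.** Metric map $\eta^*(\alpha)=(zw'(z)\alpha(z),\alpha_u,\alpha_v)$ from $T^*M_0$ to $TM_0$, $\eta(\alpha,\beta)=\langle\alpha,\eta^*(\beta)\rangle$; gradient $\nabla f=\eta^*(df)$. Christoffel operator $\Gamma_X(\alpha)=\big(\frac{\alpha'(z)X(z)}{w'(z)},0,0\big)$; covariant derivative of $1$-forms $\nabla_X\alpha=\partial_X\alpha-\Gamma_X(\alpha)$ (componentwise derivative at fixed $z$), extended to vectors by duality. $C_X:T^*M_0\to T^*M_0$, the transpose of the Frobenius multiplication by $X$ on $TM_0$, is $C_X(\alpha)=$ $$\Big(\tfrac{X}{zw'}\big[(zw'\alpha)_{>0}-(zw')_{>0}\alpha+z\alpha+\tfrac{e^u}z(\alpha+\alpha_v)+\alpha_u\big]+(X_{>0}\alpha)_{<0}-(X_{\le0}\alpha)_{\ge0}+\tfrac{e^u}zX_u(\alpha+\alpha_v)+X_v\alpha,$$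 $$(X\alpha)_0+X_u\alpha_u+X_v\alpha_v,\ \ \big(e^u(X+zw'X_u)(\alpha+\alpha_v)\big)_1-e^uX_u\alpha_v+X_v\alpha_u\Big),$$ where $X=X(z)$, $\alpha=\alpha(z)$ inside the functional expressions. Euler field $E=(w-zw',v,2)$; $\mathcal U=C_E$ on $T^*M_0$; $\mathcal V=\frac12-\nabla E$ on $TM_0$ (where $\nabla E:X\mapsto\nabla_XE$), and the same symbol denotes its transpose on $T^*M_0$. **Deformed flat functions.** A function $y$ on $M_0\times\mathbb C^\times$ is deformed flat if $\partial_X dy=(\Gamma_X+\zeta C_X)(dy)$ for every vector field $X$ on $M_0$, and $\partial_\zeta dy=(\mathcal U-\frac1\zeta\mathcal V)(dy)$, where $d$ is the differential along $M_0$ at fixed $\zeta$. A basis (system) of deformed flat coordinates is an independent family of deformed flat functions. **Flat coordinates.** $t^u=u$, $t^v=v$, $t^\alpha=\frac1{2\pi i}\oint_{|z|=1}\frac{w^{-\alpha}}\alpha\frac{dz}z$ ($\alpha\neq0$), $t^0=-\frac1{2\pi i}\oint_{|z|=1}\log\frac wz\frac{dz}z$; in them $\eta_{\alpha\beta}=\delta_{\alpha+\beta,-1}$, $\eta_{uv}=\eta_{vu}=1$, other entries zero. Indices are raised with this matrix: $y^\alpha=y_{-1-\alpha}$, $y^u=y_v$, $y^v=y_u$. On $TM_0$, $\mathcal V\nabla t^{\hat\alpha}=\mu_{\hat\alpha}\nabla t^{\hat\alpha}$ with $\mu_\alpha=-\alpha-\frac12$, $\mu_v=\frac12$, $\mu_u=-\frac12$.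 **Levelt basis.** A family $\{y_{\hat\alpha}\}_{\hat\alpha\in\hat{\mathbb Z}}$ of deformed flat coordinates is a Levelt basis (system), at $\zeta=0$, if the operator $Y$ on $TM_0$ determined by $Y(\nabla t^{\hat\alpha})=\nabla y^{\hat\alpha}$ factorizes as $Y=\Theta\,\zeta^{\mathcal V}\zeta^{R}$ where $\Theta$ is analytic at $\zeta=0$ with $\Theta|_{\zeta=0}=\mathrm{Id}$ and $R=R_1+R_2+\cdots$ is a nilpotent operator, constant in flat coordinates, with $R_{2n+1}$ symmetric and $R_{2n}$ skew-symmetric with respect to $\eta$, and $\zeta^{\mathcal V}R_k\zeta^{-\mathcal V}=\zeta^kR_k$. *)

theory Defs
  imports "HOL-Complex_Analysis.Complex_Analysis"
begin

section \<open>Laurent series on the unit circle\<close>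

definition cmean :: "(complex \<Rightarrow> complex) \<Rightarrow> complex" where
  "cmean f = 1 / (2 * of_real pi * \<i>) * contour_integral (circlepath 0 1) (\<lambda>z. f z / z)"

definition lcoeff :: "(complex \<Rightarrow> complex) \<Rightarrow> int \<Rightarrow> complex" where
  "lcoeff f k = cmean (\<lambda>z. f z * z powi (- k))"

definition ltrunc :: "int set \<Rightarrow> (complex \<Rightarrow> complex) \<Rightarrow> complex \<Rightarrow> complex" where
  "ltrunc K f z = (\<Sum>\<^sub>\<infinity>k\<in>K. lcoeff f k * z powi k)"

text \<open>Holomorphic near the closed exterior disc (which contains infinity), with value \<open>L\<close> at
  infinity, expressed in the chart \<open>1/z\<close>.\<close>

definition holo_ext :: "(complex \<Rightarrow> complex) \<Rightarrow> complex \<Rightarrow> bool" where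
  "holo_ext f L \<longleftrightarrow> (\<lambda>z. if z = 0 then L else f (1 / z)) analytic_on cball 0 1"

definition Ein :: "complex \<Rightarrow> complex" where
  "Ein z = - (\<Sum>n. (- z) ^ Suc n / (fact (Suc n) * of_nat (Suc n)))"


section \<open>The manifold\<close>

definition M0 :: "((complex \<Rightarrow> complex) \<times> (complex \<Rightarrow> complex)) set" where
  "M0 = {(l, b).
     holo_ext (\<lambda>z. l z / z) 1 \<and>
     (\<exists>c. c \<noteq> 0 \<and> (\<lambda>z. if z = 0 then c else z * b z) analytic_on cball 0 1) \<and>
     (\<forall>z\<in>sphere 0 1. deriv (\<lambda>z. l z + b z) z \<noteq> 0) \<and>
     (let \<gamma> = (\<lambda>z. l z + b z) \<circ> circlepath 0 1 in
        simple_path \<gamma> \<and> 0 \<in> inside (path_image \<gamma>) \<and>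
        (\<forall>a\<in>inside (path_image \<gamma>). winding_number \<gamma> a = 1)) \<and>
     (\<forall>z. 1 \<le> norm z \<longrightarrow> l z \<noteq> 0) \<and>
     (\<forall>z. 0 < norm z \<and> norm z \<le> 1 \<longrightarrow> b z \<noteq> 0)}"

text \<open>The coordinate \<open>u\<close> (a logarithm of the coefficient of \<open>1/z\<close> in the second function) and
  the branch of \<open>log (w/z)\<close> are multivalued on \<open>M0\<close>.  A point of the covering on which they are
  single-valued consists of the coordinates \<open>(w, v, u)\<close> of a point of \<open>M0\<close> and a branch
  \<open>lw\<close> of \<open>log (w/z)\<close> on the circle.\<close>

datatype pt = Pt (wf: "complex \<Rightarrow> complex") (vc: complex) (uc: complex) (lw: "complex \<Rightarrow> complex")

text \<open>The pair with coordinates \<open>(w, v, u)\<close>: solve \<open>lam + lamb = w\<close>, where \<open>lam = z + O(1)\<close> has only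
  powers \<open>\<le> 1\<close>, while \<open>lamb = exp u / z + v + \<dots>\<close> has only powers \<open>\<ge> -1\<close>.\<close>

definition lam :: "pt \<Rightarrow> complex \<Rightarrow> complex" where
  "lam p z = z + ltrunc {..0} (wf p) z - vc p - exp (uc p) / z"

definition lamb :: "pt \<Rightarrow> complex \<Rightarrow> complex" where
  "lamb p z = ltrunc {0<..} (wf p) z - z + vc p + exp (uc p) / z"

definition MM :: "pt set" where
  "MM = {p. wf p analytic_on sphere 0 1 \<and> (lam p, lamb p) \<in> M0 \<and>
     lw p analytic_on sphere 0 1 \<and> (\<forall>z\<in>sphere 0 1. exp (lw p z) = wf p z / z)}"

text \<open>Elements of \<open>H(S^1)\<close> are represented by functions analytic on the circle; only their germs
  along the circle (equivalently, their values on it) matter.\<close>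

definition pt_eq :: "pt \<Rightarrow> pt \<Rightarrow> bool" where
  "pt_eq p q \<longleftrightarrow> (\<forall>z\<in>sphere 0 1. wf p z = wf q z \<and> lw p z = lw q z) \<and> vc p = vc q \<and> uc p = uc q"


section \<open>Vectors and 1-forms\<close>

datatype triple = Triple (fn: "complex \<Rightarrow> complex") (cv: complex) (cu: complex)

definition triples :: "triple set" where
  "triples = {X. fn X analytic_on sphere 0 1}"

definition teq :: "triple \<Rightarrow> triple \<Rightarrow> bool" where
  "teq X Y \<longleftrightarrow> (\<forall>z\<in>sphere 0 1. fn X z = fn Y z) \<and> cv X = cv Y \<and> cu X = cu Y"

definition tzero :: triple where "tzero = Triple (\<lambda>_. 0) 0 0"

definition tadd :: "triple \<Rightarrow> triple \<Rightarrow> triple" where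
  "tadd X Y = Triple (\<lambda>z. fn X z + fn Y z) (cv X + cv Y) (cu X + cu Y)"

definition tscale :: "complex \<Rightarrow> triple \<Rightarrow> triple" where
  "tscale c X = Triple (\<lambda>z. c * fn X z) (c * cv X) (c * cu X)"

definition tcomb :: "'i set \<Rightarrow> ('i \<Rightarrow> complex) \<Rightarrow> ('i \<Rightarrow> triple) \<Rightarrow> triple" where
  "tcomb A c F = Triple (\<lambda>z. \<Sum>i\<in>A. c i * fn (F i) z) (\<Sum>i\<in>A. c i * cv (F i)) (\<Sum>i\<in>A. c i * cu (F i))"

definition pair :: "triple \<Rightarrow> triple \<Rightarrow> complex" where
  "pair \<alpha> X = cmean (\<lambda>z. fn \<alpha> z * fn X z) + cv \<alpha> * cv X + cu \<alpha> * cu X"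

text \<open>The straight line through \<open>p\<close> in direction \<open>X\<close> in the coordinates \<open>(w, v, u)\<close>; for small
  \<open>\<epsilon>\<close> the last component is the continuation of the branch of \<open>log (w/z)\<close> along it.\<close>

definition move :: "pt \<Rightarrow> triple \<Rightarrow> complex \<Rightarrow> pt" where
  "move p X \<epsilon> = Pt (\<lambda>z. wf p z + \<epsilon> * fn X z) (vc p + \<epsilon> * cv X) (uc p + \<epsilon> * cu X)
     (\<lambda>z. lw p z + Ln (1 + \<epsilon> * fn X z / wf p z))"

definition is_differential :: "(pt \<Rightarrow> complex) \<Rightarrow> pt \<Rightarrow> triple \<Rightarrow> bool" where
  "is_differential f p \<alpha> \<longleftrightarrow> \<alpha> \<in> triples \<and>
     (\<forall>X\<in>triples. ((\<lambda>\<epsilon>. f (move p X \<epsilon>)) has_field_derivative pair \<alpha> X) (at 0))"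

text \<open>Unique up to \<open>teq\<close> when it exists, since the pairing is nondegenerate.\<close>

definition differential :: "(pt \<Rightarrow> complex) \<Rightarrow> pt \<Rightarrow> triple" where
  "differential f p = (SOME \<alpha>. is_differential f p \<alpha>)"

definition has_triple_derivative :: "(complex \<Rightarrow> triple) \<Rightarrow> triple \<Rightarrow> complex \<Rightarrow> bool" where
  "has_triple_derivative F D s \<longleftrightarrow>
     (\<forall>z\<in>sphere 0 1. ((\<lambda>t. fn (F t) z) has_field_derivative fn D z) (at s)) \<and>
     ((\<lambda>t. cv (F t)) has_field_derivative cv D) (at s) \<and>
     ((\<lambda>t. cu (F t)) has_field_derivative cu D) (at s)"

definition dir_deriv :: "(pt \<Rightarrow> triple) \<Rightarrow> pt \<Rightarrow> triple \<Rightarrow> triple" where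
  "dir_deriv F p X = Triple (\<lambda>z. deriv (\<lambda>\<epsilon>. fn (F (move p X \<epsilon>)) z) 0)
     (deriv (\<lambda>\<epsilon>. cv (F (move p X \<epsilon>))) 0) (deriv (\<lambda>\<epsilon>. cu (F (move p X \<epsilon>))) 0)"


section \<open>Frobenius structure\<close>

definition zwp :: "pt \<Rightarrow> complex \<Rightarrow> complex" where
  "zwp p z = z * deriv (wf p) z"

definition sharp :: "pt \<Rightarrow> triple \<Rightarrow> triple" where
  "sharp p \<alpha> = Triple (\<lambda>z. zwp p z * fn \<alpha> z) (cu \<alpha>) (cv \<alpha>)"

definition grad :: "(pt \<Rightarrow> complex) \<Rightarrow> pt \<Rightarrow> triple" where
  "grad f p = sharp p (differential f p)"

text \<open>The metric on vectors, \<open>\<langle>\<alpha>, Y\<rangle>\<close> with \<open>sharp p \<alpha> = X\<close>.\<close>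

definition metric :: "pt \<Rightarrow> triple \<Rightarrow> triple \<Rightarrow> complex" where
  "metric p X Y = pair (Triple (\<lambda>z. fn X z / zwp p z) (cu X) (cv X)) Y"

definition christoffel :: "pt \<Rightarrow> triple \<Rightarrow> triple \<Rightarrow> triple" where
  "christoffel p X \<alpha> = Triple (\<lambda>z. deriv (fn \<alpha>) z * fn X z / deriv (wf p) z) 0 0"

definition Cop :: "pt \<Rightarrow> triple \<Rightarrow> triple \<Rightarrow> triple" where
  "Cop p X \<alpha> =
    (let e = exp (uc p); x = fn X; a = fn \<alpha> in
     Triple
       (\<lambda>z. x z / zwp p z *
              (ltrunc {0<..} (\<lambda>t. zwp p t * a t) z - ltrunc {0<..} (zwp p) z * a z
                + z * a z + e / z * (a z + cv \<alpha>) + cu \<alpha>)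
          + ltrunc {..<0} (\<lambda>t. ltrunc {0<..} x t * a t) z
          - ltrunc {0..} (\<lambda>t. ltrunc {..0} x t * a t) z
          + e / z * cu X * (a z + cv \<alpha>) + cv X * a z)
       (lcoeff (\<lambda>t. x t * a t) 0 + cu X * cu \<alpha> + cv X * cv \<alpha>)
       (lcoeff (\<lambda>t. e * (x t + zwp p t * cu X) * (a t + cv \<alpha>)) 1
          - e * cu X * cv \<alpha> + cv X * cu \<alpha>))"

definition euler :: "pt \<Rightarrow> triple" where
  "euler p = Triple (\<lambda>z. wf p z - zwp p z) (vc p) 2"

definition Uop :: "pt \<Rightarrow> triple \<Rightarrow> triple" where
  "Uop p \<alpha> = Cop p (euler p) \<alpha>"

text \<open>Covariant derivative of a vector field \<open>F\<close> by duality: it is determined by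
  \<open>\<partial>\<^sub>X \<langle>\<alpha>, F\<rangle> = \<langle>\<nabla>\<^sub>X \<alpha>, F\<rangle> + \<langle>\<alpha>, \<nabla>\<^sub>X F\<rangle>\<close> for 1-forms \<open>\<alpha>\<close> with constant components,
  for which \<open>\<nabla>\<^sub>X \<alpha> = - christoffel p X \<alpha>\<close>.\<close>

definition cov_deriv_vec :: "(pt \<Rightarrow> triple) \<Rightarrow> pt \<Rightarrow> triple \<Rightarrow> triple" where
  "cov_deriv_vec F p X = (SOME W. W \<in> triples \<and>
     (\<forall>\<alpha>\<in>triples. pair \<alpha> W = pair \<alpha> (dir_deriv F p X) + pair (christoffel p X \<alpha>) (F p)))"

definition Vvec :: "pt \<Rightarrow> triple \<Rightarrow> triple" where
  "Vvec p X = tadd (tscale (1/2) X) (tscale (-1) (cov_deriv_vec euler p X))"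

definition Vform :: "pt \<Rightarrow> triple \<Rightarrow> triple" where
  "Vform p \<alpha> = (SOME \<beta>. \<beta> \<in> triples \<and> (\<forall>X\<in>triples. pair \<beta> X = pair \<alpha> (Vvec p X)))"


section \<open>Deformed flat functions\<close>

text \<open>Functions multivalued in \<open>\<zeta> \<in> \<complex>\<^sup>\<times>\<close> are functions of \<open>s = log \<zeta> \<in> \<complex>\<close>, so that
  \<open>\<zeta> powr a\<close> becomes \<open>exp (a * s)\<close> and \<open>\<partial>\<^sub>s = \<zeta> \<partial>\<^sub>\<zeta>\<close>.
  The equation in direction \<open>X\<close> only involves the value of the vector field \<open>X\<close> at \<open>p\<close>.\<close>

definition dform :: "(pt \<Rightarrow> complex \<Rightarrow> complex) \<Rightarrow> pt \<Rightarrow> complex \<Rightarrow> triple" where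
  "dform y p s = differential (\<lambda>q. y q s) p"

definition deformed_flat :: "(pt \<Rightarrow> complex \<Rightarrow> complex) \<Rightarrow> bool" where
  "deformed_flat y \<longleftrightarrow>
     (\<forall>p\<in>MM. \<forall>q\<in>MM. pt_eq p q \<longrightarrow> y p = y q) \<and>
     (\<forall>p\<in>MM. \<forall>s. \<exists>\<alpha>. is_differential (\<lambda>q. y q s) p \<alpha>) \<and>
     (\<forall>p\<in>MM. \<forall>s. \<forall>X\<in>triples.
        has_triple_derivative (\<lambda>\<epsilon>. dform y (move p X \<epsilon>) s)
          (tadd (christoffel p X (dform y p s)) (tscale (exp s) (Cop p X (dform y p s)))) 0) \<and>
     (\<forall>p\<in>MM. \<forall>s.
        has_triple_derivative (\<lambda>t. dform y p t)
          (tscale (exp s)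
             (tadd (Uop p (dform y p s)) (tscale (- 1 / exp s) (Vform p (dform y p s))))) s)"

datatype idx = Ix int | Iv | Iu

text \<open>Independence of a family of functions on \<open>M0\<close>: linear independence of the differentials
  at each point.\<close>

definition deformed_flat_coordinates :: "(idx \<Rightarrow> pt \<Rightarrow> complex \<Rightarrow> complex) \<Rightarrow> bool" where
  "deformed_flat_coordinates y \<longleftrightarrow>
     (\<forall>i. deformed_flat (y i)) \<and>
     (\<forall>p\<in>MM. \<forall>s. \<forall>A c. finite A \<longrightarrow> teq (tcomb A c (\<lambda>i. dform (y i) p s)) tzero \<longrightarrow>
        (\<forall>i\<in>A. c i = 0))"


section \<open>Flat coordinates and Levelt bases\<close>

fun tcoord :: "idx \<Rightarrow> pt \<Rightarrow> complex" where
  "tcoord (Ix a) p =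
     (if a = 0 then - cmean (lw p) else cmean (\<lambda>z. wf p z powi (- a) / of_int a))"
| "tcoord Iv p = vc p"
| "tcoord Iu p = uc p"

fun raised :: "(idx \<Rightarrow> 'a) \<Rightarrow> idx \<Rightarrow> 'a" where
  "raised y (Ix a) = y (Ix (- 1 - a))"
| "raised y Iv = y Iu"
| "raised y Iu = y Iv"

text \<open>The eigenvalues of \<open>Vvec p\<close> on the gradients of the flat coordinates.\<close>

fun mu :: "idx \<Rightarrow> complex" where
  "mu (Ix a) = - of_int a - 1/2"
| "mu Iv = 1/2"
| "mu Iu = - 1/2"

text \<open>Operators constant in flat coordinates are given by column-finite matrices acting on the
  linear span of the gradients of the flat coordinates (a dense subspace of the tangent space):
  the \<open>j\<close>-th gradient is sent to the combination with coefficients the \<open>j\<close>-th column.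
  The operators \<open>\<zeta> powr V\<close> do not extend to the whole tangent space.\<close>

type_synonym mat = "idx \<Rightarrow> idx \<Rightarrow> complex"

definition col_finite :: "mat \<Rightarrow> bool" where
  "col_finite A \<longleftrightarrow> (\<forall>j. finite {i. A i j \<noteq> 0})"

definition mmul :: "mat \<Rightarrow> mat \<Rightarrow> mat" where
  "mmul A B = (\<lambda>i j. \<Sum>k | B k j \<noteq> 0. A i k * B k j)"

primrec mpow :: "mat \<Rightarrow> nat \<Rightarrow> mat" where
  "mpow A 0 = (\<lambda>i j. if i = j then 1 else 0)"
| "mpow A (Suc n) = mmul A (mpow A n)"

text \<open>\<open>\<zeta> powr R\<close> for nilpotent \<open>R\<close> (a finite sum), and \<open>\<zeta> powr V\<close>, at \<open>\<zeta> = exp s\<close>.\<close>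

definition zeta_R :: "mat \<Rightarrow> complex \<Rightarrow> mat" where
  "zeta_R R s = (\<lambda>i j. \<Sum>n. s ^ n / fact n * mpow R n i j)"

definition zeta_V :: "complex \<Rightarrow> mat" where
  "zeta_V s = (\<lambda>i j. if i = j then exp (s * mu i) else 0)"

definition flatvec :: "pt \<Rightarrow> (idx \<Rightarrow> complex) \<Rightarrow> triple" where
  "flatvec p c = tcomb {i. c i \<noteq> 0} c (\<lambda>i. grad (tcoord i) p)"

definition mat_apply :: "pt \<Rightarrow> mat \<Rightarrow> idx \<Rightarrow> triple" where
  "mat_apply p A j = flatvec p (\<lambda>i. A i j)"

text \<open>\<open>T\<close> is a linear operator from the span of the flat gradients to the tangent space.\<close>

definition linear_on_flat :: "pt \<Rightarrow> (triple \<Rightarrow> triple) \<Rightarrow> bool" where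
  "linear_on_flat p T \<longleftrightarrow>
     (\<forall>c. \<forall>X\<in>triples. finite {i. c i \<noteq> 0} \<longrightarrow> teq X (flatvec p c) \<longrightarrow>
        T X \<in> triples \<and> teq (T X) (tcomb {i. c i \<noteq> 0} c (\<lambda>i. T (grad (tcoord i) p))))"

text \<open>Holomorphic dependence on \<open>\<zeta>\<close> in the disc of radius \<open>r\<close>, with values in
  \<open>H(S^1) \<oplus> \<complex>\<^sup>2\<close>; separate holomorphy of \<open>G\<close> amounts to joint holomorphy (Hartogs).\<close>

definition analytic_curve :: "real \<Rightarrow> (complex \<Rightarrow> triple) \<Rightarrow> bool" where
  "analytic_curve r F \<longleftrightarrow>
     (\<exists>A G. open A \<and> sphere 0 1 \<subseteq> A \<and>
        (\<forall>\<zeta>\<in>ball 0 r. (\<lambda>z. G z \<zeta>) holomorphic_on A \<and> (\<forall>z\<in>sphere 0 1. fn (F \<zeta>) z = G z \<zeta>)) \<and>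
        (\<forall>z\<in>A. (\<lambda>\<zeta>. G z \<zeta>) holomorphic_on ball 0 r)) \<and>
     (\<lambda>\<zeta>. cv (F \<zeta>)) holomorphic_on ball 0 r \<and>
     (\<lambda>\<zeta>. cu (F \<zeta>)) holomorphic_on ball 0 r"

definition admissible_R :: "mat \<Rightarrow> bool" where
  "admissible_R R \<longleftrightarrow>
     col_finite R \<and> (\<exists>N. \<forall>i j. mpow R N i j = 0) \<and>
     (\<exists>Rk :: nat \<Rightarrow> mat.
        (\<forall>k\<ge>1. col_finite (Rk k)) \<and>
        (\<forall>i j. ((\<lambda>k. Rk k i j) has_sum R i j) {1..}) \<and>
        (\<forall>k\<ge>1. \<forall>s. mmul (mmul (zeta_V s) (Rk k)) (zeta_V (- s)) = (\<lambda>i j. exp s ^ k * Rk k i j)) \<and>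
        (\<forall>k\<ge>1. \<forall>p\<in>MM. \<forall>i j.
           metric p (mat_apply p (Rk k) i) (grad (tcoord j) p) =
             (if odd k then 1 else - 1) * metric p (grad (tcoord i) p) (mat_apply p (Rk k) j)))"

definition levelt_basis :: "(idx \<Rightarrow> pt \<Rightarrow> complex \<Rightarrow> complex) \<Rightarrow> bool" where
  "levelt_basis y \<longleftrightarrow>
     deformed_flat_coordinates y \<and>
     (\<exists>(R :: mat) (\<Theta> :: pt \<Rightarrow> complex \<Rightarrow> triple \<Rightarrow> triple).
        admissible_R R \<and>
        (\<forall>p\<in>MM. \<forall>\<zeta>. linear_on_flat p (\<Theta> p \<zeta>)) \<and>
        (\<forall>p\<in>MM. \<exists>r>0. \<forall>i. analytic_curve r (\<lambda>\<zeta>. \<Theta> p \<zeta> (grad (tcoord i) p))) \<and>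
        (\<forall>p\<in>MM. \<forall>i. teq (\<Theta> p 0 (grad (tcoord i) p)) (grad (tcoord i) p)) \<and>
        (\<forall>p\<in>MM. \<forall>s j.
           teq (grad (\<lambda>q. raised y j q s) p)
               (\<Theta> p (exp s) (mat_apply p (mmul (zeta_V s) (zeta_R R s)) j))))"


section \<open>The functions\<close>

definition log_lam_z :: "pt \<Rightarrow> complex \<Rightarrow> complex" where
  "log_lam_z p = (SOME g. holo_ext g 0 \<and> (\<forall>z. 1 \<le> norm z \<longrightarrow> exp (g z) = lam p z / z))"

definition log_z_lamb :: "pt \<Rightarrow> complex \<Rightarrow> complex" where
  "log_z_lamb p = (SOME g. g analytic_on cball 0 1 \<and> g 0 = uc p \<and>
     (\<forall>z. 0 < norm z \<and> norm z \<le> 1 \<longrightarrow> exp (g z) = z * lamb p z))"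

text \<open>\<open>log (1 + lamb/lam)\<close> and \<open>log (lamb (lam + lamb))\<close>.\<close>

definition log1 :: "pt \<Rightarrow> complex \<Rightarrow> complex" where
  "log1 p z = lw p z - log_lam_z p z"

definition log2 :: "pt \<Rightarrow> complex \<Rightarrow> complex" where
  "log2 p z = log_z_lamb p z + lw p z"

fun theta :: "idx \<Rightarrow> pt \<Rightarrow> complex \<Rightarrow> complex" where
  "theta (Ix a) p \<zeta> =
     (if a = - 1 then
        - cmean (\<lambda>z. exp (- lam p z * \<zeta>) * (log1 p z + Ein (- lam p z * \<zeta>) - 1)
                    + exp ((lamb p z - lam p z) / 2 * \<zeta>))
      else
        - cmean (\<lambda>z. (lam p z + lamb p z) powi (a + 1) / of_int (a + 1)
                    * exp ((lamb p z - lam p z) / 2 * \<zeta>)))"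
| "theta Iv p \<zeta> =
     cmean (\<lambda>z. - exp (- lam p z * \<zeta>) * (log1 p z + Ein (- lam p z * \<zeta>) - 1)
               + exp (lamb p z * \<zeta>) * (log2 p z - Ein (lamb p z * \<zeta>) - 1))"
| "theta Iu p \<zeta> = cmean (\<lambda>z. (exp (lamb p z * \<zeta>) - 1) / \<zeta>)"

fun ycoord :: "idx \<Rightarrow> pt \<Rightarrow> complex \<Rightarrow> complex" where
  "ycoord (Ix a) p s = exp ((of_int a + 1/2) * s) * theta (Ix a) p (exp s)"
| "ycoord Iv p s =
     exp (1/2 * s) * (1 / exp s * theta Iv p (exp s) + 2 * s * theta Iu p (exp s))"
| "ycoord Iu p s = exp (1/2 * s) * theta Iu p (exp s)"

end

theory Submission
  imports Defs
begin

text \<open>Each function \<open>y\<close> is the mean over the circle of an \<open>f(\<lambda>, \<lambda>')\<close> (here \<open>\<lambda>'\<close> stands for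
  \<open>\<lambda>\<close>-bar) whose partial derivatives \<open>P - c\<^sub>1 / \<lambda>\<close> and \<open>Q + c\<^sub>2 / \<lambda>'\<close> satisfy
  \<open>dP = S dw - \<zeta> (P - c\<^sub>1 / \<lambda>) d\<lambda>\<close> and \<open>dQ = S dw + \<zeta> (Q + c\<^sub>2 / \<lambda>') d\<lambda>'\<close>, both for variations of the point of
  the manifold and for variations of \<open>z\<close>.  Hence
  \<open>dy = (P\<^sub>\<ge>\<^sub>0 + Q\<^sub><\<^sub>0, (Q - P)\<^sub>0, e\<^sup>u (Q - P)\<^sub>1 + c\<^sub>2)\<close>, and comparing the two kinds of variations turns the
  derivative of \<open>dy\<close> into the Christoffel term plus \<open>\<zeta> C (dy)\<close>.  The equation in \<open>\<zeta>\<close> follows in the same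
  way from the homogeneity of \<open>f\<close>.

  If a combination of the \<open>dy\<close> vanishes, so does its \<open>S\<close>.  This is a relation between \<open>1\<close>,
  \<open>e\<close> to the \<open>- \<zeta>w/2\<close> and \<open>e\<close> to the \<open>\<zeta>w/2\<close> with Laurent polynomials in \<open>w\<close> as coefficients; by the periodicity of the
  exponentials all coefficients vanish, which leaves only the multiples of \<open>y\<^sub>u\<close>.  They are excluded because
  \<open>e\<close> to the \<open>\<zeta>\<lambda>'\<close> has an essential singularity at \<open>0\<close>.

  The operator \<open>\<Theta>\<close> sends \<open>\<nabla>t\<close> to the gradient of the corresponding \<open>\<theta>\<close>, whose integrand is entire in \<open>\<zeta>\<close>.\<close>

section \<open>Laurent series near the unit circle\<close>

text \<open>The terms \<open>c\<^sub>1 / \<lambda>\<close> and \<open>c\<^sub>2 / \<lambda>'\<close>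
  are split off because \<open>1 / \<lambda>\<close> times a variation of \<open>\<lambda>\<close>
  extends outside the circle and vanishes at infinity, so it is invisible to the mean, whereas
  \<open>1 / \<lambda>'\<close> times a variation of \<open>\<lambda>'\<close> extends inside, with
  the variation of \<open>u\<close> as its value at \<open>0\<close>. \<open>Ein\<close> is what
  produces exactly these terms. The term \<open>2 log \<zeta> \<theta>\<^sub>u\<close> of
  \<open>y\<^sub>v\<close> repairs homogeneity: scaling both functions adds twice the logarithm of
  the factor to \<open>log (\<lambda>' (\<lambda> + \<lambda>'))\<close>. Two obstacles shape the
  proof. Truncated series have to be differentiated in parameters, so they are written as Cauchy
  integrals over a slightly larger circle; the parameter is a position on a line in the manifold,
  the point \<open>z\<close>, or \<open>log \<zeta>\<close>. And logarithms and differentials are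
  Hilbert choices, identified by normalisation at \<open>0\<close> or infinity and by nondegeneracy
  of the pairing. Besides scaling, rotation of \<open>z\<close> supplies identities; the Euler field
  is scaling minus rotation.\<close>

definition ann :: "real \<Rightarrow> complex set" where
  "ann R = {z. 1 / R < norm z \<and> norm z < R}"

lemma open_ann [simp]: "open (ann R)"
proof -
  have "ann R = norm -` {1/R<..<R}" by (auto simp: ann_def)
  then show ?thesis by (simp add: open_vimage continuous_on_norm continuous_on_id)
qed

lemma connected_ann: "connected (ann R)"
  using connected_annulus(1)[where 'N = complex, of "1 / R" 0 R] by (simp add: ann_def)

lemma sphere_subset_ann: "1 < R \<Longrightarrow> sphere 0 1 \<subseteq> ann R"
  by (auto simp: ann_def)

lemma ann_mono: "1 < R \<Longrightarrow> R \<le> R' \<Longrightarrow> ann R \<subseteq> ann R'"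
proof -
  assume "1 < R" "R \<le> R'"
  then have "1 / R' \<le> 1 / R" by (simp add: divide_left_mono)
  then show ?thesis using \<open>R \<le> R'\<close> by (auto simp: ann_def)
qed

lemma ann_nonzero: "1 < R \<Longrightarrow> z \<in> ann R \<Longrightarrow> z \<noteq> 0"
  by (auto simp: ann_def)

lemma sphere_nonzero: "z \<in> sphere 0 1 \<Longrightarrow> z \<noteq> (0::complex)"
  by auto

text \<open>Compactness gives one radius \<open>e\<close> for all points of the circle, and a point
  of \<open>ann (1 + e)\<close> is closer than \<open>e\<close> to its radial projection
  \<open>u\<close>.\<close>

lemma ann_nbhd:
  assumes "open S" "sphere 0 1 \<subseteq> S"
  obtains R where "1 < R" "ann R \<subseteq> S"
proof -
  obtain e where e: "e > 0" "(\<Union>x\<in>sphere 0 1. ball x e) \<subseteq> S"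
    using compact_subset_open_imp_ball_epsilon_subset[OF compact_sphere assms] by blast
  have "ann (1 + e) \<subseteq> S"
  proof
    fix z :: complex assume z: "z \<in> ann (1 + e)"
    then have nz: "z \<noteq> 0" using ann_nonzero e by (metis less_add_same_cancel1)
    define u where "u = z / of_real (norm z)"
    have "norm z > 1 - e"
    proof -
      have "1 - e < 1 / (1 + e)" using e(1) by (simp add: field_simps)
      then show ?thesis using z by (simp add: ann_def)
    qed
    then have "\<bar>norm z - 1\<bar> < e" using z by (auto simp: ann_def abs_less_iff)
    moreover have "u - z = of_real (1 - norm z) * u" using nz by (simp add: u_def field_simps)
    moreover have "norm u = 1" using nz by (simp add: u_def norm_divide)
    ultimately have "dist u z < e" by (simp add: dist_norm norm_mult del: of_real_diff) 
    then have "z \<in> (\<Union>x\<in>sphere 0 1. ball x e)" using \<open>norm u = 1\<close> by (intro UN_I[of u]) auto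
    then show "z \<in> S" using e(2) by blast
  qed
  then show ?thesis using that[of "1 + e"] e(1) by auto
qed

lemma analytic_sphere_ann:
  assumes "f analytic_on sphere 0 1"
  obtains R where "1 < R" "f holomorphic_on ann R"
  using assms unfolding analytic_on_holomorphic by (metis ann_nbhd holomorphic_on_subset)

lemma holomorphic_ann_sphere: "f holomorphic_on ann R \<Longrightarrow> 1 < R \<Longrightarrow> f analytic_on sphere 0 1"
  unfolding analytic_on_holomorphic using open_ann sphere_subset_ann by blast

lemma cball_nbhd:
  assumes "open S" "cball 0 1 \<subseteq> (S :: complex set)"
  obtains R where "1 < R" "ball 0 R \<subseteq> S"
proof -
  obtain e where e: "e > 0" "(\<Union>x\<in>cball 0 1. ball x e) \<subseteq> S"
    using compact_subset_open_imp_ball_epsilon_subset[OF compact_cball assms] by blast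
  have "ball 0 (1 + e) \<subseteq> S"
  proof
    fix z :: complex assume z: "z \<in> ball 0 (1 + e)"
    show "z \<in> S"
    proof (cases "norm z \<le> 1")
      case True then show ?thesis using assms by auto
    next
      case False
      define u where "u = z / of_real (norm z)"
      have nz: "z \<noteq> 0" using False by auto
      have "\<bar>norm z - 1\<bar> < e" using z False by auto
      moreover have "u - z = of_real (1 - norm z) * u" using nz by (simp add: u_def field_simps)
      moreover have "norm u = 1" using nz by (simp add: u_def norm_divide)
      ultimately have "dist u z < e" by (simp add: dist_norm norm_mult del: of_real_diff) 
      then have "z \<in> (\<Union>x\<in>cball 0 1. ball x e)" using \<open>norm u = 1\<close> by (intro UN_I[of u]) auto
      then show "z \<in> S" using e(2) by blast
    qed
  qed
  then show ?thesis using that[of "1 + e"] e(1) by auto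
qed

lemma cball_ball_nbhd:
  assumes "f analytic_on cball 0 1"
  obtains R where "1 < R" "f holomorphic_on ball 0 R"
  using assms unfolding analytic_on_holomorphic by (metis cball_nbhd holomorphic_on_subset)

lemma holomorphic_ball_cball: "f holomorphic_on ball 0 R \<Longrightarrow> 1 < R \<Longrightarrow> f analytic_on cball 0 1"
  unfolding analytic_on_holomorphic by (rule exI[of _ "ball 0 R"]) auto

section \<open>Means over circles and Laurent coefficients\<close>

definition cmean_r :: "real \<Rightarrow> (complex \<Rightarrow> complex) \<Rightarrow> complex" where
  "cmean_r r f = integral {0..1} (\<lambda>x. f (of_real r * exp (2 * of_real pi * \<i> * of_real x)))"

lemma norm_circle [simp]: "norm (exp (2 * of_real pi * \<i> * of_real x)) = 1"
  by (simp add: norm_exp_eq_Re)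

text \<open>On a circle around \<open>0\<close> the form \<open>dz / z\<close> is a constant
  multiple of \<open>dx\<close>. Means thereby become interval integrals of continuous functions, to
  which additivity and the Leibniz rule apply directly.\<close>

lemma contour_circle_cmean_r:
  assumes "r \<noteq> 0"
  shows "contour_integral (circlepath 0 r) (\<lambda>z. f z / z) = 2 * of_real pi * \<i> * cmean_r r f"
proof -
  have "contour_integral (circlepath 0 r) (\<lambda>z. f z / z) =
     integral {0..1} (\<lambda>x. 2 * of_real pi * \<i> * f (of_real r * exp (2 * of_real pi * \<i> * of_real x)))"
    unfolding contour_integral_integral vector_derivative_circlepath
    unfolding circlepath
    by (rule integral_cong) (use assms in \<open>simp add: field_simps\<close>)
  then show ?thesis by (simp add: cmean_r_def)
qed

lemma cmean_eq_cmean_r: "cmean f = cmean_r 1 f"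
  using contour_circle_cmean_r[of 1 f] by (simp add: cmean_def)

lemma cmean_cong:
  assumes "\<And>z. z \<in> sphere 0 1 \<Longrightarrow> f z = g z"
  shows "cmean f = cmean g"
  unfolding cmean_eq_cmean_r cmean_r_def
  by (rule integral_cong) (use assms in auto)

lemma lcoeff_cong:
  assumes "\<And>z. z \<in> sphere 0 1 \<Longrightarrow> f z = g z"
  shows "lcoeff f k = lcoeff g k"
  unfolding lcoeff_def by (rule cmean_cong) (use assms in auto)

lemma ltrunc_cong:
  assumes "\<And>z. z \<in> sphere 0 1 \<Longrightarrow> f z = g z"
  shows "ltrunc K f = ltrunc K g"
  unfolding ltrunc_def using lcoeff_cong[OF assms] by presburger

lemma lcoeff_0: "lcoeff f 0 = cmean f"
  unfolding lcoeff_def by (rule cmean_cong) auto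

lemma lcoeff_1: "lcoeff f 1 = cmean (\<lambda>z. f z / z)"
  unfolding lcoeff_def by (rule cmean_cong) (auto simp: power_int_minus field_simps)

lemma circle_integrable:
  fixes f :: "complex \<Rightarrow> complex"
  assumes "continuous_on (sphere 0 r) f" "0 \<le> r"
  shows "(\<lambda>x. f (of_real r * exp (2 * of_real pi * \<i> * of_real x))) integrable_on {0..1::real}"
proof -
  have "continuous_on {0..1} (\<lambda>x. f (of_real r * exp (2 * of_real pi * \<i> * of_real x)))"
    by (rule continuous_on_compose2[OF assms(1)])
       (use assms in \<open>auto intro!: continuous_intros simp: norm_mult\<close>)
  then show ?thesis by (rule integrable_continuous_interval)
qed

lemma cmean_cmult: "cmean (\<lambda>z. c * f z) = c * cmean f"
  unfolding cmean_eq_cmean_r cmean_r_def by simp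

lemma cmean_add:
  assumes "continuous_on (sphere 0 1) f" "continuous_on (sphere 0 1) g"
  shows "cmean (\<lambda>z. f z + g z) = cmean f + cmean g"
  unfolding cmean_eq_cmean_r cmean_r_def
  using assms[THEN circle_integrable] by (simp add: integral_add)

lemma cmean_const [simp]: "cmean (\<lambda>z. c) = c"
  unfolding cmean_eq_cmean_r cmean_r_def by simp

lemma cmean_uminus: "cmean (\<lambda>z. - f z) = - cmean f"
  using cmean_cmult[of "-1" f] by simp

lemma cmean_diff:
  assumes "continuous_on (sphere 0 1) f" "continuous_on (sphere 0 1) g"
  shows "cmean (\<lambda>z. f z - g z) = cmean f - cmean g"
  using cmean_add[OF assms(1) continuous_on_minus[OF assms(2)]] by (simp add: cmean_uminus)

text \<open>Inversion reverses the circle: substitute \<open>- x\<close> for \<open>x\<close> and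
  shift by one period. It translates every statement about the disc into one about the
  exterior.\<close>

lemma cmean_invert:
  assumes f: "continuous_on (sphere 0 1) f"
  shows "cmean (\<lambda>z. f (1 / z)) = cmean f"
proof -
  let ?g = "\<lambda>x. f (exp (2 * of_real pi * \<i> * of_real x))"
  have g: "continuous_on S ?g" for S :: "real set"
    by (rule continuous_on_compose2[OF f]) (auto intro!: continuous_intros)
  have "integral {0..1} ?g = integral {-1..-0} (\<lambda>x. ?g (- x))"
    by (rule Henstock_Kurzweil_Integration.integral_reflect_real[symmetric])
  also have "\<dots> = integral {0..1} (\<lambda>x. ?g (- (x + -1)))"
  proof -
    have "continuous_on {0 + -1..1 + -1} (\<lambda>x. ?g (- x))"
      by (rule continuous_on_compose2[OF g[of UNIV]]) (auto intro!: continuous_intros)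
    from integral_shift[OF this] show ?thesis unfolding o_def by simp
  qed
  also have "\<dots> = integral {0..1} (\<lambda>x. f (1 / exp (2 * of_real pi * \<i> * of_real x)))"
    by (intro integral_cong arg_cong[of _ _ f])
       (simp add: algebra_simps exp_diff exp_add exp_minus inverse_eq_divide)
  finally show ?thesis by (simp add: cmean_eq_cmean_r cmean_r_def)
qed

lemma lcoeff_invert:
  assumes f: "continuous_on (sphere 0 1) f"
  shows "lcoeff (\<lambda>z. f (1 / z)) k = lcoeff f (- k)"
proof -
  have "lcoeff f (- k) = cmean (\<lambda>z. f (1 / z) * (1 / z) powi k)"
    unfolding lcoeff_def
    by (subst cmean_invert[symmetric]) (auto intro!: continuous_intros f)
  also have "\<dots> = lcoeff (\<lambda>z. f (1 / z)) k"
    unfolding lcoeff_def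
    by (rule cmean_cong) (auto simp: power_int_minus power_int_divide_distrib field_simps)
  finally show ?thesis ..
qed

text \<open>For \<open>k \<ge> 0\<close> this is Cauchy's formula for derivatives. For
  \<open>k < 0\<close> the weight \<open>z powi (- k)\<close> is a positive power, so the integrand
  is holomorphic with a zero at \<open>0\<close>, and so is its mean.\<close>

lemma lcoeff_holomorphic:
  assumes F: "F holomorphic_on ball 0 R" and R: "1 < R"
  shows "lcoeff F k = (if 0 \<le> k then (deriv ^^ nat k) F 0 / fact (nat k) else 0)"
proof -
  have hol: "G holomorphic_on ball 0 1" "continuous_on (cball 0 1) G" if "G holomorphic_on ball 0 R" for G
  proof -
    have "ball 0 1 \<subseteq> ball (0::complex) R" "cball 0 1 \<subseteq> ball (0::complex) R" using R by auto
    then show "G holomorphic_on ball 0 1" "continuous_on (cball 0 1) G"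
      using that holomorphic_on_subset holomorphic_on_imp_continuous_on by blast+
  qed
  show ?thesis
  proof (cases "0 \<le> k")
    case True
    have "((\<lambda>u. F u / (u - 0) ^ Suc (nat k)) has_contour_integral
        ((2 * pi * \<i>) / (fact (nat k)) * (deriv ^^ nat k) F 0)) (circlepath 0 1)"
      using hol[OF F] by (intro Cauchy_has_contour_integral_higher_derivative_circlepath) auto
    then have "contour_integral (circlepath 0 1) (\<lambda>u. F u / (u - 0) ^ Suc (nat k)) =
        ((2 * pi * \<i>) / (fact (nat k)) * (deriv ^^ nat k) F 0)"
      by (rule contour_integral_unique)
    also have "contour_integral (circlepath 0 1) (\<lambda>u. F u / (u - 0) ^ Suc (nat k)) =
        contour_integral (circlepath 0 1) (\<lambda>u. (F u * u powi (- k)) / u)"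
      by (rule contour_integral_cong)
         (use True in \<open>auto simp: power_int_def power_inverse field_simps\<close>)
    finally show ?thesis using True unfolding lcoeff_def cmean_def by simp
  next
    case False
    define G where "G = (\<lambda>z. F z * z ^ nat (- k))"
    have G: "G holomorphic_on ball 0 R" unfolding G_def by (intro holomorphic_intros F)
    have "((\<lambda>u. G u / (u - 0) ^ Suc 0) has_contour_integral
        ((2 * pi * \<i>) / (fact 0) * (deriv ^^ 0) G 0)) (circlepath 0 1)"
      using hol[OF G] by (intro Cauchy_has_contour_integral_higher_derivative_circlepath) auto
    moreover have "G 0 = 0" using False by (simp add: G_def)
    ultimately have "contour_integral (circlepath 0 1) (\<lambda>u. G u / u) = 0"
      by (intro contour_integral_unique) simp
    then have "cmean G = 0" by (simp add: cmean_def)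
    moreover have "lcoeff F k = cmean G"
      unfolding lcoeff_def G_def by (rule cmean_cong) (use False in \<open>auto simp: power_int_def\<close>)
    ultimately show ?thesis using False by simp
  qed
qed

lemma cmean_holomorphic:
  assumes F: "F holomorphic_on ball 0 R" and R: "1 < R"
  shows "cmean F = F 0"
  using lcoeff_holomorphic[OF assms, of 0] by (simp add: lcoeff_0)

lemma has_sum_lcoeff_holomorphic:
  assumes F: "F holomorphic_on ball 0 R" and R: "1 < R" and z: "norm z < R"
  shows "((\<lambda>k. lcoeff F k * z powi k) has_sum F z) {0..}"
proof -
  define a where "a = (\<lambda>n. (deriv ^^ n) F 0 / fact n)"
  have s: "(\<lambda>n. a n * y ^ n) sums F y" if "norm y < R" for y
    using holomorphic_power_series[OF F, of y] that by (simp add: a_def)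
  \<comment> \<open>\<open>has_sum\<close> is unconditional summation, so absolute convergence is
    required; it follows from convergence at the strictly larger radius \<open>y\<close>.\<close>
  obtain y :: real where y: "norm z < y" "y < R" using z dense by blast
  have "summable (\<lambda>n. norm (a n * z ^ n))"
    by (rule powser_insidea[of _ "of_real y"])
       (use s[of "of_real y"] y norm_ge_zero[of z] in \<open>auto simp: sums_iff abs_if\<close>)
  then have "((\<lambda>n. a n * z ^ n) has_sum F z) UNIV"
    using s[OF z] by (rule norm_summable_imp_has_sum)
  then show ?thesis
    by (subst has_sum_reindex_bij_witness[where i = int and j = nat and T = UNIV
          and h = "\<lambda>n. a n * z ^ n" and s' = "F z"])
       (auto simp: lcoeff_holomorphic[OF F R] a_def power_int_def)
qed

section \<open>Cauchy integrals and the Laurent decomposition\<close>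

lemma cmean_r_has_derivative:
  assumes d: "\<And>e z. e \<in> U \<Longrightarrow> norm z = r \<Longrightarrow> ((\<lambda>e. F e z) has_field_derivative F' e z) (at e)"
    and c: "\<And>e. e \<in> U \<Longrightarrow> continuous_on (sphere 0 r) (F e)"
    and c': "continuous_on (U \<times> sphere 0 r) (\<lambda>(e, z). F' e z)"
    and U: "open U" "convex U" "e \<in> U" and r: "0 \<le> r"
  shows "((\<lambda>e. cmean_r r (F e)) has_field_derivative cmean_r r (F' e)) (at e)"
proof -
  let ?c = "\<lambda>x. of_real r * exp (2 * of_real pi * \<i> * of_real x)"
  have "((\<lambda>e. integral (cbox 0 1) (\<lambda>x. F e (?c x))) has_field_derivative
      integral (cbox 0 1) (\<lambda>x. F' e (?c x))) (at e within U)"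
  proof (rule leibniz_rule_field_derivative[where U = U])
    show "((\<lambda>e. F e (?c x)) has_field_derivative F' e (?c x)) (at e within U)"
      if "e \<in> U" "x \<in> cbox 0 1" for e x
      by (rule has_field_derivative_at_within, rule d) (use that r in \<open>auto simp: norm_mult\<close>)
    show "(\<lambda>x. F e (?c x)) integrable_on cbox 0 1" if "e \<in> U" for e
      using circle_integrable[OF c[OF that] r] by simp
    have "continuous_on (U \<times> cbox 0 1) (\<lambda>x. (\<lambda>(e, z). F' e z) (fst x, ?c (snd x)))"
      by (rule continuous_on_compose2[OF c']) (use r in \<open>auto intro!: continuous_intros simp: norm_mult\<close>)
    then show "continuous_on (U \<times> cbox 0 1) (\<lambda>(e, x). F' e (?c x))" by (simp add: case_prod_unfold)
  qed (use U in auto)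
  then show ?thesis unfolding at_within_open[OF U(3,1)] cmean_r_def interval_cbox .
qed

text \<open>The Cauchy integral of \<open>f t / (t - z)\<close> over the circle of radius
  \<open>r\<close>; the factor \<open>t\<close> compensates the \<open>dt / t\<close> that is built
  into the mean.\<close>

definition cauchy_r :: "real \<Rightarrow> (complex \<Rightarrow> complex) \<Rightarrow> complex \<Rightarrow> complex" where
  "cauchy_r r f z = cmean_r r (\<lambda>t. f t * t / (t - z))"

lemma cauchy_r_holomorphic:
  assumes f: "continuous_on (sphere 0 r) f" and r: "0 < r"
  shows "cauchy_r r f holomorphic_on ball 0 r"
proof -
  have "((\<lambda>z. cauchy_r r f z) has_field_derivative cmean_r r (\<lambda>t. f t * t / (t - z)\<^sup>2)) (at z)"
    if "z \<in> ball 0 r" for z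
    unfolding cauchy_r_def
  proof (rule cmean_r_has_derivative[where U = "ball 0 r"])
    show "((\<lambda>z. f t * t / (t - z)) has_field_derivative f t * t / (t - z)\<^sup>2) (at z)"
      if "z \<in> ball 0 r" "norm t = r" for z t
      using that by (auto intro!: derivative_eq_intros simp: power2_eq_square)
    show "continuous_on (sphere 0 r) (\<lambda>t. f t * t / (t - z))" if "z \<in> ball 0 r" for z
      using that by (auto intro!: continuous_intros f)
    have "continuous_on (ball 0 r \<times> sphere 0 r) (\<lambda>x. f (snd x) * snd x / (snd x - fst x)\<^sup>2)"
      by (intro continuous_intros continuous_on_compose2[OF f]) auto
    then show "continuous_on (ball 0 r \<times> sphere 0 r) (\<lambda>(z, t). f t * t / (t - z)\<^sup>2)"
      by (simp add: case_prod_unfold)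
  qed (use that r in auto)
  then show ?thesis by (meson holomorphic_onI field_differentiable_def field_differentiable_at_within)
qed

text \<open>Up to sign this is the Cauchy integral at an exterior point \<open>z = 1 / s\<close>,
  since \<open>t / (t - 1 / s) = - t * s / (1 - t * s)\<close>. In this form it is regular at
  \<open>s = 0\<close>, the point at infinity.\<close>

lemma cauchy_r_exterior_holomorphic:
  assumes f: "continuous_on (sphere 0 r) f" and r: "0 < r"
  shows "(\<lambda>s. cmean_r r (\<lambda>t. f t * t * s / (1 - t * s))) holomorphic_on ball 0 (1 / r)"
proof -
  have nz: "1 - t * s \<noteq> 0" if "s \<in> ball 0 (1 / r)" "norm t = r" for s t :: complex
  proof
    assume "1 - t * s = 0"
    then have "norm t * norm s = 1" by (metis eq_iff_diff_eq_0 norm_mult norm_one)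
    then show False using that r by (simp add: field_simps)
  qed
  have "((\<lambda>s. cmean_r r (\<lambda>t. f t * t * s / (1 - t * s))) has_field_derivative
      cmean_r r (\<lambda>t. f t * t / (1 - t * s)\<^sup>2)) (at s)"
    if "s \<in> ball 0 (1 / r)" for s
  proof (rule cmean_r_has_derivative[where U = "ball 0 (1 / r)"])
    show "((\<lambda>s. f t * t * s / (1 - t * s)) has_field_derivative f t * t / (1 - t * s)\<^sup>2) (at s)"
      if "s \<in> ball 0 (1 / r)" "norm t = r" for s t
      using nz[OF that] by (auto intro!: derivative_eq_intros simp: power2_eq_square field_simps)
    show "continuous_on (sphere 0 r) (\<lambda>t. f t * t * s / (1 - t * s))" if "s \<in> ball 0 (1 / r)" for s
      using nz[OF that] by (auto intro!: continuous_intros f)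
    have "continuous_on (ball 0 (1 / r) \<times> sphere 0 r) (\<lambda>x. f (snd x) * snd x / (1 - snd x * fst x)\<^sup>2)"
      using nz by (intro continuous_intros continuous_on_compose2[OF f]) auto
    then show "continuous_on (ball 0 (1 / r) \<times> sphere 0 r) (\<lambda>(s, t). f t * t / (1 - t * s)\<^sup>2)"
      by (simp add: case_prod_unfold)
  qed (use that r in auto)
  then show ?thesis by (meson holomorphic_onI field_differentiable_def field_differentiable_at_within)
qed

text \<open>The linear homotopy between concentric circles runs through circles whose radii are
  convex combinations of \<open>a\<close> and \<open>b\<close>, so it stays in the annulus and
  Cauchy's theorem applies.\<close>

lemma circle_means_equal:
  assumes f: "f holomorphic_on ann R" and R: "1 < R" and ab: "1 / R < a" "a < R" "1 / R < b" "b < R"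
  shows "cmean_r a f = cmean_r b f"
proof -
  have pos: "0 < a" "0 < b" using ab R by (smt (verit) divide_pos_pos)+
  have "homotopic_loops (ann R) (circlepath 0 a) (circlepath 0 b)"
  proof (rule homotopic_loops_linear)
    fix t :: real
    show "closed_segment (circlepath 0 a t) (circlepath 0 b t) \<subseteq> ann R"
    proof
      fix x assume "x \<in> closed_segment (circlepath 0 a t) (circlepath 0 b t)"
      then obtain u where u: "0 \<le> u" "u \<le> 1"
        and x: "x = (1 - u) *\<^sub>R circlepath 0 a t + u *\<^sub>R circlepath 0 b t"
        by (auto simp: in_segment)
      have "x = of_real ((1 - u) * a + u * b) * exp (2 * of_real pi * \<i> * of_real t)"
        by (simp add: x circlepath scaleR_conv_of_real algebra_simps)
      then have n: "norm x = (1 - u) * a + u * b"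
        using pos u by (simp add: norm_mult del: of_real_add of_real_mult)
      have "1 / R < (1 - u) * a + u * b"
        using convex_bound_lt[of "- a" "- (1/R)" "- b" "1 - u" u] ab u by (simp add: algebra_simps)
      moreover have "(1 - u) * a + u * b < R"
        using convex_bound_lt[of a R b "1 - u" u] ab u by (simp add: algebra_simps)
      ultimately show "x \<in> ann R" by (simp add: ann_def n)
    qed
  qed auto
  then have "contour_integral (circlepath 0 a) (\<lambda>z. f z / z) = contour_integral (circlepath 0 b) (\<lambda>z. f z / z)"
    by (rule Cauchy_theorem_homotopic_loops) (use R in \<open>auto intro!: holomorphic_intros f dest: ann_nonzero\<close>)
  then show ?thesis using pos by (simp add: contour_circle_cmean_r)
qed

lemma cmean_r_add:
  assumes "continuous_on (sphere 0 r) f" "continuous_on (sphere 0 r) g" "0 \<le> r"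
  shows "cmean_r r (\<lambda>z. f z + g z) = cmean_r r f + cmean_r r g"
  unfolding cmean_r_def
  using circle_integrable[OF assms(1,3)] circle_integrable[OF assms(2,3)] by (simp add: integral_add)

lemma cmean_r_cmult: "cmean_r r (\<lambda>z. c * f z) = c * cmean_r r f"
  unfolding cmean_r_def by simp

lemma cmean_r_cong:
  assumes "\<And>z. norm z = r \<Longrightarrow> f z = g z" "0 \<le> r"
  shows "cmean_r r f = cmean_r r g"
  unfolding cmean_r_def by (rule integral_cong) (use assms in \<open>auto simp: norm_mult\<close>)

lemma cauchy_kernel_inside:
  assumes "norm z < r"
  shows "cmean_r r (\<lambda>t. t / (t - z)) = 1"
proof -
  have r: "0 < r" using assms norm_ge_zero[of z] by linarith
  have "((\<lambda>u. 1 / (u - z)) has_contour_integral 2 * of_real pi * \<i> * 1) (circlepath 0 r)"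
    by (rule Cauchy_integral_circlepath) (use assms in \<open>auto intro!: continuous_intros holomorphic_intros\<close>)
  then have "contour_integral (circlepath 0 r) (\<lambda>u. 1 / (u - z)) = 2 * of_real pi * \<i>"
    using contour_integral_unique by force
  also have "contour_integral (circlepath 0 r) (\<lambda>u. 1 / (u - z)) =
      contour_integral (circlepath 0 r) (\<lambda>u. (u / (u - z)) / u)"
    by (rule contour_integral_cong) (use r in auto)
  also have "\<dots> = 2 * of_real pi * \<i> * cmean_r r (\<lambda>u. u / (u - z))"
    by (rule contour_circle_cmean_r) (use r in simp)
  finally show ?thesis by simp
qed

lemma cauchy_kernel_outside:
  assumes "r < norm z" "0 < r"
  shows "cmean_r r (\<lambda>t. t / (t - z)) = 0"
proof -
  have "((\<lambda>u. 1 / (u - z)) has_contour_integral 0) (circlepath 0 r)"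
    by (rule Cauchy_theorem_convex_simple[of _ "ball 0 (norm z)"])
       (use assms in \<open>auto intro!: holomorphic_intros\<close>)
  then have "contour_integral (circlepath 0 r) (\<lambda>u. 1 / (u - z)) = 0"
    using contour_integral_unique by force
  also have "contour_integral (circlepath 0 r) (\<lambda>u. 1 / (u - z)) =
      contour_integral (circlepath 0 r) (\<lambda>u. (u / (u - z)) / u)"
    by (rule contour_integral_cong) (use assms in auto)
  also have "\<dots> = 2 * of_real pi * \<i> * cmean_r r (\<lambda>u. u / (u - z))"
    by (rule contour_circle_cmean_r) (use assms in simp)
  finally show ?thesis by simp
qed

text \<open>The difference quotient of \<open>f\<close> at \<open>z\<close> is holomorphic on the annulus, so its means over the
  two circles agree, which is the Cauchy formula for the annulus.\<close>

lemma annulus_cauchy: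
  assumes f: "f holomorphic_on ann R" and R: "1 < R" and ab: "1 / R < a" "a < norm z" "norm z < b" "b < R"
  shows "f z = cauchy_r b f z - cauchy_r a f z"
proof -
  have pos: "0 < a" "0 < b" using ab R by (smt (verit) divide_pos_pos)+
  define h where "h = (\<lambda>t. if t = z then deriv f z else (f t - f z) / (t - z))"
  have "h holomorphic_on ann R" unfolding h_def by (rule pole_lemma_open[OF f]) simp
  then have "(\<lambda>t. h t * t) holomorphic_on ann R" by (intro holomorphic_intros)
  then have e: "cmean_r a (\<lambda>t. h t * t) = cmean_r b (\<lambda>t. h t * t)"
    by (rule circle_means_equal) (use ab R in auto)
  have "cmean_r r (\<lambda>t. h t * t) = cauchy_r r f z - f z * cmean_r r (\<lambda>t. t / (t - z))"
    if r: "1 / R < r" "r < R" "r \<noteq> norm z" "0 < r" for r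
  proof -
    have "sphere 0 r \<subseteq> ann R" using r by (auto simp: ann_def)
    then have c: "continuous_on (sphere 0 r) f"
      using f holomorphic_on_imp_continuous_on continuous_on_subset by blast
    have "cmean_r r (\<lambda>t. h t * t) = cmean_r r (\<lambda>t. f t * t / (t - z) + (- f z) * (t / (t - z)))"
      by (rule cmean_r_cong) (use r in \<open>auto simp: h_def left_diff_distrib diff_divide_distrib\<close>)
    also have "\<dots> = cauchy_r r f z + cmean_r r (\<lambda>t. (- f z) * (t / (t - z)))"
      unfolding cauchy_r_def using r by (intro cmean_r_add) (auto intro!: continuous_intros c)
    finally show ?thesis by (simp only: cmean_r_cmult) simp
  qed
  from this[of a] this[of b] show ?thesis
    using e ab pos cauchy_kernel_inside[of z b] cauchy_kernel_outside[of a z] by (simp add: diff_eq_eq)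
qed

lemma norm_inverse_less: "1 < R \<Longrightarrow> 1 / R < norm (z :: complex) \<Longrightarrow> norm (1 / z) < R"
proof -
  assume R: "1 < R" and z: "1 / R < norm z"
  then have "0 < norm z" by (smt (verit) divide_pos_pos)
  then show ?thesis using R z by (simp add: norm_divide field_simps)
qed

text \<open>The Laurent decomposition: the part with nonnegative powers extends to the disc, the part
  with negative powers, expressed in the chart \<open>1/z\<close>, extends to the disc and vanishes at \<open>0\<close>.\<close>

definition laurent_split ::
  "(complex \<Rightarrow> complex) \<Rightarrow> real \<Rightarrow> (complex \<Rightarrow> complex) \<Rightarrow> (complex \<Rightarrow> complex) \<Rightarrow> bool" where
  "laurent_split f R F G \<longleftrightarrow> 1 < R \<and> F holomorphic_on ball 0 R \<and> G holomorphic_on ball 0 R \<and> G 0 = 0 \<and>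
     (\<forall>z\<in>ann R. f z = F z + G (1 / z))"

lemma holomorphic_continuous_sphere:
  "F holomorphic_on ball 0 R \<Longrightarrow> 1 < R \<Longrightarrow> continuous_on (sphere 0 1) F"
  by (rule continuous_on_subset[OF holomorphic_on_imp_continuous_on]) auto

lemma analytic_imp_continuous_sphere:
  "f analytic_on sphere 0 1 \<Longrightarrow> continuous_on (sphere 0 1) f"
  by (simp add: analytic_imp_holomorphic holomorphic_on_imp_continuous_on)

lemma cauchy_r_laurent_split:
  assumes f: "f holomorphic_on ann R" and R: "1 < R" and r: "1 < r" "r < R"
  shows "\<exists>G. laurent_split f r (cauchy_r r f) G"
proof -
  \<comment> \<open>The inner circle is the image of the outer one under inversion, so both parts
    become holomorphic on discs of the same radius \<open>r\<close>.\<close>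
  define a where "a = 1 / r"
  have a: "1 / R < a" "a < 1" using r R divide_strict_left_mono[of r R 1] by (auto simp: a_def)
  have a_R: "a < R" using a R by linarith
  have "1 / R < 1" using R by simp
  then have R1: "1 / R < r" using r by linarith
  have cont: "continuous_on (sphere 0 s) f" if "1 / R < s" "s < R" for s
    by (rule continuous_on_subset[OF holomorphic_on_imp_continuous_on[OF f]]) (use that in \<open>auto simp: ann_def\<close>)
  define G where "G = (\<lambda>s. cmean_r a (\<lambda>t. f t * t * s / (1 - t * s)))"
  have "cauchy_r r f holomorphic_on ball 0 r"
    by (rule cauchy_r_holomorphic) (use r R R1 in \<open>auto intro!: cont\<close>)
  moreover have "G holomorphic_on ball 0 r"
    using cauchy_r_exterior_holomorphic[of a f] cont[of a] a r R a_R by (simp add: G_def a_def)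
  moreover have "G 0 = 0" by (simp add: G_def cmean_r_def)
  moreover have "f z = cauchy_r r f z + G (1 / z)" if z: "z \<in> ann r" for z
  proof -
    have nz: "z \<noteq> 0" using z r(1) ann_nonzero by blast
    have "G (1 / z) = cmean_r a (\<lambda>t. (-1) * (f t * t / (t - z)))"
      unfolding G_def
    proof (rule cmean_r_cong)
      fix t :: complex assume t: "norm t = a"
      then have "t \<noteq> z" using z by (auto simp: ann_def a_def)
      then show "f t * t * (1 / z) / (1 - t * (1 / z)) = - 1 * (f t * t / (t - z))"
        using nz by (simp add: field_simps)
    qed (use r in \<open>simp add: a_def\<close>)
    then have "G (1 / z) = - cauchy_r a f z" unfolding cmean_r_cmult by (simp add: cauchy_r_def)
    then show ?thesis
      using annulus_cauchy[OF f R, of a z r] z a r by (simp add: ann_def a_def)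
  qed
  ultimately show ?thesis using r unfolding laurent_split_def by blast
qed

context
  fixes f F G R
  assumes split: "laurent_split f R F G"
begin

lemma laurent_split_holomorphic: "f holomorphic_on ann R"
proof -
  have "(\<lambda>z. F z + G (1 / z)) holomorphic_on ann R"
  proof (intro holomorphic_intros)
    show "F holomorphic_on ann R"
      using split by (auto simp: laurent_split_def ann_def intro: holomorphic_on_subset)
    have "(G \<circ> (\<lambda>z. 1 / z)) holomorphic_on ann R"
      by (rule holomorphic_on_compose_gen[where t = "ball 0 R"])
         (use split in \<open>auto simp: laurent_split_def ann_def norm_inverse_less intro!: holomorphic_intros\<close>)
    then show "(\<lambda>z. G (1 / z)) holomorphic_on ann R" by (simp add: o_def)
  qed
  then show ?thesis
    by (rule holomorphic_transform) (use split in \<open>auto simp: laurent_split_def\<close>)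
qed

lemma laurent_split_lcoeff: "lcoeff f k = lcoeff F k + lcoeff G (- k)"
proof -
  have R: "1 < R" and F: "continuous_on (sphere 0 1) F" and G: "continuous_on (sphere 0 1) G"
    using split holomorphic_continuous_sphere by (auto simp: laurent_split_def)
  have G': "continuous_on (sphere 0 1) (\<lambda>z. G (1 / z))"
    by (rule continuous_on_compose2[OF G]) (auto intro!: continuous_intros simp: norm_divide)
  have "lcoeff f k = lcoeff (\<lambda>z. F z + G (1 / z)) k"
    by (rule lcoeff_cong) (use split sphere_subset_ann[OF R] in \<open>auto simp: laurent_split_def\<close>)
  also have "\<dots> = cmean (\<lambda>z. F z * z powi (- k) + G (1 / z) * z powi (- k))"
    by (simp add: lcoeff_def ring_distribs)
  also have "\<dots> = lcoeff F k + lcoeff (\<lambda>z. G (1 / z)) k"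
    unfolding lcoeff_def by (intro cmean_add continuous_intros F G') auto
  finally show ?thesis by (simp add: lcoeff_invert[OF G])
qed

text \<open>The two parts share no index: \<open>F\<close> has no negative coefficients, and
  \<open>G 0 = 0\<close> leaves the constant term to \<open>F\<close> alone.\<close>

lemma laurent_split_coeffs:
  "0 \<le> k \<Longrightarrow> lcoeff f k = lcoeff F k" "k < 0 \<Longrightarrow> lcoeff f k = lcoeff G (- k)"
  "cmean f = F 0"
proof -
  have R: "1 < R" and F: "F holomorphic_on ball 0 R" and G: "G holomorphic_on ball 0 R" and G0: "G 0 = 0"
    using split by (auto simp: laurent_split_def)
  show 1: "0 \<le> k \<Longrightarrow> lcoeff f k = lcoeff F k" for k
    unfolding laurent_split_lcoeff using G0 by (cases "k = 0") (simp_all add: lcoeff_holomorphic[OF G R])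
  show "k < 0 \<Longrightarrow> lcoeff f k = lcoeff G (- k)"
    unfolding laurent_split_lcoeff by (simp add: lcoeff_holomorphic[OF F R])
  show "cmean f = F 0"
    using 1[of 0] cmean_holomorphic[OF F R] by (simp add: lcoeff_0)
qed

text \<open>Valid on the whole disc and not just on the annulus. The values inside the circle enter
  the condition that \<open>lamb\<close> has no zeros there.\<close>

lemma laurent_split_ltrunc_nonneg:
  assumes "norm z < R"
  shows "ltrunc {0..} f z = F z" "ltrunc {0<..} f z = F z - F 0"
proof -
  have R: "1 < R" and F: "F holomorphic_on ball 0 R" using split by (auto simp: laurent_split_def)
  have s: "((\<lambda>k. lcoeff F k * z powi k) has_sum F z) {0..}"
    by (rule has_sum_lcoeff_holomorphic[OF F R assms])
  show "ltrunc {0..} f z = F z"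
    unfolding ltrunc_def using infsumI[OF s]
    by (subst infsum_cong[where g = "\<lambda>k. lcoeff F k * z powi k"]) (auto simp: laurent_split_coeffs)
  have "((\<lambda>k. lcoeff F k * z powi k) has_sum (F z - (\<Sum>k\<in>{0}. lcoeff F k * z powi k))) ({0..} - {0})"
    by (rule has_sum_Diff[OF s has_sum_finite]) auto
  moreover have "{0..} - {0} = {0::int<..}" by auto
  ultimately have "((\<lambda>k. lcoeff F k * z powi k) has_sum (F z - F 0)) {0<..}"
    using cmean_holomorphic[OF F R] by (simp add: lcoeff_0)
  then show "ltrunc {0<..} f z = F z - F 0"
    unfolding ltrunc_def
    by (subst infsum_cong[where g = "\<lambda>k. lcoeff F k * z powi k"]) (auto simp: laurent_split_coeffs infsumI)
qed

lemma laurent_split_ltrunc_nonpos: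
  assumes "1 / R < norm z"
  shows "ltrunc {..<0} f z = G (1 / z)" "ltrunc {..0} f z = G (1 / z) + F 0"
proof -
  have R: "1 < R" and F: "F holomorphic_on ball 0 R" and G: "G holomorphic_on ball 0 R" and G0: "G 0 = 0"
    using split by (auto simp: laurent_split_def)
  have z: "z \<noteq> 0" "norm (1 / z) < R"
    using assms R norm_inverse_less by auto
  have "((\<lambda>k. lcoeff G k * (1 / z) powi k) has_sum G (1 / z)) {0..}"
    by (rule has_sum_lcoeff_holomorphic[OF G R z(2)])
  moreover have "((\<lambda>k. lcoeff G (- k) * z powi k) has_sum G (1 / z)) {..0} \<longleftrightarrow>
      ((\<lambda>k. lcoeff G k * (1 / z) powi k) has_sum G (1 / z)) {0..}"
    by (rule has_sum_reindex_bij_witness[where i = uminus and j = uminus])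
       (use z in \<open>auto simp: power_int_minus power_int_divide_distrib field_simps\<close>)
  ultimately have s: "((\<lambda>k. lcoeff G (- k) * z powi k) has_sum G (1 / z)) {..0}" by simp
  have "((\<lambda>k. lcoeff G (- k) * z powi k) has_sum (G (1 / z) - (\<Sum>k\<in>{0}. lcoeff G (- k) * z powi k))) ({..0} - {0})"
    by (rule has_sum_Diff[OF s has_sum_finite]) auto
  moreover have "{..0} - {0} = {..<0::int}" by auto
  ultimately have s': "((\<lambda>k. lcoeff G (- k) * z powi k) has_sum G (1 / z)) {..<0}"
    using cmean_holomorphic[OF G R] G0 by (simp add: lcoeff_0)
  then have s'': "((\<lambda>k. lcoeff f k * z powi k) has_sum G (1 / z)) {..<0}"
    by (subst has_sum_cong[where g = "\<lambda>k. lcoeff G (- k) * z powi k"]) (auto simp: laurent_split_coeffs)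
  then show "ltrunc {..<0} f z = G (1 / z)"
    unfolding ltrunc_def by (simp add: infsumI)
  have "((\<lambda>k. lcoeff f k * z powi k) has_sum (G (1 / z) + (\<Sum>k\<in>{0}. lcoeff f k * z powi k))) ({..<0} \<union> {0})"
    by (rule has_sum_Un_disjoint[OF s'' has_sum_finite]) auto
  moreover have "{..<0} \<union> {0} = {..0::int}" by auto
  ultimately show "ltrunc {..0} f z = G (1 / z) + F 0"
    unfolding ltrunc_def by (auto simp: lcoeff_0 laurent_split_coeffs intro!: infsumI)
qed

end

lemma analytic_laurent_split:
  assumes "f analytic_on sphere 0 1"
  obtains R F G where "laurent_split f R F G"
proof -
  obtain R where "1 < R" "f holomorphic_on ann R" using analytic_sphere_ann[OF assms] .
  then show ?thesis using that cauchy_r_laurent_split[of f R "(1 + R) / 2"] by auto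
qed

text \<open>Turns an infinite sum of coefficients into an integral over a circle that stays away
  from \<open>z\<close>; this is the form in which truncations can be differentiated in
  parameters.\<close>

lemma ltrunc_eq_cauchy_r:
  assumes f: "f holomorphic_on ann R" and r: "1 < r" "r < R" "norm z < r"
  shows "ltrunc {0..} f z = cauchy_r r f z"
  using cauchy_r_laurent_split[OF f _ r(1,2)] laurent_split_ltrunc_nonneg(1) r by fastforce

lemma laurent_split_radius:
  assumes "laurent_split f R F G" "1 < r" "r \<le> R"
  shows "laurent_split f r F G"
proof -
  have "ball 0 r \<subseteq> ball (0::complex) R" "ann r \<subseteq> ann R"
    using assms ann_mono by auto
  then show ?thesis
    using assms holomorphic_on_subset unfolding laurent_split_def by blast
qed

lemma laurent_split_add:
  assumes "laurent_split f R F G" "laurent_split f' R F' G'"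
  shows "laurent_split (\<lambda>z. f z + c * f' z) R (\<lambda>z. F z + c * F' z) (\<lambda>z. G z + c * G' z)"
  using assms unfolding laurent_split_def by (auto intro!: holomorphic_intros simp: algebra_simps)

text \<open>One radius serves all \<open>c\<close>, because the splits of \<open>f\<close> and
  \<open>g\<close> are combined linearly. Along a line in the manifold \<open>c\<close> is the
  moving parameter.\<close>

lemma ltrunc_lin:
  assumes "f analytic_on sphere 0 1" "g analytic_on sphere 0 1" 
  obtains r where "1 < r"
    "\<And>c z. norm z < r \<Longrightarrow> ltrunc {0<..} (\<lambda>z. f z + c * g z) z = ltrunc {0<..} f z + c * ltrunc {0<..} g z"
    "\<And>c z. 1 / r < norm z \<Longrightarrow> ltrunc {..0} (\<lambda>z. f z + c * g z) z = ltrunc {..0} f z + c * ltrunc {..0} g z"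
    "\<And>c z. norm z < r \<Longrightarrow> ltrunc {0..} (\<lambda>z. f z + c * g z) z = ltrunc {0..} f z + c * ltrunc {0..} g z"
    "\<And>c z. 1 / r < norm z \<Longrightarrow> ltrunc {..<0} (\<lambda>z. f z + c * g z) z = ltrunc {..<0} f z + c * ltrunc {..<0} g z"
proof -
  obtain R F G where s: "laurent_split f R F G" using analytic_laurent_split[OF assms(1)] .
  obtain R' F' G' where s': "laurent_split g R' F' G'" using analytic_laurent_split[OF assms(2)] .
  define r where "r = min R R'"
  have r: "1 < r" using s s' by (auto simp: r_def laurent_split_def)
  note 1 = laurent_split_radius[OF s r] and 2 = laurent_split_radius[OF s' r]
  have 1: "laurent_split f r F G" and 2: "laurent_split g r F' G'"
    by (rule 1, simp add: r_def) (rule 2, simp add: r_def)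
  note 3 = laurent_split_add[OF 1 2]
  show ?thesis
    by (rule that[OF r])
       (simp_all add: laurent_split_ltrunc_nonneg[OF 1] laurent_split_ltrunc_nonneg[OF 2] laurent_split_ltrunc_nonneg[OF 3]
          laurent_split_ltrunc_nonpos[OF 1] laurent_split_ltrunc_nonpos[OF 2] laurent_split_ltrunc_nonpos[OF 3] algebra_simps)
qed

text \<open>The projection \<open>ltrunc {0..}\<close> is determined by its values on functions extending to one of
  the two sides of the circle.\<close>

definition extends_in :: "(complex \<Rightarrow> complex) \<Rightarrow> complex \<Rightarrow> bool" where
  "extends_in f c \<longleftrightarrow> (\<exists>F. F analytic_on cball 0 1 \<and> F 0 = c \<and> (\<forall>z\<in>sphere 0 1. f z = F z))"

definition extends_out :: "(complex \<Rightarrow> complex) \<Rightarrow> complex \<Rightarrow> bool" where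
  "extends_out f c \<longleftrightarrow> extends_in (\<lambda>z. f (1 / z)) c"

lemma extends_in_cong:
  "extends_in f c \<Longrightarrow> (\<And>z. z \<in> sphere 0 1 \<Longrightarrow> g z = f z) \<Longrightarrow> extends_in g c"
  unfolding extends_in_def by auto

lemma extends_out_cong:
  "extends_out f c \<Longrightarrow> (\<And>z. z \<in> sphere 0 1 \<Longrightarrow> g z = f z) \<Longrightarrow> extends_out g c"
  unfolding extends_out_def by (rule extends_in_cong) (auto simp: norm_divide)

lemma extends_in_const [simp, intro]: "extends_in (\<lambda>_. c) c"
  unfolding extends_in_def by (intro exI[of _ "\<lambda>_. c"]) (auto intro!: analytic_intros)

lemma extends_in_id [simp, intro]: "extends_in (\<lambda>z. z) 0"
  unfolding extends_in_def by (intro exI[of _ "\<lambda>z. z"]) (auto intro!: analytic_intros)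

lemma extends_in_add: "extends_in f a \<Longrightarrow> extends_in g b \<Longrightarrow> extends_in (\<lambda>z. f z + g z) (a + b)"
  unfolding extends_in_def
proof (elim exE conjE)
  fix F G assume "F analytic_on cball 0 1" "G analytic_on cball 0 1" "F 0 = a" "G 0 = b"
    "\<forall>z\<in>sphere 0 1. f z = F z" "\<forall>z\<in>sphere 0 1. g z = G z"
  then show "\<exists>F. F analytic_on cball 0 1 \<and> F 0 = a + b \<and> (\<forall>z\<in>sphere 0 1. f z + g z = F z)"
    by (intro exI[of _ "\<lambda>z. F z + G z"]) (auto intro!: analytic_intros)
qed

lemma extends_in_mult: "extends_in f a \<Longrightarrow> extends_in g b \<Longrightarrow> extends_in (\<lambda>z. f z * g z) (a * b)"
  unfolding extends_in_def
proof (elim exE conjE)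
  fix F G assume "F analytic_on cball 0 1" "G analytic_on cball 0 1" "F 0 = a" "G 0 = b"
    "\<forall>z\<in>sphere 0 1. f z = F z" "\<forall>z\<in>sphere 0 1. g z = G z"
  then show "\<exists>F. F analytic_on cball 0 1 \<and> F 0 = a * b \<and> (\<forall>z\<in>sphere 0 1. f z * g z = F z)"
    by (intro exI[of _ "\<lambda>z. F z * G z"]) (auto intro!: analytic_intros)
qed

lemma extends_in_uminus: "extends_in f a \<Longrightarrow> extends_in (\<lambda>z. - f z) (- a)"
  using extends_in_mult[OF extends_in_const[of "-1"]] by simp

lemma extends_in_diff: "extends_in f a \<Longrightarrow> extends_in g b \<Longrightarrow> extends_in (\<lambda>z. f z - g z) (a - b)"
  using extends_in_add[OF _ extends_in_uminus] by (metis (no_types, lifting) ext uminus_add_conv_diff add.commute)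

lemma extends_out_const [simp, intro]: "extends_out (\<lambda>_. c) c"
  unfolding extends_out_def by simp

lemma extends_out_inverse [simp, intro]: "extends_out (\<lambda>z. 1 / z) 0"
  unfolding extends_out_def by (rule extends_in_cong[OF extends_in_id]) simp

lemma extends_out_add: "extends_out f a \<Longrightarrow> extends_out g b \<Longrightarrow> extends_out (\<lambda>z. f z + g z) (a + b)"
  unfolding extends_out_def by (rule extends_in_add)

lemma extends_out_mult: "extends_out f a \<Longrightarrow> extends_out g b \<Longrightarrow> extends_out (\<lambda>z. f z * g z) (a * b)"
  unfolding extends_out_def by (rule extends_in_mult)

lemma extends_out_diff: "extends_out f a \<Longrightarrow> extends_out g b \<Longrightarrow> extends_out (\<lambda>z. f z - g z) (a - b)"
  unfolding extends_out_def by (rule extends_in_diff)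

lemma extends_in_mean:
  assumes "extends_in f a"
  shows "cmean f = a"
proof -
  obtain F where F: "F analytic_on cball 0 1" "F 0 = a" "\<forall>z\<in>sphere 0 1. f z = F z"
    using assms unfolding extends_in_def by blast
  obtain R where "1 < R" "F holomorphic_on ball 0 R" using cball_ball_nbhd[OF F(1)] .
  then have "cmean F = a" using cmean_holomorphic F(2) by blast
  then show ?thesis using cmean_cong[of f F] F(3) by simp
qed

lemma extends_in_cont: "extends_in f a \<Longrightarrow> continuous_on (sphere 0 1) f"
proof -
  assume "extends_in f a"
  then obtain F where F: "F analytic_on cball 0 1" "\<forall>z\<in>sphere 0 1. f z = F z"
    unfolding extends_in_def by blast
  then have "continuous_on (sphere 0 1) F"
    by (intro analytic_imp_continuous_sphere analytic_on_subset[OF F(1)]) auto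
  then show ?thesis using F(2) continuous_on_cong by (metis (no_types, lifting))
qed

lemma extends_out_cont: "extends_out f a \<Longrightarrow> continuous_on (sphere 0 1) f"
proof -
  assume "extends_out f a"
  then have "continuous_on (sphere 0 1) (\<lambda>z. f (1 / z))"
    unfolding extends_out_def by (rule extends_in_cont)
  then have "continuous_on (sphere 0 1) (\<lambda>z. f (1 / (1 / z)))"
    by (rule continuous_on_compose2) (auto intro!: continuous_intros simp: norm_divide)
  then show ?thesis by simp
qed

lemma extends_out_mean: "extends_out f a \<Longrightarrow> cmean f = a"
  using extends_in_mean[of "\<lambda>z. f (1 / z)"] cmean_invert[OF extends_out_cont] unfolding extends_out_def by metis

text \<open>Such extensions form a Laurent split on a common radius. Most truncations of products
  below are computed by writing down the inner and the outer summand and appealing to this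
  lemma.\<close>

lemma ltrunc_nonneg_unique:
  assumes eq: "\<And>z. z \<in> sphere 0 1 \<Longrightarrow> f z = g z + h z" and g: "extends_in g a" and h: "extends_out h 0"
    and z: "z \<in> sphere 0 1"
  shows "ltrunc {0..} f z = g z"
proof -
  obtain F where F: "F analytic_on cball 0 1" "\<forall>z\<in>sphere 0 1. g z = F z"
    using g unfolding extends_in_def by blast
  obtain H where H: "H analytic_on cball 0 1" "H 0 = 0" "\<forall>z\<in>sphere 0 1. h (1 / z) = H z"
    using h unfolding extends_in_def extends_out_def by blast
  have H': "h z = H (1 / z)" if "z \<in> sphere 0 1" for z
  proof -
    have "1 / z \<in> sphere 0 1" using that by (simp add: norm_divide)
    then show ?thesis using H(3) by force
  qed
  obtain R where R: "1 < R" "F holomorphic_on ball 0 R" using cball_ball_nbhd[OF F(1)] .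
  obtain R' where R': "1 < R'" "H holomorphic_on ball 0 R'" using cball_ball_nbhd[OF H(1)] .
  define r where "r = min R R'"
  have "laurent_split (\<lambda>z. F z + H (1 / z)) r F H"
    using R R' H(2) by (auto simp: laurent_split_def r_def elim!: holomorphic_on_subset)
  moreover have "ltrunc {0..} f = ltrunc {0..} (\<lambda>z. F z + H (1 / z))"
    by (rule ltrunc_cong) (use eq F(2) H' in auto)
  ultimately show ?thesis
    using laurent_split_ltrunc_nonneg(1)[of _ r F H z] z R R' F(2) by (simp add: r_def)
qed

lemma extends_in_nonneg_part:
  assumes "f analytic_on sphere 0 1"
  shows "extends_in (ltrunc {0..} f) (cmean f)" "extends_out (\<lambda>z. f z - ltrunc {0..} f z) 0"
proof -
  obtain R F G where s: "laurent_split f R F G" using analytic_laurent_split[OF assms] .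
  then have R: "1 < R" and F: "F holomorphic_on ball 0 R" and G: "G holomorphic_on ball 0 R" "G 0 = 0"
    and f: "\<And>z. z \<in> ann R \<Longrightarrow> f z = F z + G (1 / z)"
    by (auto simp: laurent_split_def)
  show "extends_in (ltrunc {0..} f) (cmean f)"
    unfolding extends_in_def
    by (intro exI[of _ F])
       (use R F s in \<open>auto simp: laurent_split_coeffs(3) laurent_split_ltrunc_nonneg intro!: holomorphic_ball_cball[OF _ R]\<close>)
  show "extends_out (\<lambda>z. f z - ltrunc {0..} f z) 0"
    unfolding extends_out_def extends_in_def
    by (intro exI[of _ G])
       (use R G s f sphere_subset_ann[OF R] in \<open>auto simp: laurent_split_ltrunc_nonneg norm_divide ann_def intro!: holomorphic_ball_cball[OF _ R]\<close>)
qed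

lemma ltrunc_other:
  assumes "f analytic_on sphere 0 1" "z \<in> sphere 0 1"
  shows "ltrunc {0<..} f z = ltrunc {0..} f z - cmean f"
    "ltrunc {..<0} f z = f z - ltrunc {0..} f z"
    "ltrunc {..0} f z = f z - ltrunc {0..} f z + cmean f"
proof -
  obtain R F G where s: "laurent_split f R F G" using analytic_laurent_split[OF assms(1)] .
  then have R: "1 < R" and f: "f z = F z + G (1 / z)"
    using assms(2) sphere_subset_ann[of R] by (auto simp: laurent_split_def subset_iff)
  show "ltrunc {0<..} f z = ltrunc {0..} f z - cmean f"
    "ltrunc {..<0} f z = f z - ltrunc {0..} f z"
    "ltrunc {..0} f z = f z - ltrunc {0..} f z + cmean f"
    using assms(2) R f
    by (simp_all add: laurent_split_ltrunc_nonneg[OF s] laurent_split_ltrunc_nonpos[OF s] laurent_split_coeffs(3)[OF s])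
qed

lemma ltrunc_analytic:
  assumes "f analytic_on sphere 0 1"
  shows "ltrunc {0..} f analytic_on sphere 0 1" "ltrunc {0<..} f analytic_on sphere 0 1"
    "ltrunc {..<0} f analytic_on sphere 0 1" "ltrunc {..0} f analytic_on sphere 0 1"
proof -
  obtain R F G where s: "laurent_split f R F G" using analytic_laurent_split[OF assms] .
  then have R: "1 < R" and F: "F holomorphic_on ann R" and G: "(\<lambda>z. f z - F z) holomorphic_on ann R"
    and f: "\<And>z. z \<in> ann R \<Longrightarrow> f z = F z + G (1 / z)"
    using laurent_split_holomorphic[OF s]
    by (auto simp: laurent_split_def ann_def intro!: holomorphic_intros intro: holomorphic_on_subset)
  have i: "norm z < R" "1 / R < norm z" if "z \<in> ann R" for z using that by (auto simp: ann_def)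
  have "ltrunc {0..} f holomorphic_on ann R"
    by (rule holomorphic_transform[OF F]) (simp add: laurent_split_ltrunc_nonneg[OF s] i)
  moreover have "ltrunc {0<..} f holomorphic_on ann R"
    by (rule holomorphic_transform[of "\<lambda>z. F z - F 0"])
       (auto intro!: holomorphic_intros F simp: laurent_split_ltrunc_nonneg[OF s] i)
  moreover have "ltrunc {..<0} f holomorphic_on ann R"
    by (rule holomorphic_transform[OF G]) (simp add: laurent_split_ltrunc_nonpos[OF s] i f)
  moreover have "ltrunc {..0} f holomorphic_on ann R"
    by (rule holomorphic_transform[of "\<lambda>z. f z - F z + F 0"])
       (intro holomorphic_intros G, simp add: laurent_split_ltrunc_nonpos[OF s] i f)
  ultimately show "ltrunc {0..} f analytic_on sphere 0 1" "ltrunc {0<..} f analytic_on sphere 0 1"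
    "ltrunc {..<0} f analytic_on sphere 0 1" "ltrunc {..0} f analytic_on sphere 0 1"
    using R by (auto intro: holomorphic_ann_sphere)
qed

lemma one_islimpt_unit_circle: "1 islimpt sphere (0::complex) 1"
proof (rule connected_imp_perfect)
  have "1 \<in> sphere (0::complex) 1" "-1 \<in> sphere (0::complex) 1" by auto
  then show "sphere (0::complex) 1 \<noteq> {x}" for x by (metis one_neq_neg_one singletonD)
qed (auto simp: connected_sphere_eq)

text \<open>The circle has a limit point in the connected annulus. Equations are known on the circle
  only, but differentiating them needs a neighbourhood.\<close>

lemma ann_identity:
  assumes fg: "f holomorphic_on ann R" "g holomorphic_on ann R" and R: "1 < R"
    and eq: "\<And>z. z \<in> sphere 0 1 \<Longrightarrow> f z = g z" and z: "z \<in> ann R"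
  shows "f z = g z"
proof -
  note lim = one_islimpt_unit_circle
  have "f z - g z = 0"
    by (rule analytic_continuation[where f = "\<lambda>z. f z - g z" and S = "ann R" and U = "sphere 0 1" and \<xi> = 1])
       (use fg lim eq z sphere_subset_ann[OF R] in \<open>auto intro!: holomorphic_intros connected_ann\<close>)
  then show ?thesis by simp
qed

lemma common_ann:
  assumes "\<And>f. f \<in> set fs \<Longrightarrow> f analytic_on sphere 0 1"
  shows "\<exists>R>1. \<forall>f\<in>set fs. f holomorphic_on ann R"
  using assms
proof (induction fs)
  case Nil
  show ?case by (intro exI[of _ 2]) auto
next
  case (Cons f fs)
  then obtain R1 where R1: "1 < R1" "\<forall>f\<in>set fs. f holomorphic_on ann R1" by auto
  obtain R2 where R2: "1 < R2" "f holomorphic_on ann R2" using analytic_sphere_ann Cons.prems by (metis list.set_intros(1))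
  have "ann (min R1 R2) \<subseteq> ann R1" "ann (min R1 R2) \<subseteq> ann R2"
    using R1(1) R2(1) by (intro ann_mono; simp)+
  then show ?case
    using R1 R2 by (intro exI[of _ "min R1 R2"]) (auto elim: holomorphic_on_subset)
qed

text \<open>Makes \<open>deriv\<close> well defined for elements of \<open>H(S^1)\<close>, which are
  compared on the circle only.\<close>

lemma deriv_eq_sphere:
  assumes "f analytic_on sphere 0 1" "g analytic_on sphere 0 1"
    "\<And>z. z \<in> sphere 0 1 \<Longrightarrow> f z = g z" "z \<in> sphere 0 1"
  shows "deriv f z = deriv g z"
proof -
  obtain R where R: "1 < R" "f holomorphic_on ann R" "g holomorphic_on ann R"
    using common_ann[of "[f, g]"] assms(1,2) by auto
  then have R': "f z = g z" if "z \<in> ann R" for z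
    using ann_identity[OF R(2,3,1) assms(3) that] by simp
  have "z \<in> ann R" using assms(4) sphere_subset_ann[OF R(1)] by blast
  then have "eventually (\<lambda>z. z \<in> ann R) (nhds z)" by (simp add: eventually_nhds_in_open)
  then have "eventually (\<lambda>z. f z = g z) (nhds z)" by (rule eventually_mono) (rule R')
  then show ?thesis by (rule deriv_cong_ev) simp
qed

text \<open>After division by \<open>z\<close> the integrand has the single-valued primitive
  \<open>f\<close> near the circle. This is both integration by parts and the rotation invariance of
  means.\<close>

lemma cmean_deriv:
  assumes "f analytic_on sphere 0 1"
  shows "cmean (\<lambda>z. z * deriv f z) = 0"
proof -
  obtain R where R: "1 < R" "f holomorphic_on ann R" using analytic_sphere_ann[OF assms] .
  have "(deriv f has_contour_integral 0) (circlepath 0 1)"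
  proof (rule Cauchy_theorem_primitive)
    show "(f has_field_derivative deriv f x) (at x within ann R)" if "x \<in> ann R" for x
      using holomorphic_derivI[OF R(2) open_ann that] by (rule has_field_derivative_at_within)
    show "path_image (circlepath 0 1) \<subseteq> ann R" using sphere_subset_ann[OF R(1)] by simp
  qed simp_all
  then have "contour_integral (circlepath 0 1) (deriv f) = 0" by (rule contour_integral_unique)
  moreover have "contour_integral (circlepath 0 1) (deriv f) = contour_integral (circlepath 0 1) (\<lambda>z. z * deriv f z / z)"
    by (rule contour_integral_cong) auto
  ultimately show ?thesis by (simp add: cmean_def)
qed

section \<open>Differentiation under the mean\<close>

text \<open>Joint continuity of \<open>F'\<close> feeds the Leibniz rule; holomorphy of both slices
  in \<open>z\<close> lets truncations be taken of \<open>F\<close> and of \<open>F'\<close>. The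
  set \<open>W\<close> is not a product in general, since inequalities between moduli in both
  variables will cut it out.\<close>

definition fam ::
  "(complex \<times> complex) set \<Rightarrow> (complex \<Rightarrow> complex \<Rightarrow> complex) \<Rightarrow> (complex \<Rightarrow> complex \<Rightarrow> complex) \<Rightarrow> bool" where
  "fam W F F' \<longleftrightarrow> open W \<and>
     continuous_on W (\<lambda>x. F (fst x) (snd x)) \<and> continuous_on W (\<lambda>x. F' (fst x) (snd x)) \<and>
     (\<forall>e z. (e, z) \<in> W \<longrightarrow> ((\<lambda>e. F e z) has_field_derivative F' e z) (at e)) \<and>
     (\<forall>e. F e holomorphic_on {z. (e, z) \<in> W}) \<and> (\<forall>e. F' e holomorphic_on {z. (e, z) \<in> W})"

lemma famI:
  assumes "open W" "continuous_on W (\<lambda>x. F (fst x) (snd x))" "continuous_on W (\<lambda>x. F' (fst x) (snd x))"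
    "\<And>e z. (e, z) \<in> W \<Longrightarrow> ((\<lambda>e. F e z) has_field_derivative F' e z) (at e)"
    "\<And>e. F e holomorphic_on {z. (e, z) \<in> W}" "\<And>e. F' e holomorphic_on {z. (e, z) \<in> W}"
  shows "fam W F F'"
  using assms unfolding fam_def by blast

lemma famD:
  assumes "fam W F F'"
  shows "open W" "continuous_on W (\<lambda>x. F (fst x) (snd x))" "continuous_on W (\<lambda>x. F' (fst x) (snd x))"
    "\<And>e z. (e, z) \<in> W \<Longrightarrow> ((\<lambda>e. F e z) has_field_derivative F' e z) (at e)"
    "\<And>e. F e holomorphic_on {z. (e, z) \<in> W}" "\<And>e. F' e holomorphic_on {z. (e, z) \<in> W}"
  using assms unfolding fam_def by blast+

text \<open>The combination rules deliver derivatives in raw form. The intended formula is then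
  proved as an algebraic identity at points of \<open>W\<close> only, where the denominators do not
  vanish.\<close>

lemma fam_deriv_cong:
  assumes "fam W F F'" "\<And>e z. (e, z) \<in> W \<Longrightarrow> F' e z = G' e z"
  shows "fam W F G'"
proof (rule famI)
  show "continuous_on W (\<lambda>x. G' (fst x) (snd x))"
    using famD(3)[OF assms(1)] by (rule continuous_on_eq) (simp add: assms(2))
  show "G' e holomorphic_on {z. (e, z) \<in> W}" for e
    using famD(6)[OF assms(1)] by (rule holomorphic_transform) (simp add: assms(2))
qed (use famD[OF assms(1)] assms(2) in auto)

lemma open_snd_vimage: "open W \<Longrightarrow> open {e. (e, z) \<in> W}"
proof -
  assume "open W"
  then have "open ((\<lambda>e. (e, z)) -` W)" by (intro open_vimage) (auto intro!: continuous_intros)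
  then show ?thesis by (simp add: vimage_def)
qed

lemma fam_cong:
  assumes "fam W F F'" "\<And>e z. (e, z) \<in> W \<Longrightarrow> G e z = F e z"
  shows "fam W G F'"
proof (rule famI)
  show "continuous_on W (\<lambda>x. G (fst x) (snd x))"
    using famD(2)[OF assms(1)] by (rule continuous_on_eq) (simp add: assms(2))
  show "G e holomorphic_on {z. (e, z) \<in> W}" for e
    using famD(5)[OF assms(1)] by (rule holomorphic_transform) (simp add: assms(2))
  show "((\<lambda>e. G e z) has_field_derivative F' e z) (at e)" if "(e, z) \<in> W" for e z
  proof -
    have "eventually (\<lambda>y. (y, z) \<in> W) (nhds e)"
      using eventually_nhds_in_open[OF open_snd_vimage[OF famD(1)[OF assms(1)]], of e z] that by simp
    then have "eventually (\<lambda>y. F y z = G y z) (nhds e)" by (rule eventually_mono) (simp add: assms(2))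
    then show ?thesis by (rule DERIV_cong_ev[THEN iffD1, OF refl _ refl famD(4)[OF assms(1) that]])
  qed
qed (use famD[OF assms(1)] in auto)

lemma fam_subset:
  assumes "fam W F F'" "open V" "V \<subseteq> W"
  shows "fam V F F'"
proof (rule famI)
  show "F e holomorphic_on {z. (e, z) \<in> V}" "F' e holomorphic_on {z. (e, z) \<in> V}" for e
    using famD(5,6)[OF assms(1), of e] assms(3) by (auto elim!: holomorphic_on_subset)
qed (use famD[OF assms(1)] assms in \<open>auto intro: continuous_on_subset\<close>)

lemma fam_fixed:
  assumes "g holomorphic_on A" "open W" "W \<subseteq> UNIV \<times> A"
  shows "fam W (\<lambda>e. g) (\<lambda>e z. 0)"
proof (rule famI)
  show "continuous_on W (\<lambda>x. g (snd x))"
    by (rule continuous_on_compose2[OF holomorphic_on_imp_continuous_on[OF assms(1)]])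
       (use assms in \<open>auto intro!: continuous_intros\<close>)
  show "g holomorphic_on {z. (e, z) \<in> W}" for e
    using assms by (auto elim!: holomorphic_on_subset)
qed (use assms in auto)

lemma fam_param:
  assumes "\<And>e. (c has_field_derivative c' e) (at e)" "open W"
  shows "fam W (\<lambda>e z. c e) (\<lambda>e z. c' e)"
proof -
  have c: "c holomorphic_on UNIV" using assms(1) by (meson holomorphic_onI field_differentiable_def field_differentiable_at_within)
  moreover have "c' = deriv c" using DERIV_imp_deriv[OF assms(1)] by auto
  ultimately have c': "c' holomorphic_on UNIV" by (simp add: holomorphic_deriv)
  show ?thesis
  proof (rule famI)
    show "continuous_on W (\<lambda>x. c (fst x))" "continuous_on W (\<lambda>x. c' (fst x))"
      by (rule continuous_on_compose2[OF holomorphic_on_imp_continuous_on[OF c]]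
            continuous_on_compose2[OF holomorphic_on_imp_continuous_on[OF c']]; auto intro!: continuous_intros)+
  qed (use assms in auto)
qed

lemma fam_const: "open W \<Longrightarrow> fam W (\<lambda>e z. c) (\<lambda>e z. 0)"
  by (rule fam_fixed[where A = UNIV]) auto

lemma fam_add:
  assumes "fam W F F'" "fam W G G'"
  shows "fam W (\<lambda>e z. F e z + G e z) (\<lambda>e z. F' e z + G' e z)"
  by (rule famI) (intro continuous_intros holomorphic_intros derivative_intros famD(1)[OF assms(1)]
     famD(2-6)[OF assms(1)] famD(2-6)[OF assms(2)]; assumption)+

lemma fam_mult:
  assumes "fam W F F'" "fam W G G'"
  shows "fam W (\<lambda>e z. F e z * G e z) (\<lambda>e z. F' e z * G e z + G' e z * F e z)"
proof (rule famI)
  show "((\<lambda>e. F e z * G e z) has_field_derivative F' e z * G e z + G' e z * F e z) (at e)"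
    if "(e, z) \<in> W" for e z
    using DERIV_mult[OF famD(4)[OF assms(1) that] famD(4)[OF assms(2) that]] by simp
qed (intro continuous_intros holomorphic_intros famD(1)[OF assms(1)]
     famD(2,3,5,6)[OF assms(1)] famD(2,3,5,6)[OF assms(2)])+

lemma fam_compose:
  assumes "fam W F F'" and h: "\<And>x. x \<in> D \<Longrightarrow> (h has_field_derivative h' x) (at x)" and D: "open D"
    and img: "\<And>e z. (e, z) \<in> W \<Longrightarrow> F e z \<in> D"
  shows "fam W (\<lambda>e z. h (F e z)) (\<lambda>e z. h' (F e z) * F' e z)"
proof (rule famI)
  have hh: "h holomorphic_on D" using h by (meson holomorphic_onI field_differentiable_def field_differentiable_at_within)
  have "deriv h holomorphic_on D" using hh D by (simp add: holomorphic_deriv)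
  then have hh': "h' holomorphic_on D"
    by (rule holomorphic_transform) (simp add: DERIV_imp_deriv[OF h])
  have "continuous_on W (\<lambda>x. g (F (fst x) (snd x)))" if "g holomorphic_on D" for g
    by (rule continuous_on_compose2[OF holomorphic_on_imp_continuous_on[OF that] famD(2)[OF assms(1)]])
       (use img in auto)
  then show "continuous_on W (\<lambda>x. h (F (fst x) (snd x)))"
    "continuous_on W (\<lambda>x. h' (F (fst x) (snd x)) * F' (fst x) (snd x))"
    using hh hh' famD(3)[OF assms(1)] by (auto intro: continuous_on_mult)
  have "(\<lambda>z. g (F e z)) holomorphic_on {z. (e, z) \<in> W}" if "g holomorphic_on D" for g e
    using holomorphic_on_compose_gen[OF famD(5)[OF assms(1), of e] that] img by (auto simp: o_def)
  then show "(\<lambda>z. h (F e z)) holomorphic_on {z. (e, z) \<in> W}"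
    "(\<lambda>z. h' (F e z) * F' e z) holomorphic_on {z. (e, z) \<in> W}" for e
    using hh hh' famD(6)[OF assms(1)] by (auto intro: holomorphic_on_mult)
  show "((\<lambda>e. h (F e z)) has_field_derivative h' (F e z) * F' e z) (at e)" if "(e, z) \<in> W" for e z
    by (rule DERIV_chain2[OF h[OF img[OF that]] famD(4)[OF assms(1) that]])
qed (rule famD(1)[OF assms(1)])

lemma fam_cmult: "fam W F F' \<Longrightarrow> fam W (\<lambda>e z. c * F e z) (\<lambda>e z. c * F' e z)"
  by (rule fam_compose[where D = UNIV and h = "\<lambda>x. c * x" and h' = "\<lambda>x. c"]) (auto intro!: derivative_eq_intros)

lemma fam_uminus: "fam W F F' \<Longrightarrow> fam W (\<lambda>e z. - F e z) (\<lambda>e z. - F' e z)"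
  using fam_cmult[of W F F' "-1"] by simp

lemma fam_diff: "fam W F F' \<Longrightarrow> fam W G G' \<Longrightarrow> fam W (\<lambda>e z. F e z - G e z) (\<lambda>e z. F' e z - G' e z)"
  using fam_add[OF _ fam_uminus] by fastforce

lemma fam_exp: "fam W F F' \<Longrightarrow> fam W (\<lambda>e z. exp (F e z)) (\<lambda>e z. exp (F e z) * F' e z)"
  by (rule fam_compose[where D = UNIV]) (auto intro!: derivative_eq_intros)

lemma fam_powi:
  "fam W F F' \<Longrightarrow> (\<And>e z. (e, z) \<in> W \<Longrightarrow> F e z \<noteq> 0) \<Longrightarrow>
    fam W (\<lambda>e z. F e z powi n) (\<lambda>e z. of_int n * F e z powi (n - 1) * F' e z)"
  by (rule fam_compose[where D = "- {0}"]) (auto intro!: derivative_eq_intros)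

lemma fam_inverse:
  "fam W F F' \<Longrightarrow> (\<And>e z. (e, z) \<in> W \<Longrightarrow> F e z \<noteq> 0) \<Longrightarrow>
    fam W (\<lambda>e z. 1 / F e z) (\<lambda>e z. - (1 / (F e z)\<^sup>2) * F' e z)"
  by (rule fam_compose[where D = "- {0}"]) (auto intro!: derivative_eq_intros simp: power2_eq_square)

lemma fam_analytic:
  assumes "fam W F F'" "{e} \<times> sphere 0 1 \<subseteq> W"
  shows "F e analytic_on sphere 0 1" "F' e analytic_on sphere 0 1"
proof -
  have "open ((\<lambda>z. (e, z)) -` W)" using famD(1)[OF assms(1)] by (intro open_vimage) (auto intro!: continuous_intros)
  then have "open {z. (e, z) \<in> W}" "sphere 0 1 \<subseteq> {z. (e, z) \<in> W}" using assms(2) by (auto simp: vimage_def)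
  then show "F e analytic_on sphere 0 1" "F' e analytic_on sphere 0 1"
    using famD(5,6)[OF assms(1), of e] unfolding analytic_on_holomorphic by blast+
qed

text \<open>Tube lemma around the compact slice \<open>{e0} \<times> sphere 0 1\<close>. A product
  neighbourhood provides one annulus for all nearby parameters.\<close>

lemma fam_tube:
  assumes "open W" "{e0} \<times> sphere 0 1 \<subseteq> W"
  obtains d R where "0 < d" "1 < R" "ball e0 d \<times> ann R \<subseteq> (W :: (complex \<times> complex) set)"
proof -
  have "compact ({e0} \<times> sphere (0::complex) 1)" by (intro compact_Times) auto
  then obtain d where d: "d > 0" "(\<Union>x\<in>{e0} \<times> sphere 0 1. ball x d) \<subseteq> W"
    using compact_subset_open_imp_ball_epsilon_subset[OF _ assms] by metis
  have "sphere 0 1 \<subseteq> (\<Union>x\<in>sphere 0 1. ball x (d / 2) :: complex set)" using d by auto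
  then obtain R where R: "1 < R" "ann R \<subseteq> (\<Union>x\<in>sphere 0 1. ball x (d / 2))"
    using ann_nbhd[of "\<Union>x\<in>sphere 0 1. ball x (d / 2)"] by blast
  have "ball e0 (d / 2) \<times> ann R \<subseteq> W"
  proof clarify
    fix e z assume e: "e \<in> ball e0 (d / 2)" and "z \<in> ann R"
    then obtain x where x: "x \<in> sphere 0 1" "dist x z < d / 2" using R(2) by auto
    have "dist (e0, x) (e, z) \<le> dist e0 e + dist x z"
      unfolding dist_Pair_Pair by (rule sqrt_sum_squares_le_sum) auto
    then have "(e, z) \<in> ball (e0, x) d" using e x by simp
    then show "(e, z) \<in> W" using d(2) x(1) by blast
  qed
  then show ?thesis using that[of "d / 2" R] d(1) R(1) by auto
qed

lemma fam_cmean_r: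
  assumes F: "fam W F F'" and W: "ball e0 d \<times> sphere 0 r \<subseteq> W" and d: "0 < d" "0 \<le> r"
  shows "((\<lambda>e. cmean_r r (F e)) has_field_derivative cmean_r r (F' e0)) (at e0)"
proof (rule cmean_r_has_derivative[where U = "ball e0 d"])
  show "((\<lambda>e. F e z) has_field_derivative F' e z) (at e)" if "e \<in> ball e0 d" "norm z = r" for e z
    by (rule famD(4)[OF F]) (use that W in auto)
  show "continuous_on (sphere 0 r) (F e)" if "e \<in> ball e0 d" for e
    by (rule continuous_on_subset[OF holomorphic_on_imp_continuous_on[OF famD(5)[OF F]]]) (use that W in auto)
  show "continuous_on (ball e0 d \<times> sphere 0 r) (\<lambda>(e, z). F' e z)"
    using continuous_on_subset[OF famD(3)[OF F] W] by (simp add: case_prod_unfold)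
qed (use d in auto)

lemma fam_cmean:
  assumes "fam W F F'" "{e0} \<times> sphere 0 1 \<subseteq> W"
  shows "((\<lambda>e. cmean (F e)) has_field_derivative cmean (F' e0)) (at e0)"
proof -
  obtain d R where "0 < d" "1 < R" "ball e0 d \<times> ann R \<subseteq> W" using fam_tube[OF famD(1)[OF assms(1)] assms(2)] .
  then show ?thesis unfolding cmean_eq_cmean_r
    using sphere_subset_ann[of R] by (intro fam_cmean_r[OF assms(1)]) auto
qed

lemma fam_lcoeff_1:
  assumes "fam W F F'" "{e0} \<times> sphere 0 1 \<subseteq> W"
  shows "((\<lambda>e. lcoeff (F e) 1) has_field_derivative lcoeff (F' e0) 1) (at e0)"
proof -
  define V where "V = W \<inter> (UNIV \<times> - {0})"
  have V: "open V" "V \<subseteq> W" "{e0} \<times> sphere 0 1 \<subseteq> V"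
    using assms famD(1)[OF assms(1)] by (auto simp: V_def intro!: open_Int open_Times)
  have "fam V (\<lambda>e z. F e z * (1 / z)) (\<lambda>e z. F' e z * (1 / z) + 0 * F e z)"
    by (intro fam_mult fam_subset[OF assms(1)] V fam_fixed[where A = "- {0}"])
       (auto intro!: holomorphic_intros simp: V_def V(1)[unfolded V_def])
  from fam_cmean[OF this V(3)] show ?thesis unfolding lcoeff_1 by simp
qed

text \<open>The truncation at \<open>z\<close> is a Cauchy integral over the circle of radius
  \<open>r > norm z\<close>, for every parameter near \<open>e0\<close> the same circle, so it can
  be differentiated under the integral.\<close>

lemma fam_ltrunc_ball:
  assumes F: "fam W F F'" and W: "ball e0 d \<times> ann R \<subseteq> W" and d: "0 < d" and z: "1 < r" "r < R" "norm z < r"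
  shows "((\<lambda>e. ltrunc {0..} (F e) z) has_field_derivative ltrunc {0..} (F' e0) z) (at e0)"
proof -
  \<comment> \<open>Removing \<open>z\<close> from the annulus keeps the kernel
    \<open>t / (t - z)\<close> holomorphic; the circle of radius \<open>r\<close> remains inside
    \<open>V\<close>.\<close>
  define V where "V = ball e0 d \<times> (ann R \<inter> - {z})"
  have V: "open V" "V \<subseteq> W" "ball e0 d \<times> sphere 0 r \<subseteq> V"
  proof -
    have "1 / R < 1" using z by simp
    then have "1 / R < r" using z by linarith
    then show "ball e0 d \<times> sphere 0 r \<subseteq> V" using z by (auto simp: V_def ann_def)
  qed (use W in \<open>auto simp: V_def intro!: open_Int open_Times\<close>)
  have "fam V (\<lambda>e t. F e t * (t / (t - z))) (\<lambda>e t. F' e t * (t / (t - z)) + 0 * F e t)"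
    by (intro fam_mult fam_subset[OF F] V fam_fixed[where A = "- {z}"])
       (auto intro!: holomorphic_intros simp: V_def V(1)[unfolded V_def])
  from fam_cmean_r[OF this V(3)] have
    "((\<lambda>e. cauchy_r r (F e) z) has_field_derivative cauchy_r r (F' e0) z) (at e0)"
    using d z by (simp add: cauchy_r_def)
  moreover have eq: "ltrunc {0..} (F e) z = cauchy_r r (F e) z" "ltrunc {0..} (F' e) z = cauchy_r r (F' e) z"
    if "e \<in> ball e0 d" for e
    by (rule ltrunc_eq_cauchy_r[of _ R], use that W famD(5,6)[OF F, of e] z in \<open>auto elim!: holomorphic_on_subset\<close>)+
  ultimately show ?thesis
    using d eq(2)[of e0] eventually_nhds_in_open[of "ball e0 d" e0]
    by (subst DERIV_cong_ev[OF refl _ refl]) (auto elim!: eventually_mono simp: eq(1))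
qed

lemma fam_ltrunc:
  assumes "fam W F F'" "{e0} \<times> sphere 0 1 \<subseteq> W" "z \<in> sphere 0 1"
  shows "((\<lambda>e. ltrunc {0..} (F e) z) has_field_derivative ltrunc {0..} (F' e0) z) (at e0)"
proof -
  obtain d R where "0 < d" "1 < R" "ball e0 d \<times> ann R \<subseteq> W" using fam_tube[OF famD(1)[OF assms(1)] assms(2)] .
  then show ?thesis using assms fam_ltrunc_ball[of W F F' e0 d R "(1 + R) / 2" z] by auto
qed

section \<open>Points and curves of the manifold\<close>

text \<open>The conditions on \<open>w'\<close> and on the curve \<open>w(S\<^sup>1)\<close> in \<open>MM\<close> are dropped: the remaining ones are easily
  seen to be stable under small moves, and they suffice for the functions \<open>y\<close> to be differentiable.\<close>

definition MW :: "pt set" where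
  "MW = {p. wf p analytic_on sphere 0 1 \<and> lw p analytic_on sphere 0 1 \<and>
     (\<forall>z\<in>sphere 0 1. exp (lw p z) = wf p z / z) \<and>
     (\<forall>z. 1 \<le> norm z \<longrightarrow> lam p z \<noteq> 0) \<and> (\<forall>z. 0 < norm z \<and> norm z \<le> 1 \<longrightarrow> lamb p z \<noteq> 0)}"

lemma MM_subset_MW: "MM \<subseteq> MW"
proof
  fix p assume p: "p \<in> MM"
  then have "(lam p, lamb p) \<in> M0" unfolding MM_def by blast
  then have "\<forall>z. 1 \<le> norm z \<longrightarrow> lam p z \<noteq> 0" "\<forall>z. 0 < norm z \<and> norm z \<le> 1 \<longrightarrow> lamb p z \<noteq> 0"
    unfolding M0_def mem_Collect_eq case_prod_conv by blast+
  then show "p \<in> MW" using p unfolding MM_def MW_def by blast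
qed

lemma MWD:
  assumes "p \<in> MW"
  shows "wf p analytic_on sphere 0 1" "lw p analytic_on sphere 0 1"
    "z \<in> sphere 0 1 \<Longrightarrow> exp (lw p z) = wf p z / z" "1 \<le> norm z \<Longrightarrow> lam p z \<noteq> 0"
    "0 < norm z \<Longrightarrow> norm z \<le> 1 \<Longrightarrow> lamb p z \<noteq> 0" "z \<in> sphere 0 1 \<Longrightarrow> wf p z \<noteq> 0"
proof -
  show "wf p analytic_on sphere 0 1" "lw p analytic_on sphere 0 1"
    "1 \<le> norm z \<Longrightarrow> lam p z \<noteq> 0" "0 < norm z \<Longrightarrow> norm z \<le> 1 \<Longrightarrow> lamb p z \<noteq> 0"
    and *: "z \<in> sphere 0 1 \<Longrightarrow> exp (lw p z) = wf p z / z"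
    using assms unfolding MW_def by blast+
  show "z \<in> sphere 0 1 \<Longrightarrow> wf p z \<noteq> 0" using * by (metis exp_not_eq_zero div_0)
qed

lemma lam_add_lamb:
  assumes "wf p analytic_on sphere 0 1" "z \<in> sphere 0 1"
  shows "lam p z + lamb p z = wf p z"
  using ltrunc_other[OF assms] by (simp add: lam_def lamb_def)

lemma lam_analytic:
  assumes "wf p analytic_on sphere 0 1"
  shows "lam p analytic_on sphere 0 1" "lamb p analytic_on sphere 0 1"
  unfolding lam_def[abs_def] lamb_def[abs_def]
  by (auto intro!: analytic_intros ltrunc_analytic assms)

lemma MM_deriv_nonzero:
  assumes "p \<in> MM" "z \<in> sphere 0 1"
  shows "deriv (wf p) z \<noteq> 0" "zwp p z \<noteq> 0"
proof -
  have w: "wf p analytic_on sphere 0 1" using assms by (simp add: MM_def)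
  have "deriv (\<lambda>z. lam p z + lamb p z) z \<noteq> 0"
  proof -
    have "(lam p, lamb p) \<in> M0" using assms unfolding MM_def by blast
    then show ?thesis using assms(2) unfolding M0_def mem_Collect_eq case_prod_conv by blast
  qed
  moreover have "deriv (\<lambda>z. lam p z + lamb p z) z = deriv (wf p) z"
    by (rule deriv_eq_sphere) (use w assms(2) lam_add_lamb in \<open>auto intro!: analytic_intros lam_analytic\<close>)
  ultimately show "deriv (wf p) z \<noteq> 0" by simp
  then show "zwp p z \<noteq> 0" using assms(2) by (auto simp: zwp_def)
qed

text \<open>In the chart \<open>t = 1 / z\<close> the factor \<open>t\<close> divides by
  \<open>z\<close>, which makes a function of nonpositive powers vanish at infinity. Both
  \<open>lam\<close> and its variations are assembled from such functions.\<close>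

lemma triple_parts_out:
  assumes "f analytic_on sphere 0 1"
  obtains C where "C analytic_on cball 0 1" "C 0 = 0"
    "\<And>t. t \<noteq> 0 \<Longrightarrow> norm t \<le> 1 \<Longrightarrow> C t = t * (ltrunc {..0} f (1 / t) + c)"
proof -
  obtain R F G where s: "laurent_split f R F G" using analytic_laurent_split[OF assms] .
  then have R: "1 < R" and G: "G holomorphic_on ball 0 R" by (auto simp: laurent_split_def)
  show ?thesis
  proof (rule that)
    show "(\<lambda>t. t * (G t + F 0 + c)) analytic_on cball 0 1"
      by (intro analytic_intros holomorphic_ball_cball[OF G R])
    fix t :: complex assume t: "t \<noteq> 0" "norm t \<le> 1"
    then have "1 / R < norm (1 / t)" using R by (auto simp: norm_divide frac_less2 intro!: divide_strict_left_mono)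
    then show "t * (G t + F 0 + c) = t * (ltrunc {..0} f (1 / t) + c)"
      by (simp add: laurent_split_ltrunc_nonpos[OF s])
  qed simp
qed

lemma triple_parts_in:
  assumes "f analytic_on sphere 0 1"
  obtains C where "C analytic_on cball 0 1" "C 0 = 0"
    "\<And>t. norm t \<le> 1 \<Longrightarrow> C t = t * (ltrunc {0<..} f t + c)"
proof -
  obtain R F G where s: "laurent_split f R F G" using analytic_laurent_split[OF assms] .
  then have R: "1 < R" and F: "F holomorphic_on ball 0 R" by (auto simp: laurent_split_def)
  show ?thesis
  proof (rule that)
    show "(\<lambda>t. t * (F t - F 0 + c)) analytic_on cball 0 1"
      by (intro analytic_intros holomorphic_ball_cball[OF F R])
    fix t :: complex assume t: "norm t \<le> 1"
    then have "norm t < R" using R by simp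
    then show "t * (F t - F 0 + c) = t * (ltrunc {0<..} f t + c)"
      by (simp add: laurent_split_ltrunc_nonneg[OF s])
  qed simp
qed

text \<open>\<open>H\<close> is \<open>lam / z\<close> in the chart at infinity, and the value
  \<open>1\<close> is the normalisation \<open>lam = z + O(1)\<close>. It transports nonvanishing
  outside the circle to nonvanishing on a compact disc.\<close>

lemma lam_chart:
  assumes "wf p analytic_on sphere 0 1"
  obtains H where "H analytic_on cball 0 1" "H 0 = 1" "\<And>t. t \<noteq> 0 \<Longrightarrow> norm t \<le> 1 \<Longrightarrow> H t = t * lam p (1 / t)"
proof -
  obtain C where C: "C analytic_on cball 0 1" "C 0 = 0"
    "\<And>t. t \<noteq> 0 \<Longrightarrow> norm t \<le> 1 \<Longrightarrow> C t = t * (ltrunc {..0} (wf p) (1 / t) + - vc p)"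
    using triple_parts_out[OF assms] by blast
  show ?thesis
  proof (rule that[of "\<lambda>t. 1 + C t - exp (uc p) * t\<^sup>2"])
    show "1 + C t - exp (uc p) * t\<^sup>2 = t * lam p (1 / t)" if "t \<noteq> 0" "norm t \<le> 1" for t
      using C(3)[OF that] that by (simp add: lam_def algebra_simps power2_eq_square)
  qed (use C in \<open>auto intro!: analytic_intros\<close>)
qed

lemma lamb_chart:
  assumes "wf p analytic_on sphere 0 1"
  obtains H where "H analytic_on cball 0 1" "H 0 = exp (uc p)" "\<And>t. t \<noteq> 0 \<Longrightarrow> norm t \<le> 1 \<Longrightarrow> H t = t * lamb p t"
proof -
  obtain C where C: "C analytic_on cball 0 1" "C 0 = 0"
    "\<And>t. norm t \<le> 1 \<Longrightarrow> C t = t * (ltrunc {0<..} (wf p) t + vc p)"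
    using triple_parts_in[OF assms] by blast
  show ?thesis
    by (rule that[of "\<lambda>t. C t - t\<^sup>2 + exp (uc p)"])
       (use C in \<open>auto intro!: analytic_intros simp: lamb_def field_simps power2_eq_square\<close>)
qed

section \<open>Branches of the logarithms\<close>

lemma cball_log:
  assumes H: "H analytic_on cball 0 1" and nz: "\<And>t. norm t \<le> 1 \<Longrightarrow> H t \<noteq> 0" and c: "exp c = H 0"
  obtains g where "g analytic_on cball 0 1" "g 0 = c" "\<And>t. norm t \<le> 1 \<Longrightarrow> exp (g t) = H t"
proof -
  obtain R where R: "1 < R" "H holomorphic_on ball 0 R" using cball_ball_nbhd[OF H] .
  have "open (ball 0 R \<inter> H -` (- {0}))"
    by (rule continuous_open_preimage) (use R holomorphic_on_imp_continuous_on in auto)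
  then obtain R' where R': "1 < R'" "ball 0 R' \<subseteq> ball 0 R \<inter> H -` (- {0})"
    using cball_nbhd[of "ball 0 R \<inter> H -` (- {0})"] R nz by (auto simp: subset_iff)
  have h: "H holomorphic_on ball 0 R'" using R R' holomorphic_on_subset by blast
  have nz': "H z \<noteq> 0" if "z \<in> ball 0 R'" for z using R'(2) that by blast
  obtain g where g: "g holomorphic_on ball 0 R'" "\<And>z. z \<in> ball 0 R' \<Longrightarrow> H z = exp (g z)"
    using contractible_imp_holomorphic_log[OF h convex_imp_contractible[OF convex_ball] nz'] by blast
  have e: "exp (g 0) = exp c" using g(2)[of 0] R' c by simp
  show ?thesis
  proof (rule that[of "\<lambda>z. g z - g 0 + c"])
    show "(\<lambda>z. g z - g 0 + c) analytic_on cball 0 1"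
      by (intro analytic_intros holomorphic_ball_cball[OF g(1) R'(1)])
    show "exp (g t - g 0 + c) = H t" if "norm t \<le> 1" for t
      using g(2)[of t] that R'(1) by (simp add: exp_add exp_diff e)
  qed simp
qed

text \<open>Two logarithms differ by multiples of \<open>2 pi i\<close>. A continuous function with
  such discrete values is constant on a connected set, and one common value fixes the
  constant.\<close>

lemma log_unique:
  assumes S: "connected S" and a: "a \<in> S" "f a = g a"
    and f: "continuous_on S f" and g: "continuous_on S g"
    and eq: "\<And>z. z \<in> S \<Longrightarrow> exp (f z) = exp (g z :: complex)" and z: "z \<in> S"
  shows "f z = g z"
proof -
  have "(\<lambda>z. f z - g z) constant_on S"
  proof (rule continuous_discrete_range_constant[OF S])
    show "continuous_on S (\<lambda>z. f z - g z)" by (intro continuous_intros f g)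
    fix x assume x: "x \<in> S"
    have int: "\<exists>n::int. f y - g y = of_int n * (2 * of_real pi * \<i>)" if "y \<in> S" for y
      using eq[OF that] unfolding exp_eq by (auto simp: algebra_simps)
    have "1 \<le> norm ((f y - g y) - (f x - g x))" if y: "y \<in> S" and ne: "f y - g y \<noteq> f x - g x" for y
    proof -
      obtain m n :: int where mn: "f y - g y = of_int m * (2 * of_real pi * \<i>)" "f x - g x = of_int n * (2 * of_real pi * \<i>)"
        using int x y by blast
      then have "m \<noteq> n" using ne by auto
      then have "1 \<le> \<bar>of_int (m - n) :: real\<bar>" by linarith
      moreover have "1 \<le> 2 * pi" using pi_gt3 by linarith
      ultimately have "1 * 1 \<le> \<bar>of_int (m - n) :: real\<bar> * (2 * pi)" by (intro mult_mono) auto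
      also have "\<dots> = norm (of_int (m - n) * (2 * of_real pi * \<i>))"
        by (simp add: norm_mult del: of_int_diff)
      also have "of_int (m - n) * (2 * of_real pi * \<i>) = (f y - g y) - (f x - g x)"
        unfolding mn by (simp add: algebra_simps)
      finally show ?thesis by simp
    qed
    then show "\<exists>e>0. \<forall>y. y \<in> S \<and> f y - g y \<noteq> f x - g x \<longrightarrow> e \<le> norm (f y - g y - (f x - g x))"
      by (intro exI[of _ 1]) auto
  qed
  then have "f z - g z = f a - g a" using a z unfolding constant_on_def by metis
  then show ?thesis using a by simp
qed

lemma analytic_cball_cont: "f analytic_on cball 0 1 \<Longrightarrow> continuous_on (cball 0 1) f"
  by (simp add: analytic_imp_holomorphic holomorphic_on_imp_continuous_on)

text \<open>The third claim turns the Hilbert choice into a characterisation: any logarithm that is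
  continuous up to infinity and zero there agrees with it. This is how the choices at neighbouring
  points get related.\<close>

lemma log_lam_z:
  assumes p: "p \<in> MW"
  shows "holo_ext (log_lam_z p) 0" "1 \<le> norm z \<Longrightarrow> exp (log_lam_z p z) = lam p z / z"
    "continuous_on (cball 0 1) (\<lambda>t. if t = 0 then 0 else g (1 / t)) \<Longrightarrow> (\<And>z. 1 \<le> norm z \<Longrightarrow> exp (g z) = lam p z / z) \<Longrightarrow> 1 \<le> norm z \<Longrightarrow> log_lam_z p z = g z"
proof -
  obtain H where H: "H analytic_on cball 0 1" "H 0 = 1" "\<And>t. t \<noteq> 0 \<Longrightarrow> norm t \<le> 1 \<Longrightarrow> H t = t * lam p (1 / t)"
    using lam_chart MWD(1)[OF p] by metis
  have nz: "H t \<noteq> 0" if "norm t \<le> 1" for t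
    using H(2) H(3)[of t] MWD(4)[OF p, of "1 / t"] that by (cases "t = 0") (auto simp: norm_divide)
  obtain g0 where g0: "g0 analytic_on cball 0 1" "g0 0 = 0" "\<And>t. norm t \<le> 1 \<Longrightarrow> exp (g0 t) = H t"
    using cball_log[OF H(1) nz, of 0] H(2) by auto
  have "holo_ext (\<lambda>z. g0 (1 / z)) 0"
  proof -
    have "(\<lambda>z. if z = 0 then 0 else g0 (1 / (1 / z))) = g0" using g0(2) by auto
    then show ?thesis unfolding holo_ext_def using g0(1) by simp
  qed
  moreover have "exp (g0 (1 / z)) = lam p z / z" if "1 \<le> norm z" for z
    using g0(3)[of "1 / z"] H(3)[of "1 / z"] that by (cases "z = 0") (auto simp: norm_divide)
  ultimately have "\<exists>g. holo_ext g 0 \<and> (\<forall>z. 1 \<le> norm z \<longrightarrow> exp (g z) = lam p z / z)" by blast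
  from someI_ex[OF this] have *: "holo_ext (log_lam_z p) 0 \<and> (\<forall>z. 1 \<le> norm z \<longrightarrow> exp (log_lam_z p z) = lam p z / z)"
    unfolding log_lam_z_def .
  then show "holo_ext (log_lam_z p) 0" "1 \<le> norm z \<Longrightarrow> exp (log_lam_z p z) = lam p z / z" by auto
  assume g: "continuous_on (cball 0 1) (\<lambda>t. if t = 0 then 0 else g (1 / t))" "\<And>z. 1 \<le> norm z \<Longrightarrow> exp (g z) = lam p z / z" "1 \<le> norm z"
  let ?f = "\<lambda>t. if t = 0 then 0 else log_lam_z p (1 / t)" and ?g = "\<lambda>t. if t = 0 then 0 else g (1 / t)"
  have "?f (1 / z) = ?g (1 / z)"
  proof (rule log_unique[where S = "cball 0 1" and a = 0 and f = ?f and g = ?g])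
    show "continuous_on (cball 0 1) (\<lambda>t. if t = 0 then 0 else log_lam_z p (1 / t))"
      "continuous_on (cball 0 1) (\<lambda>t. if t = 0 then 0 else g (1 / t))"
      using * g(1) unfolding holo_ext_def by (auto intro: analytic_cball_cont)
    show "exp (if t = 0 then 0 else log_lam_z p (1 / t)) = exp (if t = 0 then 0 else g (1 / t))"
      if "t \<in> cball 0 1" for t
      using * g(2)[of "1 / t"] that by (cases "t = 0") (auto simp: norm_divide)
  qed (use g(3) in \<open>auto simp: norm_divide divide_simps\<close>)
  moreover have "z \<noteq> 0" using g(3) by auto
  ultimately show "log_lam_z p z = g z" by simp
qed

text \<open>As at infinity, the last claim characterises the Hilbert choice. Prescribing the value
  \<open>uc p\<close> at \<open>0\<close> selects the branch belonging to \<open>u\<close> itself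
  and not only to \<open>exp u\<close>.\<close>

lemma log_z_lamb:
  assumes p: "p \<in> MW"
  shows "log_z_lamb p analytic_on cball 0 1" "log_z_lamb p 0 = uc p"
    "0 < norm z \<Longrightarrow> norm z \<le> 1 \<Longrightarrow> exp (log_z_lamb p z) = z * lamb p z"
    "continuous_on (cball 0 1) g \<Longrightarrow> g 0 = uc p \<Longrightarrow> (\<And>z. 0 < norm z \<Longrightarrow> norm z \<le> 1 \<Longrightarrow> exp (g z) = z * lamb p z) \<Longrightarrow>
       norm z \<le> 1 \<Longrightarrow> log_z_lamb p z = g z"
proof -
  obtain H where H: "H analytic_on cball 0 1" "H 0 = exp (uc p)" "\<And>t. t \<noteq> 0 \<Longrightarrow> norm t \<le> 1 \<Longrightarrow> H t = t * lamb p t"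
    using lamb_chart MWD(1)[OF p] by metis
  have nz: "H t \<noteq> 0" if "norm t \<le> 1" for t
    using H(2) H(3)[of t] MWD(5)[OF p, of t] that by (cases "t = 0") auto
  obtain g0 where g0: "g0 analytic_on cball 0 1" "g0 0 = uc p" "\<And>t. norm t \<le> 1 \<Longrightarrow> exp (g0 t) = H t"
    using cball_log[OF H(1) nz, of "uc p"] H(2) by auto
  have "exp (g0 z) = z * lamb p z" if "0 < norm z" "norm z \<le> 1" for z
    using g0(3)[of z] H(3)[of z] that by auto
  then have "\<exists>g. g analytic_on cball 0 1 \<and> g 0 = uc p \<and> (\<forall>z. 0 < norm z \<and> norm z \<le> 1 \<longrightarrow> exp (g z) = z * lamb p z)"
    using g0 by blast
  from someI_ex[OF this] have *: "log_z_lamb p analytic_on cball 0 1 \<and> log_z_lamb p 0 = uc p \<and>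
      (\<forall>z. 0 < norm z \<and> norm z \<le> 1 \<longrightarrow> exp (log_z_lamb p z) = z * lamb p z)"
    unfolding log_z_lamb_def .
  then show "log_z_lamb p analytic_on cball 0 1" "log_z_lamb p 0 = uc p"
    "0 < norm z \<Longrightarrow> norm z \<le> 1 \<Longrightarrow> exp (log_z_lamb p z) = z * lamb p z" by auto
  assume g: "continuous_on (cball 0 1) g" "g 0 = uc p" "\<And>z. 0 < norm z \<Longrightarrow> norm z \<le> 1 \<Longrightarrow> exp (g z) = z * lamb p z" "norm z \<le> 1"
  show "log_z_lamb p z = g z"
  proof (rule log_unique[where S = "cball 0 1" and a = 0 and f = "log_z_lamb p" and g = g])
    show "continuous_on (cball 0 1) (log_z_lamb p)" "continuous_on (cball 0 1) g"
      using * g(1) by (auto intro: analytic_cball_cont)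
    show "exp (log_z_lamb p t) = exp (g t)" if "t \<in> cball 0 1" for t
      using * g(2) g(3)[of t] that by (cases "t = 0") auto
  qed (use g * in auto)
qed

lemma holo_ext_analytic_sphere:
  assumes "holo_ext g c"
  shows "g analytic_on sphere 0 1"
proof -
  let ?h = "\<lambda>z. if z = 0 then c else g (1 / z)"
  obtain R where R: "1 < R" "?h holomorphic_on ball 0 R"
    using cball_ball_nbhd assms unfolding holo_ext_def by blast
  have "(?h \<circ> (\<lambda>z. 1 / z)) holomorphic_on ann R"
    by (rule holomorphic_on_compose_gen[OF _ R(2)])
       (use R in \<open>auto simp: ann_def norm_inverse_less intro!: holomorphic_intros\<close>)
  then have "g holomorphic_on ann R"
    by (rule holomorphic_transform) (use ann_nonzero[OF R(1)] in auto)
  then show ?thesis using R(1) holomorphic_ann_sphere by blast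
qed

lemma log_parts_analytic:
  assumes "p \<in> MW"
  shows "log_lam_z p analytic_on sphere 0 1" "log_z_lamb p analytic_on sphere 0 1"
    "log1 p analytic_on sphere 0 1" "log2 p analytic_on sphere 0 1"
proof -
  show 1: "log_lam_z p analytic_on sphere 0 1" using holo_ext_analytic_sphere log_lam_z(1)[OF assms] .
  show 2: "log_z_lamb p analytic_on sphere 0 1"
    using log_z_lamb(1)[OF assms] by (rule analytic_on_subset) auto
  show "log1 p analytic_on sphere 0 1" "log2 p analytic_on sphere 0 1"
    unfolding log1_def[abs_def] log2_def[abs_def] by (intro analytic_intros 1 2 MWD(2)[OF assms])+
qed

section \<open>The functions of a point along the lines \<open>move p X\<close>\<close>

lemma norm_inverse_le_1: "1 \<le> norm (z :: complex) \<Longrightarrow> norm (1 / z) \<le> 1"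
  by (simp add: norm_divide divide_le_eq_1)

text \<open>The exact increment of \<open>lam\<close> along the line, not its linear part: the
  coefficient of \<open>1 / z\<close> is \<open>exp u\<close> and moves nonlinearly in
  \<open>e\<close>.\<close>

definition dlam :: "pt \<Rightarrow> triple \<Rightarrow> complex \<Rightarrow> complex \<Rightarrow> complex" where
  "dlam p X e z = e * (ltrunc {..0} (fn X) z - cv X) - (exp (uc p + e * cu X) - exp (uc p)) / z"

definition dlamb :: "pt \<Rightarrow> triple \<Rightarrow> complex \<Rightarrow> complex \<Rightarrow> complex" where
  "dlamb p X e z = e * (ltrunc {0<..} (fn X) z + cv X) + (exp (uc p + e * cu X) - exp (uc p)) / z"

lemma lam_move:
  assumes "wf p analytic_on sphere 0 1" "fn X analytic_on sphere 0 1"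
  shows "1 \<le> norm z \<Longrightarrow> lam (move p X e) z = lam p z + dlam p X e z"
    "norm z \<le> 1 \<Longrightarrow> lamb (move p X e) z = lamb p z + dlamb p X e z"
proof -
  obtain r where r: "1 < r"
    "\<And>c z. norm z < r \<Longrightarrow> ltrunc {0<..} (\<lambda>z. wf p z + c * fn X z) z = ltrunc {0<..} (wf p) z + c * ltrunc {0<..} (fn X) z"
    "\<And>c z. 1 / r < norm z \<Longrightarrow> ltrunc {..0} (\<lambda>z. wf p z + c * fn X z) z = ltrunc {..0} (wf p) z + c * ltrunc {..0} (fn X) z"
    by (rule ltrunc_lin[OF assms]) (rule that; assumption)
  have "1 / r < 1" using r(1) by simp
  then show "1 \<le> norm z \<Longrightarrow> lam (move p X e) z = lam p z + dlam p X e z"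
    unfolding lam_def dlam_def move_def pt.sel using r(3)[of z e]
    by (simp add: right_diff_distrib diff_divide_distrib)
  show "norm z \<le> 1 \<Longrightarrow> lamb (move p X e) z = lamb p z + dlamb p X e z"
    unfolding lamb_def dlamb_def move_def pt.sel using r(2)[of z e] r(1)
    by (simp add: distrib_left diff_divide_distrib)
qed

text \<open>On a compact set \<open>H\<close> is bounded away from \<open>0\<close> while
  \<open>C1\<close> and \<open>C2\<close> are bounded, so the estimate is uniform in
  \<open>t\<close>. The slot \<open>\<phi>\<close> is meant for the increment of
  \<open>exp u\<close>.\<close>

lemma small_perturbation:
  fixes H C1 C2 :: "complex \<Rightarrow> complex"
  assumes S: "compact S" "S \<noteq> {}" and c: "continuous_on S H" "continuous_on S C1" "continuous_on S C2"
    and nz: "\<And>t. t \<in> S \<Longrightarrow> H t \<noteq> 0" and phi: "(\<phi> \<longlongrightarrow> 0) (nhds (0::complex))"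
  shows "eventually (\<lambda>e. \<forall>t\<in>S. norm (e * C1 t + \<phi> e * C2 t) < norm (H t)) (nhds 0)"
proof -
  obtain x where x: "x \<in> S" "\<And>y. y \<in> S \<Longrightarrow> norm (H x) \<le> norm (H y)"
    using continuous_attains_inf[OF S continuous_on_norm[OF c(1)]] by blast
  obtain B1 where B1: "\<And>t. t \<in> S \<Longrightarrow> norm (C1 t) \<le> B1"
    using compact_imp_bounded[OF compact_continuous_image[OF c(2) S(1)]] by (auto simp: bounded_iff)
  obtain B2 where B2: "\<And>t. t \<in> S \<Longrightarrow> norm (C2 t) \<le> B2"
    using compact_imp_bounded[OF compact_continuous_image[OF c(3) S(1)]] by (auto simp: bounded_iff)
  have "((\<lambda>e. norm e * B1 + norm (\<phi> e) * B2) \<longlongrightarrow> norm (0::complex) * B1 + norm (0::complex) * B2) (nhds 0)"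
    by (intro tendsto_intros phi filterlim_ident)
  moreover have "norm (H x) > 0" using nz x by simp
  ultimately have "eventually (\<lambda>e. norm e * B1 + norm (\<phi> e) * B2 < norm (H x)) (nhds 0)"
    using order_tendstoD(2)[of "\<lambda>e. norm e * B1 + norm (\<phi> e) * B2" 0 "nhds 0" "norm (H x)"] by simp
  then show ?thesis
  proof (rule eventually_mono, intro ballI)
    fix e t assume e: "norm e * B1 + norm (\<phi> e) * B2 < norm (H x)" and t: "t \<in> S"
    have "norm (e * C1 t + \<phi> e * C2 t) \<le> norm e * norm (C1 t) + norm (\<phi> e) * norm (C2 t)"
      by (metis norm_mult norm_triangle_ineq)
    also have "\<dots> \<le> norm e * B1 + norm (\<phi> e) * B2"
      using B1 B2 t by (intro add_mono mult_left_mono) auto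
    finally show "norm (e * C1 t + \<phi> e * C2 t) < norm (H t)" using e x(2)[OF t] by linarith
  qed
qed

lemma exp_increment_tendsto: "((\<lambda>e. exp (u + e * c) - exp u) \<longlongrightarrow> 0) (nhds (0::complex))"
proof -
  have "((\<lambda>e. exp (u + e * c) - exp u) \<longlongrightarrow> exp (u + 0 * c) - exp u) (nhds (0::complex))"
    by (intro tendsto_intros filterlim_ident)
  then show ?thesis by simp
qed

text \<open>From \<open>norm (K t / H t) < 1\<close> the argument of \<open>Ln\<close> stays in the
  right half-plane, away from the cut, so the correction is analytic on the closed disc.\<close>

lemma chart_perturbed_log:
  assumes g: "g analytic_on cball 0 1" and H: "H analytic_on cball 0 1" and K: "K analytic_on cball 0 1"
    and small: "\<And>t. t \<in> cball 0 1 \<Longrightarrow> norm (K t) < norm (H t)"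
    and e: "\<And>t. t \<in> cball 0 1 \<Longrightarrow> exp (g t) = H t"
  shows "(\<lambda>t. g t + Ln (1 + K t / H t)) analytic_on cball 0 1"
    "\<And>t. t \<in> cball 0 1 \<Longrightarrow> exp (g t + Ln (1 + K t / H t)) = H t + K t"
proof -
  have nz: "H t \<noteq> 0" if "t \<in> cball 0 1" for t using small[OF that] by auto
  have n: "norm (K t / H t) < 1" if "t \<in> cball 0 1" for t
    using small[OF that] nz[OF that] by (simp add: norm_divide)
  have "1 + K t / H t \<notin> \<real>\<^sub>\<le>\<^sub>0" if "t \<in> cball 0 1" for t
  proof
    assume "1 + K t / H t \<in> \<real>\<^sub>\<le>\<^sub>0"
    then have "Re (K t / H t) \<le> -1" by (simp add: complex_nonpos_Reals_iff)
    then show False using n[OF that] abs_Re_le_cmod[of "K t / H t"] by linarith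
  qed
  then show "(\<lambda>t. g t + Ln (1 + K t / H t)) analytic_on cball 0 1"
    by (intro analytic_intros g H K nz) auto
  show "exp (g t + Ln (1 + K t / H t)) = H t + K t" if "t \<in> cball 0 1" for t
  proof -
    have "1 + K t / H t \<noteq> 0" using n[OF that] by (metis add_eq_0_iff norm_minus_cancel norm_one order_less_irrefl)
    then show ?thesis using nz[OF that] by (simp add: exp_add e[OF that] field_simps)
  qed
qed

text \<open>In the chart \<open>t = 1 / z\<close> the exterior becomes a compact disc, so smallness
  is uniform up to infinity. The increment vanishes at \<open>t = 0\<close>; hence the corrected
  logarithm still vanishes there, and uniqueness identifies it with the one chosen at the moved
  point.\<close>

lemma move_lam_log:
  assumes p: "p \<in> MW" and X: "X \<in> triples"
  shows "eventually (\<lambda>e. \<forall>z. 1 \<le> norm z \<longrightarrow> norm (dlam p X e z) < norm (lam p z)) (nhds 0)"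
    "eventually (\<lambda>e. move p X e \<in> MW \<longrightarrow> (\<forall>z. 1 \<le> norm z \<longrightarrow>
       log_lam_z (move p X e) z = log_lam_z p z + Ln (1 + dlam p X e z / lam p z))) (nhds 0)"
proof -
  have Xa: "fn X analytic_on sphere 0 1" using X by (simp add: triples_def)
  obtain H where H: "H analytic_on cball 0 1" "H 0 = 1" "\<And>t. t \<noteq> 0 \<Longrightarrow> norm t \<le> 1 \<Longrightarrow> H t = t * lam p (1 / t)"
    using lam_chart MWD(1)[OF p] by metis
  have nz: "H t \<noteq> 0" if "t \<in> cball 0 1" for t
    using H(2) H(3)[of t] MWD(4)[OF p, of "1 / t"] that by (cases "t = 0") (auto simp: norm_divide)
  obtain C where C: "C analytic_on cball 0 1" "C 0 = 0"
    "\<And>t. t \<noteq> 0 \<Longrightarrow> norm t \<le> 1 \<Longrightarrow> C t = t * (ltrunc {..0} (fn X) (1 / t) + - cv X)"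
    using triple_parts_out[OF Xa] by blast
  define K where "K = (\<lambda>e t. e * C t + (exp (uc p + e * cu X) - exp (uc p)) * (- (t\<^sup>2)))"
  have Ka: "K e analytic_on cball 0 1" for e unfolding K_def by (intro analytic_intros C)
  have K: "K e t = t * dlam p X e (1 / t)" if "t \<noteq> 0" "norm t \<le> 1" for e t
    using that by (simp add: K_def dlam_def C(3) algebra_simps power2_eq_square)
  have K0: "K e 0 = 0" for e by (simp add: K_def C)
  have ev: "eventually (\<lambda>e. \<forall>t\<in>cball 0 1. norm (K e t) < norm (H t)) (nhds 0)"
    unfolding K_def
    by (rule small_perturbation) (use nz in \<open>auto intro!: analytic_cball_cont C H exp_increment_tendsto continuous_intros\<close>)
  show 1: "eventually (\<lambda>e. \<forall>z. 1 \<le> norm z \<longrightarrow> norm (dlam p X e z) < norm (lam p z)) (nhds 0)"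
    using ev
  proof (rule eventually_mono, intro allI impI)
    fix e z assume *: "\<forall>t\<in>cball 0 1. norm (K e t) < norm (H t)" "1 \<le> norm (z::complex)"
    then have z: "z \<noteq> 0" "norm (1 / z) \<le> 1" using norm_inverse_le_1 by auto
    then have "norm (K e (1 / z)) < norm (H (1 / z))" using * by auto
    moreover have "K e (1 / z) = dlam p X e z / z" "H (1 / z) = lam p z / z"
      using z K[of "1 / z" e] H(3)[of "1 / z"] by simp_all
    ultimately show "norm (dlam p X e z) < norm (lam p z)"
      using z(1) by (simp add: norm_divide divide_less_cancel)
  qed
  show "eventually (\<lambda>e. move p X e \<in> MW \<longrightarrow> (\<forall>z. 1 \<le> norm z \<longrightarrow>
       log_lam_z (move p X e) z = log_lam_z p z + Ln (1 + dlam p X e z / lam p z))) (nhds 0)"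
    using ev
  proof (rule eventually_mono, intro allI impI)
    fix e z assume *: "\<forall>t\<in>cball 0 1. norm (K e t) < norm (H t)" "move p X e \<in> MW" "1 \<le> norm (z::complex)"
    let ?g = "\<lambda>t. if t = 0 then 0 else log_lam_z p (1 / t)"
    have ga: "?g analytic_on cball 0 1" using log_lam_z(1)[OF p] by (simp add: holo_ext_def)
    have ge: "exp (?g t) = H t" if "t \<in> cball 0 1" for t
      using log_lam_z(2)[OF p, of "1 / t"] H(2) H(3)[of t] that by (cases "t = 0") (auto simp: norm_divide)
    note L = chart_perturbed_log[OF ga H(1) Ka _ ge, of e]
    have L1: "(\<lambda>t. ?g t + Ln (1 + K e t / H t)) analytic_on cball 0 1"
      and L2: "\<And>t. t \<in> cball 0 1 \<Longrightarrow> exp (?g t + Ln (1 + K e t / H t)) = H t + K e t"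
      using L * by blast+
    let ?h = "\<lambda>z. log_lam_z p z + Ln (1 + dlam p X e z / lam p z)"
    have q: "K e t / H t = dlam p X e (1 / t) / lam p (1 / t)" if "t \<noteq> 0" "norm t \<le> 1" for t
      using that by (simp add: K H(3))
    show "log_lam_z (move p X e) z = ?h z"
    proof (rule log_lam_z(3)[OF *(2) _ _ *(3)])
      have "(if t = 0 then 0 else ?h (1 / t)) = ?g t + Ln (1 + K e t / H t)" if "t \<in> cball 0 1" for t
        using q[of t] K0 that by auto
      then show "continuous_on (cball 0 1) (\<lambda>t. if t = 0 then 0 else ?h (1 / t))"
        using analytic_cball_cont[OF L1] by (rule continuous_on_eq[rotated, OF sym])
    next
      fix z :: complex assume z: "1 \<le> norm z"
      then have z': "z \<noteq> 0" "norm (1 / z) \<le> 1" using norm_inverse_le_1 by auto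
      have "exp (?h z) = H (1 / z) + K e (1 / z)"
        using L2[of "1 / z"] z' q[of "1 / z"] by simp
      also have "\<dots> = lam (move p X e) z / z"
        using z' lam_move(1)[OF MWD(1)[OF p] Xa z] by (simp add: K H(3) add_divide_distrib)
      finally show "exp (?h z) = lam (move p X e) z / z" .
    qed
  qed
qed

lemma move_lamb_log:
  assumes p: "p \<in> MW" and X: "X \<in> triples"
  shows "eventually (\<lambda>e. \<forall>z. 0 < norm z \<and> norm z \<le> 1 \<longrightarrow> norm (dlamb p X e z) < norm (lamb p z)) (nhds 0)"
    "eventually (\<lambda>e. move p X e \<in> MW \<longrightarrow> (\<forall>z. 0 < norm z \<and> norm z \<le> 1 \<longrightarrow>
       log_z_lamb (move p X e) z = log_z_lamb p z + Ln (1 + dlamb p X e z / lamb p z))) (nhds 0)"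
proof -
  have Xa: "fn X analytic_on sphere 0 1" using X by (simp add: triples_def)
  obtain H where H: "H analytic_on cball 0 1" "H 0 = exp (uc p)" "\<And>t. t \<noteq> 0 \<Longrightarrow> norm t \<le> 1 \<Longrightarrow> H t = t * lamb p t"
    using lamb_chart MWD(1)[OF p] by metis
  have nz: "H t \<noteq> 0" if "t \<in> cball 0 1" for t
    using H(2) H(3)[of t] MWD(5)[OF p, of t] that by (cases "t = 0") auto
  obtain C where C: "C analytic_on cball 0 1" "C 0 = 0"
    "\<And>t. norm t \<le> 1 \<Longrightarrow> C t = t * (ltrunc {0<..} (fn X) t + cv X)"
    using triple_parts_in[OF Xa] by blast
  define K where "K = (\<lambda>e t. e * C t + (exp (uc p + e * cu X) - exp (uc p)) * 1)"
  have Ka: "K e analytic_on cball 0 1" for e unfolding K_def by (intro analytic_intros C)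
  have K: "K e t = t * dlamb p X e t" if "t \<noteq> 0" "norm t \<le> 1" for e t
    using that by (simp add: K_def dlamb_def C(3) distrib_left[of t] mult.left_commute[of t e])
  have ev: "eventually (\<lambda>e. \<forall>t\<in>cball 0 1. norm (K e t) < norm (H t)) (nhds 0)"
    unfolding K_def
    by (rule small_perturbation) (use nz in \<open>auto intro!: analytic_cball_cont C H exp_increment_tendsto continuous_intros\<close>)
  show 1: "eventually (\<lambda>e. \<forall>z. 0 < norm z \<and> norm z \<le> 1 \<longrightarrow> norm (dlamb p X e z) < norm (lamb p z)) (nhds 0)"
    using ev
  proof (rule eventually_mono, intro allI impI)
    fix e z assume *: "\<forall>t\<in>cball 0 1. norm (K e t) < norm (H t)" "0 < norm z \<and> norm (z::complex) \<le> 1"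
    then have "norm (K e z) < norm (H z)" by auto
    moreover have "K e z = z * dlamb p X e z" "H z = z * lamb p z"
      using * K[of z e] H(3)[of z] by auto
    ultimately show "norm (dlamb p X e z) < norm (lamb p z)"
      using * by (simp add: norm_mult)
  qed
  \<comment> \<open>At \<open>0\<close> the corrected logarithm has the value
    \<open>uc p + Ln (exp (e * cu X))\<close>. This is the new \<open>u\<close> only while
    \<open>e * cu X\<close> lies in the principal strip, whence the additional smallness.\<close>
  have "((\<lambda>e. e * cu X) \<longlongrightarrow> 0 * cu X) (nhds 0)" by (intro tendsto_intros filterlim_ident)
  then have "eventually (\<lambda>e. dist (e * cu X) 0 < 1) (nhds 0)" by (intro tendstoD) auto
  with ev show "eventually (\<lambda>e. move p X e \<in> MW \<longrightarrow> (\<forall>z. 0 < norm z \<and> norm z \<le> 1 \<longrightarrow>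
       log_z_lamb (move p X e) z = log_z_lamb p z + Ln (1 + dlamb p X e z / lamb p z))) (nhds 0)"
  proof (eventually_elim, intro allI impI)
    fix e z assume *: "\<forall>t\<in>cball 0 1. norm (K e t) < norm (H t)" "dist (e * cu X) 0 < 1"
      "move p X e \<in> MW" "0 < norm z \<and> norm (z::complex) \<le> 1"
    let ?g = "log_z_lamb p"
    have ge: "exp (?g t) = H t" if "t \<in> cball 0 1" for t
      using log_z_lamb(2,3)[OF p] H(2) H(3)[of t] that by (cases "t = 0") auto
    note L = chart_perturbed_log[OF log_z_lamb(1)[OF p] H(1) Ka _ ge, of e]
    have L1: "(\<lambda>t. ?g t + Ln (1 + K e t / H t)) analytic_on cball 0 1"
      and L2: "\<And>t. t \<in> cball 0 1 \<Longrightarrow> exp (?g t + Ln (1 + K e t / H t)) = H t + K e t"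
      using L * by blast+
    have q: "K e t / H t = dlamb p X e t / lamb p t" if "t \<noteq> 0" "norm t \<le> 1" for t
      using that by (simp add: K H(3))
    have "log_z_lamb (move p X e) z = ?g z + Ln (1 + K e z / H z)"
    proof (rule log_z_lamb(4)[OF *(3) analytic_cball_cont[OF L1]])
      have "\<bar>Im (e * cu X)\<bar> \<le> norm (e * cu X)" by (rule abs_Im_le_cmod)
      then have "\<bar>Im (e * cu X)\<bar> < pi" using *(2) pi_gt3 by (simp add: dist_norm)
      then have "Ln (exp (e * cu X)) = e * cu X" by (intro Ln_exp) auto
      moreover have "1 + K e 0 / H 0 = exp (e * cu X)"
        by (simp add: K_def C H(2) exp_add field_simps)
      ultimately show "?g 0 + Ln (1 + K e 0 / H 0) = uc (move p X e)"
        using log_z_lamb(2)[OF p] by (simp add: move_def)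
    next
      fix z :: complex assume z: "0 < norm z" "norm z \<le> 1"
      have "exp (?g z + Ln (1 + K e z / H z)) = H z + K e z"
        using L2[of z] z by simp
      also have "\<dots> = z * lamb (move p X e) z"
        using z lam_move(2)[OF MWD(1)[OF p] Xa z(2)] by (simp add: K H(3) ring_distribs)
      finally show "exp (?g z + Ln (1 + K e z / H z)) = z * lamb (move p X e) z" .
    qed (use * in auto)
    then show "log_z_lamb (move p X e) z = log_z_lamb p z + Ln (1 + dlamb p X e z / lamb p z)"
      using q[of z] * by simp
  qed
qed

lemma one_plus_not_nonpos:
  assumes "norm (x :: complex) < 1"
  shows "1 + x \<notin> \<real>\<^sub>\<le>\<^sub>0" "1 + x \<noteq> 0"
proof -
  have "\<bar>Re x\<bar> < 1" using assms abs_Re_le_cmod[of x] by linarith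
  then show *: "1 + x \<notin> \<real>\<^sub>\<le>\<^sub>0" by (auto simp: complex_nonpos_Reals_iff)
  show "1 + x \<noteq> 0" using * by force
qed

text \<open>Openness along lines is all that directional derivatives require: an identity valid on
  \<open>MW\<close> may be differentiated at a point of \<open>MW\<close>.\<close>

lemma move_in_MW:
  assumes p: "p \<in> MW" and X: "X \<in> triples"
  shows "eventually (\<lambda>e. move p X e \<in> MW) (nhds 0)"
proof -
  have Xa: "fn X analytic_on sphere 0 1" using X by (simp add: triples_def)
  have "eventually (\<lambda>e. \<forall>z\<in>sphere 0 1. norm (e * fn X z + 0 * 0) < norm (wf p z)) (nhds 0)"
    by (rule small_perturbation[where \<phi> = "\<lambda>e. 0" and ?C2.0 = "\<lambda>z. 0"])
       (use MWD(6)[OF p] in \<open>auto intro!: analytic_imp_continuous_sphere Xa MWD(1)[OF p]\<close>)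
  with move_lam_log(1)[OF assms] move_lamb_log(1)[OF assms] show ?thesis
  proof eventually_elim
    fix e assume l: "\<forall>z. 1 \<le> norm z \<longrightarrow> norm (dlam p X e z) < norm (lam p z)"
      and b: "\<forall>z. 0 < norm z \<and> norm z \<le> 1 \<longrightarrow> norm (dlamb p X e z) < norm (lamb p z)"
      and w: "\<forall>z\<in>sphere 0 1. norm (e * fn X z + 0 * 0) < norm (wf p z)"
    have wn: "norm (e * fn X z / wf p z) < 1" if "z \<in> sphere 0 1" for z
      using w that MWD(6)[OF p that] by (auto simp: norm_divide norm_mult)
    have 1: "wf (move p X e) analytic_on sphere 0 1"
      unfolding move_def pt.sel by (intro analytic_intros Xa MWD(1)[OF p])
    have 2: "lw (move p X e) analytic_on sphere 0 1"
      unfolding move_def pt.sel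
      by (intro analytic_intros Xa MWD(1,2)[OF p] MWD(6)[OF p])
         (use one_plus_not_nonpos(1)[OF wn] in auto)
    have 3: "exp (lw (move p X e) z) = wf (move p X e) z / z" if "z \<in> sphere 0 1" for z
    proof -
      have "exp (lw (move p X e) z) = wf p z / z * (1 + e * fn X z / wf p z)"
        using one_plus_not_nonpos(2)[OF wn[OF that]] MWD(3)[OF p that] by (simp add: move_def exp_add)
      also have "\<dots> = wf (move p X e) z / z"
        using MWD(6)[OF p that] by (simp add: move_def distrib_left add_divide_distrib)
      finally show ?thesis .
    qed
    have 4: "lam (move p X e) z \<noteq> 0" if "1 \<le> norm z" for z
      using l that lam_move(1)[OF MWD(1)[OF p] Xa that, of e]
      by (metis add_eq_0_iff norm_minus_cancel order_less_irrefl)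
    have 5: "lamb (move p X e) z \<noteq> 0" if "0 < norm z" "norm z \<le> 1" for z
      using b that lam_move(2)[OF MWD(1)[OF p] Xa that(2), of e]
      by (metis add_eq_0_iff norm_minus_cancel order_less_irrefl)
    show "move p X e \<in> MW" unfolding MW_def using 1 2 3 4 5 by blast
  qed
qed

text \<open>A family of pairs \<open>(\<lambda>, \<lambda>')\<close> of nonvanishing functions with nonvanishing sum, together with
  branches of \<open>log ((\<lambda> + \<lambda>') / \<lambda>)\<close> and \<open>log (\<lambda>' (\<lambda> + \<lambda>'))\<close>.  It is instantiated with the curve
  \<open>move p X\<close>, with the point \<open>z\<close> itself as the parameter, and with a constant family.\<close>

definition logfam where
  "logfam W l l' b b' L1 L2 \<longleftrightarrow> fam W l l' \<and> fam W b b' \<and>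
     (\<forall>e z. (e, z) \<in> W \<longrightarrow> l e z \<noteq> 0 \<and> b e z \<noteq> 0 \<and> l e z + b e z \<noteq> 0) \<and>
     fam W L1 (\<lambda>e z. (l' e z + b' e z) / (l e z + b e z) - l' e z / l e z) \<and>
     fam W L2 (\<lambda>e z. b' e z / b e z + (l' e z + b' e z) / (l e z + b e z))"

lemma deriv_of_log:
  assumes g: "g holomorphic_on A" and h: "h holomorphic_on A" and A: "open A"
    and e: "\<And>z. z \<in> A \<Longrightarrow> exp (g z) = h z" and z: "z \<in> A"
  shows "deriv g z = deriv h z / (h z :: complex)"
proof -
  have "((\<lambda>z. exp (g z)) has_field_derivative exp (g z) * deriv g z) (at z)"
    by (rule DERIV_chain2[OF DERIV_exp holomorphic_derivI[OF g A z]])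
  moreover have "(h has_field_derivative deriv h z) (at z)" by (rule holomorphic_derivI[OF h A z])
  then have "((\<lambda>z. exp (g z)) has_field_derivative deriv h z) (at z)"
    by (rule has_field_derivative_transform_within_open[OF _ A z]) (simp add: e)
  ultimately have "exp (g z) * deriv g z = deriv h z" by (rule DERIV_unique)
  then show ?thesis using e[OF z] by (metis exp_not_eq_zero nonzero_mult_div_cancel_left)
qed

text \<open>One annulus for all ingredients of the integrands. The two formulas for logarithmic
  derivatives are those demanded by \<open>logfam\<close> when \<open>z\<close> is the
  parameter.\<close>

definition regular_ann :: "pt \<Rightarrow> real \<Rightarrow> bool" where
  "regular_ann p R \<longleftrightarrow> 1 < R \<and> lam p holomorphic_on ann R \<and> lamb p holomorphic_on ann R \<and>
     wf p holomorphic_on ann R \<and> log1 p holomorphic_on ann R \<and> log2 p holomorphic_on ann R \<and>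
     (\<forall>z\<in>ann R. lam p z + lamb p z = wf p z \<and> lam p z \<noteq> 0 \<and> lamb p z \<noteq> 0 \<and> wf p z \<noteq> 0 \<and>
        deriv (log1 p) z = (deriv (lam p) z + deriv (lamb p) z) / (lam p z + lamb p z) - deriv (lam p) z / lam p z \<and>
        deriv (log2 p) z = deriv (lamb p) z / lamb p z + (deriv (lam p) z + deriv (lamb p) z) / (lam p z + lamb p z))"

lemma MW_regular_ann:
  assumes p: "p \<in> MW" and fs: "\<And>f. f \<in> set fs \<Longrightarrow> f analytic_on sphere 0 1"
  obtains R where "regular_ann p R" "\<And>f. f \<in> set fs \<Longrightarrow> f holomorphic_on ann R"
proof -
  note w = MWD(1)[OF p]
  have nz: "lam p z \<noteq> 0" "lamb p z \<noteq> 0" "wf p z \<noteq> 0" if "z \<in> sphere 0 1" for z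
    using MWD(4,5,6)[OF p] that sphere_nonzero[OF that] by auto
  have "\<exists>R>1. \<forall>f\<in>set ([lam p, lamb p, wf p, lw p, log_lam_z p, log_z_lamb p,
      \<lambda>z. 1 / lam p z, \<lambda>z. 1 / lamb p z, \<lambda>z. 1 / wf p z] @ fs). f holomorphic_on ann R"
    by (rule common_ann) (use fs nz in \<open>auto intro!: analytic_intros lam_analytic w MWD(2)[OF p] log_parts_analytic[OF p]\<close>)
  then obtain R where R: "1 < R" and
    h: "lam p holomorphic_on ann R" "lamb p holomorphic_on ann R" "wf p holomorphic_on ann R"
      "lw p holomorphic_on ann R" "log_lam_z p holomorphic_on ann R" "log_z_lamb p holomorphic_on ann R"
      "(\<lambda>z. 1 / lam p z) holomorphic_on ann R" "(\<lambda>z. 1 / lamb p z) holomorphic_on ann R"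
      "(\<lambda>z. 1 / wf p z) holomorphic_on ann R"
    and hf: "\<And>f. f \<in> set fs \<Longrightarrow> f holomorphic_on ann R" by auto
  \<comment> \<open>Division by zero gives \<open>0\<close>, so at a zero of \<open>f\<close> the
    product \<open>f z * (1 / f z)\<close> would be \<open>0\<close>; by the identity principle it
    is \<open>1\<close> on the whole annulus. The reciprocals are in the list above for this
    purpose.\<close>
  have nzR: "f z \<noteq> 0" if "f holomorphic_on ann R" "(\<lambda>z. 1 / f z) holomorphic_on ann R"
    "\<And>z. z \<in> sphere 0 1 \<Longrightarrow> f z \<noteq> 0" "z \<in> ann R" for f :: "complex \<Rightarrow> complex" and z
  proof -
    have "f z * (1 / f z) = 1"
      by (rule ann_identity[OF holomorphic_on_mult[OF that(1,2)] holomorphic_on_const R _ that(4)])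
         (use that(3) in auto)
    then show ?thesis by auto
  qed
  have nz': "lam p z \<noteq> 0" "lamb p z \<noteq> 0" "wf p z \<noteq> 0" if "z \<in> ann R" for z
    using nzR[OF h(1,7) nz(1) that] nzR[OF h(2,8) nz(2) that] nzR[OF h(3,9) nz(3) that] by auto
  have z0: "z \<noteq> 0" if "z \<in> ann R" for z using that R ann_nonzero by blast

  have sum: "lam p z + lamb p z = wf p z" if "z \<in> ann R" for z
    by (rule ann_identity[OF holomorphic_on_add[OF h(1,2)] h(3) R lam_add_lamb[OF w] that])
  have e1: "exp (lw p z) = wf p z / z" if "z \<in> ann R" for z
    by (rule ann_identity[OF _ _ R MWD(3)[OF p] that]) (use h z0 in \<open>auto intro!: holomorphic_intros\<close>)
  have e2: "exp (log_lam_z p z) = lam p z / z" if "z \<in> ann R" for z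
    by (rule ann_identity[OF _ _ R log_lam_z(2)[OF p] that]) (use h z0 in \<open>auto intro!: holomorphic_intros\<close>)
  have e3: "exp (log_z_lamb p z) = z * lamb p z" if "z \<in> ann R" for z
    by (rule ann_identity[OF _ _ R log_z_lamb(3)[OF p] that]) (use h z0 in \<open>auto intro!: holomorphic_intros\<close>)
  have d: "(f has_field_derivative deriv f z) (at z)" if "f holomorphic_on ann R" "z \<in> ann R" for f z
    by (rule holomorphic_derivI[OF that(1) open_ann that(2)])
  have d1: "deriv (lw p) z = deriv (wf p) z / wf p z - 1 / z" if "z \<in> ann R" for z
  proof -
    have "deriv (\<lambda>z. wf p z / z) z = (deriv (wf p) z * z - wf p z * 1) / (z * z)"
      by (rule DERIV_imp_deriv, rule DERIV_divide[OF d[OF h(3) that] DERIV_ident z0[OF that]])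
    moreover have "(\<lambda>z. wf p z / z) holomorphic_on ann R" using z0 by (intro holomorphic_intros h) auto
    ultimately have "deriv (lw p) z = (deriv (wf p) z * z - wf p z * 1) / (z * z) / (wf p z / z)"
      using deriv_of_log[OF h(4) _ open_ann e1 that] by simp
    then show ?thesis using nz'(3)[OF that] z0[OF that] by (simp add: divide_simps mult.commute)
  qed
  have d2: "deriv (log_lam_z p) z = deriv (lam p) z / lam p z - 1 / z" if "z \<in> ann R" for z
  proof -
    have "deriv (\<lambda>z. lam p z / z) z = (deriv (lam p) z * z - lam p z * 1) / (z * z)"
      by (rule DERIV_imp_deriv, rule DERIV_divide[OF d[OF h(1) that] DERIV_ident z0[OF that]])
    moreover have "(\<lambda>z. lam p z / z) holomorphic_on ann R" using z0 by (intro holomorphic_intros h) auto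
    ultimately have "deriv (log_lam_z p) z = (deriv (lam p) z * z - lam p z * 1) / (z * z) / (lam p z / z)"
      using deriv_of_log[OF h(5) _ open_ann e2 that] by simp
    then show ?thesis using nz'(1)[OF that] z0[OF that] by (simp add: divide_simps mult.commute)
  qed
  have d3: "deriv (log_z_lamb p) z = deriv (lamb p) z / lamb p z + 1 / z" if "z \<in> ann R" for z
  proof -
    have "deriv (\<lambda>z. z * lamb p z) z = 1 * lamb p z + deriv (lamb p) z * z"
      by (rule DERIV_imp_deriv, rule DERIV_mult[OF DERIV_ident d[OF h(2) that]])
    moreover have "(\<lambda>z. z * lamb p z) holomorphic_on ann R" by (intro holomorphic_intros h)
    ultimately have "deriv (log_z_lamb p) z = (1 * lamb p z + deriv (lamb p) z * z) / (z * lamb p z)"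
      using deriv_of_log[OF h(6) _ open_ann e3 that] by simp
    then show ?thesis using nz'(2)[OF that] z0[OF that] by (simp add: add_divide_distrib)
  qed
  have dw: "deriv (wf p) z = deriv (lam p) z + deriv (lamb p) z" if "z \<in> ann R" for z
  proof -
    have "((\<lambda>z. lam p z + lamb p z) has_field_derivative deriv (lam p) z + deriv (lamb p) z) (at z)"
      by (rule DERIV_add[OF d[OF h(1) that] d[OF h(2) that]])
    then have "(wf p has_field_derivative deriv (lam p) z + deriv (lamb p) z) (at z)"
      by (rule has_field_derivative_transform_within_open[OF _ open_ann that sum])
    then show ?thesis by (rule DERIV_imp_deriv)
  qed
  have l1: "deriv (log1 p) z = (deriv (lam p) z + deriv (lamb p) z) / (lam p z + lamb p z) - deriv (lam p) z / lam p z"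
    if "z \<in> ann R" for z
    unfolding log1_def[abs_def] DERIV_imp_deriv[OF DERIV_diff[OF d[OF h(4) that] d[OF h(5) that]]]
    using that by (simp add: d1 d2 dw sum)
  have l2: "deriv (log2 p) z = deriv (lamb p) z / lamb p z + (deriv (lam p) z + deriv (lamb p) z) / (lam p z + lamb p z)"
    if "z \<in> ann R" for z
    unfolding log2_def[abs_def] DERIV_imp_deriv[OF DERIV_add[OF d[OF h(6) that] d[OF h(4) that]]]
    using that by (simp add: d1 d3 dw sum)
  have h1: "log1 p holomorphic_on ann R" "log2 p holomorphic_on ann R"
    unfolding log1_def[abs_def] log2_def[abs_def] by (intro holomorphic_intros h)+
  show ?thesis
    by (rule that[OF _ hf]) (use R h h1 sum nz' l1 l2 in \<open>auto simp: regular_ann_def\<close>)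
qed

text \<open>Here the first variable is the point of the circle and the second one a dummy. The
  parameter derivative of the general rules then becomes the derivative along the circle.\<close>

lemma fam_point:
  assumes "c holomorphic_on A" "open A"
  shows "fam (A \<times> UNIV) (\<lambda>e z. c e) (\<lambda>e z. deriv c e)"
proof (rule famI)
  have g: "continuous_on (A \<times> UNIV) (\<lambda>x. g (fst x))" if "g holomorphic_on A" for g :: "complex \<Rightarrow> complex"
    by (rule continuous_on_compose2[OF holomorphic_on_imp_continuous_on[OF that]]) (auto intro!: continuous_intros)
  have h: "deriv c holomorphic_on A" using assms by (rule holomorphic_deriv)
  show "continuous_on (A \<times> UNIV) (\<lambda>x. c (fst x))" by (rule g[OF assms(1)])
  show "continuous_on (A \<times> UNIV) (\<lambda>x. deriv c (fst x))" by (rule g[OF h])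
  show "((\<lambda>e. c e) has_field_derivative deriv c e) (at e)" if "(e, z) \<in> A \<times> UNIV" for e z
    using holomorphic_derivI[OF assms] that by auto
qed (use assms in \<open>auto intro!: open_Times\<close>)

lemma logfam_point:
  assumes "p \<in> MW"
  obtains A where "open A" "sphere 0 1 \<subseteq> A"
    "logfam (A \<times> UNIV) (\<lambda>e z. lam p e) (\<lambda>e z. deriv (lam p) e) (\<lambda>e z. lamb p e) (\<lambda>e z. deriv (lamb p) e)
       (\<lambda>e z. log1 p e) (\<lambda>e z. log2 p e)"
proof -
  obtain R where R: "regular_ann p R" using MW_regular_ann[OF assms, of "[]"] by auto
  note R' = R[unfolded regular_ann_def]
  note f = fam_point[OF _ open_ann]
  show ?thesis
  proof (rule that[OF open_ann sphere_subset_ann])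
    show "logfam (ann R \<times> UNIV) (\<lambda>e z. lam p e) (\<lambda>e z. deriv (lam p) e) (\<lambda>e z. lamb p e) (\<lambda>e z. deriv (lamb p) e)
       (\<lambda>e z. log1 p e) (\<lambda>e z. log2 p e)"
      unfolding logfam_def
    proof (intro conjI)
      show "fam (ann R \<times> UNIV) (\<lambda>e z. log1 p e)
         (\<lambda>e z. (deriv (lam p) e + deriv (lamb p) e) / (lam p e + lamb p e) - deriv (lam p) e / lam p e)"
        by (rule fam_deriv_cong[OF f]) (use R' in auto)
      show "fam (ann R \<times> UNIV) (\<lambda>e z. log2 p e)
         (\<lambda>e z. deriv (lamb p) e / lamb p e + (deriv (lam p) e + deriv (lamb p) e) / (lam p e + lamb p e))"
        by (rule fam_deriv_cong[OF f]) (use R' in auto)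
    qed (use R' f in auto)
  qed (use R' in auto)
qed

text \<open>The point of the manifold is fixed, and only the scalar \<open>x\<close> and the
  coefficients vary with the parameter: the situation of the equation in
  \<open>\<zeta>\<close>.\<close>

lemma logfam_const:
  assumes "regular_ann p R"
  shows "logfam (UNIV \<times> ann R) (\<lambda>e. lam p) (\<lambda>e z. 0) (\<lambda>e. lamb p) (\<lambda>e z. 0) (\<lambda>e. log1 p) (\<lambda>e. log2 p)"
proof -
  have f: "fam (UNIV \<times> ann R) (\<lambda>e. g) (\<lambda>e z. 0)" if "g holomorphic_on ann R" for g
    by (rule fam_fixed[OF that]) (auto intro!: open_Times)
  show ?thesis
    unfolding logfam_def using assms by (auto intro!: f simp: regular_ann_def)
qed

lemma fam_Ln_ratio:
  assumes F: "fam W F F'" and g: "fam W (\<lambda>e. g) (\<lambda>e z. 0)"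
    and small: "\<And>e z. (e, z) \<in> W \<Longrightarrow> norm (F e z) < norm (g z)"
  shows "fam W (\<lambda>e z. Ln (1 + F e z / g z)) (\<lambda>e z. F' e z / (g z + F e z))"
proof -
  have nz: "g z \<noteq> 0" if "(e, z) \<in> W" for e z using small[OF that] by auto
  have n: "norm (F e z / g z) < 1" if "(e, z) \<in> W" for e z
    using small[OF that] nz[OF that] by (simp add: norm_divide)
  have "fam W (\<lambda>e z. Ln (1 + F e z * (1 / g z)))
     (\<lambda>e z. 1 / (1 + F e z * (1 / g z)) * (0 + (F' e z * (1 / g z) + - (1 / (g z)\<^sup>2) * 0 * F e z)))"
  proof (rule fam_compose[where D = "- \<real>\<^sub>\<le>\<^sub>0"])
    show "(Ln has_field_derivative 1 / x) (at x)" if "x \<in> - \<real>\<^sub>\<le>\<^sub>0" for x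
      using has_field_derivative_Ln[of x] that by (simp add: inverse_eq_divide)
    show "open (- \<real>\<^sub>\<le>\<^sub>0 :: complex set)" by (simp add: open_Compl closed_nonpos_Reals_complex)
    show "1 + F e z * (1 / g z) \<in> - \<real>\<^sub>\<le>\<^sub>0" if "(e, z) \<in> W" for e z
      using one_plus_not_nonpos(1)[OF n[OF that]] by simp
  qed (intro fam_add fam_mult fam_const fam_inverse F g nz famD(1)[OF F]; assumption)
  then have "fam W (\<lambda>e z. Ln (1 + F e z * (1 / g z))) (\<lambda>e z. F' e z / (g z + F e z))"
  proof (rule fam_deriv_cong)
    fix e z assume "(e, z) \<in> W"
    then have "g z \<noteq> 0" by (rule nz)
    then have "1 + F e z * (1 / g z) = (g z + F e z) / g z" by (simp add: add_divide_distrib)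
    then show "1 / (1 + F e z * (1 / g z)) * (0 + (F' e z * (1 / g z) + - (1 / (g z)\<^sup>2) * 0 * F e z)) = F' e z / (g z + F e z)"
      using \<open>g z \<noteq> 0\<close> by simp
  qed
  then show ?thesis by simp
qed

definition lam_curve :: "pt \<Rightarrow> triple \<Rightarrow> complex \<Rightarrow> complex \<Rightarrow> complex" where
  "lam_curve p X e z = lam p z + dlam p X e z"

definition lamb_curve :: "pt \<Rightarrow> triple \<Rightarrow> complex \<Rightarrow> complex \<Rightarrow> complex" where
  "lamb_curve p X e z = lamb p z + dlamb p X e z"

text \<open>The \<open>e\<close>-derivative of \<open>dlam\<close>. It depends on \<open>e\<close>
  through the exponential; at \<open>e = 0\<close> it is the variation of \<open>lam\<close> in the
  direction \<open>X\<close>.\<close>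

definition lam_dir :: "pt \<Rightarrow> triple \<Rightarrow> complex \<Rightarrow> complex \<Rightarrow> complex" where
  "lam_dir p X e z = ltrunc {..0} (fn X) z - cv X - cu X * exp (uc p + e * cu X) / z"

definition lamb_dir :: "pt \<Rightarrow> triple \<Rightarrow> complex \<Rightarrow> complex \<Rightarrow> complex" where
  "lamb_dir p X e z = ltrunc {0<..} (fn X) z + cv X + cu X * exp (uc p + e * cu X) / z"

definition log1_curve :: "pt \<Rightarrow> triple \<Rightarrow> complex \<Rightarrow> complex \<Rightarrow> complex" where
  "log1_curve p X e z = log1 p z + Ln (1 + e * fn X z / wf p z) - Ln (1 + dlam p X e z / lam p z)"

definition log2_curve :: "pt \<Rightarrow> triple \<Rightarrow> complex \<Rightarrow> complex \<Rightarrow> complex" where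
  "log2_curve p X e z = log2 p z + Ln (1 + dlamb p X e z / lamb p z) + Ln (1 + e * fn X z / wf p z)"

text \<open>Near \<open>e = 0\<close> the chosen logarithms at the moved point agree with explicit
  expressions in \<open>e\<close>, and only these can be differentiated.\<close>

lemma move_curves:
  assumes p: "p \<in> MW" and X: "X \<in> triples"
  shows "eventually (\<lambda>e. \<forall>z\<in>sphere 0 1. lam (move p X e) z = lam_curve p X e z \<and>
     lamb (move p X e) z = lamb_curve p X e z \<and> log1 (move p X e) z = log1_curve p X e z \<and>
     log2 (move p X e) z = log2_curve p X e z) (nhds 0)"
  using move_in_MW[OF assms] move_lam_log(2)[OF assms] move_lamb_log(2)[OF assms]
proof eventually_elim
  fix e
  assume m: "move p X e \<in> MW" and "move p X e \<in> MW \<longrightarrow> (\<forall>z. 1 \<le> norm z \<longrightarrow>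
       log_lam_z (move p X e) z = log_lam_z p z + Ln (1 + dlam p X e z / lam p z))"
    and "move p X e \<in> MW \<longrightarrow> (\<forall>z. 0 < norm z \<and> norm z \<le> 1 \<longrightarrow>
       log_z_lamb (move p X e) z = log_z_lamb p z + Ln (1 + dlamb p X e z / lamb p z))"
  then have "log_lam_z (move p X e) z = log_lam_z p z + Ln (1 + dlam p X e z / lam p z)"
    "log_z_lamb (move p X e) z = log_z_lamb p z + Ln (1 + dlamb p X e z / lamb p z)"
    if "z \<in> sphere 0 1" for z using that sphere_nonzero[OF that] by auto
  moreover have "lam (move p X e) z = lam_curve p X e z" "lamb (move p X e) z = lamb_curve p X e z"
    if "z \<in> sphere 0 1" for z
    using lam_move[OF MWD(1)[OF p], of X z e] X that by (auto simp: triples_def lam_curve_def lamb_curve_def)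
  moreover have "lw (move p X e) z = lw p z + Ln (1 + e * fn X z / wf p z)" for z by (simp add: move_def)
  ultimately show "\<forall>z\<in>sphere 0 1. lam (move p X e) z = lam_curve p X e z \<and>
     lamb (move p X e) z = lamb_curve p X e z \<and> log1 (move p X e) z = log1_curve p X e z \<and>
     log2 (move p X e) z = log2_curve p X e z"
    by (simp add: log1_def log2_def log1_curve_def log2_curve_def)
qed

lemma fam_open_Collect:
  assumes F: "fam W F F'" and g: "fam W G G'"
  shows "open {(e, z). (e, z) \<in> W \<and> norm (F e z) < norm (G e z)}"
proof -
  have "open (W \<inter> (\<lambda>x. norm (G (fst x) (snd x)) - norm (F (fst x) (snd x))) -` {0<..})"
    by (rule continuous_open_preimage) (use famD(1,2)[OF F] famD(2)[OF g] in \<open>auto intro!: continuous_intros\<close>)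
  also have "W \<inter> (\<lambda>x. norm (G (fst x) (snd x)) - norm (F (fst x) (snd x))) -` {0<..} =
      {(e, z). (e, z) \<in> W \<and> norm (F e z) < norm (G e z)}" by auto
  finally show ?thesis .
qed

lemma logfam_curve:
  assumes p: "p \<in> MW" and X: "X \<in> triples"
  obtains W where "{0} \<times> sphere 0 1 \<subseteq> W"
    "logfam W (lam_curve p X) (lam_dir p X) (lamb_curve p X) (lamb_dir p X) (log1_curve p X) (log2_curve p X)"
proof -
  have Xa: "fn X analytic_on sphere 0 1" using X by (simp add: triples_def)
  define TX where "TX = ltrunc {..0} (fn X)"
  define NX where "NX = ltrunc {0<..} (fn X)"
  obtain R where R: "regular_ann p R" and "\<And>f. f \<in> set [fn X, TX, NX] \<Longrightarrow> f holomorphic_on ann R"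
    by (rule MW_regular_ann[OF p, of "[fn X, TX, NX]"])
       (auto simp: TX_def NX_def intro!: Xa ltrunc_analytic)
  then have hX: "fn X holomorphic_on ann R" "TX holomorphic_on ann R" "NX holomorphic_on ann R" by auto
  note R' = R[unfolded regular_ann_def]
  have R1: "1 < R" using R' by simp
  have sumX: "TX z + NX z = fn X z" if "z \<in> ann R" for z
    by (rule ann_identity[OF _ hX(1) R1 _ that])
       (use hX ltrunc_other[OF Xa] in \<open>auto intro!: holomorphic_intros simp: TX_def NX_def\<close>)
  define V where "V = (UNIV :: complex set) \<times> ann R"
  have V: "open V" by (auto simp: V_def intro!: open_Times)
  have fx: "fam V (\<lambda>e. g) (\<lambda>e z. 0)" if "g holomorphic_on ann R" for g
    by (rule fam_fixed[OF that V]) (simp add: V_def)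
  have iz: "(\<lambda>z. 1 / z) holomorphic_on ann R" using ann_nonzero[OF R1] by (auto intro!: holomorphic_intros)
  have par: "fam V (\<lambda>e z. e) (\<lambda>e z. 1)" by (rule fam_param[OF DERIV_ident V])
  have ex: "fam V (\<lambda>e z. exp (uc p + e * cu X) - exp (uc p)) (\<lambda>e z. exp (uc p + e * cu X) * cu X)"
    by (rule fam_param[OF _ V]) (auto intro!: derivative_eq_intros)
  have dl: "fam V (dlam p X) (lam_dir p X)"
    unfolding dlam_def[abs_def] lam_dir_def[abs_def] TX_def[symmetric]
  proof (rule fam_deriv_cong[OF fam_cong])
    show "fam V (\<lambda>e z. e * (TX z - cv X) - (exp (uc p + e * cu X) - exp (uc p)) * (1 / z))
      (\<lambda>e z. (1 * (TX z - cv X) + (0 - 0) * e) - (exp (uc p + e * cu X) * cu X * (1 / z) + 0 * (exp (uc p + e * cu X) - exp (uc p))))"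
      by (intro fam_diff fam_mult par fx hX fam_const V ex iz)
  qed auto
  have db: "fam V (dlamb p X) (lamb_dir p X)"
    unfolding dlamb_def[abs_def] lamb_dir_def[abs_def] NX_def[symmetric]
  proof (rule fam_deriv_cong[OF fam_cong])
    show "fam V (\<lambda>e z. e * (NX z + cv X) + (exp (uc p + e * cu X) - exp (uc p)) * (1 / z))
      (\<lambda>e z. (1 * (NX z + cv X) + (0 + 0) * e) + (exp (uc p + e * cu X) * cu X * (1 / z) + 0 * (exp (uc p + e * cu X) - exp (uc p))))"
      by (intro fam_add fam_mult par fx hX fam_const V ex iz)
  qed auto
  have dw: "fam V (\<lambda>e z. e * fn X z) (\<lambda>e z. fn X z)"
    by (rule fam_deriv_cong[OF fam_mult[OF par fx[OF hX(1)]]]) simp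
  have base: "fam V (\<lambda>e. lam p) (\<lambda>e z. 0)" "fam V (\<lambda>e. lamb p) (\<lambda>e z. 0)" "fam V (\<lambda>e. wf p) (\<lambda>e z. 0)"
    "fam V (\<lambda>e. log1 p) (\<lambda>e z. 0)" "fam V (\<lambda>e. log2 p) (\<lambda>e z. 0)"
    using R' by (auto intro!: fx)
  \<comment> \<open>On \<open>W\<close> the three arguments of \<open>Ln\<close> in
    \<open>log1_curve\<close> and \<open>log2_curve\<close> are closer than \<open>1\<close> to
    \<open>1\<close>, and neither function nor their sum vanishes. The slice \<open>e = 0\<close>
    lies in \<open>W\<close> because the increments are zero there.\<close>
  define W where "W = {(e, z). (e, z) \<in> V \<and> norm (dlam p X e z) < norm (lam p z)} \<inter>
     {(e, z). (e, z) \<in> V \<and> norm (dlamb p X e z) < norm (lamb p z)} \<inter>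
     {(e, z). (e, z) \<in> V \<and> norm (e * fn X z) < norm (wf p z)}"
  have W: "open W" unfolding W_def by (intro open_Int fam_open_Collect[OF dl base(1)] fam_open_Collect[OF db base(2)] fam_open_Collect[OF dw base(3)])
  have WV: "W \<subseteq> V" by (auto simp: W_def)
  note sub = fam_subset[OF _ W WV]
  have Wr: "lam p z + lamb p z = wf p z" "TX z + NX z = fn X z" if "(e, z) \<in> W" for e z
    using that WV R' sumX by (auto simp: V_def)
  have sumW: "lam_curve p X e z + lamb_curve p X e z = wf p z + e * fn X z"
    "lam_dir p X e z + lamb_dir p X e z = fn X z" if "(e, z) \<in> W" for e z
  proof -
    have "lam_curve p X e z + lamb_curve p X e z = (lam p z + lamb p z) + e * (TX z + NX z)"
      by (simp add: lam_curve_def lamb_curve_def dlam_def dlamb_def TX_def NX_def algebra_simps)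
    then show "lam_curve p X e z + lamb_curve p X e z = wf p z + e * fn X z" by (simp add: Wr[OF that])
    show "lam_dir p X e z + lamb_dir p X e z = fn X z"
      using Wr(2)[OF that] by (simp add: lam_dir_def lamb_dir_def TX_def NX_def)
  qed
  have ne: "a + b \<noteq> 0" if "norm b < norm a" for a b :: complex
    using that by (metis add_eq_0_iff norm_minus_cancel order_less_irrefl)
  show ?thesis
  proof (rule that[of W])
    have "dlam p X 0 z = 0" "dlamb p X 0 z = 0" for z by (simp_all add: dlam_def dlamb_def)
    then show "{0} \<times> sphere 0 1 \<subseteq> W"
      using sphere_subset_ann[OF R1] R' by (auto simp: W_def V_def)
    show "logfam W (lam_curve p X) (lam_dir p X) (lamb_curve p X) (lamb_dir p X) (log1_curve p X) (log2_curve p X)"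
      unfolding logfam_def
    proof (intro conjI allI impI)
      show "fam W (lam_curve p X) (lam_dir p X)" unfolding lam_curve_def[abs_def]
        by (rule fam_deriv_cong[OF fam_add[OF sub[OF base(1)] sub[OF dl]]]) simp
      show "fam W (lamb_curve p X) (lamb_dir p X)" unfolding lamb_curve_def[abs_def]
        by (rule fam_deriv_cong[OF fam_add[OF sub[OF base(2)] sub[OF db]]]) simp
      show "lam_curve p X e z \<noteq> 0" "lamb_curve p X e z \<noteq> 0" "lam_curve p X e z + lamb_curve p X e z \<noteq> 0"
        if "(e, z) \<in> W" for e z
        unfolding sumW[OF that] using that ne unfolding W_def lam_curve_def lamb_curve_def by blast+
      have Lw: "fam W (\<lambda>e z. Ln (1 + e * fn X z / wf p z)) (\<lambda>e z. fn X z / (wf p z + e * fn X z))"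
        by (rule fam_Ln_ratio[OF sub[OF dw] sub[OF base(3)]]) (auto simp: W_def)
      have Ll: "fam W (\<lambda>e z. Ln (1 + dlam p X e z / lam p z)) (\<lambda>e z. lam_dir p X e z / (lam p z + dlam p X e z))"
        by (rule fam_Ln_ratio[OF sub[OF dl] sub[OF base(1)]]) (auto simp: W_def)
      have Lb: "fam W (\<lambda>e z. Ln (1 + dlamb p X e z / lamb p z)) (\<lambda>e z. lamb_dir p X e z / (lamb p z + dlamb p X e z))"
        by (rule fam_Ln_ratio[OF sub[OF db] sub[OF base(2)]]) (auto simp: W_def)
      show "fam W (log1_curve p X) (\<lambda>e z. (lam_dir p X e z + lamb_dir p X e z) / (lam_curve p X e z + lamb_curve p X e z) -
          lam_dir p X e z / lam_curve p X e z)"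
        unfolding log1_curve_def[abs_def]
        by (rule fam_deriv_cong[OF fam_diff[OF fam_add[OF sub[OF base(4)] Lw] Ll]]) (simp add: sumW, simp add: lam_curve_def)
      show "fam W (log2_curve p X) (\<lambda>e z. lamb_dir p X e z / lamb_curve p X e z +
          (lam_dir p X e z + lamb_dir p X e z) / (lam_curve p X e z + lamb_curve p X e z))"
        unfolding log2_curve_def[abs_def]
        by (rule fam_deriv_cong[OF fam_add[OF fam_add[OF sub[OF base(5)] Lb] Lw]]) (simp add: sumW, simp add: lamb_curve_def)
    qed
  qed
qed

section \<open>The integrands\<close>

text \<open>The entire function \<open>(1 - exp (- z)) / z\<close>, which is the derivative of
  \<open>Ein\<close>.\<close>

definition Ein1 :: "complex \<Rightarrow> complex" where
  "Ein1 z = (\<Sum>n. (-1) ^ n / fact (Suc n) * z ^ n)"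

lemma Ein1_summable: "summable (\<lambda>n. (-1) ^ n / fact (Suc n) * (z :: complex) ^ n)"
proof (rule summable_comparison_test')
  show "summable (\<lambda>n. norm z ^ n /\<^sub>R fact n)" using summable_exp_generic[of "norm z"] by simp
  show "norm ((-1) ^ n / fact (Suc n) * z ^ n) \<le> norm z ^ n /\<^sub>R fact n" if "0 \<le> n" for n
  proof -
    have "fact n \<le> (fact (Suc n) :: real)" by (rule fact_mono) simp
    then show ?thesis by (simp add: norm_mult norm_divide norm_power divide_simps mult_left_mono del: fact_Suc)
  qed
qed

lemma Ein_summable: "summable (\<lambda>n. (if n = 0 then 0 else - ((-1) ^ n / (fact n * of_nat n))) * (z :: complex) ^ n)"
proof (rule summable_comparison_test')
  show "summable (\<lambda>n. norm z ^ n /\<^sub>R fact n)" using summable_exp_generic[of "norm z"] by simp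
  show "norm ((if n = 0 then 0 else - ((-1) ^ n / (fact n * of_nat n))) * z ^ n) \<le> norm z ^ n /\<^sub>R fact n"
    if "0 \<le> n" for n
  proof (cases "n = 0")
    case False
    then have "1 \<le> real n" by simp
    then have "fact n * norm z ^ n * 1 \<le> fact n * norm z ^ n * real n"
      by (intro mult_left_mono) auto
    then show ?thesis using False by (simp add: norm_mult norm_divide norm_power divide_simps mult_ac)
  qed simp
qed

lemma Ein_powser: "Ein z = (\<Sum>n. (if n = 0 then 0 else - ((-1) ^ n / (fact n * of_nat n))) * z ^ n)"
proof -
  let ?f = "\<lambda>n. (if n = 0 then 0 else - ((-1) ^ n / (fact n * of_nat n))) * z ^ n"
  have "suminf ?f = (\<Sum>n. ?f (Suc n)) + ?f 0"
    using suminf_split_head[OF Ein_summable[of z]] by simp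
  also have "(\<lambda>n. ?f (Suc n)) = (\<lambda>n. - ((- z) ^ Suc n / (fact (Suc n) * of_nat (Suc n))))"
  proof
    fix n show "?f (Suc n) = - ((- z) ^ Suc n / (fact (Suc n) * of_nat (Suc n)))"
      by (simp add: power_minus[of z "Suc n"] del: power_Suc fact_Suc of_nat_Suc)
  qed
  also have "(\<Sum>n. - ((- z) ^ Suc n / (fact (Suc n) * of_nat (Suc n)))) = Ein z"
    unfolding Ein_def
  proof (rule suminf_minus)
    have "summable (\<lambda>n. ?f (Suc n))" using Ein_summable[of z] by (subst summable_Suc_iff)
    then have "summable (\<lambda>n. - ?f (Suc n))" by (rule summable_minus)
    also have "(\<lambda>n. - ?f (Suc n)) = (\<lambda>n. (- z) ^ Suc n / (fact (Suc n) * of_nat (Suc n)))"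
    proof
      fix n show "- ?f (Suc n) = (- z) ^ Suc n / (fact (Suc n) * of_nat (Suc n))"
        by (simp add: power_minus[of z "Suc n"] del: power_Suc fact_Suc of_nat_Suc)
    qed
    finally show "summable (\<lambda>n. (- z) ^ Suc n / (fact (Suc n) * of_nat (Suc n)))" .
  qed
  finally show ?thesis by simp
qed

lemma Ein_deriv: "(Ein has_field_derivative Ein1 z) (at z)"
proof -
  let ?c = "\<lambda>n. if n = 0 then 0 else - ((-1) ^ n / (fact n * of_nat n)) :: complex"
  have "((\<lambda>z. \<Sum>n. ?c n * z ^ n) has_field_derivative (\<Sum>n. diffs ?c n * z ^ n)) (at z)"
    by (rule termdiffs_strong_converges_everywhere) (rule Ein_summable)
  moreover have "diffs ?c = (\<lambda>n. (-1) ^ n / fact (Suc n))"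
    unfolding diffs_def by (simp del: fact_Suc of_nat_Suc add: fun_eq_iff)
  moreover have "Ein = (\<lambda>z. \<Sum>n. ?c n * z ^ n)" using Ein_powser by blast
  ultimately show ?thesis by (simp add: Ein1_def)
qed

lemma Ein1_mult: "z * Ein1 z = 1 - exp (- z)"
proof -
  have "(\<lambda>n. (- z) ^ n /\<^sub>R fact n) sums exp (- z)" by (rule exp_converges)
  then have "(\<lambda>n. (- z) ^ Suc n /\<^sub>R fact (Suc n)) sums (exp (- z) - 1)"
    by (subst sums_Suc_iff) simp
  then have "(\<lambda>n. - ((- z) ^ Suc n /\<^sub>R fact (Suc n))) sums (- (exp (- z) - 1))" by (rule sums_minus)
  moreover have "- ((- z) ^ Suc n /\<^sub>R fact (Suc n)) = z * ((-1) ^ n / fact (Suc n) * z ^ n)" for n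
    by (simp add: power_minus[of z] scaleR_conv_of_real divide_inverse mult_ac del: fact_Suc)
  ultimately have "(\<lambda>n. z * ((-1) ^ n / fact (Suc n) * z ^ n)) sums (1 - exp (- z))" by simp
  moreover have "(\<lambda>n. z * ((-1) ^ n / fact (Suc n) * z ^ n)) sums (z * Ein1 z)"
    unfolding Ein1_def by (intro sums_mult summable_sums Ein1_summable)
  ultimately show ?thesis using sums_unique2 by blast
qed

definition expo_mid :: "complex \<Rightarrow> complex \<Rightarrow> complex \<Rightarrow> complex" where
  "expo_mid x l b = exp ((b - l) / 2 * x)"

definition log_block1 :: "complex \<Rightarrow> complex \<Rightarrow> complex \<Rightarrow> complex" where
  "log_block1 x l L = exp (- l * x) * (L + Ein (- l * x) - 1)"

definition log_block2 :: "complex \<Rightarrow> complex \<Rightarrow> complex \<Rightarrow> complex" where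
  "log_block2 x b L = exp (b * x) * (L - Ein (b * x) - 1)"

context
  fixes W l l' b b' L1 L2 and X X' :: "complex \<Rightarrow> complex"
  assumes lf: "logfam W l l' b b' L1 L2" and X: "\<And>e. (X has_field_derivative X' e) (at e)"
begin

lemma logfamD:
  shows logfam_l: "fam W l l'" and logfam_b: "fam W b b'"
    and logfam_nz: "\<And>e z. (e, z) \<in> W \<Longrightarrow> l e z \<noteq> 0" "\<And>e z. (e, z) \<in> W \<Longrightarrow> b e z \<noteq> 0"
      "\<And>e z. (e, z) \<in> W \<Longrightarrow> l e z + b e z \<noteq> 0"
    and logfam_L1: "fam W L1 (\<lambda>e z. (l' e z + b' e z) / (l e z + b e z) - l' e z / l e z)"
    and logfam_L2: "fam W L2 (\<lambda>e z. b' e z / b e z + (l' e z + b' e z) / (l e z + b e z))"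
  using lf unfolding logfam_def by blast+

lemma logfam_open: "open W"
  using famD(1)[OF logfam_l] .

lemma fam_X: "fam W (\<lambda>e z. X e) (\<lambda>e z. X' e)"
  by (rule fam_param[OF X logfam_open])

lemma fam_expl: "fam W (\<lambda>e z. exp (- l e z * X e)) (\<lambda>e z. - exp (- l e z * X e) * (l' e z * X e + l e z * X' e))"
  by (rule fam_deriv_cong[OF fam_exp[OF fam_mult[OF fam_uminus[OF logfam_l] fam_X]]]) (simp add: algebra_simps)

lemma fam_expb: "fam W (\<lambda>e z. exp (b e z * X e)) (\<lambda>e z. exp (b e z * X e) * (b' e z * X e + b e z * X' e))"
  by (rule fam_deriv_cong[OF fam_exp[OF fam_mult[OF logfam_b fam_X]]]) (simp add: algebra_simps)

lemma fam_w: "fam W (\<lambda>e z. l e z + b e z) (\<lambda>e z. l' e z + b' e z)"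
  by (rule fam_add[OF logfam_l logfam_b])

lemma fam_expl_w: "fam W (\<lambda>e z. exp (- l e z * X e) / (l e z + b e z))
   (\<lambda>e z. - exp (- l e z * X e) * (l' e z * X e + l e z * X' e) / (l e z + b e z)
        - exp (- l e z * X e) * (l' e z + b' e z) / (l e z + b e z)\<^sup>2)"
  by (rule fam_deriv_cong[OF fam_cong[OF fam_mult[OF fam_expl fam_inverse[OF fam_w logfam_nz(3)]]]])
     simp_all

lemma fam_expb_w: "fam W (\<lambda>e z. exp (b e z * X e) / (l e z + b e z))
   (\<lambda>e z. exp (b e z * X e) * (b' e z * X e + b e z * X' e) / (l e z + b e z)
        - exp (b e z * X e) * (l' e z + b' e z) / (l e z + b e z)\<^sup>2)"
  by (rule fam_deriv_cong[OF fam_cong[OF fam_mult[OF fam_expb fam_inverse[OF fam_w logfam_nz(3)]]]])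
     simp_all

text \<open>Since \<open>x * exp (- l * x) * Ein1 (- l * x) = (1 - exp (- l * x)) / l\<close>, the
  derivative of \<open>Ein\<close> replaces the term \<open>exp (- l * x) / l\<close> coming from
  the logarithm by \<open>1 / l\<close>. That remainder has only negative powers at
  infinity.\<close>

lemma fam_log_block1:
  "fam W (\<lambda>e z. log_block1 (X e) (l e z) (L1 e z))
     (\<lambda>e z. - (l' e z * X e + l e z * X' e) * log_block1 (X e) (l e z) (L1 e z)
        + exp (- l e z * X e) * (l' e z + b' e z) / (l e z + b e z) - l' e z / l e z
        - l e z * X' e * exp (- l e z * X e) * Ein1 (- l e z * X e))"
  unfolding log_block1_def
proof (rule fam_deriv_cong[OF fam_mult[OF fam_expl fam_diff[OF fam_add[OF logfam_L1
          fam_compose[OF fam_mult[OF fam_uminus[OF logfam_l] fam_X] Ein_deriv open_UNIV]] fam_const[OF logfam_open]]]])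
  fix e z assume W: "(e, z) \<in> W"
  define A where "A = exp (- l e z * X e)"
  have A: "A * exp (l e z * X e) = 1" by (simp add: A_def flip: exp_add)
  have "l e z * X e * Ein1 (- l e z * X e) = exp (l e z * X e) - 1"
    using Ein1_mult[of "- l e z * X e"] by (simp add: algebra_simps)
  then have "A * (l e z * X e * Ein1 (- l e z * X e)) = 1 - A" using A by (simp only: right_diff_distrib) simp
  then have *: "A * X e * Ein1 (- l e z * X e) = 1 / l e z - A / l e z"
    using logfam_nz(1)[OF W] by (simp add: field_simps)
  have "- A * (l' e z * X e + l e z * X' e) * (L1 e z + Ein (- l e z * X e) - 1) +
      ((l' e z + b' e z) / (l e z + b e z) - l' e z / l e z + Ein1 (- l e z * X e) * (- l' e z * X e + X' e * - l e z) - 0) * A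
    = - (l' e z * X e + l e z * X' e) * (A * (L1 e z + Ein (- l e z * X e) - 1)) + A * (l' e z + b' e z) / (l e z + b e z)
      - l' e z * (A / l e z) - l' e z * (A * X e * Ein1 (- l e z * X e)) - l e z * X' e * A * Ein1 (- l e z * X e)"
    by (simp add: algebra_simps add_divide_distrib)
  also have "\<dots> = - (l' e z * X e + l e z * X' e) * (A * (L1 e z + Ein (- l e z * X e) - 1)) + A * (l' e z + b' e z) / (l e z + b e z)
      - l' e z / l e z - l e z * X' e * A * Ein1 (- l e z * X e)"
    unfolding * by (simp add: algebra_simps)
  finally show "- exp (- l e z * X e) * (l' e z * X e + l e z * X' e) * (L1 e z + Ein (- l e z * X e) - 1) +
      ((l' e z + b' e z) / (l e z + b e z) - l' e z / l e z + Ein1 (- l e z * X e) * (- l' e z * X e + X' e * - l e z) - 0) *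
        exp (- l e z * X e)
    = - (l' e z * X e + l e z * X' e) * (exp (- l e z * X e) * (L1 e z + Ein (- l e z * X e) - 1))
      + exp (- l e z * X e) * (l' e z + b' e z) / (l e z + b e z) - l' e z / l e z
      - l e z * X' e * exp (- l e z * X e) * Ein1 (- l e z * X e)"
    unfolding A_def .
qed auto

text \<open>Mirror image of the previous lemma: what remains is \<open>b' / b\<close>, and its mean
  will be the variation of \<open>u\<close> when \<open>b\<close> is \<open>lamb\<close>.\<close>

lemma fam_log_block2:
  "fam W (\<lambda>e z. log_block2 (X e) (b e z) (L2 e z))
     (\<lambda>e z. (b' e z * X e + b e z * X' e) * log_block2 (X e) (b e z) (L2 e z)
        + exp (b e z * X e) * (l' e z + b' e z) / (l e z + b e z) + b' e z / b e z
        - b e z * X' e * exp (b e z * X e) * Ein1 (b e z * X e))"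
  unfolding log_block2_def
proof (rule fam_deriv_cong[OF fam_mult[OF fam_expb fam_diff[OF fam_diff[OF logfam_L2
          fam_compose[OF fam_mult[OF logfam_b fam_X] Ein_deriv open_UNIV]] fam_const[OF logfam_open]]]])
  fix e z assume W: "(e, z) \<in> W"
  define A where "A = exp (b e z * X e)"
  have A: "A * exp (- b e z * X e) = 1" by (simp add: A_def flip: exp_add)
  have "b e z * X e * Ein1 (b e z * X e) = 1 - exp (- b e z * X e)"
    using Ein1_mult[of "b e z * X e"] by (simp add: algebra_simps)
  then have "A * (b e z * X e * Ein1 (b e z * X e)) = A - 1" using A by (simp only: right_diff_distrib) simp
  then have *: "A * X e * Ein1 (b e z * X e) = A / b e z - 1 / b e z"
    using logfam_nz(2)[OF W] by (simp add: field_simps)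
  have "A * (b' e z * X e + b e z * X' e) * (L2 e z - Ein (b e z * X e) - 1) +
      (b' e z / b e z + (l' e z + b' e z) / (l e z + b e z) - Ein1 (b e z * X e) * (b' e z * X e + X' e * b e z) - 0) * A
    = (b' e z * X e + b e z * X' e) * (A * (L2 e z - Ein (b e z * X e) - 1)) + A * (l' e z + b' e z) / (l e z + b e z)
      + b' e z * (A / b e z) - b' e z * (A * X e * Ein1 (b e z * X e)) - b e z * X' e * A * Ein1 (b e z * X e)"
    by (simp add: algebra_simps add_divide_distrib)
  also have "\<dots> = (b' e z * X e + b e z * X' e) * (A * (L2 e z - Ein (b e z * X e) - 1)) + A * (l' e z + b' e z) / (l e z + b e z)
      + b' e z / b e z - b e z * X' e * A * Ein1 (b e z * X e)"
    unfolding * by (simp add: algebra_simps)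
  finally show "exp (b e z * X e) * (b' e z * X e + b e z * X' e) * (L2 e z - Ein (b e z * X e) - 1) +
      (b' e z / b e z + (l' e z + b' e z) / (l e z + b e z) - Ein1 (b e z * X e) * (b' e z * X e + X' e * b e z) - 0) *
        exp (b e z * X e)
    = (b' e z * X e + b e z * X' e) * (exp (b e z * X e) * (L2 e z - Ein (b e z * X e) - 1))
      + exp (b e z * X e) * (l' e z + b' e z) / (l e z + b e z) + b' e z / b e z
      - b e z * X' e * exp (b e z * X e) * Ein1 (b e z * X e)"
    unfolding A_def .
qed auto

lemma fam_expo_mid:
  "fam W (\<lambda>e z. expo_mid (X e) (l e z) (b e z))
     (\<lambda>e z. expo_mid (X e) (l e z) (b e z) * ((b' e z - l' e z) / 2 * X e + (b e z - l e z) / 2 * X' e))"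
proof -
  have "fam W (\<lambda>e z. exp (1 / 2 * (b e z - l e z) * X e))
     (\<lambda>e z. exp (1 / 2 * (b e z - l e z) * X e) * (1 / 2 * (b' e z - l' e z) * X e + X' e * (1 / 2 * (b e z - l e z))))"
    by (intro fam_exp fam_mult fam_cmult fam_diff logfam_l logfam_b fam_X)
  then show ?thesis unfolding expo_mid_def by (simp add: mult.commute)
qed

lemma fam_w_powi: "fam W (\<lambda>e z. (l e z + b e z) powi n) (\<lambda>e z. of_int n * (l e z + b e z) powi (n - 1) * (l' e z + b' e z))"
  by (rule fam_powi[OF fam_w logfam_nz(3)])

end

text \<open>Every deformed flat coordinate is the mean of a function \<open>f(\<lambda>, \<lambda>')\<close> of the following form, where
  \<open>x\<close> stands for \<open>\<zeta>\<close>. Up to the terms \<open>- k1 / \<lambda>\<close> and \<open>k2 / \<lambda>'\<close>, which only have powers that do not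
  contribute to the differential, \<open>flatP\<close> and \<open>flatQ\<close> are its two partial derivatives, \<open>flatS\<close> is the mixed
  one, and \<open>flatQ - flatP = x f + kU\<close>.\<close>

datatype coef = Coef (deg: int) (kG: complex) (k1: complex) (k2: complex) (kU: complex)

definition flatF :: "coef \<Rightarrow> complex \<Rightarrow> complex \<Rightarrow> complex \<Rightarrow> complex \<Rightarrow> complex \<Rightarrow> complex" where
  "flatF k x l b L1 L2 = kG k * ((l + b) powi deg k * expo_mid x l b) + k1 k * log_block1 x l L1
     + k2 k * log_block2 x b L2 + kU k * ((exp (b * x) - 1) / x)"

definition flatP :: "coef \<Rightarrow> complex \<Rightarrow> complex \<Rightarrow> complex \<Rightarrow> complex \<Rightarrow> complex \<Rightarrow> complex" where
  "flatP k x l b L1 L2 =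
     kG k * ((of_int (deg k) * (l + b) powi (deg k - 1) - x / 2 * (l + b) powi deg k) * expo_mid x l b)
     + k1 k * (exp (- l * x) / (l + b) - x * log_block1 x l L1) + k2 k * (exp (b * x) / (l + b))"

definition flatQ :: "coef \<Rightarrow> complex \<Rightarrow> complex \<Rightarrow> complex \<Rightarrow> complex \<Rightarrow> complex \<Rightarrow> complex" where
  "flatQ k x l b L1 L2 =
     kG k * ((of_int (deg k) * (l + b) powi (deg k - 1) + x / 2 * (l + b) powi deg k) * expo_mid x l b)
     + k1 k * (exp (- l * x) / (l + b)) + k2 k * (exp (b * x) / (l + b) + x * log_block2 x b L2)
     + kU k * exp (b * x)"

definition flatS :: "coef \<Rightarrow> complex \<Rightarrow> complex \<Rightarrow> complex \<Rightarrow> complex" where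
  "flatS k x l b =
     kG k * ((of_int (deg k) * of_int (deg k - 1) * (l + b) powi (deg k - 2) - x\<^sup>2 / 4 * (l + b) powi deg k) * expo_mid x l b)
     - k1 k * ((x / (l + b) + 1 / (l + b)\<^sup>2) * exp (- l * x))
     + k2 k * ((x / (l + b) - 1 / (l + b)\<^sup>2) * exp (b * x))"

text \<open>The derivative of \<open>flatP\<close> in \<open>x\<close> alone, with coefficients,
  \<open>l\<close>, \<open>b\<close> and logarithms held fixed; \<open>flatQx\<close> is the
  analogue for \<open>flatQ\<close>.\<close>

definition flatPx :: "coef \<Rightarrow> complex \<Rightarrow> complex \<Rightarrow> complex \<Rightarrow> complex \<Rightarrow> complex \<Rightarrow> complex" where
  "flatPx k x l b L1 L2 =
     kG k * ((of_int (deg k) * (l + b) powi (deg k - 1) - x / 2 * (l + b) powi deg k) * (b - l) / 2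
        - (l + b) powi deg k / 2) * expo_mid x l b
     + k1 k * (x * l * exp (- l * x) * Ein1 (- l * x) + x * l * log_block1 x l L1 - log_block1 x l L1 - l * exp (- l * x) / (l + b))
     + k2 k * (b * exp (b * x) / (l + b))"

definition flatQx :: "coef \<Rightarrow> complex \<Rightarrow> complex \<Rightarrow> complex \<Rightarrow> complex \<Rightarrow> complex \<Rightarrow> complex" where
  "flatQx k x l b L1 L2 =
     kG k * ((of_int (deg k) * (l + b) powi (deg k - 1) + x / 2 * (l + b) powi deg k) * (b - l) / 2
        + (l + b) powi deg k / 2) * expo_mid x l b
     - k1 k * (l * exp (- l * x) / (l + b))
     + k2 k * (log_block2 x b L2 + x * b * log_block2 x b L2 - x * b * exp (b * x) * Ein1 (b * x) + b * exp (b * x) / (l + b))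
     + kU k * (b * exp (b * x))"

text \<open>\<open>N\<close> and \<open>M\<close> stand for the degree and the degree minus one, and
  \<open>a\<close>, \<open>c\<close>, \<open>d\<close> for the powers of \<open>l + b\<close> with
  exponents \<open>deg - 2\<close>, \<open>deg - 1\<close>, \<open>deg\<close>. The identity is
  polynomial in independent letters, so no power has to be expanded.\<close>

lemma flatP_alg: fixes g g' N M a c d E x x' l l' b b' :: complex 
  shows "g' * ((N * c - 1 / 2 * x * d) * E) +
        ((N * (M * a * (l' + b')) - (1 / 2 * x' * d + N * c * (l' + b') * (1 / 2 * x))) * E +
         E * ((b' - l') / 2 * x + (b - l) / 2 * x') * (N * c - 1 / 2 * x * d)) * g =
      g' * ((N * c - x / 2 * d) * E) + g * ((N * M * a - x\<^sup>2 / 4 * d) * E) * (l' + b')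
      - x * (g * ((N * c - x / 2 * d) * E)) * l'
      + x' * (g * ((N * c - x / 2 * d) * (b - l) / 2 - d / 2) * E)"
  by (simp add: field_simps power2_eq_square)
lemma flatQ_alg: fixes g g' N M a c d E x x' l l' b b' :: complex 
  shows "g' * ((N * c + 1 / 2 * x * d) * E) +
        ((N * (M * a * (l' + b')) + (1 / 2 * x' * d + N * c * (l' + b') * (1 / 2 * x))) * E +
         E * ((b' - l') / 2 * x + (b - l) / 2 * x') * (N * c + 1 / 2 * x * d)) * g =
      g' * ((N * c + x / 2 * d) * E) + g * ((N * M * a - x\<^sup>2 / 4 * d) * E) * (l' + b')
      + x * (g * ((N * c + x / 2 * d) * E)) * b'
      + x' * (g * ((N * c + x / 2 * d) * (b - l) / 2 + d / 2) * E)"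
  by (simp add: field_simps power2_eq_square)

lemma flatP_alg1:
  fixes c c' x x' l l' b' A F w p :: complex
  assumes "l \<noteq> 0" "w \<noteq> 0"
  shows "c' * (A / w - x * F)
      + ((- A * (l' * x + l * x') / w - A * (l' + b') / w\<^sup>2)
         - (x' * F + (- (l' * x + l * x') * F + A * (l' + b') / w - l' / l - l * x' * A * p) * x)) * c
    = c' * (A / w - x * F) - c * ((x / w + 1 / w\<^sup>2) * A) * (l' + b')
      - x * (c * (A / w - x * F) - c / l) * l'
      + x' * (c * (x * l * A * p + x * l * F - F - l * A / w))"
  using assms by (simp add: field_simps power2_eq_square)

lemma flatP_alg2:
  fixes c c' x x' b l' b' A w :: complex
  assumes "w \<noteq> 0"
  shows "c' * (A / w) + (A * (b' * x + b * x') / w - A * (l' + b') / w\<^sup>2) * c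
    = c' * (A / w) + c * ((x / w - 1 / w\<^sup>2) * A) * (l' + b') - x * (c * (A / w)) * l' + x' * (c * (b * A / w))"
  using assms by (simp add: field_simps power2_eq_square)

lemma flatQ_alg1:
  fixes c c' x x' l l' b' A w :: complex
  assumes "w \<noteq> 0"
  shows "c' * (A / w) + (- A * (l' * x + l * x') / w - A * (l' + b') / w\<^sup>2) * c
    = c' * (A / w) - c * ((x / w + 1 / w\<^sup>2) * A) * (l' + b') + x * (c * (A / w)) * b' - x' * (c * (l * A / w))"
  using assms by (simp add: field_simps power2_eq_square)

lemma flatQ_alg2:
  fixes c c' x x' b l' b' A F w p :: complex
  assumes "b \<noteq> 0" "w \<noteq> 0"
  shows "c' * (A / w + x * F)
      + ((A * (b' * x + b * x') / w - A * (l' + b') / w\<^sup>2)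
         + (x' * F + ((b' * x + b * x') * F + A * (l' + b') / w + b' / b - b * x' * A * p) * x)) * c
    = c' * (A / w + x * F) + c * ((x / w - 1 / w\<^sup>2) * A) * (l' + b')
      + x * (c * (A / w + x * F) + c / b) * b'
      + x' * (c * (F + x * b * F - x * b * A * p + b * A / w))"
  using assms by (simp add: field_simps power2_eq_square)

context
  fixes W l l' b b' L1 L2 and X X' G G' C1 C1' C2 C2' U U' :: "complex \<Rightarrow> complex" and n :: int
  assumes lf: "logfam W l l' b b' L1 L2" and X: "\<And>e. (X has_field_derivative X' e) (at e)"
    and G: "\<And>e. (G has_field_derivative G' e) (at e)"
    and C1: "\<And>e. (C1 has_field_derivative C1' e) (at e)" and C2: "\<And>e. (C2 has_field_derivative C2' e) (at e)"
    and U: "\<And>e. (U has_field_derivative U' e) (at e)"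
begin

text \<open>All arguments vary at once, so a single formula serves every use: constant coefficients
  and \<open>X' = 0\<close> for moves of the point and for moves of \<open>z\<close>, and
  \<open>l' = b' = 0\<close> for the equation in \<open>\<zeta>\<close>.\<close>

lemma fam_flatP:
  "fam W (\<lambda>e z. flatP (Coef n (G e) (C1 e) (C2 e) (U e)) (X e) (l e z) (b e z) (L1 e z) (L2 e z))
     (\<lambda>e z. flatP (Coef n (G' e) (C1' e) (C2' e) (U' e)) (X e) (l e z) (b e z) (L1 e z) (L2 e z)
        + flatS (Coef n (G e) (C1 e) (C2 e) (U e)) (X e) (l e z) (b e z) * (l' e z + b' e z)
        - X e * (flatP (Coef n (G e) (C1 e) (C2 e) (U e)) (X e) (l e z) (b e z) (L1 e z) (L2 e z) - C1 e / l e z) * l' e z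
        + X' e * flatPx (Coef n (G e) (C1 e) (C2 e) (U e)) (X e) (l e z) (b e z) (L1 e z) (L2 e z))"
proof -
  note o = logfam_open[OF lf X] and nz = logfam_nz[OF lf X]
  note fx = fam_X[OF lf X] and par = fam_param[OF _ o]
  let ?w = "\<lambda>e z. l e z + b e z" and ?M = "\<lambda>e z. expo_mid (X e) (l e z) (b e z)"
  let ?A = "\<lambda>e z. exp (- l e z * X e)" and ?B = "\<lambda>e z. exp (b e z * X e)"
  let ?F = "\<lambda>e z. log_block1 (X e) (l e z) (L1 e z)"
  have 1: "fam W (\<lambda>e z. G e * ((of_int n * ?w e z powi (n - 1) - X e / 2 * ?w e z powi n) * ?M e z))
     (\<lambda>e z. G' e * ((of_int n * ?w e z powi (n - 1) - X e / 2 * ?w e z powi n) * ?M e z)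
      + G e * ((of_int n * of_int (n - 1) * ?w e z powi (n - 2) - (X e)\<^sup>2 / 4 * ?w e z powi n) * ?M e z) * (l' e z + b' e z)
      - X e * (G e * ((of_int n * ?w e z powi (n - 1) - X e / 2 * ?w e z powi n) * ?M e z)) * l' e z
      + X' e * (G e * ((of_int n * ?w e z powi (n - 1) - X e / 2 * ?w e z powi n) * (b e z - l e z) / 2
        - ?w e z powi n / 2) * ?M e z))"
  proof (rule fam_deriv_cong)
    show "fam W (\<lambda>e z. G e * ((of_int n * ?w e z powi (n - 1) - X e / 2 * ?w e z powi n) * ?M e z))
      (\<lambda>e z. G' e * ((of_int n * ?w e z powi (n - 1) - 1 / 2 * X e * ?w e z powi n) * ?M e z) +
        ((of_int n * (of_int (n - 1) * ?w e z powi (n - 1 - 1) * (l' e z + b' e z)) -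
          (1 / 2 * X' e * ?w e z powi n + of_int n * ?w e z powi (n - 1) * (l' e z + b' e z) * (1 / 2 * X e))) * ?M e z +
         ?M e z * ((b' e z - l' e z) / 2 * X e + (b e z - l e z) / 2 * X' e) *
         (of_int n * ?w e z powi (n - 1) - 1 / 2 * X e * ?w e z powi n)) * G e)"
      using fam_mult[OF par[OF G] fam_mult[OF fam_diff[OF fam_cmult[OF fam_w_powi[OF lf X]]
          fam_mult[OF fam_cmult[OF fx, of "1/2"] fam_w_powi[OF lf X]]] fam_expo_mid[OF lf X]], of "of_int n" "n - 1" n]
      by simp
  qed (simp only: diff_diff_eq one_add_one, rule flatP_alg)
  have 2: "fam W (\<lambda>e z. C1 e * (?A e z / ?w e z - X e * ?F e z))
     (\<lambda>e z. C1' e * (?A e z / ?w e z - X e * ?F e z) - C1 e * ((X e / ?w e z + 1 / (?w e z)\<^sup>2) * ?A e z) * (l' e z + b' e z)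
      - X e * (C1 e * (?A e z / ?w e z - X e * ?F e z) - C1 e / l e z) * l' e z
      + X' e * (C1 e * (X e * l e z * ?A e z * Ein1 (- l e z * X e) + X e * l e z * ?F e z - ?F e z - l e z * ?A e z / ?w e z)))"
    by (rule fam_deriv_cong[OF fam_mult[OF par[OF C1] fam_diff[OF fam_expl_w[OF lf X] fam_mult[OF fx fam_log_block1[OF lf X]]]]])
       (rule flatP_alg1[OF nz(1) nz(3)])
  have 3: "fam W (\<lambda>e z. C2 e * (?B e z / ?w e z))
     (\<lambda>e z. C2' e * (?B e z / ?w e z) + C2 e * ((X e / ?w e z - 1 / (?w e z)\<^sup>2) * ?B e z) * (l' e z + b' e z)
       - X e * (C2 e * (?B e z / ?w e z)) * l' e z + X' e * (C2 e * (b e z * ?B e z / ?w e z)))"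
    by (rule fam_deriv_cong[OF fam_mult[OF par[OF C2] fam_expb_w[OF lf X]]]) (rule flatP_alg2[OF nz(3)])
  have comb: "(a1 + s1 * w - x * p1 * l + y * q1) + (a2 - s2 * w - x * (p2 - c) * l + y * q2) + (a3 + s3 * w - x * p3 * l + y * q3)
     = (a1 + a2 + a3) + (s1 - s2 + s3) * w - x * ((p1 + p2 + p3) - c) * l + y * (q1 + q2 + q3)"
    for a1 a2 a3 s1 s2 s3 w x p1 p2 p3 l y q1 q2 q3 c :: complex by (simp add: algebra_simps)
  show ?thesis
    unfolding flatP_def flatS_def flatPx_def coef.sel
    by (rule fam_deriv_cong[OF fam_add[OF fam_add[OF 1 2] 3]]) (rule comb)
qed

lemma fam_flatQ:
  "fam W (\<lambda>e z. flatQ (Coef n (G e) (C1 e) (C2 e) (U e)) (X e) (l e z) (b e z) (L1 e z) (L2 e z))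
     (\<lambda>e z. flatQ (Coef n (G' e) (C1' e) (C2' e) (U' e)) (X e) (l e z) (b e z) (L1 e z) (L2 e z)
        + flatS (Coef n (G e) (C1 e) (C2 e) (U e)) (X e) (l e z) (b e z) * (l' e z + b' e z)
        + X e * (flatQ (Coef n (G e) (C1 e) (C2 e) (U e)) (X e) (l e z) (b e z) (L1 e z) (L2 e z) + C2 e / b e z) * b' e z
        + X' e * flatQx (Coef n (G e) (C1 e) (C2 e) (U e)) (X e) (l e z) (b e z) (L1 e z) (L2 e z))"
proof -
  note o = logfam_open[OF lf X] and nz = logfam_nz[OF lf X]
  note fx = fam_X[OF lf X] and par = fam_param[OF _ o]
  let ?w = "\<lambda>e z. l e z + b e z" and ?M = "\<lambda>e z. expo_mid (X e) (l e z) (b e z)"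
  let ?A = "\<lambda>e z. exp (- l e z * X e)" and ?B = "\<lambda>e z. exp (b e z * X e)"
  let ?F = "\<lambda>e z. log_block2 (X e) (b e z) (L2 e z)"
  have 1: "fam W (\<lambda>e z. G e * ((of_int n * ?w e z powi (n - 1) + X e / 2 * ?w e z powi n) * ?M e z))
     (\<lambda>e z. G' e * ((of_int n * ?w e z powi (n - 1) + X e / 2 * ?w e z powi n) * ?M e z)
      + G e * ((of_int n * of_int (n - 1) * ?w e z powi (n - 2) - (X e)\<^sup>2 / 4 * ?w e z powi n) * ?M e z) * (l' e z + b' e z)
      + X e * (G e * ((of_int n * ?w e z powi (n - 1) + X e / 2 * ?w e z powi n) * ?M e z)) * b' e z
      + X' e * (G e * ((of_int n * ?w e z powi (n - 1) + X e / 2 * ?w e z powi n) * (b e z - l e z) / 2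
        + ?w e z powi n / 2) * ?M e z))"
  proof (rule fam_deriv_cong)
    show "fam W (\<lambda>e z. G e * ((of_int n * ?w e z powi (n - 1) + X e / 2 * ?w e z powi n) * ?M e z))
      (\<lambda>e z. G' e * ((of_int n * ?w e z powi (n - 1) + 1 / 2 * X e * ?w e z powi n) * ?M e z) +
        ((of_int n * (of_int (n - 1) * ?w e z powi (n - 1 - 1) * (l' e z + b' e z)) +
          (1 / 2 * X' e * ?w e z powi n + of_int n * ?w e z powi (n - 1) * (l' e z + b' e z) * (1 / 2 * X e))) * ?M e z +
         ?M e z * ((b' e z - l' e z) / 2 * X e + (b e z - l e z) / 2 * X' e) *
         (of_int n * ?w e z powi (n - 1) + 1 / 2 * X e * ?w e z powi n)) * G e)"
      using fam_mult[OF par[OF G] fam_mult[OF fam_add[OF fam_cmult[OF fam_w_powi[OF lf X]]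
          fam_mult[OF fam_cmult[OF fx, of "1/2"] fam_w_powi[OF lf X]]] fam_expo_mid[OF lf X]], of "of_int n" "n - 1" n]
      by simp
  qed (simp only: diff_diff_eq one_add_one, rule flatQ_alg)
  have 2: "fam W (\<lambda>e z. C1 e * (?A e z / ?w e z))
     (\<lambda>e z. C1' e * (?A e z / ?w e z) - C1 e * ((X e / ?w e z + 1 / (?w e z)\<^sup>2) * ?A e z) * (l' e z + b' e z)
      + X e * (C1 e * (?A e z / ?w e z)) * b' e z - X' e * (C1 e * (l e z * ?A e z / ?w e z)))"
    by (rule fam_deriv_cong[OF fam_mult[OF par[OF C1] fam_expl_w[OF lf X]]]) (rule flatQ_alg1[OF nz(3)])
  have 3: "fam W (\<lambda>e z. C2 e * (?B e z / ?w e z + X e * ?F e z))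
     (\<lambda>e z. C2' e * (?B e z / ?w e z + X e * ?F e z) + C2 e * ((X e / ?w e z - 1 / (?w e z)\<^sup>2) * ?B e z) * (l' e z + b' e z)
       + X e * (C2 e * (?B e z / ?w e z + X e * ?F e z) + C2 e / b e z) * b' e z
       + X' e * (C2 e * (?F e z + X e * b e z * ?F e z - X e * b e z * ?B e z * Ein1 (b e z * X e) + b e z * ?B e z / ?w e z)))"
    by (rule fam_deriv_cong[OF fam_mult[OF par[OF C2] fam_add[OF fam_expb_w[OF lf X] fam_mult[OF fx fam_log_block2[OF lf X]]]]])
       (rule flatQ_alg2[OF nz(2) nz(3)])
  have 4: "fam W (\<lambda>e z. U e * ?B e z)
     (\<lambda>e z. U' e * ?B e z + X e * (U e * ?B e z) * b' e z + X' e * (U e * (b e z * ?B e z)))"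
    by (rule fam_deriv_cong[OF fam_mult[OF par[OF U] fam_expb[OF lf X]]]) (simp add: algebra_simps)
  have comb: "((a1 + s1 * w + x * p1 * l + y * q1) + (a2 - s2 * w + x * p2 * l - y * q2) + (a3 + s3 * w + x * (p3 + c) * l + y * q3)) + (a4 + x * p4 * l + y * q4)
     = (a1 + a2 + a3 + a4) + (s1 - s2 + s3) * w + x * ((p1 + p2 + p3 + p4) + c) * l + y * (q1 - q2 + q3 + q4)"
    for a1 a2 a3 a4 s1 s2 s3 w x p1 p2 p3 p4 l y q1 q2 q3 q4 c :: complex by (simp add: algebra_simps)
  show ?thesis
    unfolding flatQ_def flatS_def flatQx_def coef.sel
    by (rule fam_deriv_cong[OF fam_add[OF fam_add[OF fam_add[OF 1 2] 3] 4]]) (rule comb)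
qed

end

lemma fam_flatF:
  assumes lf: "logfam W l l' b b' L1 L2" and x: "x \<noteq> 0"
  shows "fam W (\<lambda>e z. flatF k x (l e z) (b e z) (L1 e z) (L2 e z))
     (\<lambda>e z. (flatP k x (l e z) (b e z) (L1 e z) (L2 e z) - k1 k / l e z) * l' e z
        + (flatQ k x (l e z) (b e z) (L1 e z) (L2 e z) + k2 k / b e z) * b' e z)"
proof -
  have X: "((\<lambda>e. x) has_field_derivative 0) (at e)" for e by simp
  note fs = fam_w_powi[OF lf X] fam_expo_mid[OF lf X] fam_log_block1[OF lf X] fam_log_block2[OF lf X] fam_expb[OF lf X]
  let ?w = "\<lambda>e z. l e z + b e z" and ?M = "\<lambda>e z. expo_mid x (l e z) (b e z)" and ?n = "deg k"
  let ?A = "\<lambda>e z. exp (- l e z * x)" and ?B = "\<lambda>e z. exp (b e z * x)"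
  let ?F1 = "\<lambda>e z. log_block1 x (l e z) (L1 e z)" and ?F2 = "\<lambda>e z. log_block2 x (b e z) (L2 e z)"
  have 1: "fam W (\<lambda>e z. kG k * (?w e z powi ?n * ?M e z))
    (\<lambda>e z. kG k * ((of_int ?n * ?w e z powi (?n - 1) - x / 2 * ?w e z powi ?n) * ?M e z) * l' e z
       + kG k * ((of_int ?n * ?w e z powi (?n - 1) + x / 2 * ?w e z powi ?n) * ?M e z) * b' e z)"
    by (rule fam_deriv_cong[OF fam_cmult[OF fam_mult[OF fs(1,2)]]]) (simp add: field_simps)
  have 2: "fam W (\<lambda>e z. k1 k * ?F1 e z)
    (\<lambda>e z. (k1 k * (?A e z / ?w e z - x * ?F1 e z) - k1 k / l e z) * l' e z + k1 k * (?A e z / ?w e z) * b' e z)"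
    by (rule fam_deriv_cong[OF fam_cmult[OF fs(3)]]) (simp add: algebra_simps add_divide_distrib)
  have 3: "fam W (\<lambda>e z. k2 k * ?F2 e z)
    (\<lambda>e z. k2 k * (?B e z / ?w e z) * l' e z + (k2 k * (?B e z / ?w e z + x * ?F2 e z) + k2 k / b e z) * b' e z)"
    by (rule fam_deriv_cong[OF fam_cmult[OF fs(4)]]) (simp add: algebra_simps add_divide_distrib)
  have 4: "fam W (\<lambda>e z. kU k * ((?B e z - 1) / x)) (\<lambda>e z. kU k * ?B e z * b' e z)"
  proof -
    have "fam W (\<lambda>e z. kU k / x * (?B e z - 1)) (\<lambda>e z. kU k * ?B e z * b' e z)"
      by (rule fam_deriv_cong[OF fam_cmult[OF fam_diff[OF fs(5) fam_const[OF logfam_open[OF lf X]]]]])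
         (use x in simp)
    then show ?thesis by simp
  qed
  have comb: "((p1 * l + q1 * b) + ((p2 - c) * l + q2 * b) + (p3 * l + (q3 + d) * b)) + q4 * b
    = ((p1 + p2 + p3) - c) * l + ((q1 + q2 + q3 + q4) + d) * b"
    for p1 p2 p3 q1 q2 q3 q4 c d l b :: complex by (simp add: algebra_simps)
  show ?thesis
    unfolding flatF_def flatP_def flatQ_def
    by (rule fam_deriv_cong[OF fam_add[OF fam_add[OF fam_add[OF 1 2] 3] 4]]) (rule comb)
qed

text \<open>The coefficients of a flat coordinate, as functions of \<open>log x\<close>, satisfy \<open>k' = coef_deriv x k\<close>.\<close>

definition coef_deriv :: "complex \<Rightarrow> coef \<Rightarrow> coef" where
  "coef_deriv x k = Coef (deg k) ((of_int (deg k) - 1 / 2) * kG k) (- k1 k / 2) (- k2 k / 2) (kU k / 2 + 2 * x * k2 k)"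

context
  fixes x l b :: complex and k :: coef
  assumes nz: "l \<noteq> 0" "b \<noteq> 0" "l + b \<noteq> 0"
begin

lemma w_powi:
  "(l + b) powi (deg k - 1) = (l + b) powi (deg k - 2) * (l + b)"
  "(l + b) powi deg k = (l + b) powi (deg k - 2) * (l + b)\<^sup>2"
proof -
  show 1: "(l + b) powi (deg k - 1) = (l + b) powi (deg k - 2) * (l + b)"
    using power_int_add_1[of "l + b" "deg k - 2"] nz(3) by (simp add: algebra_simps)
  have "(l + b) powi deg k = (l + b) powi (deg k - 1) * (l + b)"
    using power_int_add_1[of "l + b" "deg k - 1"] nz(3) by (simp add: algebra_simps)
  then show "(l + b) powi deg k = (l + b) powi (deg k - 2) * (l + b)\<^sup>2"
    unfolding 1 by (simp add: power2_eq_square)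
qed

text \<open>Euler's relation: the right side is \<open>l * dP/dl + b * dP/db + P / 2\<close>,
  because \<open>dP/db = S\<close> and \<open>dP/dl = S - x * (P - k1 / l)\<close>. The left side is
  the derivative along \<open>log x\<close>, coefficients included.\<close>

lemma flatP_homogeneous:
  "flatP (coef_deriv x k) x l b L1 L2 + x * flatPx k x l b L1 L2
    = flatS k x l b * (l + b) - x * (flatP k x l b L1 L2 - k1 k / l) * l + flatP k x l b L1 L2 / 2"
proof -
  define A where "A = exp (- l * x)"
  have "A * exp (l * x) = 1" by (simp add: A_def flip: exp_add)
  moreover have "x * l * Ein1 (- l * x) = exp (l * x) - 1"
    using Ein1_mult[of "- l * x"] by (simp add: algebra_simps)
  ultimately have A: "x * l * A * Ein1 (- l * x) = 1 - A"
    by (metis (no_types, opaque_lifting) mult.assoc mult.commute mult.right_neutral right_diff_distrib')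
  define F where "F = log_block1 x l L1"
  have 1: "- c / 2 * (A / w - x * F) + x * (c * (y + x * l * F - F - l * A / w))
     = - (c * ((x / w + 1 / w\<^sup>2) * A)) * w - x * (c * (A / w - x * F) - c / l) * l + c * (A / w - x * F) / 2"
    if "y = 1 - A" "w \<noteq> 0" for c y w
    unfolding that(1) using that(2) nz(1) by (simp add: field_simps power2_eq_square)
  have 2: "- c / 2 * (B / w) + x * (c * (b * B / w))
     = c * ((x / w - 1 / w\<^sup>2) * B) * w - x * (c * (B / w)) * l + c * (B / w) / 2"
    if "w = l + b" "w \<noteq> 0" for c B w
  proof -
    have b: "b = w - l" using that(1) by simp
    show ?thesis unfolding b using that(2) by (simp add: field_simps power2_eq_square)
  qed
  have 3: "((N - 1 / 2) * g) * ((N * (a * w) - x / 2 * (a * w\<^sup>2)) * E)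
      + x * (g * ((N * (a * w) - x / 2 * (a * w\<^sup>2)) * (b - l) / 2 - (a * w\<^sup>2) / 2) * E)
     = g * ((N * (N - 1) * a - x\<^sup>2 / 4 * (a * w\<^sup>2)) * E) * w
       - x * (g * ((N * (a * w) - x / 2 * (a * w\<^sup>2)) * E)) * l + (g * ((N * (a * w) - x / 2 * (a * w\<^sup>2)) * E)) / 2"
    if "w = l + b" for N g a E w
    unfolding that by (simp add: field_simps power2_eq_square)
  have comb: "(a1 + a2 + a3) + x * (q1 + q2 + q3) = (s1 - s2 + s3) * w - x * ((p1 + p2 + p3) - c) * l + (p1 + p2 + p3) / 2"
    if "a1 + x * q1 = s1 * w - x * p1 * l + p1 / 2" "a2 + x * q2 = - s2 * w - x * (p2 - c) * l + p2 / 2"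
      "a3 + x * q3 = s3 * w - x * p3 * l + p3 / 2"
    for a1 a2 a3 q1 q2 q3 s1 s2 s3 p1 p2 p3 w c
    using arg_cong2[OF arg_cong2[OF that(1,2), of "(+)"] that(3), of "(+)"] by (simp add: algebra_simps add_divide_distrib)
  show ?thesis
    unfolding flatP_def flatPx_def flatS_def coef_deriv_def coef.sel
    apply (rule comb)
    subgoal unfolding w_powi of_int_diff of_int_1 by (rule 3) simp
    subgoal unfolding A_def[symmetric] F_def[symmetric] by (rule 1[OF A nz(3)])
    subgoal by (rule 2[OF refl nz(3)])
    done
qed

text \<open>The logarithm of \<open>b * (l + b)\<close> is not homogeneous: applying
  \<open>l * d/dl + b * d/db\<close> to it gives \<open>2\<close>. The summand
  \<open>2 * x * k2\<close> in \<open>coef_deriv\<close> compensates this, and it is the origin of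
  the factor \<open>2\<close> in \<open>2 log \<zeta> \<theta>\<^sub>u\<close>.\<close>

lemma flatQ_homogeneous:
  "flatQ (coef_deriv x k) x l b L1 L2 + x * flatQx k x l b L1 L2
    = flatS k x l b * (l + b) + x * (flatQ k x l b L1 L2 + k2 k / b) * b + flatQ k x l b L1 L2 / 2"
proof -
  define B where "B = exp (b * x)"
  have "B * exp (- b * x) = 1" by (simp add: B_def flip: exp_add)
  moreover have "x * b * Ein1 (b * x) = 1 - exp (- b * x)"
    using Ein1_mult[of "b * x"] by (simp add: algebra_simps)
  ultimately have A: "x * b * B * Ein1 (b * x) = B - 1"
    by (metis (no_types, opaque_lifting) mult.assoc mult.commute mult.right_neutral right_diff_distrib')
  define F where "F = log_block2 x b L2"
  have 1: "- c / 2 * (B / w + x * F) + x * (c * (F + x * b * F - y + b * B / w)) + 2 * x * c * B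
     = c * ((x / w - 1 / w\<^sup>2) * B) * w + x * (c * (B / w + x * F) + c / b) * b + c * (B / w + x * F) / 2"
    if "y = B - 1" "w \<noteq> 0" for c y w
    unfolding that(1) using that(2) nz(2) by (simp add: field_simps power2_eq_square)
  have 2: "- c / 2 * (A / w) - x * (c * (l * A / w))
     = - (c * ((x / w + 1 / w\<^sup>2) * A)) * w + x * (c * (A / w)) * b + c * (A / w) / 2"
    if "w = l + b" "w \<noteq> 0" for c A w
  proof -
    have b: "b = w - l" using that(1) by simp
    show ?thesis unfolding b using that(2) by (simp add: field_simps power2_eq_square)
  qed
  have 3: "((N - 1 / 2) * g) * ((N * (a * w) + x / 2 * (a * w\<^sup>2)) * E)
      + x * (g * ((N * (a * w) + x / 2 * (a * w\<^sup>2)) * (b - l) / 2 + (a * w\<^sup>2) / 2) * E)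
     = g * ((N * (N - 1) * a - x\<^sup>2 / 4 * (a * w\<^sup>2)) * E) * w
       + x * (g * ((N * (a * w) + x / 2 * (a * w\<^sup>2)) * E)) * b + (g * ((N * (a * w) + x / 2 * (a * w\<^sup>2)) * E)) / 2"
    if "w = l + b" for N g a E w
    unfolding that by (simp add: field_simps power2_eq_square)
  have comb: "(a1 + a2 + a3 + (u / 2 + 2 * x * c) * B) + x * (q1 - q2 + q3 + q4)
      = (s1 - s2 + s3) * w + x * ((p1 + p2 + p3 + u * B) + d) * b + (p1 + p2 + p3 + u * B) / 2"
    if "a1 + x * q1 = s1 * w + x * p1 * b + p1 / 2" "a2 - x * q2 = - s2 * w + x * p2 * b + p2 / 2"
      "a3 + x * q3 + 2 * x * c * B = s3 * w + x * (p3 + d) * b + p3 / 2" "q4 = u * (b * B)"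
    for a1 a2 a3 q1 q2 q3 q4 s1 s2 s3 p1 p2 p3 w c d u
    using arg_cong2[OF arg_cong2[OF that(1,2), of "(+)"] that(3), of "(+)"] unfolding that(4)
    by (simp add: algebra_simps add_divide_distrib)
  show ?thesis
    unfolding flatQ_def flatQx_def flatS_def coef_deriv_def coef.sel B_def[symmetric]
    apply (rule comb)
    subgoal unfolding w_powi of_int_diff of_int_1 by (rule 3) simp
    subgoal by (rule 2[OF refl nz(3)])
    subgoal unfolding F_def[symmetric] by (rule 1[OF A nz(3)])
    subgoal by (rule refl)
    done
qed

end

section \<open>Differentials of means\<close>

text \<open>The singularity at \<open>0\<close> is removable, and the value there is the first
  Taylor coefficient, which is the mean of \<open>f z / z\<close>. It splits products with
  \<open>exp u / z\<close>, whose pole is moved to the outer part.\<close>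

lemma extends_in_shift:
  assumes "extends_in f a"
  shows "extends_in (\<lambda>z. (f z - a) / z) (cmean (\<lambda>z. f z / z))"
proof -
  obtain F where F: "F analytic_on cball 0 1" "F 0 = a" "\<forall>z\<in>sphere 0 1. f z = F z"
    using assms unfolding extends_in_def by blast
  obtain R where R: "1 < R" "F holomorphic_on ball 0 R" using cball_ball_nbhd[OF F(1)] .
  let ?H = "\<lambda>z. if z = 0 then deriv F 0 else (F z - F 0) / (z - 0)"
  have "?H holomorphic_on ball 0 R" by (rule pole_lemma_open[OF R(2)]) simp
  then have "?H analytic_on cball 0 1" using R(1) by (rule holomorphic_ball_cball)
  then have in_d: "extends_in (\<lambda>z. (f z - a) / z) (deriv F 0)"
    unfolding extends_in_def using F by (intro exI[of _ ?H]) auto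
  have c: "continuous_on (sphere 0 1) f" using extends_in_cont[OF assms] .
  have "deriv F 0 = cmean (\<lambda>z. (f z - a) / z)" using extends_in_mean[OF in_d] by simp
  also have "\<dots> = cmean (\<lambda>z. f z / z) - cmean (\<lambda>z. a * (1 / z))"
    unfolding diff_divide_distrib times_divide_eq_right mult_1_right
    by (rule cmean_diff) (auto intro!: continuous_intros c)
  also have "cmean (\<lambda>z. a * (1 / z)) = 0"
    unfolding cmean_cmult using extends_out_mean[OF extends_out_inverse] by simp
  finally show ?thesis using in_d by simp
qed

lemma extends_out_shift:
  assumes "extends_out f 0"
  shows "extends_out (\<lambda>z. z * f z) (cmean (\<lambda>z. z * f z))"
proof -
  have "extends_in (\<lambda>z. (f (1 / z) - 0) / z) (cmean (\<lambda>z. f (1 / z) / z))"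
    using assms unfolding extends_out_def by (rule extends_in_shift)
  then have "extends_in (\<lambda>z. (1 / z) * f (1 / z)) (cmean (\<lambda>z. (1 / z) * f (1 / z)))"
    by simp
  also have "cmean (\<lambda>z. (1 / z) * f (1 / z)) = cmean (\<lambda>z. z * f z)"
    by (rule cmean_invert) (auto intro!: continuous_intros extends_out_cont[OF assms])
  finally show ?thesis unfolding extends_out_def by simp
qed

lemma extends_in_id_0: "extends_in (\<lambda>z. z * f z) v" if "extends_in f a" "v = 0"
  using extends_in_mult[OF extends_in_id that(1)] that(2) by simp

lemma extends_out_over_z: "extends_out (\<lambda>z. f z / z) 0" if "extends_out f a"
  using extends_out_mult[OF that extends_out_inverse] by simp

abbreviation "plus_part \<equiv> ltrunc {0..}"
abbreviation "minus_part f z \<equiv> f z - ltrunc {0..} f z"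

lemma plus_part_cong: "(\<And>z. z \<in> sphere 0 1 \<Longrightarrow> f z = g z) \<Longrightarrow> plus_part f z = plus_part g z"
  using ltrunc_cong[of f g "{0..}"] by simp

lemma plus_part_lin:
  assumes "f analytic_on sphere 0 1" "g analytic_on sphere 0 1" "z \<in> sphere 0 1"
  shows "plus_part (\<lambda>z. a * f z + b * g z) z = a * plus_part f z + b * plus_part g z"
proof (rule ltrunc_nonneg_unique[where h = "\<lambda>z. a * minus_part f z + b * minus_part g z"])
  note in_out = extends_in_nonneg_part[OF assms(1)] extends_in_nonneg_part[OF assms(2)]
  show "extends_in (\<lambda>z. a * plus_part f z + b * plus_part g z) (a * cmean f + b * cmean g)"
    by (intro extends_in_add extends_in_mult extends_in_const in_out)
  have "extends_out (\<lambda>z. a * minus_part f z + b * minus_part g z) (a * 0 + b * 0)"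
    by (intro extends_out_add extends_out_mult extends_out_const in_out)
  then show "extends_out (\<lambda>z. a * minus_part f z + b * minus_part g z) 0" by simp
qed (use assms in \<open>auto simp: algebra_simps\<close>)

lemma plus_part_in: "extends_in f a \<Longrightarrow> z \<in> sphere 0 1 \<Longrightarrow> plus_part f z = f z"
  by (rule ltrunc_nonneg_unique[where h = "\<lambda>z. 0"]) auto

lemma plus_part_out: "extends_out f 0 \<Longrightarrow> z \<in> sphere 0 1 \<Longrightarrow> plus_part f z = 0"
  using ltrunc_nonneg_unique[of f "\<lambda>z. 0" f 0 z] by auto

lemma lam_extends:
  assumes p: "p \<in> MW"
  shows "extends_out (\<lambda>z. z / lam p z) 1" "extends_out (\<lambda>z. 1 / lam p z) 0"
    "extends_in (\<lambda>z. 1 / (z * lamb p z)) (exp (- uc p))" "extends_in (\<lambda>z. 1 / lamb p z) 0"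
proof -
  obtain H where H: "H analytic_on cball 0 1" "H 0 = 1" "\<And>t. t \<noteq> 0 \<Longrightarrow> norm t \<le> 1 \<Longrightarrow> H t = t * lam p (1 / t)"
    using lam_chart MWD(1)[OF p] by metis
  have nz: "H t \<noteq> 0" if "t \<in> cball 0 1" for t
    using H(2) H(3)[of t] MWD(4)[OF p, of "1 / t"] that by (cases "t = 0") (auto simp: norm_divide)
  have Hs: "H t = t * lam p (1 / t)" if "t \<in> sphere 0 1" for t
    using H(3)[of t] that sphere_nonzero by auto
  have "extends_in (\<lambda>t. (1 / t) / lam p (1 / t)) 1"
    unfolding extends_in_def
    by (rule exI[of _ "\<lambda>t. 1 / H t"]) (use nz H(1,2) Hs in \<open>auto intro!: analytic_intros\<close>)
  then show 1: "extends_out (\<lambda>z. z / lam p z) 1" unfolding extends_out_def .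
  have "extends_out (\<lambda>z. (1 / z) * (z / lam p z)) (0 * 1)"
    by (rule extends_out_mult[OF extends_out_inverse 1])
  then have "extends_out (\<lambda>z. (1 / z) * (z / lam p z)) 0" by simp
  then show "extends_out (\<lambda>z. 1 / lam p z) 0" by (rule extends_out_cong) auto
  obtain K where K: "K analytic_on cball 0 1" "K 0 = exp (uc p)" "\<And>t. t \<noteq> 0 \<Longrightarrow> norm t \<le> 1 \<Longrightarrow> K t = t * lamb p t"
    using lamb_chart MWD(1)[OF p] by metis
  have nz: "K t \<noteq> 0" if "t \<in> cball 0 1" for t
    using K(2) K(3)[of t] MWD(5)[OF p, of t] that by (cases "t = 0") auto
  show 3: "extends_in (\<lambda>z. 1 / (z * lamb p z)) (exp (- uc p))"
    unfolding extends_in_def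
    by (rule exI[of _ "\<lambda>t. 1 / K t"])
       (use nz K sphere_nonzero in \<open>auto intro!: analytic_intros simp: exp_minus inverse_eq_divide\<close>)
  have "extends_in (\<lambda>z. z * (1 / (z * lamb p z))) 0" by (rule extends_in_id_0[OF 3 refl])
  then show "extends_in (\<lambda>z. 1 / lamb p z) 0" by (rule extends_in_cong) auto
qed

text \<open>The differential of the mean of \<open>f(\<lambda>, \<lambda>')\<close> with partial derivatives \<open>P - c1 / \<lambda>\<close> and \<open>Q + c2 / \<lambda>'\<close>.\<close>

definition trunc_form :: "pt \<Rightarrow> (complex \<Rightarrow> complex) \<Rightarrow> (complex \<Rightarrow> complex) \<Rightarrow> complex \<Rightarrow> triple" where
  "trunc_form p P Q c = Triple (\<lambda>z. plus_part P z + minus_part Q z) (cmean (\<lambda>z. Q z - P z))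
     (exp (uc p) * cmean (\<lambda>z. (Q z - P z) / z) + c)"

lemma trunc_form_triples:
  assumes "P analytic_on sphere 0 1" "Q analytic_on sphere 0 1"
  shows "trunc_form p P Q c \<in> triples"
  unfolding trunc_form_def triples_def by (auto intro!: analytic_intros ltrunc_analytic assms)

lemma mean_pairing:
  assumes p: "p \<in> MW" and P: "P analytic_on sphere 0 1" and Q: "Q analytic_on sphere 0 1"
    and X: "X \<in> triples"
  shows "cmean (\<lambda>z. (P z - c1 / lam p z) * lam_dir p X 0 z + (Q z + c2 / lamb p z) * lamb_dir p X 0 z)
    = pair (trunc_form p P Q c2) X"
proof -
  have Xa: "fn X analytic_on sphere 0 1" using X by (simp add: triples_def)
  define e where "e = exp (uc p)"
  define x where "x = fn X"
  define x0 where "x0 = cmean x"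
  note pp = extends_in_nonneg_part[OF P] extends_in_nonneg_part[OF Q] extends_in_nonneg_part[OF Xa, folded x_def x0_def]
  have La: "lam_dir p X 0 z = minus_part x z + x0 - cv X - cu X * e / z"
    and Lb: "lamb_dir p X 0 z = plus_part x z - x0 + cv X + cu X * e / z" if "z \<in> sphere 0 1" for z
    using ltrunc_other[OF Xa that] by (simp_all add: lam_dir_def lamb_dir_def e_def x_def x0_def)
  have Lout: "extends_out (lam_dir p X 0) (0 + x0 - cv X - cu X * e * 0)"
  proof (rule extends_out_cong)
    show "extends_out (\<lambda>z. minus_part x z + x0 - cv X - cu X * e * (1 / z)) (0 + x0 - cv X - cu X * e * 0)"
      by (intro extends_out_diff extends_out_add extends_out_mult extends_out_const extends_out_inverse pp)
  qed (simp add: La)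
  have xg: "extends_in (\<lambda>z. plus_part x z - x0) (x0 - x0)" by (intro extends_in_diff extends_in_const pp)
  have xl: "extends_out (\<lambda>z. minus_part x z + x0) (0 + x0)" by (intro extends_out_add extends_out_const pp)
  have zLb: "extends_in (\<lambda>z. z * lamb_dir p X 0 z) (0 * (x0 - x0 + cv X) + cu X * e)"
  proof (rule extends_in_cong)
    show "extends_in (\<lambda>z. z * (plus_part x z - x0 + cv X) + cu X * e) (0 * (x0 - x0 + cv X) + cu X * e)"
      by (intro extends_in_add extends_in_mult extends_in_const extends_in_id xg)
  qed (auto simp: Lb distrib_left)
  \<comment> \<open>At \<open>0\<close> the variation of \<open>z * lamb\<close> is
    \<open>cu X * exp u\<close>, and \<open>z * lamb\<close> itself is \<open>exp u\<close>; the
    quotient is the logarithmic variation \<open>cu X\<close>.\<close>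
  have v: "(0 * (x0 - x0 + cv X) + cu X * e) * exp (- uc p) = cu X" by (simp add: e_def exp_minus)
  have Lbb: "extends_in (\<lambda>z. lamb_dir p X 0 z / lamb p z) (cu X)"
  proof (rule extends_in_cong)
    show "extends_in (\<lambda>z. (z * lamb_dir p X 0 z) * (1 / (z * lamb p z))) (cu X)"
      using extends_in_mult[OF zLb lam_extends(3)[OF p]] unfolding v .
  qed auto
  \<comment> \<open>After the terms of the asserted pairing are separated, the rest splits into
    \<open>I\<close>, which extends to the disc, and \<open>N\<close>, which extends outside with
    value \<open>0\<close> at infinity. Only \<open>c2 * cu X\<close> survives in the mean; the term
    with \<open>c1\<close> belongs to \<open>N\<close>.\<close>
  define I where "I = (\<lambda>z. plus_part Q z * (plus_part x z - x0) - plus_part P z * (plus_part x z - x0)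
     + c2 * (lamb_dir p X 0 z / lamb p z))"
  define N where "N = (\<lambda>z. minus_part P z * (cv X + lam_dir p X 0 z) + cu X * e * (minus_part P z * (1 / z))
     - c1 * (1 / lam p z * lam_dir p X 0 z) - minus_part Q z * (minus_part x z + x0))"
  have I: "extends_in I (cmean Q * (x0 - x0) - cmean P * (x0 - x0) + c2 * cu X)"
    unfolding I_def by (intro extends_in_add extends_in_diff extends_in_mult extends_in_const pp xg Lbb)
  have N: "extends_out N (0 * (cv X + (0 + x0 - cv X - cu X * e * 0)) + cu X * e * (0 * 0)
     - c1 * (0 * (0 + x0 - cv X - cu X * e * 0)) - 0 * (0 + x0))"
    unfolding N_def
    by (intro extends_out_add extends_out_diff extends_out_mult extends_out_const extends_out_inverse pp xl Lout lam_extends[OF p])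
  have PQc: "continuous_on (sphere 0 1) P" "continuous_on (sphere 0 1) Q" "continuous_on (sphere 0 1) x"
    "continuous_on (sphere 0 1) (plus_part P)" "continuous_on (sphere 0 1) (plus_part Q)"
    using P Q Xa by (auto simp: x_def intro!: analytic_imp_continuous_sphere ltrunc_analytic)
  have "cmean (\<lambda>z. (P z - c1 / lam p z) * lam_dir p X 0 z + (Q z + c2 / lamb p z) * lamb_dir p X 0 z)
     = cmean (\<lambda>z. (plus_part P z + minus_part Q z) * x z + cv X * (Q z - P z) + (cu X * e) * ((Q z - P z) / z) + (I z + N z))"
  proof (rule cmean_cong)
    fix z :: complex assume z: "z \<in> sphere 0 1"
    have alg: "(P - c1 / l) * La + (Q + c2 / b) * Lb
        = (Pp + (Q - Qp)) * x + cv * (Q - P) + cue * ((Q - P) / z) +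
          ((Qp * (xp - x0) - Pp * (xp - x0) + c2 * (Lb / b))
           + ((P - Pp) * (cv + La) + cue * ((P - Pp) * (1 / z)) - c1 * (1 / l * La) - (Q - Qp) * (x - xp + x0)))"
      if "La = x - xp + x0 - cv - cue / z" "Lb = xp - x0 + cv + cue / z"
      for P Q Pp Qp x xp La Lb l b cv cue :: complex
    proof -
      have "(P - c1 / l) * La + (Q + c2 / b) * Lb = P * La + Q * Lb - c1 * (1 / l * La) + c2 * (Lb / b)"
        by (simp add: algebra_simps)
      also have "P * La + Q * Lb = (Pp + (Q - Qp)) * x + cv * (Q - P) + cue * ((Q - P) / z) +
          (Qp * (xp - x0) - Pp * (xp - x0)) + (P - Pp) * (cv + La) + cue * ((P - Pp) * (1 / z)) - (Q - Qp) * (x - xp + x0)"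
        unfolding that by (simp add: algebra_simps diff_divide_distrib add_divide_distrib)
      finally show ?thesis by simp
    qed
    show "(P z - c1 / lam p z) * lam_dir p X 0 z + (Q z + c2 / lamb p z) * lamb_dir p X 0 z
      = (plus_part P z + minus_part Q z) * x z + cv X * (Q z - P z) + (cu X * e) * ((Q z - P z) / z) + (I z + N z)"
      unfolding I_def N_def by (rule alg) (use La[OF z] Lb[OF z] in auto)
  qed
  also have "\<dots> = cmean (\<lambda>z. (plus_part P z + minus_part Q z) * x z) + cmean (\<lambda>z. cv X * (Q z - P z))
     + cmean (\<lambda>z. (cu X * e) * ((Q z - P z) / z)) + (cmean I + cmean N)"
    by (subst cmean_add, (auto intro!: continuous_intros PQc extends_in_cont[OF I] extends_out_cont[OF N])[2])+ simp
  also have "cmean I = c2 * cu X" using extends_in_mean[OF I] by simp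
  also have "cmean N = 0" using extends_out_mean[OF N] by simp
  finally show ?thesis
    unfolding cmean_cmult by (simp add: pair_def trunc_form_def x_def e_def algebra_simps)
qed

lemma plus_part_eqI:
  assumes "\<And>z. z \<in> sphere 0 1 \<Longrightarrow> f z = g z + h z" "extends_in g a" "extends_out h v" "v = 0" "z \<in> sphere 0 1"
  shows "plus_part f z = g z"
  using ltrunc_nonneg_unique[OF assms(1,2)] assms(3-5) by simp

lemma analytic_derivI: "f analytic_on S \<Longrightarrow> z \<in> S \<Longrightarrow> (f has_field_derivative deriv f z) (at z)"
  using analytic_on_imp_differentiable_at DERIV_deriv_iff_field_differentiable by blast

text \<open>The operator \<open>z * d/dz\<close> keeps both sides of a Laurent split apart: on
  \<open>G (1 / z)\<close> it gives \<open>- (1 / z) * deriv G (1 / z)\<close>, which again vanishes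
  at infinity.\<close>

lemma deriv_parts:
  assumes "f analytic_on sphere 0 1"
  shows "extends_in (\<lambda>z. z * deriv (plus_part f) z) 0"
    "extends_out (\<lambda>z. z * deriv f z - z * deriv (plus_part f) z) 0"
proof -
  obtain R F G where s: "laurent_split f R F G" using analytic_laurent_split[OF assms] .
  then have R: "1 < R" and F: "F holomorphic_on ball 0 R" and G: "G holomorphic_on ball 0 R"
    and f: "\<And>z. z \<in> ann R \<Longrightarrow> f z = F z + G (1 / z)"
    by (auto simp: laurent_split_def)
  have in_ann: "z \<in> ann R" "z \<in> ball 0 R" "z \<noteq> 0" if "z \<in> sphere 0 1" for z
    using that R sphere_subset_ann[OF R] by auto
  have dT: "deriv (plus_part f) z = deriv F z" if "z \<in> sphere 0 1" for z
  proof (rule deriv_eq_sphere[OF ltrunc_analytic(1)[OF assms] _ _ that])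
    show "F analytic_on sphere 0 1"
      by (rule analytic_on_subset[OF holomorphic_ball_cball[OF F R]]) auto
  qed (use R in \<open>auto simp: laurent_split_ltrunc_nonneg[OF s]\<close>)
  have dF: "deriv F holomorphic_on ball 0 R" and dG: "deriv G holomorphic_on ball 0 R"
    using F G by (auto intro: holomorphic_deriv)
  show "extends_in (\<lambda>z. z * deriv (plus_part f) z) 0"
    unfolding extends_in_def
    by (rule exI[of _ "\<lambda>z. z * deriv F z"])
       (auto intro!: analytic_intros holomorphic_ball_cball[OF F R] simp: dT)
  have df: "deriv f z = deriv F z - deriv G (1 / z) / z\<^sup>2" if z: "z \<in> sphere 0 1" for z
  proof (rule DERIV_imp_deriv)
    have iz: "1 / z \<in> ball 0 R" using z R by (simp add: norm_divide)
    have "((\<lambda>z. F z + G (1 / z)) has_field_derivative deriv F z + deriv G (1 / z) * (- (1 / z\<^sup>2))) (at z)"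
    proof (rule DERIV_add[OF holomorphic_derivI[OF F open_ball in_ann(2)[OF z]]
          DERIV_chain2[where f = G and g = "\<lambda>z. 1 / z", OF holomorphic_derivI[OF G open_ball iz]]])
      show "((\<lambda>z. 1 / z) has_field_derivative - (1 / z\<^sup>2)) (at z)"
        using in_ann(3)[OF z] by (auto intro!: derivative_eq_intros simp: power2_eq_square)
    qed
    then have "((\<lambda>z. F z + G (1 / z)) has_field_derivative deriv F z - deriv G (1 / z) / z\<^sup>2) (at z)" by simp
    then show "(f has_field_derivative deriv F z - deriv G (1 / z) / z\<^sup>2) (at z)"
      by (rule has_field_derivative_transform_within_open[OF _ open_ann in_ann(1)[OF z]]) (simp add: f)
  qed
  show "extends_out (\<lambda>z. z * deriv f z - z * deriv (plus_part f) z) 0"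
    unfolding extends_out_def extends_in_def
  proof (rule exI[of _ "\<lambda>z. - (z * deriv G z)"], intro conjI ballI)
    show "(\<lambda>z. - (z * deriv G z)) analytic_on cball 0 1"
      by (intro analytic_intros holomorphic_ball_cball[OF G R])
    fix z :: complex assume z: "z \<in> sphere 0 1"
    then have "1 / z \<in> sphere 0 1" by (simp add: norm_divide)
    then show "1 / z * deriv f (1 / z) - 1 / z * deriv (plus_part f) (1 / z) = - (z * deriv G z)"
      using in_ann(3)[OF z] by (simp add: df dT power2_eq_square right_diff_distrib)
  qed simp
qed

lemma plus_part_deriv:
  assumes "f analytic_on sphere 0 1" "z \<in> sphere 0 1"
  shows "z * deriv (plus_part f) z = plus_part (\<lambda>z. z * deriv f z) z"
  by (rule plus_part_eqI[symmetric, OF _ deriv_parts[OF assms(1)] refl assms(2)]) simp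

section \<open>The operators of the Frobenius structure\<close>

text \<open>On the circle this is \<open>z * deriv (lam p) z\<close>, written through a truncation
  of \<open>zwp\<close> in order to match the expressions inside \<open>Cop\<close>; likewise
  \<open>zlamb\<close>.\<close>

definition zlam :: "pt \<Rightarrow> complex \<Rightarrow> complex" where
  "zlam p z = z + minus_part (zwp p) z + exp (uc p) / z"

definition zlamb :: "pt \<Rightarrow> complex \<Rightarrow> complex" where
  "zlamb p z = plus_part (zwp p) z - z - exp (uc p) / z"

lemma zwp_analytic: "wf p analytic_on sphere 0 1 \<Longrightarrow> zwp p analytic_on sphere 0 1"
  unfolding zwp_def[abs_def] by (intro analytic_intros)

lemma lam_deriv:
  assumes w: "wf p analytic_on sphere 0 1" and z: "z \<in> sphere 0 1"
  shows "z * deriv (lam p) z = zlam p z" "z * deriv (lamb p) z = zlamb p z"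
proof -
  note d = analytic_derivI[OF _ z] and z0 = sphere_nonzero[OF z]
  have "((\<lambda>z. z + (wf p z - plus_part (wf p) z + cmean (wf p)) - vc p - exp (uc p) / z) has_field_derivative
      1 + (deriv (wf p) z - deriv (plus_part (wf p)) z + 0) - 0 - (- (exp (uc p) / z\<^sup>2))) (at z)"
    by (intro DERIV_diff DERIV_add d w ltrunc_analytic)
       (use z0 in \<open>auto intro!: derivative_eq_intros simp: power2_eq_square\<close>)
  then have "deriv (\<lambda>z. z + (wf p z - plus_part (wf p) z + cmean (wf p)) - vc p - exp (uc p) / z) z =
      1 + (deriv (wf p) z - deriv (plus_part (wf p)) z + 0) - 0 - (- (exp (uc p) / z\<^sup>2))" by (rule DERIV_imp_deriv)
  moreover have "deriv (lam p) z = deriv (\<lambda>z. z + (wf p z - plus_part (wf p) z + cmean (wf p)) - vc p - exp (uc p) / z) z"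
    by (rule deriv_eq_sphere[OF lam_analytic(1)[OF w] _ _ z])
       (auto intro!: analytic_intros w ltrunc_analytic simp: lam_def ltrunc_other[OF w])
  ultimately have d1: "deriv (lam p) z = 1 + (deriv (wf p) z - deriv (plus_part (wf p)) z + 0) - 0 - (- (exp (uc p) / z\<^sup>2))"
    by (simp only:)
  show "z * deriv (lam p) z = zlam p z"
    unfolding d1 zlam_def zwp_def[abs_def] plus_part_deriv[OF w z, symmetric]
    using z0 by (simp add: algebra_simps power2_eq_square)
  have "((\<lambda>z. plus_part (wf p) z - cmean (wf p) - z + vc p + exp (uc p) / z) has_field_derivative
      deriv (plus_part (wf p)) z - 0 - 1 + 0 + (- (exp (uc p) / z\<^sup>2))) (at z)"
    by (intro DERIV_diff DERIV_add d w ltrunc_analytic)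
       (use z0 in \<open>auto intro!: derivative_eq_intros simp: power2_eq_square\<close>)
  then have "deriv (\<lambda>z. plus_part (wf p) z - cmean (wf p) - z + vc p + exp (uc p) / z) z =
      deriv (plus_part (wf p)) z - 0 - 1 + 0 + (- (exp (uc p) / z\<^sup>2))" by (rule DERIV_imp_deriv)
  moreover have "deriv (lamb p) z = deriv (\<lambda>z. plus_part (wf p) z - cmean (wf p) - z + vc p + exp (uc p) / z) z"
    by (rule deriv_eq_sphere[OF lam_analytic(2)[OF w] _ _ z])
       (auto intro!: analytic_intros w ltrunc_analytic simp: lamb_def ltrunc_other[OF w])
  ultimately have d2: "deriv (lamb p) z = deriv (plus_part (wf p)) z - 0 - 1 + 0 + (- (exp (uc p) / z\<^sup>2))"
    by (simp only:)
  show "z * deriv (lamb p) z = zlamb p z"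
    unfolding d2 zlamb_def zwp_def[abs_def] plus_part_deriv[OF w z, symmetric]
    using z0 by (simp add: algebra_simps power2_eq_square)
qed

lemma zwp_mean: "wf p analytic_on sphere 0 1 \<Longrightarrow> cmean (zwp p) = 0"
  unfolding zwp_def[abs_def] by (rule cmean_deriv)

text \<open>Only the equations of \<open>P\<close> and \<open>Q\<close> along the circle are
  assumed. They are linear in \<open>P\<close>, \<open>Q\<close>, \<open>S\<close>,
  \<open>c1\<close>, \<open>c2\<close> together, so linear combinations of deformed flat functions
  satisfy them too.\<close>

locale flat_data =
  fixes p x P Q S c1 c2
  assumes p: "p \<in> MM" and x: "x \<noteq> 0"
    and P: "P analytic_on sphere 0 1" and Q: "Q analytic_on sphere 0 1" and S: "S analytic_on sphere 0 1"
    and dP: "\<And>z. z \<in> sphere 0 1 \<Longrightarrow> z * deriv P z = S z * zwp p z - x * (P z - c1 / lam p z) * zlam p z"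
    and dQ: "\<And>z. z \<in> sphere 0 1 \<Longrightarrow> z * deriv Q z = S z * zwp p z + x * (Q z + c2 / lamb p z) * zlamb p z"
begin

lemma pW: "p \<in> MW"
  using p MM_subset_MW by blast

lemmas w = MWD(1)[OF pW]
lemmas W = zwp_analytic[OF w]
lemmas PQW_parts = extends_in_nonneg_part[OF P] extends_in_nonneg_part[OF Q] extends_in_nonneg_part[OF W, unfolded zwp_mean[OF w]]

definition "e = exp (uc p)"
definition "\<alpha> = trunc_form p P Q c2"
definition "P0 = cmean P"
definition "Q0 = cmean Q"
definition "m1 = cmean (\<lambda>z. z * minus_part P z)"
definition "m2 = cmean (\<lambda>z. z * minus_part Q z)"

lemma alpha: "fn \<alpha> z = plus_part P z + minus_part Q z" "cu \<alpha> = e * cmean (\<lambda>z. (Q z - P z) / z) + c2"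
  by (simp_all add: \<alpha>_def trunc_form_def e_def)

lemma analytic_parts: "plus_part P analytic_on sphere 0 1" "plus_part Q analytic_on sphere 0 1" "plus_part (zwp p) analytic_on sphere 0 1"
  by (intro ltrunc_analytic P Q W)+

lemmas continuous_parts = analytic_parts[THEN analytic_imp_continuous_sphere] P[THEN analytic_imp_continuous_sphere]
  Q[THEN analytic_imp_continuous_sphere] W[THEN analytic_imp_continuous_sphere]

lemma alpha_analytic: "fn \<alpha> analytic_on sphere 0 1" "\<alpha> \<in> triples"
proof -
  show "\<alpha> \<in> triples" unfolding \<alpha>_def by (rule trunc_form_triples[OF P Q])
  then show "fn \<alpha> analytic_on sphere 0 1" by (simp add: triples_def)
qed

lemma alpha_cv: "cv \<alpha> = Q0 - P0"
  unfolding \<alpha>_def trunc_form_def Q0_def P0_def using continuous_parts by (simp add: cmean_diff)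

lemma zlam_cont: "continuous_on (sphere 0 1) (zlam p)" "continuous_on (sphere 0 1) (zlamb p)"
  unfolding zlam_def[abs_def] zlamb_def[abs_def] by (auto intro!: continuous_intros continuous_parts)

lemma lam_cont: "continuous_on (sphere 0 1) (lam p)" "continuous_on (sphere 0 1) (lamb p)"
  by (intro analytic_imp_continuous_sphere lam_analytic[OF w])+

lemma lam_nz: "z \<in> sphere 0 1 \<Longrightarrow> lam p z \<noteq> 0" "z \<in> sphere 0 1 \<Longrightarrow> lamb p z \<noteq> 0"
  using MWD(4)[OF pW, of z] MWD(5)[OF pW, of z] sphere_nonzero[of z] by auto

lemma QP_deriv:
  assumes "z \<in> sphere 0 1"
  shows "z * deriv (\<lambda>z. Q z - P z) z = x * ((P z - c1 / lam p z) * zlam p z + (Q z + c2 / lamb p z) * zlamb p z)"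
proof -
  have "deriv (\<lambda>z. Q z - P z) z = deriv Q z - deriv P z"
    by (rule DERIV_imp_deriv, rule DERIV_diff[OF analytic_derivI[OF Q assms] analytic_derivI[OF P assms]])
  then show ?thesis unfolding right_diff_distrib dP[OF assms] dQ[OF assms]
    by (simp only: right_diff_distrib dP[OF assms] dQ[OF assms]) (simp add: algebra_simps)
qed

text \<open>Rotation invariance. The vector \<open>X\<close> is the infinitesimal rotation,
  corrected so that the leading term of \<open>lam\<close> stays \<open>z\<close>; \<open>-1\<close>
  is the weight of the coefficient of \<open>1 / z\<close>. The rotation has mean zero, since it is
  \<open>1 / x\<close> times the derivative of \<open>Q - P\<close> along the circle, and the
  correction \<open>\<plusminus> z\<close> yields \<open>m2 - m1\<close> and, from
  \<open>z / lam \<rightarrow> 1\<close> at infinity, \<open>c1\<close>.\<close>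

lemma zero_mode: "cmean (\<lambda>z. fn \<alpha> z * zwp p z) - cu \<alpha> + m1 - m2 - c1 = 0"
proof -
  define X where "X = Triple (zwp p) 0 (-1)"
  have X: "X \<in> triples" using W by (simp add: X_def triples_def)
  let ?f1 = "\<lambda>z. P z - c1 / lam p z" and ?f2 = "\<lambda>z. Q z + c2 / lamb p z"
  have dirs: "lam_dir p X 0 z = zlam p z - z" "lamb_dir p X 0 z = zlamb p z + z" if "z \<in> sphere 0 1" for z
    using ltrunc_other[OF W that] zwp_mean[OF w] by (simp_all add: lam_dir_def lamb_dir_def zlam_def zlamb_def X_def)
  have c: "continuous_on (sphere 0 1) ?f1" "continuous_on (sphere 0 1) ?f2"
    using lam_nz by (auto intro!: continuous_intros continuous_parts lam_cont)
  have "x * cmean (\<lambda>z. ?f1 z * zlam p z + ?f2 z * zlamb p z) = 0"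
    using cmean_deriv[of "\<lambda>z. Q z - P z"] P Q cmean_cong[OF QP_deriv]
    by (simp add: cmean_cmult analytic_on_diff)
  then have 0: "cmean (\<lambda>z. ?f1 z * zlam p z + ?f2 z * zlamb p z) = 0" using x by simp
  have zP: "cmean (\<lambda>z. z * P z) = m1" "cmean (\<lambda>z. z * Q z) = m2"
  proof -
    have "cmean (\<lambda>z. z * P z) = cmean (\<lambda>z. z * plus_part P z) + m1"
      unfolding m1_def
      by (subst cmean_add[symmetric]) (auto intro!: continuous_intros continuous_parts cmean_cong simp: algebra_simps)
    then show "cmean (\<lambda>z. z * P z) = m1"
      using extends_in_mean[OF extends_in_id_0[OF PQW_parts(1) refl]] by simp
    have "cmean (\<lambda>z. z * Q z) = cmean (\<lambda>z. z * plus_part Q z) + m2"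
      unfolding m2_def
      by (subst cmean_add[symmetric]) (auto intro!: continuous_intros continuous_parts cmean_cong simp: algebra_simps)
    then show "cmean (\<lambda>z. z * Q z) = m2"
      using extends_in_mean[OF extends_in_id_0[OF PQW_parts(3) refl]] by simp
  qed
  have "cmean (\<lambda>z. ?f1 z * lam_dir p X 0 z + ?f2 z * lamb_dir p X 0 z)
      = cmean (\<lambda>z. (?f1 z * zlam p z + ?f2 z * zlamb p z) + ((z * Q z - z * P z) + (c1 * (z / lam p z) + c2 * (z * (1 / lamb p z)))))"
    by (rule cmean_cong) (simp add: dirs algebra_simps add_divide_distrib diff_divide_distrib)
  also have "\<dots> = 0 + ((m2 - m1) + (c1 * 1 + c2 * 0))"
  proof -
    note c' = lam_nz continuous_parts lam_cont zlam_cont c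
    have "cmean (\<lambda>z. c1 * (z / lam p z) + c2 * (z * (1 / lamb p z))) = c1 * 1 + c2 * 0"
      unfolding extends_out_mean[OF lam_extends(1)[OF pW], symmetric]
        extends_in_mean[OF extends_in_id_0[OF lam_extends(4)[OF pW] refl], symmetric] cmean_cmult[symmetric]
      by (rule cmean_add) (use lam_nz in \<open>auto intro!: continuous_intros lam_cont\<close>)
    moreover have "cmean (\<lambda>z. z * Q z - z * P z) = m2 - m1"
      unfolding zP[symmetric] by (rule cmean_diff) (auto intro!: continuous_intros continuous_parts)
    ultimately show ?thesis
      using lam_nz
      by (subst cmean_add, (auto intro!: continuous_intros continuous_parts lam_cont zlam_cont c)[2])
         (subst cmean_add, (auto intro!: continuous_intros continuous_parts lam_cont zlam_cont c simp: 0)[3])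
  qed
  finally have "pair \<alpha> X = m2 - m1 + c1"
    unfolding \<alpha>_def using mean_pairing[OF pW P Q X, of c1 c2] by simp
  then show ?thesis by (simp add: pair_def X_def)
qed

definition bracket :: "complex \<Rightarrow> complex" where
  "bracket z = - c1 + plus_part (\<lambda>z. P z * zlam p z) z - minus_part (\<lambda>z. Q z * zlamb p z) z"

text \<open>Splitting \<open>P\<close>, \<open>Q\<close> and \<open>zwp\<close> matches all terms up
  to a constant. The truncation to positive powers in \<open>Cop\<close> removes a mean, which
  \<open>zero_mode\<close> evaluates; its \<open>m1\<close> and \<open>m2\<close> are those produced
  by the truncations in \<open>bracket\<close>.\<close>

lemma bracket_eq:
  assumes z: "z \<in> sphere 0 1"
  shows "ltrunc {0<..} (\<lambda>t. zwp p t * fn \<alpha> t) z - ltrunc {0<..} (zwp p) z * fn \<alpha> z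
     + z * fn \<alpha> z + e / z * (fn \<alpha> z + cv \<alpha>) + cu \<alpha> = bracket z"
proof -
  let ?Pp = "plus_part P" and ?Pm = "minus_part P" and ?Qp = "plus_part Q" and ?Qm = "minus_part Q"
  let ?Wp = "plus_part (zwp p)" and ?Wm = "minus_part (zwp p)"
  have a1: "(\<lambda>z. ?Pp z * ?Wm z) analytic_on sphere 0 1" and a2: "(\<lambda>z. ?Qm z * ?Wp z) analytic_on sphere 0 1"
    by (intro analytic_intros analytic_parts P Q W)+
  note ex = PQW_parts extends_in_nonneg_part[OF a1] extends_in_nonneg_part[OF a2]
  note P1 = extends_in_shift[OF PQW_parts(1)] and Q1 = extends_in_shift[OF PQW_parts(3)]
  note M1 = extends_out_shift[OF PQW_parts(2)] and M2 = extends_out_shift[OF PQW_parts(4)]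
  \<comment> \<open>Two terms cross the circle. Multiplying the outer part of \<open>P\<close> by
    \<open>z\<close> creates the constant \<open>m1\<close>, which goes inside; dividing the inner
    part by \<open>z\<close> creates the pole \<open>P0 / z\<close>, which goes outside.\<close>
  have TP: "plus_part (\<lambda>z. P z * zlam p z) z
      = plus_part (\<lambda>z. ?Pp z * ?Wm z) z + z * ?Pp z + m1 + e * ((?Pp z - P0) / z)"
  proof (rule plus_part_eqI[where
      g = "\<lambda>z. plus_part (\<lambda>z. ?Pp z * ?Wm z) z + z * ?Pp z + m1 + e * ((?Pp z - P0) / z)" and
      h = "\<lambda>z. minus_part (\<lambda>z. ?Pp z * ?Wm z) z + (z * ?Pm z - m1) + ?Pm z * ?Wm z + e * (?Pm z * (1 / z)) + e * P0 * (1 / z)", OF _ _ _ _ z])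
    show "P z * zlam p z = plus_part (\<lambda>z. ?Pp z * ?Wm z) z + z * ?Pp z + m1 + e * ((?Pp z - P0) / z)
        + (minus_part (\<lambda>z. ?Pp z * ?Wm z) z + (z * ?Pm z - m1) + ?Pm z * ?Wm z + e * (?Pm z * (1 / z)) + e * P0 * (1 / z))"
      for z by (simp add: zlam_def e_def algebra_simps diff_divide_distrib add_divide_distrib)
    show "extends_in (\<lambda>z. plus_part (\<lambda>z. ?Pp z * ?Wm z) z + z * ?Pp z + m1 + e * ((?Pp z - P0) / z))
        (cmean (\<lambda>z. ?Pp z * ?Wm z) + 0 * cmean P + m1 + e * cmean (\<lambda>z. ?Pp z / z))"
      unfolding P0_def by (intro extends_in_add extends_in_mult extends_in_const extends_in_id ex P1)
    show "extends_out (\<lambda>z. minus_part (\<lambda>z. ?Pp z * ?Wm z) z + (z * ?Pm z - m1) + ?Pm z * ?Wm z + e * (?Pm z * (1 / z)) + e * P0 * (1 / z))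
        (0 + (m1 - m1) + 0 * 0 + e * (0 * 0) + e * P0 * 0)"
      unfolding m1_def by (intro extends_out_add extends_out_diff extends_out_mult extends_out_const extends_out_inverse ex M1)
  qed simp
  have TQ: "plus_part (\<lambda>z. Q z * zlamb p z) z
      = plus_part (\<lambda>z. ?Qm z * ?Wp z) z - m2 + ?Qp z * ?Wp z - z * ?Qp z - e * ((?Qp z - Q0) / z)"
  proof (rule plus_part_eqI[where
      g = "\<lambda>z. plus_part (\<lambda>z. ?Qm z * ?Wp z) z - m2 + ?Qp z * ?Wp z - z * ?Qp z - e * ((?Qp z - Q0) / z)" and
      h = "\<lambda>z. minus_part (\<lambda>z. ?Qm z * ?Wp z) z - (z * ?Qm z - m2) - e * (?Qm z * (1 / z)) - e * Q0 * (1 / z)", OF _ _ _ _ z])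
    show "Q z * zlamb p z = plus_part (\<lambda>z. ?Qm z * ?Wp z) z - m2 + ?Qp z * ?Wp z - z * ?Qp z - e * ((?Qp z - Q0) / z)
        + (minus_part (\<lambda>z. ?Qm z * ?Wp z) z - (z * ?Qm z - m2) - e * (?Qm z * (1 / z)) - e * Q0 * (1 / z))"
      for z by (simp add: zlamb_def e_def algebra_simps diff_divide_distrib add_divide_distrib)
    show "extends_in (\<lambda>z. plus_part (\<lambda>z. ?Qm z * ?Wp z) z - m2 + ?Qp z * ?Wp z - z * ?Qp z - e * ((?Qp z - Q0) / z))
        (cmean (\<lambda>z. ?Qm z * ?Wp z) - m2 + cmean Q * 0 - 0 * cmean Q - e * cmean (\<lambda>z. ?Qp z / z))"
      unfolding Q0_def by (intro extends_in_add extends_in_diff extends_in_mult extends_in_const extends_in_id ex Q1)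
    show "extends_out (\<lambda>z. minus_part (\<lambda>z. ?Qm z * ?Wp z) z - (z * ?Qm z - m2) - e * (?Qm z * (1 / z)) - e * Q0 * (1 / z))
        (0 - (m2 - m2) - e * (0 * 0) - e * Q0 * 0)"
      unfolding m2_def by (intro extends_out_add extends_out_diff extends_out_mult extends_out_const extends_out_inverse ex M2)
  qed simp
  have TW: "plus_part (\<lambda>t. zwp p t * fn \<alpha> t) z
      = ?Wp z * ?Pp z + plus_part (\<lambda>z. ?Pp z * ?Wm z) z + plus_part (\<lambda>z. ?Qm z * ?Wp z) z"
  proof (rule plus_part_eqI[where
      g = "\<lambda>z. ?Wp z * ?Pp z + plus_part (\<lambda>z. ?Pp z * ?Wm z) z + plus_part (\<lambda>z. ?Qm z * ?Wp z) z" and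
      h = "\<lambda>z. ?Wm z * ?Qm z + minus_part (\<lambda>z. ?Pp z * ?Wm z) z + minus_part (\<lambda>z. ?Qm z * ?Wp z) z", OF _ _ _ _ z])
    show "zwp p z * fn \<alpha> z = ?Wp z * ?Pp z + plus_part (\<lambda>z. ?Pp z * ?Wm z) z + plus_part (\<lambda>z. ?Qm z * ?Wp z) z
       + (?Wm z * ?Qm z + minus_part (\<lambda>z. ?Pp z * ?Wm z) z + minus_part (\<lambda>z. ?Qm z * ?Wp z) z)" for z
      by (simp add: alpha algebra_simps)
    show "extends_in (\<lambda>z. ?Wp z * ?Pp z + plus_part (\<lambda>z. ?Pp z * ?Wm z) z + plus_part (\<lambda>z. ?Qm z * ?Wp z) z)
      (0 * cmean P + cmean (\<lambda>z. ?Pp z * ?Wm z) + cmean (\<lambda>z. ?Qm z * ?Wp z))"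
      by (intro extends_in_add extends_in_mult ex)
    show "extends_out (\<lambda>z. ?Wm z * ?Qm z + minus_part (\<lambda>z. ?Pp z * ?Wm z) z + minus_part (\<lambda>z. ?Qm z * ?Wp z) z) (0 * 0 + 0 + 0)"
      by (intro extends_out_add extends_out_mult ex)
  qed simp
  have Wa: "(\<lambda>t. zwp p t * fn \<alpha> t) analytic_on sphere 0 1" by (intro analytic_intros W alpha_analytic)
  have zm: "cmean (\<lambda>t. zwp p t * fn \<alpha> t) = cu \<alpha> - m1 + m2 + c1"
    using zero_mode by (simp add: mult.commute algebra_simps)
  define A1 where "A1 = plus_part (\<lambda>z. ?Pp z * ?Wm z) z"
  define A2 where "A2 = plus_part (\<lambda>z. ?Qm z * ?Wp z) z"
  have L: "ltrunc {0<..} (\<lambda>t. zwp p t * fn \<alpha> t) z = ?Wp z * ?Pp z + A1 + A2 - (cu \<alpha> - m1 + m2 + c1)"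
    unfolding ltrunc_other(1)[OF Wa z] TW zm A1_def A2_def ..
  show ?thesis
    unfolding bracket_def TP TQ A1_def[symmetric] A2_def[symmetric] L
    unfolding ltrunc_other(1)[OF W z] zwp_mean[OF w] alpha_cv alpha(1)
    by (simp add: zlamb_def e_def algebra_simps diff_divide_distrib add_divide_distrib)
qed

text \<open>The form is chosen for cancellation: by \<open>alpha_deriv\<close> the Christoffel term
  contains the last summand with the opposite sign, and the first two are the truncated variations
  of \<open>P\<close> and \<open>Q\<close>.\<close>

lemma C_fn:
  assumes X: "X \<in> triples" and z: "z \<in> sphere 0 1"
  shows "fn (Cop p X \<alpha>) z = - plus_part (\<lambda>z. P z * lam_dir p X 0 z) z
     + minus_part (\<lambda>z. Q z * lamb_dir p X 0 z) z + fn X z / zwp p z * bracket z"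
proof -
  let ?Pp = "plus_part P" and ?Pm = "minus_part P" and ?Qp = "plus_part Q" and ?Qm = "minus_part Q"
  have Xa: "fn X analytic_on sphere 0 1" using X by (simp add: triples_def)
  define y where "y = fn X"
  define y0 where "y0 = cmean y"
  have ya: "y analytic_on sphere 0 1" using Xa by (simp add: y_def)
  let ?xg = "\<lambda>z. plus_part y z - y0" and ?xl = "\<lambda>z. minus_part y z + y0"
  note yp = extends_in_nonneg_part[OF ya, folded y0_def]
  have xg: "extends_in ?xg (y0 - y0)" by (intro extends_in_diff extends_in_const yp)
  have xl: "extends_out ?xl (0 + y0)" by (intro extends_out_add extends_out_const yp)
  have a1: "(\<lambda>z. ?Pp z * ?xl z) analytic_on sphere 0 1" and a2: "(\<lambda>z. ?Qm z * ?xg z) analytic_on sphere 0 1"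
    by (intro analytic_intros analytic_parts ltrunc_analytic ya P Q)+
  note ex = PQW_parts xg xl extends_in_nonneg_part[OF a1] extends_in_nonneg_part[OF a2]
  note P1 = extends_in_shift[OF PQW_parts(1)] and Q1 = extends_in_shift[OF PQW_parts(3)]
  have La: "lam_dir p X 0 z = ?xl z - cv X - cu X * e / z"
    and Lb: "lamb_dir p X 0 z = ?xg z + cv X + cu X * e / z" if "z \<in> sphere 0 1" for z
    using ltrunc_other[OF ya that] by (simp_all add: lam_dir_def lamb_dir_def e_def y_def y0_def)
  have TP: "plus_part (\<lambda>z. P z * lam_dir p X 0 z) z
      = plus_part (\<lambda>z. ?Pp z * ?xl z) z - cv X * ?Pp z - cu X * e * ((?Pp z - P0) / z)"
  proof (rule plus_part_eqI[where
      g = "\<lambda>z. plus_part (\<lambda>z. ?Pp z * ?xl z) z - cv X * ?Pp z - cu X * e * ((?Pp z - P0) / z)" and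
      h = "\<lambda>z. minus_part (\<lambda>z. ?Pp z * ?xl z) z + ?Pm z * (?xl z - cv X - cu X * e * (1 / z)) - cu X * e * P0 * (1 / z)", OF _ _ _ _ z])
    show "P z * lam_dir p X 0 z = plus_part (\<lambda>z. ?Pp z * ?xl z) z - cv X * ?Pp z - cu X * e * ((?Pp z - P0) / z)
        + (minus_part (\<lambda>z. ?Pp z * ?xl z) z + ?Pm z * (?xl z - cv X - cu X * e * (1 / z)) - cu X * e * P0 * (1 / z))"
      if "z \<in> sphere 0 1" for z unfolding La[OF that] by (simp add: algebra_simps diff_divide_distrib add_divide_distrib)
    show "extends_in (\<lambda>z. plus_part (\<lambda>z. ?Pp z * ?xl z) z - cv X * ?Pp z - cu X * e * ((?Pp z - P0) / z))
        (cmean (\<lambda>z. ?Pp z * ?xl z) - cv X * cmean P - cu X * e * cmean (\<lambda>z. ?Pp z / z))"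
      unfolding P0_def by (intro extends_in_diff extends_in_mult extends_in_const ex P1)
    show "extends_out (\<lambda>z. minus_part (\<lambda>z. ?Pp z * ?xl z) z + ?Pm z * (?xl z - cv X - cu X * e * (1 / z)) - cu X * e * P0 * (1 / z))
        (0 + 0 * (0 + y0 - cv X - cu X * e * 0) - cu X * e * P0 * 0)"
      by (intro extends_out_add extends_out_diff extends_out_mult extends_out_const extends_out_inverse yp ex)
  qed simp
  have TQ: "plus_part (\<lambda>z. Q z * lamb_dir p X 0 z) z
      = plus_part (\<lambda>z. ?Qm z * ?xg z) z + ?Qp z * ?xg z + cv X * ?Qp z + cu X * e * ((?Qp z - Q0) / z)"
  proof (rule plus_part_eqI[where
      g = "\<lambda>z. plus_part (\<lambda>z. ?Qm z * ?xg z) z + ?Qp z * ?xg z + cv X * ?Qp z + cu X * e * ((?Qp z - Q0) / z)" and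
      h = "\<lambda>z. minus_part (\<lambda>z. ?Qm z * ?xg z) z + ?Qm z * (cv X + cu X * e * (1 / z)) + cu X * e * Q0 * (1 / z)", OF _ _ _ _ z])
    show "Q z * lamb_dir p X 0 z = plus_part (\<lambda>z. ?Qm z * ?xg z) z + ?Qp z * ?xg z + cv X * ?Qp z + cu X * e * ((?Qp z - Q0) / z)
        + (minus_part (\<lambda>z. ?Qm z * ?xg z) z + ?Qm z * (cv X + cu X * e * (1 / z)) + cu X * e * Q0 * (1 / z))"
      if "z \<in> sphere 0 1" for z unfolding Lb[OF that] by (simp add: algebra_simps diff_divide_distrib add_divide_distrib)
    show "extends_in (\<lambda>z. plus_part (\<lambda>z. ?Qm z * ?xg z) z + ?Qp z * ?xg z + cv X * ?Qp z + cu X * e * ((?Qp z - Q0) / z))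
        (cmean (\<lambda>z. ?Qm z * ?xg z) + cmean Q * (y0 - y0) + cv X * cmean Q + cu X * e * cmean (\<lambda>z. ?Qp z / z))"
      unfolding Q0_def by (intro extends_in_add extends_in_mult extends_in_const ex Q1)
    show "extends_out (\<lambda>z. minus_part (\<lambda>z. ?Qm z * ?xg z) z + ?Qm z * (cv X + cu X * e * (1 / z)) + cu X * e * Q0 * (1 / z))
        (0 + 0 * (cv X + cu X * e * 0) + cu X * e * Q0 * 0)"
      by (intro extends_out_add extends_out_mult extends_out_const extends_out_inverse ex)
  qed simp
  have Tg: "plus_part (\<lambda>t. ltrunc {0<..} y t * fn \<alpha> t) z = ?xg z * ?Pp z + plus_part (\<lambda>z. ?Qm z * ?xg z) z"
  proof (rule plus_part_eqI[where g = "\<lambda>z. ?xg z * ?Pp z + plus_part (\<lambda>z. ?Qm z * ?xg z) z"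
      and h = "minus_part (\<lambda>z. ?Qm z * ?xg z)", OF _ _ _ refl z])
    show "extends_in (\<lambda>z. ?xg z * ?Pp z + plus_part (\<lambda>z. ?Qm z * ?xg z) z) ((y0 - y0) * cmean P + cmean (\<lambda>z. ?Qm z * ?xg z))"
      by (intro extends_in_add extends_in_mult ex)
    show "extends_out (minus_part (\<lambda>z. ?Qm z * ?xg z)) 0" by (intro ex)
  qed (auto simp: ltrunc_other[OF ya] y0_def[symmetric] alpha algebra_simps)
  have Tl: "plus_part (\<lambda>t. ltrunc {..0} y t * fn \<alpha> t) z = plus_part (\<lambda>z. ?Pp z * ?xl z) z"
  proof (rule plus_part_eqI[where g = "\<lambda>z. plus_part (\<lambda>z. ?Pp z * ?xl z) z"
      and h = "\<lambda>z. minus_part (\<lambda>z. ?Pp z * ?xl z) z + ?Qm z * ?xl z", OF _ _ _ _ z])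
    show "extends_in (plus_part (\<lambda>z. ?Pp z * ?xl z)) (cmean (\<lambda>z. ?Pp z * ?xl z))" by (intro ex)
    show "extends_out (\<lambda>z. minus_part (\<lambda>z. ?Pp z * ?xl z) z + ?Qm z * ?xl z) (0 + 0 * (0 + y0))"
      by (intro extends_out_add extends_out_mult ex)
  qed (auto simp: ltrunc_other[OF ya] y0_def[symmetric] alpha algebra_simps)
  have a3: "(\<lambda>t. ltrunc {0<..} y t * fn \<alpha> t) analytic_on sphere 0 1"
    by (intro analytic_intros ltrunc_analytic ya alpha_analytic)
  define A1 where "A1 = plus_part (\<lambda>z. ?Pp z * ?xl z) z"
  define A2 where "A2 = plus_part (\<lambda>z. ?Qm z * ?xg z) z"
  have "fn (Cop p X \<alpha>) z = y z / zwp p z * bracket z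
     + ltrunc {..<0} (\<lambda>t. ltrunc {0<..} y t * fn \<alpha> t) z - plus_part (\<lambda>t. ltrunc {..0} y t * fn \<alpha> t) z
     + e / z * cu X * (fn \<alpha> z + cv \<alpha>) + cv X * fn \<alpha> z"
    unfolding bracket_eq[OF z, symmetric] by (simp add: Cop_def Let_def e_def y_def)
  also have "ltrunc {..<0} (\<lambda>t. ltrunc {0<..} y t * fn \<alpha> t) z = ?xg z * fn \<alpha> z - (?xg z * ?Pp z + A2)"
    unfolding ltrunc_other(2)[OF a3 z] Tg A2_def ltrunc_other(1)[OF ya z] y0_def ..
  also have "plus_part (\<lambda>t. ltrunc {..0} y t * fn \<alpha> t) z = A1" unfolding Tl A1_def ..
  finally show ?thesis
    unfolding TP TQ A1_def[symmetric] A2_def[symmetric] Lb[OF z] alpha(1) alpha_cv y_def[symmetric]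
    by (simp add: algebra_simps diff_divide_distrib add_divide_distrib)
qed

text \<open>In this component \<open>Cop\<close> is just the pairing of \<open>\<alpha>\<close> with
  \<open>X\<close>, so the claim is the formula for the differential of a mean.\<close>

lemma C_cv:
  assumes X: "X \<in> triples"
  shows "cv (Cop p X \<alpha>) = cmean (\<lambda>z. (P z - c1 / lam p z) * lam_dir p X 0 z + (Q z + c2 / lamb p z) * lamb_dir p X 0 z)"
  unfolding mean_pairing[OF pW P Q X] by (simp add: Cop_def Let_def \<alpha>_def[symmetric] pair_def lcoeff_0 mult.commute[of "fn X _"])

text \<open>The factor \<open>x\<close> on the left comes from integration by parts, which expresses
  the mean of \<open>(Q - P) / z\<close> as \<open>x\<close> times a mean of variations under
  rotation.\<close>

lemma C_cu:
  assumes X: "X \<in> triples"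
  shows "x * cu (Cop p X \<alpha>) = cu X * e * cmean (\<lambda>z. (Q z - P z) / z)
    + e * x * cmean (\<lambda>z. ((P z - c1 / lam p z) * lam_dir p X 0 z + (Q z + c2 / lamb p z) * lamb_dir p X 0 z) / z)"
proof -
  let ?Pp = "plus_part P" and ?Pm = "minus_part P" and ?Qp = "plus_part Q" and ?Qm = "minus_part Q"
  let ?f1 = "\<lambda>z. P z - c1 / lam p z" and ?f2 = "\<lambda>z. Q z + c2 / lamb p z"
  have Xa: "fn X analytic_on sphere 0 1" using X by (simp add: triples_def)
  \<comment> \<open>This is \<open>X\<close> plus \<open>cu X\<close> times the rotation. The
    combination removes the terms with \<open>exp u / z\<close> from both variations, as
    \<open>La\<close> and \<open>Lb\<close> show, and it is the one occurring in the last component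
    of \<open>Cop\<close>.\<close>
  define y where "y = (\<lambda>z. fn X z + zwp p z * cu X)"
  define y0 where "y0 = cmean y"
  define y1 where "y1 = cmean (\<lambda>z. y z / z)"
  have ya: "y analytic_on sphere 0 1" unfolding y_def by (intro analytic_intros Xa W)
  have y0X: "y0 = cmean (fn X)"
    unfolding y0_def y_def using zwp_mean[OF w] analytic_imp_continuous_sphere[OF Xa] continuous_parts
    by (subst cmean_add) (auto intro!: continuous_intros simp: mult.commute[of "zwp p _"] cmean_cmult)
  have yp: "plus_part y z = plus_part (fn X) z + cu X * plus_part (zwp p) z" if "z \<in> sphere 0 1" for z
    using plus_part_lin[OF Xa W that, of 1 "cu X"] by (simp add: y_def mult.commute)
  let ?yg = "\<lambda>z. plus_part y z - y0" and ?yl = "\<lambda>z. minus_part y z + y0"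
  note yparts = extends_in_nonneg_part[OF ya, folded y0_def]
  have yg: "extends_in ?yg (y0 - y0)" by (intro extends_in_diff extends_in_const yparts)
  have yl: "extends_out ?yl (0 + y0)" by (intro extends_out_add extends_out_const yparts)
  have yc: "continuous_on (sphere 0 1) y" "continuous_on (sphere 0 1) (plus_part y)"
    using ya by (auto intro!: analytic_imp_continuous_sphere ltrunc_analytic)
  have yg1: "extends_in (\<lambda>z. ?yg z / z) y1"
  proof -
    have "cmean (\<lambda>z. plus_part y z / z) = y1"
    proof -
      have "y1 = cmean (\<lambda>z. plus_part y z / z + minus_part y z / z)"
        unfolding y1_def by (rule cmean_cong) (simp add: diff_divide_distrib)
      also have "\<dots> = cmean (\<lambda>z. plus_part y z / z) + cmean (\<lambda>z. minus_part y z / z)"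
        by (rule cmean_add) (auto intro!: continuous_intros yc)
      also have "cmean (\<lambda>z. minus_part y z / z) = 0"
        by (rule extends_out_mean[OF extends_out_over_z[OF yparts(2)]])
      finally show ?thesis by simp
    qed
    then show ?thesis using extends_in_shift[OF yparts(1)] by simp
  qed
  have La: "lam_dir p X 0 z + cu X * zlam p z = ?yl z - cv X + cu X * z"
    and Lb: "lamb_dir p X 0 z + cu X * zlamb p z = ?yg z + cv X - cu X * z" if "z \<in> sphere 0 1" for z
    using ltrunc_other[OF Xa that]
    by (simp_all add: lam_dir_def lamb_dir_def zlam_def zlamb_def yp[OF that] y0X) (simp_all add: y_def algebra_simps)
  define I where "I = (\<lambda>z. ?Qp z * (?yg z / z) - cu X * ?Qp z + c2 * (1 / (z * lamb p z) * (?yg z + cv X - cu X * z))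
     - ?Pp z * (?yg z / z) + cu X * ?Pp z)"
  define N where "N = (\<lambda>z. cv X * (?Pm z * (1 / z)) + ?Pm z * (?yl z * (1 / z) - cv X * (1 / z) + cu X)
     - c1 * (1 / lam p z * (?yl z * (1 / z) - cv X * (1 / z) + cu X)) - ?Qm z * (?yl z * (1 / z)) - cu X * ?Qm z)"
  have I: "extends_in I (Q0 * y1 - cu X * Q0 + c2 * (exp (- uc p) * (y0 - y0 + cv X - cu X * 0)) - P0 * y1 + cu X * P0)"
    unfolding I_def P0_def Q0_def
    by (intro extends_in_add extends_in_diff extends_in_mult extends_in_const extends_in_id PQW_parts yg yg1 lam_extends[OF pW])
  have N: "extends_out N (cv X * (0 * 0) + 0 * ((0 + y0) * 0 - cv X * 0 + cu X)
     - c1 * (0 * ((0 + y0) * 0 - cv X * 0 + cu X)) - 0 * ((0 + y0) * 0) - cu X * 0)"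
    unfolding N_def
    by (intro extends_out_add extends_out_diff extends_out_mult extends_out_const extends_out_inverse PQW_parts yl lam_extends[OF pW])
  let ?G = "\<lambda>z. (?f1 z * lam_dir p X 0 z + ?f2 z * lamb_dir p X 0 z) / z"
  let ?H = "\<lambda>z. (?f1 z * zlam p z + ?f2 z * zlamb p z) / z"
  have fc: "continuous_on (sphere 0 1) ?f1" "continuous_on (sphere 0 1) ?f2"
    using lam_nz by (auto intro!: continuous_intros continuous_parts lam_cont)
  have lc: "continuous_on (sphere 0 1) (lam_dir p X 0)" "continuous_on (sphere 0 1) (lamb_dir p X 0)"
    unfolding lam_dir_def[abs_def] lamb_dir_def[abs_def]
    by (auto intro!: analytic_imp_continuous_sphere analytic_intros ltrunc_analytic Xa)
  have GH: "?G z + cu X * ?H z = fn \<alpha> z * y z / z + cv X * ((Q z - P z) / z) + (I z + N z)" if z: "z \<in> sphere 0 1" for z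
  proof -
    have alg: "(a * b + c * d) / z + k * ((a * r + c * s) / z) = (a * (b + k * r) + c * (d + k * s)) / z"
      for a b c d k r s :: complex by (simp add: algebra_simps add_divide_distrib)
    have "?G z + cu X * ?H z = (?f1 z * (lam_dir p X 0 z + cu X * zlam p z) + ?f2 z * (lamb_dir p X 0 z + cu X * zlamb p z)) / z"
      by (rule alg)
    also have "\<dots> = (?f1 z * (?yl z - cv X + cu X * z) + ?f2 z * (?yg z + cv X - cu X * z)) / z"
      unfolding La[OF z] Lb[OF z] ..
    also have "\<dots> = (P z * (?yl z - cv X + cu X * z) + Q z * (?yg z + cv X - cu X * z)) / z
        - c1 * (1 / lam p z * (?yl z * (1 / z) - cv X * (1 / z) + cu X))
        + c2 * (1 / (z * lamb p z) * (?yg z + cv X - cu X * z))"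
      using sphere_nonzero[OF z] lam_nz[OF z] by (simp add: field_simps)
    also have "(P z * (?yl z - cv X + cu X * z) + Q z * (?yg z + cv X - cu X * z)) / z
      = fn \<alpha> z * y z / z + cv X * ((Q z - P z) / z) + (?Qp z * (?yg z / z) - cu X * ?Qp z - ?Pp z * (?yg z / z) + cu X * ?Pp z)
       + (cv X * (?Pm z * (1 / z)) + ?Pm z * (?yl z * (1 / z) - cv X * (1 / z) + cu X) - ?Qm z * (?yl z * (1 / z)) - cu X * ?Qm z)"
      using sphere_nonzero[OF z] by (simp add: alpha field_simps)
    finally show ?thesis unfolding I_def N_def by (simp only: algebra_simps)
  qed
  \<comment> \<open>Apply \<open>cmean_deriv\<close> to \<open>(Q - P) / z\<close>: differentiating
    the denominator gives back the function itself with a minus sign.\<close>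
  have "cmean (\<lambda>z. (Q z - P z) / z) = x * cmean ?H"
  proof -
    let ?h = "\<lambda>z. (Q z - P z) / z"
    have ha: "?h analytic_on sphere 0 1" by (intro analytic_intros P Q) auto
    have "z * deriv ?h z = x * ?H z - ?h z" if z: "z \<in> sphere 0 1" for z
    proof -
      have "(\<lambda>z. Q z - P z) analytic_on sphere 0 1" by (intro analytic_intros P Q)
      from DERIV_divide[OF analytic_derivI[OF this z] DERIV_ident sphere_nonzero[OF z]]
      have "deriv ?h z = (deriv (\<lambda>z. Q z - P z) z * z - (Q z - P z) * 1) / (z * z)" by (rule DERIV_imp_deriv)
      then have "z * deriv ?h z = z * deriv (\<lambda>z. Q z - P z) z / z - ?h z"
        using sphere_nonzero[OF z] by (simp add: field_simps)
      then show ?thesis unfolding QP_deriv[OF z] by simp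
    qed
    then have "cmean (\<lambda>z. x * ?H z - ?h z) = 0" using cmean_deriv[OF ha] cmean_cong by (metis (no_types, lifting))
    moreover have "cmean (\<lambda>z. x * ?H z - ?h z) = x * cmean ?H - cmean ?h"
      unfolding cmean_cmult[symmetric]
      by (rule cmean_diff) (auto intro!: continuous_intros fc zlam_cont continuous_parts)
    ultimately show ?thesis by simp
  qed
  then have "cu X * e * cmean (\<lambda>z. (Q z - P z) / z) + e * x * cmean ?G = e * x * (cmean ?G + cu X * cmean ?H)"
    by (simp add: algebra_simps)
  also have "cmean ?G + cu X * cmean ?H = cmean (\<lambda>z. ?G z + cu X * ?H z)"
    unfolding cmean_cmult[symmetric]
    by (rule cmean_add[symmetric]) (auto intro!: continuous_intros fc zlam_cont lc)
  also have "\<dots> = cmean (\<lambda>z. fn \<alpha> z * y z / z + cv X * ((Q z - P z) / z) + (I z + N z))"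
    by (rule cmean_cong[OF GH])
  also have "\<dots> = cmean (\<lambda>z. fn \<alpha> z * y z / z) + cv X * cmean (\<lambda>z. (Q z - P z) / z) + (cmean I + cmean N)"
  proof -
    note c = analytic_imp_continuous_sphere[OF alpha_analytic(1)] yc continuous_parts extends_in_cont[OF I] extends_out_cont[OF N]
    have "cmean (\<lambda>z. fn \<alpha> z * y z / z + cv X * ((Q z - P z) / z) + (I z + N z))
        = cmean (\<lambda>z. fn \<alpha> z * y z / z + cv X * ((Q z - P z) / z)) + cmean (\<lambda>z. I z + N z)"
      by (rule cmean_add) (auto intro!: continuous_intros c)
    also have "cmean (\<lambda>z. fn \<alpha> z * y z / z + cv X * ((Q z - P z) / z))
        = cmean (\<lambda>z. fn \<alpha> z * y z / z) + cv X * cmean (\<lambda>z. (Q z - P z) / z)"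
      unfolding cmean_cmult[symmetric] by (rule cmean_add) (auto intro!: continuous_intros c)
    also have "cmean (\<lambda>z. I z + N z) = cmean I + cmean N"
      by (rule cmean_add) (auto intro!: c)
    finally show ?thesis .
  qed
  also have "cmean I = Q0 * y1 - cu X * Q0 + c2 * (exp (- uc p) * (y0 - y0 + cv X - cu X * 0)) - P0 * y1 + cu X * P0"
    by (rule extends_in_mean[OF I])
  also have "cmean N = 0" using extends_out_mean[OF N] by simp
  finally have R: "cu X * e * cmean (\<lambda>z. (Q z - P z) / z) + e * x * cmean ?G
    = e * x * (cmean (\<lambda>z. fn \<alpha> z * y z / z) + cv X * cmean (\<lambda>z. (Q z - P z) / z)
       + (Q0 * y1 - cu X * Q0 + c2 * (exp (- uc p) * (y0 - y0 + cv X - cu X * 0)) - P0 * y1 + cu X * P0 + 0))" .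
  have "lcoeff (\<lambda>t. e * (fn X t + zwp p t * cu X) * (fn \<alpha> t + cv \<alpha>)) 1
    = e * (cmean (\<lambda>z. fn \<alpha> z * y z / z) + cv \<alpha> * y1)"
  proof -
    have "lcoeff (\<lambda>t. e * (fn X t + zwp p t * cu X) * (fn \<alpha> t + cv \<alpha>)) 1
      = cmean (\<lambda>z. e * (fn \<alpha> z * y z / z + cv \<alpha> * (y z / z)))"
      unfolding lcoeff_1 y_def by (rule cmean_cong) (simp add: algebra_simps add_divide_distrib)
    also have "\<dots> = e * cmean (\<lambda>z. fn \<alpha> z * y z / z + cv \<alpha> * (y z / z))" by (rule cmean_cmult)
    also have "cmean (\<lambda>z. fn \<alpha> z * y z / z + cv \<alpha> * (y z / z)) = cmean (\<lambda>z. fn \<alpha> z * y z / z) + cv \<alpha> * y1"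
      unfolding y1_def cmean_cmult[symmetric]
      by (rule cmean_add) (auto intro!: continuous_intros yc analytic_imp_continuous_sphere[OF alpha_analytic(1)])
    finally show ?thesis .
  qed
  then have "cu (Cop p X \<alpha>) = e * (cmean (\<lambda>z. fn \<alpha> z * y z / z) + cv \<alpha> * y1) - e * cu X * cv \<alpha> + cv X * cu \<alpha>"
    by (simp add: Cop_def Let_def e_def)
  then have C: "cu (Cop p X \<alpha>) = e * cmean (\<lambda>z. fn \<alpha> z * y z / z) + e * (Q0 - P0) * y1 - e * cu X * (Q0 - P0)
      + cv X * e * cmean (\<lambda>z. (Q z - P z) / z) + cv X * c2"
    by (simp only: alpha(2) alpha_cv ring_distribs mult.assoc add.assoc)
  have "e * exp (- uc p) = 1" by (simp add: e_def flip: exp_add)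
  then have fin: "x * (e * A + e * (Q0 - P0) * y1 - e * cu X * (Q0 - P0) + cv X * e * B + cv X * c2)
    = e * x * (A + cv X * B + (Q0 * y1 - cu X * Q0 + c2 * (exp (- uc p) * (y0 - y0 + cv X - cu X * 0)) - P0 * y1 + cu X * P0 + 0))"
    for A B by algebra
  show ?thesis unfolding R C by (rule fin)
qed

lemma zlam_analytic: "zlam p analytic_on sphere 0 1" "zlamb p analytic_on sphere 0 1"
  unfolding zlam_def[abs_def] zlamb_def[abs_def] by (auto intro!: analytic_intros W analytic_parts)

lemma dir_analytic:
  assumes "X \<in> triples"
  shows "lam_dir p X 0 analytic_on sphere 0 1" "lamb_dir p X 0 analytic_on sphere 0 1"
  using assms unfolding lam_dir_def[abs_def] lamb_dir_def[abs_def] triples_def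
  by (auto intro!: analytic_intros ltrunc_analytic)

lemma plus_part_combination:
  assumes "A analytic_on sphere 0 1" "B analytic_on sphere 0 1" "C analytic_on sphere 0 1" "z \<in> sphere 0 1"
    and "plus_part C z = c"
  shows "plus_part (\<lambda>z. A z + a * (B z + b * C z)) z = plus_part A z + a * (plus_part B z + b * c)"
proof -
  have "(\<lambda>z. B z + b * C z) analytic_on sphere 0 1" by (intro analytic_intros assms)
  then have "plus_part (\<lambda>z. 1 * A z + a * (B z + b * C z)) z = 1 * plus_part A z + a * plus_part (\<lambda>z. B z + b * C z) z"
    by (intro plus_part_lin assms)
  also have "plus_part (\<lambda>z. B z + b * C z) z = plus_part B z + b * plus_part C z"
    using plus_part_lin[OF assms(2,3,4), of 1 b] by simp
  finally show ?thesis using assms(5) by simp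
qed

text \<open>The logarithmic derivative of \<open>lam\<close> has the value \<open>1\<close> at
  infinity, because \<open>lam\<close> grows like \<open>z\<close>; the difference from
  \<open>1\<close> is an outer part.\<close>

lemma plus_part_zlam_over_lam: "z \<in> sphere 0 1 \<Longrightarrow> plus_part (\<lambda>z. zlam p z / lam p z) z = 1"
proof (rule plus_part_eqI[where g = "\<lambda>z. 1" and h = "\<lambda>z. zlam p z / lam p z - 1", OF _ extends_in_const _ refl])
  have "extends_out (\<lambda>z. (1 + minus_part (zwp p) z * (1 / z) + exp (uc p) * ((1 / z) * (1 / z))) * (z / lam p z) - 1)
      ((1 + 0 * 0 + exp (uc p) * (0 * 0)) * 1 - 1)"
    by (intro extends_out_diff extends_out_add extends_out_mult extends_out_const extends_out_inverse PQW_parts lam_extends[OF pW])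
  then have "extends_out (\<lambda>z. (1 + minus_part (zwp p) z * (1 / z) + exp (uc p) * ((1 / z) * (1 / z))) * (z / lam p z) - 1) 0"
    by simp
  then show "extends_out (\<lambda>z. zlam p z / lam p z - 1) 0"
    by (rule extends_out_cong) (use lam_nz sphere_nonzero in \<open>auto simp: zlam_def field_simps\<close>)
qed auto

lemma plus_part_zlamb_over_lamb: "z \<in> sphere 0 1 \<Longrightarrow> plus_part (\<lambda>z. zlamb p z / lamb p z) z = zlamb p z / lamb p z"
proof (rule plus_part_in)
  show "extends_in (\<lambda>z. zlamb p z / lamb p z) ((0 * 0 - 0 * 0 - exp (uc p)) * exp (- uc p))"
  proof (rule extends_in_cong)
    show "extends_in (\<lambda>z. (z * plus_part (zwp p) z - z * z - exp (uc p)) * (1 / (z * lamb p z))) ((0 * 0 - 0 * 0 - exp (uc p)) * exp (- uc p))"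
      by (intro extends_in_mult extends_in_diff extends_in_const extends_in_id PQW_parts lam_extends[OF pW])
  qed (use lam_nz sphere_nonzero in \<open>auto simp: zlamb_def field_simps\<close>)
qed

lemma plus_part_dir_over_lam:
  assumes X: "X \<in> triples" and z: "z \<in> sphere 0 1"
  shows "plus_part (\<lambda>z. lam_dir p X 0 z / lam p z) z = 0"
    "plus_part (\<lambda>z. lamb_dir p X 0 z / lamb p z) z = lamb_dir p X 0 z / lamb p z"
proof -
  have Xa: "fn X analytic_on sphere 0 1" using X by (simp add: triples_def)
  note Xp = extends_in_nonneg_part[OF Xa]
  have "extends_out (\<lambda>z. (minus_part (fn X) z + cmean (fn X) - cv X - cu X * exp (uc p) * (1 / z)) * (1 / lam p z))
      ((0 + cmean (fn X) - cv X - cu X * exp (uc p) * 0) * 0)"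
    by (intro extends_out_diff extends_out_add extends_out_mult extends_out_const extends_out_inverse Xp lam_extends[OF pW])
  then have "extends_out (\<lambda>z. (minus_part (fn X) z + cmean (fn X) - cv X - cu X * exp (uc p) * (1 / z)) * (1 / lam p z)) 0"
    by (simp only: mult_zero_right)
  then have "extends_out (\<lambda>z. lam_dir p X 0 z / lam p z) 0"
    by (rule extends_out_cong) (simp add: lam_dir_def ltrunc_other[OF Xa])
  then show "plus_part (\<lambda>z. lam_dir p X 0 z / lam p z) z = 0" using z by (rule plus_part_out)
  have "extends_in (\<lambda>z. lamb_dir p X 0 z / lamb p z)
      ((0 * (cmean (fn X) - cmean (fn X) + cv X) + cu X * exp (uc p)) * exp (- uc p))"
  proof (rule extends_in_cong)
    show "extends_in (\<lambda>z. (z * (plus_part (fn X) z - cmean (fn X) + cv X) + cu X * exp (uc p)) * (1 / (z * lamb p z)))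
      ((0 * (cmean (fn X) - cmean (fn X) + cv X) + cu X * exp (uc p)) * exp (- uc p))"
      by (intro extends_in_diff extends_in_add extends_in_mult extends_in_const extends_in_id Xp lam_extends[OF pW])
    fix z :: complex assume z: "z \<in> sphere 0 1"
    have "z * lamb_dir p X 0 z = z * (plus_part (fn X) z - cmean (fn X) + cv X) + cu X * exp (uc p)"
      unfolding lamb_dir_def ltrunc_other(1)[OF Xa z] using sphere_nonzero[OF z] by (simp add: distrib_left)
    then show "lamb_dir p X 0 z / lamb p z =
        (z * (plus_part (fn X) z - cmean (fn X) + cv X) + cu X * exp (uc p)) * (1 / (z * lamb p z))"
      using sphere_nonzero[OF z] by (metis divide_inverse mult.right_neutral mult_divide_mult_cancel_left times_divide_eq_right)
  qed
  then show "plus_part (\<lambda>z. lamb_dir p X 0 z / lamb p z) z = lamb_dir p X 0 z / lamb p z" using z by (rule plus_part_in)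
qed

lemma SW_analytic: "f analytic_on sphere 0 1 \<Longrightarrow> (\<lambda>z. S z * f z) analytic_on sphere 0 1"
  by (intro analytic_intros S)

lemma quotient_analytic:
  assumes "f analytic_on sphere 0 1"
  shows "(\<lambda>z. f z / lam p z) analytic_on sphere 0 1" "(\<lambda>z. f z / lamb p z) analytic_on sphere 0 1"
  by (intro analytic_intros assms lam_analytic[OF w] lam_nz; assumption)+

text \<open>Truncate the equations of \<open>P\<close> and \<open>Q\<close>. The two truncations of
  \<open>S * zwp\<close> add up to the whole, the term with \<open>1 / lam\<close> leaves the
  constant \<open>c1\<close>, and the term with \<open>1 / lamb\<close> extends inside and cancels
  in the part of negative powers.\<close>

lemma alpha_deriv:
  assumes z: "z \<in> sphere 0 1"
  shows "z * deriv (fn \<alpha>) z = S z * zwp p z - x * bracket z"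
proof -
  have "((\<lambda>z. plus_part P z + (Q z - plus_part Q z)) has_field_derivative
      deriv (plus_part P) z + (deriv Q z - deriv (plus_part Q) z)) (at z)"
    by (intro DERIV_add DERIV_diff analytic_derivI[OF _ z] analytic_parts Q)
  moreover have "fn \<alpha> = (\<lambda>z. plus_part P z + (Q z - plus_part Q z))" using alpha(1) by blast
  ultimately have D: "deriv (fn \<alpha>) z = deriv (plus_part P) z + (deriv Q z - deriv (plus_part Q) z)"
    using DERIV_imp_deriv by metis
  have 1: "z * deriv (fn \<alpha>) z = plus_part (\<lambda>z. z * deriv P z) z + (z * deriv Q z - plus_part (\<lambda>z. z * deriv Q z) z)"
    unfolding D plus_part_deriv[OF P z, symmetric] plus_part_deriv[OF Q z, symmetric] by (simp add: algebra_simps)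
  have "plus_part (\<lambda>z. z * deriv P z) z = plus_part (\<lambda>z. S z * zwp p z + (- x) * (P z * zlam p z + (- c1) * (zlam p z / lam p z))) z"
    by (rule plus_part_cong) (simp add: dP algebra_simps)
  also have "\<dots> = plus_part (\<lambda>z. S z * zwp p z) z + (- x) * (plus_part (\<lambda>z. P z * zlam p z) z + (- c1) * 1)"
    by (intro plus_part_combination z plus_part_zlam_over_lam SW_analytic W quotient_analytic zlam_analytic analytic_on_mult P)
  finally have 2: "plus_part (\<lambda>z. z * deriv P z) z = \<dots>" .
  have "plus_part (\<lambda>z. z * deriv Q z) z = plus_part (\<lambda>z. S z * zwp p z + x * (Q z * zlamb p z + c2 * (zlamb p z / lamb p z))) z"
    by (rule plus_part_cong) (simp add: dQ algebra_simps)
  also have "\<dots> = plus_part (\<lambda>z. S z * zwp p z) z + x * (plus_part (\<lambda>z. Q z * zlamb p z) z + c2 * (zlamb p z / lamb p z))"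
    by (intro plus_part_combination z plus_part_zlamb_over_lamb SW_analytic W quotient_analytic zlam_analytic analytic_on_mult Q)
  finally have 3: "plus_part (\<lambda>z. z * deriv Q z) z = \<dots>" .
  show ?thesis
    unfolding 1 2 3 dQ[OF z] bracket_def by (simp add: algebra_simps)
qed

text \<open>The Christoffel term is \<open>z * deriv (fn \<alpha>) z\<close> times
  \<open>fn X / zwp\<close>, hence \<open>S * fn X\<close> minus \<open>x\<close> times the bracket
  term of \<open>C_fn\<close>. The brackets cancel, and what is left is the truncated variation of
  \<open>P\<close> and \<open>Q\<close>.\<close>

lemma dir_fn:
  assumes X: "X \<in> triples" and z: "z \<in> sphere 0 1"
  shows "plus_part (\<lambda>z. S z * fn X z - x * (P z - c1 / lam p z) * lam_dir p X 0 z) z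
      + minus_part (\<lambda>z. S z * fn X z + x * (Q z + c2 / lamb p z) * lamb_dir p X 0 z) z
    = fn (christoffel p X \<alpha>) z + x * fn (Cop p X \<alpha>) z"
proof -
  have Xa: "fn X analytic_on sphere 0 1" using X by (simp add: triples_def)
  have "plus_part (\<lambda>z. S z * fn X z - x * (P z - c1 / lam p z) * lam_dir p X 0 z) z
    = plus_part (\<lambda>z. S z * fn X z + (- x) * (P z * lam_dir p X 0 z + (- c1) * (lam_dir p X 0 z / lam p z))) z"
    by (rule plus_part_cong) (simp add: algebra_simps)
  also have "\<dots> = plus_part (\<lambda>z. S z * fn X z) z + (- x) * (plus_part (\<lambda>z. P z * lam_dir p X 0 z) z + (- c1) * 0)"
    by (intro plus_part_combination z plus_part_dir_over_lam X SW_analytic Xa quotient_analytic dir_analytic analytic_on_mult P)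
  finally have 1: "plus_part (\<lambda>z. S z * fn X z - x * (P z - c1 / lam p z) * lam_dir p X 0 z) z = \<dots>" .
  have "plus_part (\<lambda>z. S z * fn X z + x * (Q z + c2 / lamb p z) * lamb_dir p X 0 z) z
    = plus_part (\<lambda>z. S z * fn X z + x * (Q z * lamb_dir p X 0 z + c2 * (lamb_dir p X 0 z / lamb p z))) z"
    by (rule plus_part_cong) (simp add: algebra_simps)
  also have "\<dots> = plus_part (\<lambda>z. S z * fn X z) z + x * (plus_part (\<lambda>z. Q z * lamb_dir p X 0 z) z + c2 * (lamb_dir p X 0 z / lamb p z))"
    by (intro plus_part_combination z plus_part_dir_over_lam X SW_analytic Xa quotient_analytic dir_analytic analytic_on_mult Q)
  finally have 2: "plus_part (\<lambda>z. S z * fn X z + x * (Q z + c2 / lamb p z) * lamb_dir p X 0 z) z = \<dots>" .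
  have "fn (christoffel p X \<alpha>) z = (z * deriv (fn \<alpha>) z) * fn X z / zwp p z"
    using sphere_nonzero[OF z] by (simp add: christoffel_def zwp_def)
  also have "\<dots> = S z * fn X z - x * (fn X z / zwp p z * bracket z)"
    unfolding alpha_deriv[OF z] using MM_deriv_nonzero[OF p z] by (simp add: field_simps)
  finally show ?thesis
    unfolding 1 2 C_fn[OF X z] by (simp add: algebra_simps)
qed

lemma dir_continuous:
  assumes X: "X \<in> triples"
  shows "continuous_on (sphere 0 1) (\<lambda>z. (P z - c1 / lam p z) * lam_dir p X 0 z + (Q z + c2 / lamb p z) * lamb_dir p X 0 z)"
  using lam_nz
  by (auto intro!: continuous_intros continuous_parts lam_cont dir_analytic[OF X, THEN analytic_imp_continuous_sphere])

lemma dir_cv: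
  assumes X: "X \<in> triples"
  shows "cmean (\<lambda>z. (S z * fn X z + x * (Q z + c2 / lamb p z) * lamb_dir p X 0 z)
       - (S z * fn X z - x * (P z - c1 / lam p z) * lam_dir p X 0 z)) = x * cv (Cop p X \<alpha>)"
  unfolding C_cv[OF X] cmean_cmult[symmetric] by (rule cmean_cong) (simp add: algebra_simps)

lemma dir_cu:
  assumes X: "X \<in> triples"
  shows "cu X * e * cmean (\<lambda>z. (Q z - P z) / z)
    + e * cmean (\<lambda>z. ((S z * fn X z + x * (Q z + c2 / lamb p z) * lamb_dir p X 0 z)
       - (S z * fn X z - x * (P z - c1 / lam p z) * lam_dir p X 0 z)) / z) = x * cu (Cop p X \<alpha>)"
proof -
  have "cmean (\<lambda>z. ((S z * fn X z + x * (Q z + c2 / lamb p z) * lamb_dir p X 0 z)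
       - (S z * fn X z - x * (P z - c1 / lam p z) * lam_dir p X 0 z)) / z)
    = x * cmean (\<lambda>z. ((P z - c1 / lam p z) * lam_dir p X 0 z + (Q z + c2 / lamb p z) * lamb_dir p X 0 z) / z)"
    unfolding cmean_cmult[symmetric]
    by (rule cmean_cong) (simp only: times_divide_eq_right, simp add: algebra_simps)
  then show ?thesis unfolding C_cu[OF X] by simp
qed

lemma euler_triples: "euler p \<in> triples"
  unfolding euler_def triples_def by (auto intro!: analytic_intros w W)

text \<open>The Euler field is scaling minus rotation: \<open>z\<close> gets weight
  \<open>1 - 1 = 0\<close>, which keeps the normalisation of \<open>lam\<close>, and
  \<open>exp u / z\<close> gets weight \<open>1 + 1\<close>, the component \<open>2\<close> of
  \<open>euler\<close>.\<close>

lemma euler_dir: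
  assumes z: "z \<in> sphere 0 1"
  shows "lam_dir p (euler p) 0 z = lam p z - zlam p z" "lamb_dir p (euler p) 0 z = lamb p z - zlamb p z"
proof -
  have ea: "(\<lambda>z. wf p z - zwp p z) analytic_on sphere 0 1" by (intro analytic_intros w W)
  have 1: "plus_part (\<lambda>z. wf p z - zwp p z) z = plus_part (wf p) z - plus_part (zwp p) z"
    using plus_part_lin[OF w W z, of 1 "-1"] by simp
  have 2: "cmean (\<lambda>z. wf p z - zwp p z) = cmean (wf p)"
    using cmean_diff[of "wf p" "zwp p"] continuous_parts w zwp_mean[OF w] analytic_imp_continuous_sphere by simp
  show "lam_dir p (euler p) 0 z = lam p z - zlam p z" "lamb_dir p (euler p) 0 z = lamb p z - zlamb p z"
    by (simp_all add: lam_dir_def lamb_dir_def euler_def ltrunc_other[OF ea z] 1 2 lam_def lamb_def ltrunc_other[OF w z] zlam_def zlamb_def)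
qed

text \<open>The integrands on the left are derivatives along \<open>log x\<close>, by homogeneity.
  The last two terms on the right are minus the first component of \<open>V\<close> applied to
  \<open>\<alpha>\<close>; the one with \<open>wf p\<close> absorbs the rotation in the Euler field
  through \<open>alpha_deriv\<close>.\<close>

lemma scaling_fn:
  assumes z: "z \<in> sphere 0 1"
  shows "plus_part (\<lambda>z. S z * wf p z - x * (P z - c1 / lam p z) * lam p z + P z / 2) z
      + minus_part (\<lambda>z. S z * wf p z + x * (Q z + c2 / lamb p z) * lamb p z + Q z / 2) z
    = x * fn (Uop p \<alpha>) z + fn \<alpha> z / 2 + deriv (fn \<alpha>) z * wf p z / deriv (wf p) z"
proof -
  note la = lam_analytic[OF w]
  have Pl: "(\<lambda>z. P z * lam p z) analytic_on sphere 0 1" "(\<lambda>z. Q z * lamb p z) analytic_on sphere 0 1"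
    "(\<lambda>z. P z * zlam p z) analytic_on sphere 0 1" "(\<lambda>z. Q z * zlamb p z) analytic_on sphere 0 1"
    by (intro analytic_intros P Q la zlam_analytic)+
  have half: "plus_part (\<lambda>z. A z + B z / 2) z = plus_part A z + plus_part B z / 2"
    if "A analytic_on sphere 0 1" "B analytic_on sphere 0 1" for A B
    using plus_part_lin[OF that z, of 1 "1/2"] by simp
  have c: "plus_part (\<lambda>z. 1) z = 1" by (rule plus_part_in[OF extends_in_const z])
  have 1: "plus_part (\<lambda>z. S z * wf p z - x * (P z - c1 / lam p z) * lam p z + P z / 2) z
      = plus_part (\<lambda>z. S z * wf p z) z + (- x) * (plus_part (\<lambda>z. P z * lam p z) z + (- c1) * 1) + plus_part P z / 2"
  proof -
    have "plus_part (\<lambda>z. S z * wf p z - x * (P z - c1 / lam p z) * lam p z + P z / 2) z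
      = plus_part (\<lambda>z. (S z * wf p z + (- x) * (P z * lam p z + (- c1) * 1)) + P z / 2) z"
      by (rule plus_part_cong) (use lam_nz in \<open>simp add: algebra_simps\<close>)
    also have "\<dots> = plus_part (\<lambda>z. S z * wf p z + (- x) * (P z * lam p z + (- c1) * 1)) z + plus_part P z / 2"
      by (rule half) (intro analytic_intros S w P la)+
    also have "plus_part (\<lambda>z. S z * wf p z + (- x) * (P z * lam p z + (- c1) * 1)) z
      = plus_part (\<lambda>z. S z * wf p z) z + (- x) * (plus_part (\<lambda>z. P z * lam p z) z + (- c1) * 1)"
      by (rule plus_part_combination[OF SW_analytic[OF w] Pl(1) analytic_on_const z c])
    finally show ?thesis .
  qed
  have 2: "plus_part (\<lambda>z. S z * wf p z + x * (Q z + c2 / lamb p z) * lamb p z + Q z / 2) z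
      = plus_part (\<lambda>z. S z * wf p z) z + x * (plus_part (\<lambda>z. Q z * lamb p z) z + c2 * 1) + plus_part Q z / 2"
  proof -
    have "plus_part (\<lambda>z. S z * wf p z + x * (Q z + c2 / lamb p z) * lamb p z + Q z / 2) z
      = plus_part (\<lambda>z. (S z * wf p z + x * (Q z * lamb p z + c2 * 1)) + Q z / 2) z"
      by (rule plus_part_cong) (use lam_nz in \<open>simp add: algebra_simps\<close>)
    also have "\<dots> = plus_part (\<lambda>z. S z * wf p z + x * (Q z * lamb p z + c2 * 1)) z + plus_part Q z / 2"
      by (rule half) (intro analytic_intros S w Q la)+
    also have "plus_part (\<lambda>z. S z * wf p z + x * (Q z * lamb p z + c2 * 1)) z
      = plus_part (\<lambda>z. S z * wf p z) z + x * (plus_part (\<lambda>z. Q z * lamb p z) z + c2 * 1)"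
      by (rule plus_part_combination[OF SW_analytic[OF w] Pl(2) analytic_on_const z c])
    finally show ?thesis .
  qed
  have 3: "plus_part (\<lambda>z. P z * lam_dir p (euler p) 0 z) z = plus_part (\<lambda>z. P z * lam p z) z - plus_part (\<lambda>z. P z * zlam p z) z"
  proof -
    have "plus_part (\<lambda>z. P z * lam_dir p (euler p) 0 z) z = plus_part (\<lambda>z. 1 * (P z * lam p z) + (- 1) * (P z * zlam p z)) z"
      by (rule plus_part_cong) (simp add: euler_dir right_diff_distrib)
    then show ?thesis using plus_part_lin[OF Pl(1,3) z, of 1 "-1"] by simp
  qed
  have 4: "plus_part (\<lambda>z. Q z * lamb_dir p (euler p) 0 z) z = plus_part (\<lambda>z. Q z * lamb p z) z - plus_part (\<lambda>z. Q z * zlamb p z) z"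
  proof -
    have "plus_part (\<lambda>z. Q z * lamb_dir p (euler p) 0 z) z = plus_part (\<lambda>z. 1 * (Q z * lamb p z) + (- 1) * (Q z * zlamb p z)) z"
      by (rule plus_part_cong) (simp add: euler_dir right_diff_distrib)
    then show ?thesis using plus_part_lin[OF Pl(2,4) z, of 1 "-1"] by simp
  qed
  have 5: "deriv (fn \<alpha>) z * wf p z / deriv (wf p) z = S z * wf p z - x * (wf p z / zwp p z * bracket z)"
  proof -
    have "deriv (fn \<alpha>) z * wf p z / deriv (wf p) z = (z * deriv (fn \<alpha>) z) * wf p z / zwp p z"
      using sphere_nonzero[OF z] by (simp add: zwp_def)
    also have "\<dots> = S z * wf p z - x * (wf p z / zwp p z * bracket z)"
      unfolding alpha_deriv[OF z] using MM_deriv_nonzero[OF p z] by (simp add: field_simps)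
    finally show ?thesis .
  qed
  have 6: "fn (euler p) z / zwp p z * bracket z = wf p z / zwp p z * bracket z - bracket z"
    using MM_deriv_nonzero[OF p z] by (simp add: euler_def diff_divide_distrib left_diff_distrib)
  have alg: "s + (- x) * (pl + (- c1) * 1) + pp / 2 + ((sw + x * (q + c2 / b) * b + q / 2) - (s + x * (ql + c2 * 1) + qp / 2))
     = x * (- (pl - pz) + (q * (b - zb) - (ql - qz)) + (B - b')) + (pp + (q - qp)) / 2 + (sw - x * B)"
    if "b' = - c1 + pz - (q * zb - qz)" "b \<noteq> 0" for s pl pp sw q b ql qp pz zb qz B b' :: complex
    unfolding that(1) using that(2) by (simp add: field_simps)
  show ?thesis
    unfolding 1 2 5 Uop_def C_fn[OF euler_triples z] 3 4 6 alpha(1) euler_dir(2)[OF z]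
    by (rule alg[OF _ lam_nz(2)[OF z]]) (simp add: bracket_def)
qed

lemma scaling_cv:
  "cmean (\<lambda>z. (S z * wf p z + x * (Q z + c2 / lamb p z) * lamb p z + Q z / 2)
      - (S z * wf p z - x * (P z - c1 / lam p z) * lam p z + P z / 2)) = x * cv (Uop p \<alpha>) + cv \<alpha> / 2"
proof -
  let ?g = "\<lambda>z. (P z - c1 / lam p z) * lam_dir p (euler p) 0 z + (Q z + c2 / lamb p z) * lamb_dir p (euler p) 0 z"
  have ha: "(\<lambda>z. Q z - P z) analytic_on sphere 0 1" by (intro analytic_intros P Q)
  have "cmean (\<lambda>z. (S z * wf p z + x * (Q z + c2 / lamb p z) * lamb p z + Q z / 2)
      - (S z * wf p z - x * (P z - c1 / lam p z) * lam p z + P z / 2))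
    = cmean (\<lambda>z. x * ?g z + (z * deriv (\<lambda>z. Q z - P z) z + 1 / 2 * (Q z - P z)))"
    by (rule cmean_cong) (simp add: QP_deriv euler_dir algebra_simps diff_divide_distrib)
  also have "\<dots> = cmean (\<lambda>z. x * ?g z) + (cmean (\<lambda>z. z * deriv (\<lambda>z. Q z - P z) z) + cmean (\<lambda>z. 1 / 2 * (Q z - P z)))"
    using dir_continuous[OF euler_triples] analytic_imp_continuous_sphere[OF analytic_deriv[OF ha]] continuous_parts
    by (subst cmean_add, (auto intro!: continuous_intros)[2], subst cmean_add, (auto intro!: continuous_intros)[3])
  also have "\<dots> = x * cmean ?g + (0 + 1 / 2 * cmean (\<lambda>z. Q z - P z))"
    by (simp only: cmean_cmult cmean_deriv[OF ha])
  finally have 1: "cmean (\<lambda>z. (S z * wf p z + x * (Q z + c2 / lamb p z) * lamb p z + Q z / 2)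
      - (S z * wf p z - x * (P z - c1 / lam p z) * lam p z + P z / 2)) = x * cmean ?g + (0 + 1 / 2 * cmean (\<lambda>z. Q z - P z))" .
  have 2: "cv \<alpha> = cmean (\<lambda>z. Q z - P z)" by (simp add: \<alpha>_def trunc_form_def)
  show ?thesis unfolding 1 2 Uop_def C_cv[OF euler_triples] by simp
qed

lemma scaling_cu:
  "e * cmean (\<lambda>z. ((S z * wf p z + x * (Q z + c2 / lamb p z) * lamb p z + Q z / 2)
      - (S z * wf p z - x * (P z - c1 / lam p z) * lam p z + P z / 2)) / z) + (- c2 / 2) = x * cu (Uop p \<alpha>) - cu \<alpha> / 2"
proof -
  let ?g = "\<lambda>z. (P z - c1 / lam p z) * lam_dir p (euler p) 0 z + (Q z + c2 / lamb p z) * lamb_dir p (euler p) 0 z"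
  let ?h = "\<lambda>z. Q z - P z"
  have ha: "?h analytic_on sphere 0 1" by (intro analytic_intros P Q)
  have hz: "(\<lambda>z. ?h z / z) analytic_on sphere 0 1" by (intro analytic_intros P Q) auto
  have d: "z * deriv ?h z / z = z * deriv (\<lambda>z. ?h z / z) z + ?h z / z" if z: "z \<in> sphere 0 1" for z
  proof -
    from DERIV_divide[OF analytic_derivI[OF ha z] DERIV_ident sphere_nonzero[OF z]]
    have "deriv (\<lambda>z. ?h z / z) z = (deriv ?h z * z - ?h z * 1) / (z * z)" by (rule DERIV_imp_deriv)
    then show ?thesis using sphere_nonzero[OF z] by (simp add: field_simps)
  qed
  have gc: "continuous_on (sphere 0 1) (\<lambda>z. x * (?g z / z))"
    using dir_continuous[OF euler_triples] by (auto intro!: continuous_intros)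
  have dc: "continuous_on (sphere 0 1) (\<lambda>z. z * deriv (\<lambda>z. ?h z / z) z)"
    using analytic_imp_continuous_sphere[OF analytic_deriv[OF hz]] by (auto intro!: continuous_intros)
  have hc: "continuous_on (sphere 0 1) (\<lambda>z. 3 / 2 * (?h z / z))"
    using analytic_imp_continuous_sphere[OF hz] by (rule continuous_on_mult_left)
  \<comment> \<open>In the coefficient \<open>3 / 2\<close> one half comes from homogeneity, and
    \<open>1\<close> from commuting \<open>z * deriv\<close> with the division by
    \<open>z\<close>.\<close>
  have "cmean (\<lambda>z. ((S z * wf p z + x * (Q z + c2 / lamb p z) * lamb p z + Q z / 2)
      - (S z * wf p z - x * (P z - c1 / lam p z) * lam p z + P z / 2)) / z)
    = cmean (\<lambda>z. x * (?g z / z) + (z * deriv (\<lambda>z. ?h z / z) z + 3 / 2 * (?h z / z)))"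
  proof (rule cmean_cong)
    fix z :: complex assume z: "z \<in> sphere 0 1"
    have alg: "(x * a + (b + c * h)) / z = x * (a / z) + (b / z + c * (h / z))" for a b c h :: complex
      by (simp add: add_divide_distrib)
    have "(S z * wf p z + x * (Q z + c2 / lamb p z) * lamb p z + Q z / 2)
      - (S z * wf p z - x * (P z - c1 / lam p z) * lam p z + P z / 2) = x * ?g z + (z * deriv ?h z + 1 / 2 * ?h z)"
      unfolding QP_deriv[OF z] euler_dir[OF z] by (simp add: algebra_simps diff_divide_distrib)
    then have "((S z * wf p z + x * (Q z + c2 / lamb p z) * lamb p z + Q z / 2)
      - (S z * wf p z - x * (P z - c1 / lam p z) * lam p z + P z / 2)) / z = x * (?g z / z) + (z * deriv ?h z / z + 1 / 2 * (?h z / z))"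
      by (simp only: alg)
    then show "((S z * wf p z + x * (Q z + c2 / lamb p z) * lamb p z + Q z / 2)
      - (S z * wf p z - x * (P z - c1 / lam p z) * lam p z + P z / 2)) / z
      = x * (?g z / z) + (z * deriv (\<lambda>z. ?h z / z) z + 3 / 2 * (?h z / z))"
      unfolding d[OF z] by simp
  qed
  also have "\<dots> = cmean (\<lambda>z. x * (?g z / z)) + (cmean (\<lambda>z. z * deriv (\<lambda>z. ?h z / z) z) + cmean (\<lambda>z. 3 / 2 * (?h z / z)))"
    unfolding cmean_add[OF gc continuous_on_add[OF dc hc]] cmean_add[OF dc hc] ..
  also have "\<dots> = x * cmean (\<lambda>z. ?g z / z) + 3 / 2 * cmean (\<lambda>z. ?h z / z)"
    unfolding cmean_cmult cmean_deriv[OF hz] by simp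
  finally have 1: "cmean (\<lambda>z. ((S z * wf p z + x * (Q z + c2 / lamb p z) * lamb p z + Q z / 2)
      - (S z * wf p z - x * (P z - c1 / lam p z) * lam p z + P z / 2)) / z)
     = x * cmean (\<lambda>z. ?g z / z) + 3 / 2 * cmean (\<lambda>z. ?h z / z)" .
  have 2: "cu (euler p) = 2" by (simp add: euler_def)
  have 3: "e * (x * g + 3 / 2 * m) + - c2 / 2 = 2 * e * m + e * x * g - (e * m + c2) / 2" for g m
    by (simp add: field_simps)
  show ?thesis
    unfolding 1 Uop_def C_cu[OF euler_triples] alpha(2) 2 by (rule 3)
qed

end

text \<open>Testing with monomials recovers all Laurent coefficients, hence both truncations, whose
  sum is the function on the circle.\<close>

lemma pair_nondegenerate:
  assumes "\<alpha> \<in> triples" "\<beta> \<in> triples" and eq: "\<And>X. X \<in> triples \<Longrightarrow> pair \<alpha> X = pair \<beta> X"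
  shows "teq \<alpha> \<beta>"
proof -
  have a: "fn \<alpha> analytic_on sphere 0 1" "fn \<beta> analytic_on sphere 0 1" using assms by (auto simp: triples_def)
  have "Triple (\<lambda>z. z powi k) 0 0 \<in> triples" for k :: int
    unfolding triples_def analytic_on_holomorphic
    by (auto intro!: exI[of _ "- {0}"] holomorphic_intros)
  then have l: "lcoeff (fn \<alpha>) k = lcoeff (fn \<beta>) k" for k
    using eq[of "Triple (\<lambda>z. z powi (- k)) 0 0"] by (simp add: pair_def lcoeff_def)
  have t: "ltrunc K (fn \<alpha>) = ltrunc K (fn \<beta>)" for K unfolding ltrunc_def l ..
  have "fn \<alpha> z = fn \<beta> z" if "z \<in> sphere 0 1" for z
  proof -
    have "fn \<alpha> z = ltrunc {0..} (fn \<alpha>) z + ltrunc {..<0} (fn \<alpha>) z" using ltrunc_other(2)[OF a(1) that] by simp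
    also have "\<dots> = ltrunc {0..} (fn \<beta>) z + ltrunc {..<0} (fn \<beta>) z" unfolding t ..
    also have "\<dots> = fn \<beta> z" using ltrunc_other(2)[OF a(2) that] by simp
    finally show ?thesis .
  qed
  moreover have "Triple (\<lambda>_. 0) 1 0 \<in> triples" "Triple (\<lambda>_. 0) 0 1 \<in> triples" by (auto simp: triples_def)
  then have "cv \<alpha> = cv \<beta>" "cu \<alpha> = cu \<beta>"
    using eq[of "Triple (\<lambda>_. 0) 1 0"] eq[of "Triple (\<lambda>_. 0) 0 1"] by (auto simp: pair_def)
  ultimately show ?thesis by (simp add: teq_def)
qed

lemma pair_commute: "pair X Y = pair Y X"
  by (simp add: pair_def mult.commute)

lemma pair_teq: "teq X X' \<Longrightarrow> pair \<alpha> X = pair \<alpha> X'"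
  by (auto simp: pair_def teq_def intro!: cmean_cong)

section \<open>The covariant derivative of the Euler field and the operator V\<close>

lemma cmean_by_parts:
  assumes "f analytic_on sphere 0 1" "g analytic_on sphere 0 1"
  shows "cmean (\<lambda>z. z * deriv f z * g z) = - cmean (\<lambda>z. f z * (z * deriv g z))"
proof -
  have c: "continuous_on (sphere 0 1) (deriv f)" "continuous_on (sphere 0 1) (deriv g)"
    "continuous_on (sphere 0 1) f" "continuous_on (sphere 0 1) g"
    using assms by (auto intro!: analytic_imp_continuous_sphere analytic_deriv)
  have "cmean (\<lambda>z. z * deriv f z * g z) + cmean (\<lambda>z. f z * (z * deriv g z)) = cmean (\<lambda>z. z * deriv (\<lambda>z. f z * g z) z)"
    unfolding cmean_add[symmetric]
  proof (subst cmean_add[symmetric])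
    show "cmean (\<lambda>z. z * deriv f z * g z + f z * (z * deriv g z)) = cmean (\<lambda>z. z * deriv (\<lambda>z. f z * g z) z)"
    proof (rule cmean_cong)
      fix z :: complex assume z: "z \<in> sphere 0 1"
      have "deriv (\<lambda>z. f z * g z) z = deriv f z * g z + deriv g z * f z"
        by (rule DERIV_imp_deriv, rule DERIV_mult[OF analytic_derivI[OF assms(1) z] analytic_derivI[OF assms(2) z]])
      then show "z * deriv f z * g z + f z * (z * deriv g z) = z * deriv (\<lambda>z. f z * g z) z" by (simp add: algebra_simps)
    qed
  qed (auto intro!: continuous_intros c)
  also have "\<dots> = 0" by (rule cmean_deriv) (intro analytic_intros assms)
  finally show ?thesis by (simp add: eq_neg_iff_add_eq_0)
qed

context
  fixes p assumes p: "p \<in> MM"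
begin

lemma wpW: "wf p analytic_on sphere 0 1"
  using p by (simp add: MM_def)

lemma quot_analytic:
  assumes "f analytic_on sphere 0 1"
  shows "(\<lambda>z. f z * wf p z / zwp p z) analytic_on sphere 0 1"
  by (intro analytic_intros assms wpW zwp_analytic MM_deriv_nonzero(2)[OF p])

lemma dir_deriv_euler:
  assumes X: "X \<in> triples"
  shows "teq (dir_deriv euler p X) (Triple (\<lambda>z. fn X z - z * deriv (fn X) z) (cv X) 0)"
proof -
  have Xa: "fn X analytic_on sphere 0 1" using X by (simp add: triples_def)
  have "deriv (\<lambda>\<epsilon>. fn (euler (move p X \<epsilon>)) z) 0 = fn X z - z * deriv (fn X) z" if z: "z \<in> sphere 0 1" for z
  proof -
    have "deriv (wf (move p X \<epsilon>)) z = deriv (wf p) z + \<epsilon> * deriv (fn X) z" for \<epsilon>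
      unfolding move_def pt.sel
      by (rule DERIV_imp_deriv, rule DERIV_add[OF analytic_derivI[OF wpW z] DERIV_cmult[OF analytic_derivI[OF Xa z]]])
    then have "(\<lambda>\<epsilon>. fn (euler (move p X \<epsilon>)) z) = (\<lambda>\<epsilon>. wf p z + \<epsilon> * fn X z - z * (deriv (wf p) z + \<epsilon> * deriv (fn X) z))"
      by (simp add: euler_def zwp_def move_def)
    moreover have "((\<lambda>\<epsilon>. wf p z + \<epsilon> * fn X z - z * (deriv (wf p) z + \<epsilon> * deriv (fn X) z)) has_field_derivative
        fn X z - z * deriv (fn X) z) (at 0)"
      by (auto intro!: derivative_eq_intros)
    ultimately show ?thesis using DERIV_imp_deriv by metis
  qed
  moreover have "deriv (\<lambda>\<epsilon>. cv (euler (move p X \<epsilon>))) 0 = cv X"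
    by (rule DERIV_imp_deriv) (auto simp: euler_def move_def intro!: derivative_eq_intros)
  moreover have "deriv (\<lambda>\<epsilon>. cu (euler (move p X \<epsilon>))) 0 = 0" by (simp add: euler_def)
  ultimately show ?thesis by (simp add: teq_def dir_deriv_def)
qed

text \<open>Pairing the Christoffel term with the Euler field gives
  \<open>z * deriv (fn \<alpha>) z\<close> times \<open>h - fn X\<close>. Integration by parts frees
  \<open>\<alpha>\<close>, and the \<open>X\<close> part cancels the derivative in
  \<open>dir_deriv_euler\<close>. Nondegeneracy then identifies the Hilbert choice with this
  explicit vector.\<close>

lemma cov_deriv_euler:
  assumes X: "X \<in> triples"
  shows "teq (cov_deriv_vec euler p X) (Triple (\<lambda>z. fn X z - z * deriv (\<lambda>z. fn X z * wf p z / zwp p z) z) (cv X) 0)"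
    "cov_deriv_vec euler p X \<in> triples"
proof -
  have Xa: "fn X analytic_on sphere 0 1" using X by (simp add: triples_def)
  define h where "h = (\<lambda>z. fn X z * wf p z / zwp p z)"
  have h: "h analytic_on sphere 0 1" unfolding h_def by (rule quot_analytic[OF Xa])
  define Y where "Y = Triple (\<lambda>z. fn X z - z * deriv h z) (cv X) 0"
  have Y: "Y \<in> triples" unfolding Y_def triples_def by (auto intro!: analytic_intros Xa h)
  have Yeq: "pair \<alpha> Y = pair \<alpha> (dir_deriv euler p X) + pair (christoffel p X \<alpha>) (euler p)"
    if \<alpha>: "\<alpha> \<in> triples" for \<alpha>
  proof -
    have a: "fn \<alpha> analytic_on sphere 0 1" using \<alpha> by (simp add: triples_def)
    note c = a Xa h analytic_deriv[OF a] analytic_deriv[OF Xa] analytic_deriv[OF h]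
    note c = c[THEN analytic_imp_continuous_sphere]
    have 1: "pair \<alpha> (dir_deriv euler p X) = cmean (\<lambda>z. fn \<alpha> z * (fn X z - z * deriv (fn X) z)) + cv \<alpha> * cv X"
      unfolding pair_teq[OF dir_deriv_euler[OF X]] by (simp add: pair_def)
    have "pair (christoffel p X \<alpha>) (euler p) = cmean (\<lambda>z. z * deriv (fn \<alpha>) z * h z - z * deriv (fn \<alpha>) z * fn X z)"
      unfolding pair_def christoffel_def euler_def triple.sel
    proof (simp, rule cmean_cong)
      fix z :: complex assume z: "z \<in> sphere 0 1"
      show "deriv (fn \<alpha>) z * fn X z * (wf p z - zwp p z) / deriv (wf p) z
        = z * deriv (fn \<alpha>) z * h z - z * deriv (fn \<alpha>) z * fn X z"
        using MM_deriv_nonzero[OF p z] sphere_nonzero[OF z] by (simp add: h_def zwp_def field_simps)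
    qed
    also have "\<dots> = cmean (\<lambda>z. z * deriv (fn \<alpha>) z * h z) - cmean (\<lambda>z. z * deriv (fn \<alpha>) z * fn X z)"
      by (rule cmean_diff) (auto intro!: continuous_intros c)
    also have "\<dots> = cmean (\<lambda>z. fn \<alpha> z * (z * deriv (fn X) z)) - cmean (\<lambda>z. fn \<alpha> z * (z * deriv h z))"
      by (simp add: cmean_by_parts[OF a h] cmean_by_parts[OF a Xa])
    finally have 2: "pair (christoffel p X \<alpha>) (euler p) = \<dots>" .
    have "pair \<alpha> Y = cmean (\<lambda>z. fn \<alpha> z * (fn X z - z * deriv (fn X) z) + (fn \<alpha> z * (z * deriv (fn X) z) - fn \<alpha> z * (z * deriv h z))) + cv \<alpha> * cv X"
      by (simp add: pair_def Y_def) (rule cmean_cong, simp add: algebra_simps)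
    also have "cmean (\<lambda>z. fn \<alpha> z * (fn X z - z * deriv (fn X) z) + (fn \<alpha> z * (z * deriv (fn X) z) - fn \<alpha> z * (z * deriv h z)))
      = cmean (\<lambda>z. fn \<alpha> z * (fn X z - z * deriv (fn X) z)) + cmean (\<lambda>z. fn \<alpha> z * (z * deriv (fn X) z) - fn \<alpha> z * (z * deriv h z))"
      by (rule cmean_add) (auto intro!: continuous_intros c)
    also have "cmean (\<lambda>z. fn \<alpha> z * (z * deriv (fn X) z) - fn \<alpha> z * (z * deriv h z)) =
        cmean (\<lambda>z. fn \<alpha> z * (z * deriv (fn X) z)) - cmean (\<lambda>z. fn \<alpha> z * (z * deriv h z))"
      by (rule cmean_diff) (auto intro!: continuous_intros c)
    finally show ?thesis unfolding 1 2 by simp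
  qed
  have "\<exists>Y. Y \<in> triples \<and> (\<forall>\<alpha>\<in>triples. pair \<alpha> Y = pair \<alpha> (dir_deriv euler p X) + pair (christoffel p X \<alpha>) (euler p))"
    using Y Yeq by blast
  from someI_ex[OF this] have *: "cov_deriv_vec euler p X \<in> triples \<and> (\<forall>\<alpha>\<in>triples. pair \<alpha> (cov_deriv_vec euler p X) =
      pair \<alpha> (dir_deriv euler p X) + pair (christoffel p X \<alpha>) (euler p))"
    unfolding cov_deriv_vec_def .
  then show "cov_deriv_vec euler p X \<in> triples" by blast
  have "teq (cov_deriv_vec euler p X) Y"
    using * Y Yeq by (intro pair_nondegenerate) (auto simp: pair_commute[of _ Y] pair_commute[of "cov_deriv_vec euler p X"])
  then show "teq (cov_deriv_vec euler p X) (Triple (\<lambda>z. fn X z - z * deriv (\<lambda>z. fn X z * wf p z / zwp p z) z) (cv X) 0)"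
    by (simp add: Y_def h_def)
qed

text \<open>The scalar components are \<open>1 / 2\<close> minus the weights \<open>1\<close> of
  \<open>v\<close> and \<open>0\<close> of \<open>u\<close>. In the first component integration by
  parts moves the derivative from \<open>h\<close> back to \<open>\<alpha>\<close>.\<close>

lemma Vform_eq:
  assumes \<alpha>: "\<alpha> \<in> triples"
  shows "teq (Vform p \<alpha>) (Triple (\<lambda>z. - fn \<alpha> z / 2 - deriv (fn \<alpha>) z * wf p z / deriv (wf p) z) (- cv \<alpha> / 2) (cu \<alpha> / 2))"
proof -
  have a: "fn \<alpha> analytic_on sphere 0 1" using \<alpha> by (simp add: triples_def)
  define B where "B = Triple (\<lambda>z. - fn \<alpha> z / 2 - deriv (fn \<alpha>) z * wf p z / deriv (wf p) z) (- cv \<alpha> / 2) (cu \<alpha> / 2)"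
  have B: "B \<in> triples"
    unfolding B_def triples_def by (auto intro!: analytic_intros a wpW MM_deriv_nonzero(1)[OF p])
  have Beq: "pair B X = pair \<alpha> (Vvec p X)" if X: "X \<in> triples" for X
  proof -
    have Xa: "fn X analytic_on sphere 0 1" using X by (simp add: triples_def)
    define h where "h = (\<lambda>z. fn X z * wf p z / zwp p z)"
    have h: "h analytic_on sphere 0 1" unfolding h_def by (rule quot_analytic[OF Xa])
    note c = a Xa h analytic_deriv[OF a] analytic_deriv[OF Xa] analytic_deriv[OF h]
    note c = c[THEN analytic_imp_continuous_sphere]
    have V: "teq (Vvec p X) (Triple (\<lambda>z. - fn X z / 2 + z * deriv h z) (- cv X / 2) (cu X / 2))"
      using cov_deriv_euler(1)[OF X] by (simp add: teq_def Vvec_def tadd_def tscale_def h_def)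
    have "pair \<alpha> (Vvec p X) = cmean (\<lambda>z. fn \<alpha> z * (- fn X z / 2 + z * deriv h z)) - cv \<alpha> * cv X / 2 + cu \<alpha> * cu X / 2"
      unfolding pair_teq[OF V] by (simp add: pair_def)
    also have "cmean (\<lambda>z. fn \<alpha> z * (- fn X z / 2 + z * deriv h z)) = cmean (\<lambda>z. - 1 / 2 * (fn \<alpha> z * fn X z) + fn \<alpha> z * (z * deriv h z))"
      by (rule cmean_cong) (simp add: algebra_simps)
    also have "\<dots> = cmean (\<lambda>z. - 1 / 2 * (fn \<alpha> z * fn X z)) + cmean (\<lambda>z. fn \<alpha> z * (z * deriv h z))"
      by (rule cmean_add) (auto intro!: continuous_intros c)
    also have "cmean (\<lambda>z. fn \<alpha> z * (z * deriv h z)) = cmean (\<lambda>z. (-1) * (z * deriv (fn \<alpha>) z * h z))"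
      using cmean_by_parts[OF a h] by (simp only: cmean_cmult) simp
    also have "cmean (\<lambda>z. - 1 / 2 * (fn \<alpha> z * fn X z)) + cmean (\<lambda>z. (-1) * (z * deriv (fn \<alpha>) z * h z))
       = cmean (\<lambda>z. - 1 / 2 * (fn \<alpha> z * fn X z) + (-1) * (z * deriv (fn \<alpha>) z * h z))"
      by (rule cmean_add[symmetric]) (auto intro!: continuous_intros c)
    also have "\<dots> = cmean (\<lambda>z. fn B z * fn X z)"
    proof (rule cmean_cong)
      fix z :: complex assume z: "z \<in> sphere 0 1"
      show "- 1 / 2 * (fn \<alpha> z * fn X z) + (-1) * (z * deriv (fn \<alpha>) z * h z) = fn B z * fn X z"
        using MM_deriv_nonzero[OF p z] sphere_nonzero[OF z] by (simp add: B_def h_def zwp_def field_simps)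
    qed
    finally show ?thesis by (simp add: pair_def B_def)
  qed
  have "\<exists>\<beta>. \<beta> \<in> triples \<and> (\<forall>X\<in>triples. pair \<beta> X = pair \<alpha> (Vvec p X))" using B Beq by blast
  from someI_ex[OF this] have *: "Vform p \<alpha> \<in> triples \<and> (\<forall>X\<in>triples. pair (Vform p \<alpha>) X = pair \<alpha> (Vvec p X))"
    unfolding Vform_def .
  then have "teq (Vform p \<alpha>) B" using B Beq by (intro pair_nondegenerate) auto
  then show ?thesis by (simp add: B_def)
qed

end

section \<open>Deformed flat functions\<close>

definition flatF_at :: "pt \<Rightarrow> coef \<Rightarrow> complex \<Rightarrow> complex \<Rightarrow> complex" where
  "flatF_at p k x z = flatF k x (lam p z) (lamb p z) (log1 p z) (log2 p z)"

definition flatP_at :: "pt \<Rightarrow> coef \<Rightarrow> complex \<Rightarrow> complex \<Rightarrow> complex" where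
  "flatP_at p k x z = flatP k x (lam p z) (lamb p z) (log1 p z) (log2 p z)"

definition flatQ_at :: "pt \<Rightarrow> coef \<Rightarrow> complex \<Rightarrow> complex \<Rightarrow> complex" where
  "flatQ_at p k x z = flatQ k x (lam p z) (lamb p z) (log1 p z) (log2 p z)"

definition flatS_at :: "pt \<Rightarrow> coef \<Rightarrow> complex \<Rightarrow> complex \<Rightarrow> complex" where
  "flatS_at p k x z = flatS k x (lam p z) (lamb p z)"

definition flat_form :: "pt \<Rightarrow> coef \<Rightarrow> complex \<Rightarrow> triple" where
  "flat_form p k x = trunc_form p (flatP_at p k x) (flatQ_at p k x) (k2 k)"

lemma MW_nz: "p \<in> MW \<Longrightarrow> z \<in> sphere 0 1 \<Longrightarrow> lam p z \<noteq> 0 \<and> lamb p z \<noteq> 0 \<and> lam p z + lamb p z \<noteq> 0"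
  using MWD(4,6)[of p z] MWD(5)[of p z] sphere_nonzero[of z] lam_add_lamb[OF MWD(1)] by auto

lemma flat_at_analytic:
  assumes p: "p \<in> MW"
  shows "flatP_at p k x analytic_on sphere 0 1" "flatQ_at p k x analytic_on sphere 0 1" "flatS_at p k x analytic_on sphere 0 1"
proof -
  obtain R where R: "regular_ann p R" using MW_regular_ann[OF p, of "[]"] by auto
  then have R1: "1 < R" by (simp add: regular_ann_def)
  have d: "((\<lambda>e. c) has_field_derivative 0) (at e)" for c e :: complex by simp
  note fams = fam_flatP[OF logfam_const[OF R] d d d d d] fam_flatQ[OF logfam_const[OF R] d d d d d]
  have k: "k = Coef (deg k) (kG k) (k1 k) (k2 k) (kU k)" by simp
  have "{0} \<times> sphere 0 1 \<subseteq> UNIV \<times> ann R" using sphere_subset_ann[OF R1] by auto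
  note an = fams[THEN fam_analytic(1), OF this]
  show "flatP_at p k x analytic_on sphere 0 1"
    unfolding flatP_at_def[abs_def] by (subst k) (rule an)
  show "flatQ_at p k x analytic_on sphere 0 1"
    unfolding flatQ_at_def[abs_def] by (subst k) (rule an)
  show "flatS_at p k x analytic_on sphere 0 1"
    unfolding flatS_at_def[abs_def] flatS_def expo_mid_def analytic_on_holomorphic
    using R MW_nz[OF p]
    by (intro exI[of _ "ann R"])
       (auto intro!: holomorphic_intros simp: regular_ann_def sphere_subset_ann[unfolded subset_iff mem_sphere_0])
qed

lemma flat_form_triples: "p \<in> MW \<Longrightarrow> flat_form p k x \<in> triples"
  unfolding flat_form_def by (intro trunc_form_triples flat_at_analytic)

lemma curve_0: "lam_curve p X 0 = lam p" "lamb_curve p X 0 = lamb p" "log1_curve p X 0 = log1 p" "log2_curve p X 0 = log2 p"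
  by (auto simp: lam_curve_def lamb_curve_def log1_curve_def log2_curve_def dlam_def dlamb_def)

lemma dir_sum:
  assumes "X \<in> triples" "z \<in> sphere 0 1"
  shows "lam_dir p X 0 z + lamb_dir p X 0 z = fn X z"
  using ltrunc_other[of "fn X" z] assms by (simp add: lam_dir_def lamb_dir_def triples_def)

lemma has_field_derivative_eventually:
  assumes "(g has_field_derivative D) (at a)" "eventually (\<lambda>e. f e = g e) (nhds a)"
  shows "(f has_field_derivative D) (at a)"
  using DERIV_cong_ev[OF refl assms(2) refl] assms(1) by simp

text \<open>Differentiate under the mean along the explicit curves. The claim covers all of
  \<open>MW\<close>, because derivatives of the differential along a line involve the neighbouring
  points.\<close>

lemma flatF_at_differential:
  assumes p: "p \<in> MW" and x: "x \<noteq> 0"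
  shows "is_differential (\<lambda>q. cmean (flatF_at q k x)) p (flat_form p k x)"
  unfolding is_differential_def
proof (intro conjI ballI)
  show "flat_form p k x \<in> triples" by (rule flat_form_triples[OF p])
  fix X assume X: "X \<in> triples"
  obtain W where W: "{0} \<times> sphere 0 1 \<subseteq> W"
    "logfam W (lam_curve p X) (lam_dir p X) (lamb_curve p X) (lamb_dir p X) (log1_curve p X) (log2_curve p X)"
    using logfam_curve[OF p X] .
  from fam_cmean[OF fam_flatF[OF W(2) x] W(1), unfolded curve_0]
  have "((\<lambda>e. cmean (\<lambda>z. flatF k x (lam_curve p X e z) (lamb_curve p X e z) (log1_curve p X e z) (log2_curve p X e z)))
    has_field_derivative pair (flat_form p k x) X) (at 0)"
    unfolding flat_form_def mean_pairing[OF p flat_at_analytic(1,2)[OF p] X, of k x "k1 k", symmetric] flatP_at_def flatQ_at_def .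
  then show "((\<lambda>\<epsilon>. cmean (flatF_at (move p X \<epsilon>) k x)) has_field_derivative pair (flat_form p k x) X) (at 0)"
  proof (rule has_field_derivative_eventually)
    show "eventually (\<lambda>e. cmean (flatF_at (move p X e) k x) =
        cmean (\<lambda>z. flatF k x (lam_curve p X e z) (lamb_curve p X e z) (log1_curve p X e z) (log2_curve p X e z))) (nhds 0)"
      using move_curves[OF p X] by (rule eventually_mono) (rule cmean_cong, simp add: flatF_at_def)
  qed
qed

lemma move_flat_at:
  assumes "p \<in> MW" "X \<in> triples"
  shows "eventually (\<lambda>e. \<forall>z\<in>sphere 0 1. flatP_at (move p X e) k x z = flatP k x (lam_curve p X e z) (lamb_curve p X e z) (log1_curve p X e z) (log2_curve p X e z)
     \<and> flatQ_at (move p X e) k x z = flatQ k x (lam_curve p X e z) (lamb_curve p X e z) (log1_curve p X e z) (log2_curve p X e z)) (nhds 0)"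
  using move_curves[OF assms] by (rule eventually_mono) (auto simp: flatP_at_def flatQ_at_def)

text \<open>The general derivative formula once more, now with \<open>z\<close> itself as the
  parameter: this supplies the equations assumed in \<open>flat_data\<close>.\<close>

lemma flat_at_deriv:
  assumes p: "p \<in> MW" and z: "z \<in> sphere 0 1"
  shows "z * deriv (flatP_at p k x) z = flatS_at p k x z * zwp p z - x * (flatP_at p k x z - k1 k / lam p z) * zlam p z"
    "z * deriv (flatQ_at p k x) z = flatS_at p k x z * zwp p z + x * (flatQ_at p k x z + k2 k / lamb p z) * zlamb p z"
proof -
  obtain A where A: "open A" "sphere 0 1 \<subseteq> A"
    "logfam (A \<times> UNIV) (\<lambda>e z. lam p e) (\<lambda>e z. deriv (lam p) e) (\<lambda>e z. lamb p e) (\<lambda>e z. deriv (lamb p) e)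
       (\<lambda>e z. log1 p e) (\<lambda>e z. log2 p e)"
    using logfam_point[OF p] .
  have d: "((\<lambda>e. c) has_field_derivative 0) (at e)" for c e :: complex by simp
  have zA: "(z, 0) \<in> A \<times> UNIV" using z A(2) by auto
  note fams = fam_flatP[OF A(3) d d d d d, of "deg k" "kG k" "k1 k" "k2 k" "kU k" x, THEN famD(4), OF zA]
    fam_flatQ[OF A(3) d d d d d, of "deg k" "kG k" "k1 k" "k2 k" "kU k" x, THEN famD(4), OF zA]
  have zero: "flatP (Coef n 0 0 0 0) y l b L1 L2 = 0" "flatQ (Coef n 0 0 0 0) y l b L1 L2 = 0" for n y l b L1 L2
    by (simp_all add: flatP_def flatQ_def)
  note D = fams[unfolded coef.collapse zero, THEN DERIV_imp_deriv]
  note w = MWD(1)[OF p]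
  have "zwp p z = zlam p z + zlamb p z" by (simp add: zlam_def zlamb_def)
  then have e: "z * (deriv (lam p) z + deriv (lamb p) z) = zwp p z"
    unfolding lam_deriv[OF w z, symmetric] by (simp add: ring_distribs)
  have alg: "z * (0 + s * (l + b) - x * q * l + 0 * r) = s * (z * (l + b)) - x * q * (z * l)"
    "z * (0 + s * (l + b) + x * q * b + 0 * r) = s * (z * (l + b)) + x * q * (z * b)" for s l b q r
    by (simp_all add: algebra_simps)
  show "z * deriv (flatP_at p k x) z = flatS_at p k x z * zwp p z - x * (flatP_at p k x z - k1 k / lam p z) * zlam p z"
    unfolding e[symmetric] lam_deriv[OF w z, symmetric] flatP_at_def[abs_def] flatS_at_def D(1) by (rule alg)
  show "z * deriv (flatQ_at p k x) z = flatS_at p k x z * zwp p z + x * (flatQ_at p k x z + k2 k / lamb p z) * zlamb p z"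
    unfolding e[symmetric] lam_deriv[OF w z, symmetric] flatQ_at_def[abs_def] flatS_at_def D(2) by (rule alg)
qed

lemma flat_at_flat_data:
  assumes p: "p \<in> MM" and x: "x \<noteq> 0"
  shows "flat_data p x (flatP_at p k x) (flatQ_at p k x) (flatS_at p k x) (k1 k) (k2 k)"
proof -
  have pW: "p \<in> MW" using p MM_subset_MW by blast
  show ?thesis
    by unfold_locales (use p x flat_at_analytic[OF pW] flat_at_deriv[OF pW] in auto)
qed

lemma flat_form_move:
  assumes p: "p \<in> MM" and X: "X \<in> triples" and x: "x \<noteq> 0"
  shows "has_triple_derivative (\<lambda>e. flat_form (move p X e) k x)
    (tadd (christoffel p X (flat_form p k x)) (tscale x (Cop p X (flat_form p k x)))) 0"
proof -
  interpret flat_data p x "flatP_at p k x" "flatQ_at p k x" "flatS_at p k x" "k1 k" "k2 k"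
    by (rule flat_at_flat_data[OF p x])
  have al: "\<alpha> = flat_form p k x" by (simp add: \<alpha>_def flat_form_def)
  obtain W where W: "{0} \<times> sphere 0 1 \<subseteq> W"
    "logfam W (lam_curve p X) (lam_dir p X) (lamb_curve p X) (lamb_dir p X) (log1_curve p X) (log2_curve p X)"
    using logfam_curve[OF pW X] .
  let ?P = "\<lambda>e z. flatP k x (lam_curve p X e z) (lamb_curve p X e z) (log1_curve p X e z) (log2_curve p X e z)"
  let ?Q = "\<lambda>e z. flatQ k x (lam_curve p X e z) (lamb_curve p X e z) (log1_curve p X e z) (log2_curve p X e z)"
  let ?P' = "\<lambda>z. flatS_at p k x z * fn X z - x * (flatP_at p k x z - k1 k / lam p z) * lam_dir p X 0 z"
  let ?Q' = "\<lambda>z. flatS_at p k x z * fn X z + x * (flatQ_at p k x z + k2 k / lamb p z) * lamb_dir p X 0 z"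
  have d: "((\<lambda>e. c) has_field_derivative 0) (at e)" for c e :: complex by simp
  note fams = fam_flatP[OF W(2) d d d d d, of "deg k" "kG k" "k1 k" "k2 k" "kU k" x, unfolded coef.collapse]
    fam_flatQ[OF W(2) d d d d d, of "deg k" "kG k" "k1 k" "k2 k" "kU k" x, unfolded coef.collapse]
  have zero: "flatP (Coef n 0 0 0 0) y l b L1 L2 = 0" "flatQ (Coef n 0 0 0 0) y l b L1 L2 = 0" for n y l b L1 L2
    by (simp_all add: flatP_def flatQ_def)
  \<comment> \<open>The derivative families matter only at \<open>e = 0\<close> on the circle.
    Hiding them behind names leaves the integrands of \<open>dir_fn\<close>, \<open>dir_cv\<close>
    and \<open>dir_cu\<close>.\<close>
  obtain P1 Q1 where fP: "fam W ?P P1" and fQ: "fam W ?Q Q1"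
    and P1: "\<And>z. z \<in> sphere 0 1 \<Longrightarrow> P1 0 z = ?P' z" and Q1: "\<And>z. z \<in> sphere 0 1 \<Longrightarrow> Q1 0 z = ?Q' z"
    using fams by (rule that) (simp_all add: zero curve_0 flatP_at_def flatQ_at_def flatS_at_def dir_sum[OF X])
  have ev: "eventually (\<lambda>e. \<forall>z\<in>sphere 0 1. flatP_at (move p X e) k x z = ?P e z \<and> flatQ_at (move p X e) k x z = ?Q e z) (nhds 0)"
    by (rule move_flat_at[OF pW X])
  have 1: "((\<lambda>e. fn (flat_form (move p X e) k x) z) has_field_derivative
      fn (christoffel p X \<alpha>) z + x * fn (Cop p X \<alpha>) z) (at 0)" if z: "z \<in> sphere 0 1" for z
  proof -
    have "((\<lambda>e. plus_part (?P e) z + (?Q e z - plus_part (?Q e) z)) has_field_derivative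
        plus_part (P1 0) z + (Q1 0 z - plus_part (Q1 0) z)) (at 0)"
      by (intro DERIV_add DERIV_diff fam_ltrunc[OF fP W(1) z] fam_ltrunc[OF fQ W(1) z] famD(4)[OF fQ])
         (use W(1) z in auto)
    also have "plus_part (P1 0) z + (Q1 0 z - plus_part (Q1 0) z) = plus_part ?P' z + minus_part ?Q' z"
      using plus_part_cong[of "P1 0" ?P' z] plus_part_cong[of "Q1 0" ?Q' z] P1 Q1 z by simp
    also have "\<dots> = fn (christoffel p X \<alpha>) z + x * fn (Cop p X \<alpha>) z" by (rule dir_fn[OF X z])
    finally show ?thesis
    proof (rule has_field_derivative_eventually)
      show "eventually (\<lambda>e. fn (flat_form (move p X e) k x) z = plus_part (?P e) z + (?Q e z - plus_part (?Q e) z)) (nhds 0)"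
        using ev
      proof (rule eventually_mono)
        fix e assume *: "\<forall>z\<in>sphere 0 1. flatP_at (move p X e) k x z = ?P e z \<and> flatQ_at (move p X e) k x z = ?Q e z"
        then show "fn (flat_form (move p X e) k x) z = plus_part (?P e) z + (?Q e z - plus_part (?Q e) z)"
          using z plus_part_cong[of "flatP_at (move p X e) k x" "?P e" z] plus_part_cong[of "flatQ_at (move p X e) k x" "?Q e" z]
          by (simp add: flat_form_def trunc_form_def)
      qed
    qed
  qed
  note fQP = fam_diff[OF fQ fP]
  have 2: "((\<lambda>e. cv (flat_form (move p X e) k x)) has_field_derivative x * cv (Cop p X \<alpha>)) (at 0)"
  proof (rule has_field_derivative_eventually)
    have "cmean (\<lambda>z. Q1 0 z - P1 0 z) = x * cv (Cop p X \<alpha>)"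
      unfolding dir_cv[OF X, symmetric] by (rule cmean_cong) (simp add: P1 Q1)
    then show "((\<lambda>e. cmean (\<lambda>z. ?Q e z - ?P e z)) has_field_derivative x * cv (Cop p X \<alpha>)) (at 0)"
      using fam_cmean[OF fQP W(1)] by simp
    show "eventually (\<lambda>e. cv (flat_form (move p X e) k x) = cmean (\<lambda>z. ?Q e z - ?P e z)) (nhds 0)"
      using ev by (rule eventually_mono) (auto simp: flat_form_def trunc_form_def intro!: cmean_cong)
  qed
  have 3: "((\<lambda>e. cu (flat_form (move p X e) k x)) has_field_derivative x * cu (Cop p X \<alpha>)) (at 0)"
  proof (rule has_field_derivative_eventually)
    have c: "cmean (\<lambda>z. (?Q 0 z - ?P 0 z) / z) = cmean (\<lambda>z. (flatQ_at p k x z - flatP_at p k x z) / z)"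
      "cmean (\<lambda>z. (Q1 0 z - P1 0 z) / z) = cmean (\<lambda>z. (?Q' z - ?P' z) / z)"
      by (rule cmean_cong, simp add: curve_0 flatP_at_def flatQ_at_def, rule cmean_cong, simp add: P1 Q1)
    have "((\<lambda>e. exp (uc p + e * cu X) * lcoeff (\<lambda>z. ?Q e z - ?P e z) 1 + k2 k) has_field_derivative
       (exp (uc p + 0 * cu X) * cu X) * lcoeff (\<lambda>z. ?Q 0 z - ?P 0 z) 1 + lcoeff (\<lambda>z. Q1 0 z - P1 0 z) 1 * exp (uc p + 0 * cu X) + 0) (at 0)"
      by (intro DERIV_add DERIV_mult fam_lcoeff_1[OF fQP W(1)] DERIV_const) (auto intro!: derivative_eq_intros)
    also have "(exp (uc p + 0 * cu X) * cu X) * lcoeff (\<lambda>z. ?Q 0 z - ?P 0 z) 1 + lcoeff (\<lambda>z. Q1 0 z - P1 0 z) 1 * exp (uc p + 0 * cu X) + 0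
       = x * cu (Cop p X \<alpha>)"
      unfolding lcoeff_1 c dir_cu[OF X, symmetric] by (simp add: e_def)
    finally show "((\<lambda>e. exp (uc p + e * cu X) * lcoeff (\<lambda>z. ?Q e z - ?P e z) 1 + k2 k) has_field_derivative x * cu (Cop p X \<alpha>)) (at 0)" .
    show "eventually (\<lambda>e. cu (flat_form (move p X e) k x) = exp (uc p + e * cu X) * lcoeff (\<lambda>z. ?Q e z - ?P e z) 1 + k2 k) (nhds 0)"
      using ev
      by (rule eventually_mono) (auto simp: flat_form_def trunc_form_def lcoeff_1 move_def intro!: cmean_cong)
  qed
  show ?thesis
    using 1 2 3 unfolding has_triple_derivative_def al by (simp add: tadd_def tscale_def christoffel_def)
qed

text \<open>The parameter is \<open>s = log \<zeta>\<close>, so that \<open>x = exp s\<close>, and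
  the hypotheses say that the coefficients evolve by \<open>coef_deriv\<close>. Homogeneity turns
  the derivative into the integrands of the scaling lemmas.\<close>

lemma flat_form_scaling:
  assumes p: "p \<in> MM"
    and G: "\<And>s. (G has_field_derivative (of_int n - 1 / 2) * G s) (at s)"
    and C1: "\<And>s. (C1 has_field_derivative - C1 s / 2) (at s)"
    and C2: "\<And>s. (C2 has_field_derivative - C2 s / 2) (at s)"
    and U: "\<And>s. (U has_field_derivative U s / 2 + 2 * exp s * C2 s) (at s)"
  shows "has_triple_derivative (\<lambda>t. flat_form p (Coef n (G t) (C1 t) (C2 t) (U t)) (exp t))
    (tscale (exp s) (tadd (Uop p (flat_form p (Coef n (G s) (C1 s) (C2 s) (U s)) (exp s)))
       (tscale (- 1 / exp s) (Vform p (flat_form p (Coef n (G s) (C1 s) (C2 s) (U s)) (exp s)))))) s"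
proof -
  define k where "k = (\<lambda>s. Coef n (G s) (C1 s) (C2 s) (U s))"
  have ks: "k1 (k s) = C1 s" "k2 (k s) = C2 s" "k1 (Coef n a b c d) = b" "k2 (Coef n a b c d) = c" for s a b c d
    by (simp_all add: k_def)
  have pW: "p \<in> MW" using p MM_subset_MW by blast
  interpret flat_data p "exp s" "flatP_at p (k s) (exp s)" "flatQ_at p (k s) (exp s)" "flatS_at p (k s) (exp s)" "k1 (k s)" "k2 (k s)"
    by (rule flat_at_flat_data[OF p]) simp
  have al: "\<alpha> = flat_form p (k s) (exp s)" by (simp add: \<alpha>_def flat_form_def)
  obtain R where R: "regular_ann p R" using MW_regular_ann[OF pW, of "[]"] by auto
  then have R1: "1 < R" by (simp add: regular_ann_def)
  have W: "{s} \<times> sphere 0 1 \<subseteq> UNIV \<times> ann R" using sphere_subset_ann[OF R1] by auto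
  have E: "(exp has_field_derivative exp t) (at t)" for t :: complex by (rule DERIV_exp)
  let ?P = "\<lambda>t. flatP_at p (k t) (exp t)" and ?Q = "\<lambda>t. flatQ_at p (k t) (exp t)"
  let ?P' = "\<lambda>z. flatS_at p (k s) (exp s) z * wf p z - exp s * (?P s z - k1 (k s) / lam p z) * lam p z + ?P s z / 2"
  let ?Q' = "\<lambda>z. flatS_at p (k s) (exp s) z * wf p z + exp s * (?Q s z + k2 (k s) / lamb p z) * lamb p z + ?Q s z / 2"
  note fams = fam_flatP[OF logfam_const[OF R] E G C1 C2 U] fam_flatQ[OF logfam_const[OF R] E G C1 C2 U]
  have cd: "Coef n ((of_int n - 1 / 2) * G s) (- C1 s / 2) (- C2 s / 2) (U s / 2 + 2 * exp s * C2 s) = coef_deriv (exp s) (k s)"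
    by (simp add: coef_deriv_def k_def)
  have hom: "flatP (coef_deriv (exp s) (k s)) (exp s) (lam p z) (lamb p z) (log1 p z) (log2 p z)
        + exp s * flatPx (k s) (exp s) (lam p z) (lamb p z) (log1 p z) (log2 p z) = ?P' z"
    "flatQ (coef_deriv (exp s) (k s)) (exp s) (lam p z) (lamb p z) (log1 p z) (log2 p z)
        + exp s * flatQx (k s) (exp s) (lam p z) (lamb p z) (log1 p z) (log2 p z) = ?Q' z"
    if z: "z \<in> sphere 0 1" for z
    using flatP_homogeneous[of "lam p z" "lamb p z" "exp s" "k s"] flatQ_homogeneous[of "lam p z" "lamb p z" "exp s" "k s"]
      MW_nz[OF pW z] lam_add_lamb[OF w z]
    by (auto simp: flatP_at_def flatQ_at_def flatS_at_def)
  have kd: "Coef n (G s) (C1 s) (C2 s) (U s) = k s" by (simp add: k_def)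
  obtain P1 where fP': "fam (UNIV \<times> ann R) (\<lambda>e z. flatP (Coef n (G e) (C1 e) (C2 e) (U e)) (exp e) (lam p z) (lamb p z) (log1 p z) (log2 p z)) P1"
    and P1: "\<And>z. z \<in> sphere 0 1 \<Longrightarrow> P1 s z = ?P' z"
  proof (rule that[OF fams(1)])
    fix z :: complex assume "z \<in> sphere 0 1"
    from hom(1)[OF this] show "flatP (Coef n ((of_int n - 1 / 2) * G s) (- C1 s / 2) (- C2 s / 2) (U s / 2 + 2 * exp s * C2 s))
       (exp s) (lam p z) (lamb p z) (log1 p z) (log2 p z) +
      flatS (Coef n (G s) (C1 s) (C2 s) (U s)) (exp s) (lam p z) (lamb p z) * (0 + 0) -
      exp s * (flatP (Coef n (G s) (C1 s) (C2 s) (U s)) (exp s) (lam p z) (lamb p z) (log1 p z) (log2 p z) - C1 s / lam p z) * 0 +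
      exp s * flatPx (Coef n (G s) (C1 s) (C2 s) (U s)) (exp s) (lam p z) (lamb p z) (log1 p z) (log2 p z) = ?P' z"
      unfolding cd kd by simp
  qed
  obtain Q1 where fQ': "fam (UNIV \<times> ann R) (\<lambda>e z. flatQ (Coef n (G e) (C1 e) (C2 e) (U e)) (exp e) (lam p z) (lamb p z) (log1 p z) (log2 p z)) Q1"
    and Q1: "\<And>z. z \<in> sphere 0 1 \<Longrightarrow> Q1 s z = ?Q' z"
  proof (rule that[OF fams(2)])
    fix z :: complex assume "z \<in> sphere 0 1"
    from hom(2)[OF this] show "flatQ (Coef n ((of_int n - 1 / 2) * G s) (- C1 s / 2) (- C2 s / 2) (U s / 2 + 2 * exp s * C2 s))
       (exp s) (lam p z) (lamb p z) (log1 p z) (log2 p z) +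
      flatS (Coef n (G s) (C1 s) (C2 s) (U s)) (exp s) (lam p z) (lamb p z) * (0 + 0) +
      exp s * (flatQ (Coef n (G s) (C1 s) (C2 s) (U s)) (exp s) (lam p z) (lamb p z) (log1 p z) (log2 p z) + C2 s / lamb p z) * 0 +
      exp s * flatQx (Coef n (G s) (C1 s) (C2 s) (U s)) (exp s) (lam p z) (lamb p z) (log1 p z) (log2 p z) = ?Q' z"
      unfolding cd kd by simp
  qed
  have fP: "fam (UNIV \<times> ann R) ?P P1" and fQ: "fam (UNIV \<times> ann R) ?Q Q1"
  proof -
    have "?P = (\<lambda>e z. flatP (Coef n (G e) (C1 e) (C2 e) (U e)) (exp e) (lam p z) (lamb p z) (log1 p z) (log2 p z))"
      "?Q = (\<lambda>e z. flatQ (Coef n (G e) (C1 e) (C2 e) (U e)) (exp e) (lam p z) (lamb p z) (log1 p z) (log2 p z))"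
      by (auto simp: fun_eq_iff flatP_at_def flatQ_at_def k_def)
    then show "fam (UNIV \<times> ann R) ?P P1" "fam (UNIV \<times> ann R) ?Q Q1" using fP' fQ' by simp_all
  qed
  have V: "teq (Vform p \<alpha>) (Triple (\<lambda>z. - fn \<alpha> z / 2 - deriv (fn \<alpha>) z * wf p z / deriv (wf p) z) (- cv \<alpha> / 2) (cu \<alpha> / 2))"
    by (rule Vform_eq[OF p alpha_analytic(2)])
  have form: "fn (flat_form p (k t) (exp t)) z = plus_part (?P t) z + (?Q t z - plus_part (?Q t) z)"
    "cv (flat_form p (k t) (exp t)) = cmean (\<lambda>z. ?Q t z - ?P t z)"
    "cu (flat_form p (k t) (exp t)) = exp (uc p) * lcoeff (\<lambda>z. ?Q t z - ?P t z) 1 + C2 t" for t z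
    by (simp_all add: flat_form_def trunc_form_def lcoeff_1 ks)
  have 1: "((\<lambda>t. fn (flat_form p (k t) (exp t)) z) has_field_derivative
      exp s * (fn (Uop p \<alpha>) z + (- 1 / exp s) * fn (Vform p \<alpha>) z)) (at s)" if z: "z \<in> sphere 0 1" for z
  proof -
    have "((\<lambda>t. plus_part (?P t) z + (?Q t z - plus_part (?Q t) z)) has_field_derivative
        plus_part (P1 s) z + (Q1 s z - plus_part (Q1 s) z)) (at s)"
      by (intro DERIV_add DERIV_diff fam_ltrunc[OF fP W z] fam_ltrunc[OF fQ W z] famD(4)[OF fQ])
         (use sphere_subset_ann[OF R1] z in auto)
    also have "plus_part (P1 s) z + (Q1 s z - plus_part (Q1 s) z) = plus_part ?P' z + minus_part ?Q' z"
      using plus_part_cong[of "P1 s" ?P' z] plus_part_cong[of "Q1 s" ?Q' z] P1 Q1 z by simp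
    also have "\<dots> = exp s * fn (Uop p \<alpha>) z + fn \<alpha> z / 2 + deriv (fn \<alpha>) z * wf p z / deriv (wf p) z" by (rule scaling_fn[OF z])
    also have "\<dots> = exp s * (fn (Uop p \<alpha>) z + (- 1 / exp s) * fn (Vform p \<alpha>) z)"
      using V z by (simp add: teq_def distrib_left right_diff_distrib)
    finally show ?thesis unfolding form .
  qed
  note fQP = fam_diff[OF fQ fP]
  have 2: "((\<lambda>t. cv (flat_form p (k t) (exp t))) has_field_derivative
      exp s * (cv (Uop p \<alpha>) + (- 1 / exp s) * cv (Vform p \<alpha>))) (at s)"
  proof -
    have "cmean (\<lambda>z. Q1 s z - P1 s z) = exp s * cv (Uop p \<alpha>) + cv \<alpha> / 2"
      unfolding scaling_cv[symmetric] by (rule cmean_cong) (simp add: P1 Q1)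
    also have "\<dots> = exp s * (cv (Uop p \<alpha>) + (- 1 / exp s) * cv (Vform p \<alpha>))"
      using V by (simp add: teq_def distrib_left)
    finally show ?thesis unfolding form using fam_cmean[OF fQP W] by simp
  qed
  have 3: "((\<lambda>t. cu (flat_form p (k t) (exp t))) has_field_derivative
      exp s * (cu (Uop p \<alpha>) + (- 1 / exp s) * cu (Vform p \<alpha>))) (at s)"
  proof -
    have "((\<lambda>t. exp (uc p) * lcoeff (\<lambda>z. ?Q t z - ?P t z) 1 + C2 t) has_field_derivative
       exp (uc p) * lcoeff (\<lambda>z. Q1 s z - P1 s z) 1 + (- C2 s / 2)) (at s)"
      by (intro DERIV_add DERIV_cmult fam_lcoeff_1[OF fQP W] C2)
    also have "lcoeff (\<lambda>z. Q1 s z - P1 s z) 1 = cmean (\<lambda>z. (?Q' z - ?P' z) / z)"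
      unfolding lcoeff_1 by (rule cmean_cong) (simp add: P1 Q1)
    also have "exp (uc p) * cmean (\<lambda>z. (?Q' z - ?P' z) / z) + (- C2 s / 2) = exp s * cu (Uop p \<alpha>) - cu \<alpha> / 2"
      using scaling_cu by (simp only: e_def ks)
    also have "\<dots> = exp s * (cu (Uop p \<alpha>) + (- 1 / exp s) * cu (Vform p \<alpha>))"
    proof -
      have c: "cu (Vform p \<alpha>) = cu \<alpha> / 2" using V unfolding teq_def by simp
      show ?thesis unfolding c by (simp add: right_diff_distrib)
    qed
    finally show ?thesis unfolding form .
  qed
  show ?thesis
    using 1 2 3 unfolding has_triple_derivative_def k_def[symmetric] kd al
    by (simp add: tadd_def tscale_def k_def)
qed

lemma is_differential_unique:
  assumes "is_differential f p \<alpha>" "is_differential f p \<beta>"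
  shows "teq \<alpha> \<beta>"
proof (rule pair_nondegenerate)
  fix X assume "X \<in> triples"
  then show "pair \<alpha> X = pair \<beta> X"
    using assms DERIV_unique unfolding is_differential_def by blast
qed (use assms in \<open>auto simp: is_differential_def\<close>)

lemma differential_eq:
  assumes "is_differential f p \<alpha>"
  shows "teq (differential f p) \<alpha>" "differential f p \<in> triples"
proof -
  have d: "is_differential f p (differential f p)" unfolding differential_def by (rule someI[where P = "is_differential f p", OF assms])
  show "teq (differential f p) \<alpha>" by (rule is_differential_unique[OF d assms])
  show "differential f p \<in> triples" using d by (simp add: is_differential_def)
qed

lemma is_differential_cong:
  assumes "is_differential f p \<alpha>" "\<And>q. q \<in> MW \<Longrightarrow> g q = f q" "p \<in> MW"
  shows "is_differential g p \<alpha>"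
  unfolding is_differential_def
proof (intro conjI ballI)
  show "\<alpha> \<in> triples" using assms(1) by (simp add: is_differential_def)
  fix X assume X: "X \<in> triples"
  show "((\<lambda>\<epsilon>. g (move p X \<epsilon>)) has_field_derivative pair \<alpha> X) (at 0)"
  proof (rule has_field_derivative_eventually)
    show "((\<lambda>\<epsilon>. f (move p X \<epsilon>)) has_field_derivative pair \<alpha> X) (at 0)"
      using assms(1) X by (simp add: is_differential_def)
    show "eventually (\<lambda>e. g (move p X e) = f (move p X e)) (nhds 0)"
      using move_in_MW[OF assms(3) X] by (rule eventually_mono) (rule assms(2))
  qed
qed

text \<open>At \<open>a = -1\<close> the quotient \<open>w powi (a + 1) / (a + 1)\<close>
  degenerates; its place is taken by the logarithmic block together with a pure exponential. The
  last entry for \<open>Iv\<close> carries the logarithm of \<open>\<zeta>\<close>.\<close>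

fun ycoord_coef :: "idx \<Rightarrow> complex \<Rightarrow> coef" where
  "ycoord_coef (Ix a) s = Coef (a + 1) (- exp ((of_int a + 1/2) * s) / (if a = -1 then 1 else of_int (a + 1)))
     (if a = -1 then - exp (- s / 2) else 0) 0 0"
| "ycoord_coef Iv s = Coef 0 0 (- exp (- s / 2)) (exp (- s / 2)) (2 * s * exp (s / 2))"
| "ycoord_coef Iu s = Coef 0 0 0 0 (exp (s / 2))"

lemma flatF_at_mean:
  assumes p: "p \<in> MW" and x: "x \<noteq> 0"
  shows "cmean (flatF_at p k x) = kG k * cmean (\<lambda>z. (lam p z + lamb p z) powi deg k * exp ((lamb p z - lam p z) / 2 * x))
    + k1 k * cmean (\<lambda>z. exp (- lam p z * x) * (log1 p z + Ein (- lam p z * x) - 1))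
    + k2 k * cmean (\<lambda>z. exp (lamb p z * x) * (log2 p z - Ein (lamb p z * x) - 1))
    + kU k * cmean (\<lambda>z. (exp (lamb p z * x) - 1) / x)"
proof -
  have Ec: "continuous_on UNIV Ein"
    using Ein_deriv by (intro continuous_at_imp_continuous_on ballI) (auto intro: DERIV_isCont)
  note c = lam_analytic[OF MWD(1)[OF p], THEN analytic_imp_continuous_sphere]
    log_parts_analytic(3,4)[OF p, THEN analytic_imp_continuous_sphere]
  have Ein: "continuous_on (sphere 0 1) (\<lambda>z. Ein (f z))" if "continuous_on (sphere 0 1) f" for f
    by (rule continuous_on_compose2[OF Ec that]) auto
  have nz: "lam p z + lamb p z \<noteq> 0" if "z \<in> sphere 0 1" for z using MW_nz[OF p that] by blast
  have 1: "continuous_on (sphere 0 1) (\<lambda>z. kG k * ((lam p z + lamb p z) powi deg k * exp ((lamb p z - lam p z) / 2 * x)))"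
    "continuous_on (sphere 0 1) (\<lambda>z. k1 k * (exp (- lam p z * x) * (log1 p z + Ein (- lam p z * x) - 1)))"
    "continuous_on (sphere 0 1) (\<lambda>z. k2 k * (exp (lamb p z * x) * (log2 p z - Ein (lamb p z * x) - 1)))"
    "continuous_on (sphere 0 1) (\<lambda>z. kU k * ((exp (lamb p z * x) - 1) / x))"
    using nz x by (auto intro!: continuous_intros c Ein)
  show ?thesis
    unfolding flatF_at_def[abs_def] flatF_def expo_mid_def log_block1_def log_block2_def
    unfolding cmean_add[OF continuous_on_add[OF continuous_on_add[OF 1(1,2)] 1(3)] 1(4)]
      cmean_add[OF continuous_on_add[OF 1(1,2)] 1(3)] cmean_add[OF 1(1,2)] cmean_cmult ..
qed

lemma ycoord_mean:
  assumes p: "p \<in> MW"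
  shows "ycoord i p s = cmean (flatF_at p (ycoord_coef i s) (exp s))"
proof -
  have b: "cmean (flatF_at p (ycoord_coef i s) (exp s)) = kG (ycoord_coef i s) * cmean (\<lambda>z. (lam p z + lamb p z) powi deg (ycoord_coef i s) * exp ((lamb p z - lam p z) / 2 * exp s))
    + k1 (ycoord_coef i s) * cmean (\<lambda>z. exp (- lam p z * exp s) * (log1 p z + Ein (- lam p z * exp s) - 1))
    + k2 (ycoord_coef i s) * cmean (\<lambda>z. exp (lamb p z * exp s) * (log2 p z - Ein (lamb p z * exp s) - 1))
    + kU (ycoord_coef i s) * cmean (\<lambda>z. (exp (lamb p z * exp s) - 1) / exp s)"
    by (rule flatF_at_mean[OF p]) simp
  have Ec: "continuous_on UNIV Ein"
    using Ein_deriv by (intro continuous_at_imp_continuous_on ballI) (auto intro: DERIV_isCont)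
  note c = lam_analytic[OF MWD(1)[OF p], THEN analytic_imp_continuous_sphere]
    log_parts_analytic(3,4)[OF p, THEN analytic_imp_continuous_sphere]
  have Ein: "continuous_on (sphere 0 1) (\<lambda>z. Ein (f z))" if "continuous_on (sphere 0 1) f" for f
    by (rule continuous_on_compose2[OF Ec that]) auto
  show ?thesis
  proof (cases i)
    case (Ix a)
    show ?thesis
    proof (cases "a = -1")
      case True
      have T: "theta i p (exp s) = - (cmean (\<lambda>z. exp (- lam p z * exp s) * (log1 p z + Ein (- lam p z * exp s) - 1))
          + cmean (\<lambda>z. exp ((lamb p z - lam p z) / 2 * exp s)))"
        unfolding Ix True theta.simps
        by (simp, subst cmean_add) (auto intro!: continuous_intros c Ein)
      have K: "ycoord_coef i s = Coef 0 (- exp (- s / 2)) (- exp (- s / 2)) 0 0" by (simp add: Ix True)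
      have Y: "ycoord i p s = exp (- s / 2) * theta i p (exp s)"
        unfolding Ix True ycoord.simps by simp
      show ?thesis
        unfolding Y T K b[unfolded K coef.sel] by (simp add: right_diff_distrib)
    next
      case False
      have T: "theta i p (exp s) = - (1 / of_int (a + 1) * cmean (\<lambda>z. (lam p z + lamb p z) powi (a + 1) * exp ((lamb p z - lam p z) / 2 * exp s)))"
        unfolding cmean_cmult[symmetric] Ix using False by simp
      have K: "ycoord_coef i s = Coef (a + 1) (- exp ((of_int a + 1/2) * s) / of_int (a + 1)) 0 0 0" using False by (simp add: Ix)
      have Y: "ycoord i p s = exp ((of_int a + 1/2) * s) * theta i p (exp s)" unfolding Ix by simp
      show ?thesis unfolding Y T K b[unfolded K coef.sel] by simp
    qed
  next
    case Iv
    have T: "theta i p (exp s) = - cmean (\<lambda>z. exp (- lam p z * exp s) * (log1 p z + Ein (- lam p z * exp s) - 1))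
        + cmean (\<lambda>z. exp (lamb p z * exp s) * (log2 p z - Ein (lamb p z * exp s) - 1))"
      unfolding Iv theta.simps mult_minus_left cmean_uminus[symmetric]
      by (rule cmean_add) (auto intro!: continuous_intros c Ein)
    have K: "ycoord_coef i s = Coef 0 0 (- exp (- s / 2)) (exp (- s / 2)) (2 * s * exp (s / 2))" by (simp add: Iv)
    have E: "exp (1 / 2 * s) * (1 / exp s) = exp (- s / 2)"
      by (simp add: exp_minus inverse_eq_divide field_simps flip: exp_add)
    have "ycoord i p s = (exp (1 / 2 * s) * (1 / exp s)) * theta i p (exp s)
        + 2 * s * exp (s / 2) * cmean (\<lambda>z. (exp (lamb p z * exp s) - 1) / exp s)"
      unfolding Iv ycoord.simps theta.simps(3) by (simp add: distrib_left)
    then have Y: "ycoord i p s = exp (- s / 2) * theta i p (exp s)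
        + 2 * s * exp (s / 2) * cmean (\<lambda>z. (exp (lamb p z * exp s) - 1) / exp s)" unfolding E .
    have alg: "m * (- A + B) + q * C = 0 * D + - m * A + m * B + q * C" for m q A B C D :: complex
      by (simp add: algebra_simps)
    show ?thesis unfolding Y T K b[unfolded K coef.sel] by (rule alg)
  next
    case Iu
    have K: "ycoord_coef i s = Coef 0 0 0 0 (exp (s / 2))" by (simp add: Iu)
    have Y: "ycoord i p s = exp (s / 2) * cmean (\<lambda>z. (exp (lamb p z * exp s) - 1) / exp s)" unfolding Iu by simp
    show ?thesis unfolding Y K b[unfolded K coef.sel] by simp
  qed
qed

lemma ycoord_coef_deriv:
  obtains n G C1 C2 U where "ycoord_coef i = (\<lambda>s. Coef n (G s) (C1 s) (C2 s) (U s))"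
    "\<And>s. (G has_field_derivative (of_int n - 1 / 2) * G s) (at s)"
    "\<And>s. (C1 has_field_derivative - C1 s / 2) (at s)"
    "\<And>s. (C2 has_field_derivative - C2 s / 2) (at s)"
    "\<And>s. (U has_field_derivative U s / 2 + 2 * exp s * C2 s) (at s)"
proof (cases i)
  case (Ix a)
  have nz: "complex_of_int a + 1 \<noteq> 0" if "a \<noteq> -1"
    using that by (metis add_eq_0_iff2 of_int_1 of_int_eq_iff of_int_minus)
  have g: "((\<lambda>s. - exp (b * s) / c) has_field_derivative b' * (- exp (b * s) / c)) (at s)" if "b' = b" for b b' c s :: complex
  proof -
    have "((\<lambda>s. (- 1 / c) * exp (b * s)) has_field_derivative (- 1 / c) * (exp (b * s) * b)) (at s)"
      by (intro DERIV_cmult) (auto intro!: derivative_eq_intros)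
    then show ?thesis using that by (simp add: mult_ac)
  qed
  show ?thesis
    by (rule that[of "a + 1" "\<lambda>s. - exp ((of_int a + 1/2) * s) / (if a = -1 then 1 else of_int (a + 1))"
          "\<lambda>s. if a = -1 then - exp (- s / 2) else 0" "\<lambda>s. 0" "\<lambda>s. 0"])
       (use nz in \<open>auto simp: Ix intro!: derivative_eq_intros g\<close>)
next
  case Iv
  \<comment> \<open>With this identity, differentiating the factor \<open>s\<close> of
    \<open>2 * s * exp (s / 2)\<close> gives exactly the inhomogeneity
    \<open>2 * exp s * C2 s\<close>.\<close>
  have "exp (- s / 2) * exp s = exp (s / 2)" for s :: complex by (simp flip: exp_add)
  then show ?thesis
    by (intro that[of 0 "\<lambda>s. 0" "\<lambda>s. - exp (- s / 2)" "\<lambda>s. exp (- s / 2)" "\<lambda>s. 2 * s * exp (s / 2)"])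
       (auto simp: Iv intro!: derivative_eq_intros simp: field_simps)
next
  case Iu
  show ?thesis
    by (rule that[of 0 "\<lambda>s. 0" "\<lambda>s. 0" "\<lambda>s. 0" "\<lambda>s. exp (s / 2)"])
       (auto simp: Iu intro!: derivative_eq_intros)
qed

lemma ycoord_differential:
  assumes "p \<in> MW"
  shows "is_differential (\<lambda>q. ycoord i q s) p (flat_form p (ycoord_coef i s) (exp s))"
  by (rule is_differential_cong[OF flatF_at_differential[OF assms] ycoord_mean assms]) auto

lemma dform_ycoord:
  assumes "p \<in> MW"
  shows "teq (dform (ycoord i) p s) (flat_form p (ycoord_coef i s) (exp s))" "dform (ycoord i) p s \<in> triples"
  unfolding dform_def using differential_eq[OF ycoord_differential[OF assms]] by blast+

lemma lam_pt_eq: "pt_eq p q \<Longrightarrow> lam p = lam q \<and> lamb p = lamb q"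
proof -
  assume "pt_eq p q"
  then have "\<And>z. z \<in> sphere 0 1 \<Longrightarrow> wf p z = wf q z" "vc p = vc q" "uc p = uc q" by (auto simp: pt_eq_def)
  then show ?thesis using ltrunc_cong[of "wf p" "wf q"] by (auto simp: lam_def lamb_def fun_eq_iff)
qed

lemma theta_pt_eq:
  assumes "pt_eq p q"
  shows "theta i p \<zeta> = theta i q \<zeta>"
proof -
  have l: "lam p = lam q" "lamb p = lamb q" using lam_pt_eq[OF assms] by auto
  then have "log_lam_z p = log_lam_z q" "log_z_lamb p = log_z_lamb q"
    using assms by (simp_all add: log_lam_z_def log_z_lamb_def pt_eq_def)
  then have L: "log1 p z = log1 q z" "log2 p z = log2 q z" if "z \<in> sphere 0 1" for z
    using that assms by (simp_all add: log1_def log2_def pt_eq_def)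
  show ?thesis
    by (cases i) (auto simp: l L intro!: cmean_cong)
qed

lemma ycoord_pt_eq: "pt_eq p q \<Longrightarrow> ycoord i p = ycoord i q"
  by (cases i) (auto simp: fun_eq_iff theta_pt_eq simp del: theta.simps)

lemma christoffel_teq:
  assumes "teq \<alpha> \<beta>" "\<alpha> \<in> triples" "\<beta> \<in> triples"
  shows "teq (christoffel p X \<alpha>) (christoffel p X \<beta>)"
  using deriv_eq_sphere[of "fn \<alpha>" "fn \<beta>"] assms by (auto simp: teq_def christoffel_def triples_def)

lemma Cop_teq:
  assumes "teq \<alpha> \<beta>"
  shows "teq (Cop p X \<alpha>) (Cop p X \<beta>)"
proof -
  have f: "fn \<alpha> z = fn \<beta> z" if "z \<in> sphere 0 1" for z using assms that by (simp add: teq_def)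
  have c: "cv \<alpha> = cv \<beta>" "cu \<alpha> = cu \<beta>" using assms by (auto simp: teq_def)
  have l: "ltrunc K (\<lambda>t. g t * fn \<alpha> t) = ltrunc K (\<lambda>t. g t * fn \<beta> t)" for K g
    by (rule ltrunc_cong) (simp add: f)
  have "lcoeff (\<lambda>t. fn X t * fn \<alpha> t) 0 = lcoeff (\<lambda>t. fn X t * fn \<beta> t) 0"
    "lcoeff (\<lambda>t. exp (uc p) * (fn X t + zwp p t * cu X) * (fn \<alpha> t + cv \<alpha>)) 1
     = lcoeff (\<lambda>t. exp (uc p) * (fn X t + zwp p t * cu X) * (fn \<beta> t + cv \<beta>)) 1"
    by (rule lcoeff_cong, simp add: f c)+
  then show ?thesis using f unfolding teq_def Cop_def Let_def by (simp add: l c)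
qed

text \<open>Plain equality holds, because the two Hilbert choices have the same defining
  predicate.\<close>

lemma Vform_teq:
  assumes "teq \<alpha> \<beta>" "\<alpha> \<in> triples" "\<beta> \<in> triples"
  shows "Vform p \<alpha> = Vform p \<beta>"
  unfolding Vform_def using assms(1) by (simp add: pair_commute[of \<alpha>] pair_commute[of \<beta>] pair_teq[OF assms(1)])

lemma has_triple_derivative_teq:
  assumes "has_triple_derivative F D a" "eventually (\<lambda>t. teq (F' t) (F t)) (nhds a)" "teq D D'"
  shows "has_triple_derivative F' D' a"
  unfolding has_triple_derivative_def
proof (intro conjI ballI)
  show "((\<lambda>t. fn (F' t) z) has_field_derivative fn D' z) (at a)" if "z \<in> sphere 0 1" for z
  proof (rule has_field_derivative_eventually)
    show "((\<lambda>t. fn (F t) z) has_field_derivative fn D' z) (at a)"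
      using assms(1,3) that by (simp add: has_triple_derivative_def teq_def)
    show "eventually (\<lambda>t. fn (F' t) z = fn (F t) z) (nhds a)"
      using assms(2) by (rule eventually_mono) (use that in \<open>simp add: teq_def\<close>)
  qed
  show "((\<lambda>t. cv (F' t)) has_field_derivative cv D') (at a)"
  proof (rule has_field_derivative_eventually)
    show "((\<lambda>t. cv (F t)) has_field_derivative cv D') (at a)"
      using assms(1,3) by (simp add: has_triple_derivative_def teq_def)
    show "eventually (\<lambda>t. cv (F' t) = cv (F t)) (nhds a)"
      using assms(2) by (rule eventually_mono) (simp add: teq_def)
  qed
  show "((\<lambda>t. cu (F' t)) has_field_derivative cu D') (at a)"
  proof (rule has_field_derivative_eventually)
    show "((\<lambda>t. cu (F t)) has_field_derivative cu D') (at a)"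
      using assms(1,3) by (simp add: has_triple_derivative_def teq_def)
    show "eventually (\<lambda>t. cu (F' t) = cu (F t)) (nhds a)"
      using assms(2) by (rule eventually_mono) (simp add: teq_def)
  qed
qed

lemma teq_sym: "teq X Y \<Longrightarrow> teq Y X"
  by (simp add: teq_def)

lemma teq_trans: "teq X Y \<Longrightarrow> teq Y Z \<Longrightarrow> teq X Z"
  by (simp add: teq_def)

lemma tadd_teq: "teq X X' \<Longrightarrow> teq Y Y' \<Longrightarrow> teq (tadd X Y) (tadd X' Y')"
  by (simp add: teq_def tadd_def)

lemma tscale_teq: "teq X X' \<Longrightarrow> teq (tscale c X) (tscale c X')"
  by (simp add: teq_def tscale_def)

text \<open>\<open>dform\<close> is a Hilbert choice and agrees with the explicit
  \<open>flat_form\<close> only on the circle. Both equations are therefore proved for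
  \<open>flat_form\<close> and transported, each operator respecting \<open>teq\<close>.\<close>

lemma ycoord_deformed_flat: "deformed_flat (ycoord i)"
  unfolding deformed_flat_def
proof (intro conjI ballI allI impI)
  show "ycoord i p = ycoord i q" if "pt_eq p q" for p q using that by (rule ycoord_pt_eq)
  fix p s assume p: "p \<in> MM"
  then have pW: "p \<in> MW" using MM_subset_MW by blast
  show "\<exists>\<alpha>. is_differential (\<lambda>q. ycoord i q s) p \<alpha>" using ycoord_differential[OF pW] by blast
  note d = dform_ycoord[OF pW, of i s] and f = flat_form_triples[OF pW, of "ycoord_coef i s" "exp s"]
  show "has_triple_derivative (\<lambda>\<epsilon>. dform (ycoord i) (move p X \<epsilon>) s)
     (tadd (christoffel p X (dform (ycoord i) p s)) (tscale (exp s) (Cop p X (dform (ycoord i) p s)))) 0"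
    if X: "X \<in> triples" for X
  proof (rule has_triple_derivative_teq[OF flat_form_move[OF p X]])
    show "eventually (\<lambda>t. teq (dform (ycoord i) (move p X t) s) (flat_form (move p X t) (ycoord_coef i s) (exp s))) (nhds 0)"
      using move_in_MW[OF pW X] by (rule eventually_mono) (rule dform_ycoord(1))
    show "teq (tadd (christoffel p X (flat_form p (ycoord_coef i s) (exp s))) (tscale (exp s) (Cop p X (flat_form p (ycoord_coef i s) (exp s)))))
      (tadd (christoffel p X (dform (ycoord i) p s)) (tscale (exp s) (Cop p X (dform (ycoord i) p s))))"
      by (intro tadd_teq tscale_teq christoffel_teq Cop_teq teq_sym[OF d(1)] d f)
  qed simp
  obtain n G C1 C2 U where k: "ycoord_coef i = (\<lambda>s. Coef n (G s) (C1 s) (C2 s) (U s))"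
    "\<And>s. (G has_field_derivative (of_int n - 1 / 2) * G s) (at s)"
    "\<And>s. (C1 has_field_derivative - C1 s / 2) (at s)"
    "\<And>s. (C2 has_field_derivative - C2 s / 2) (at s)"
    "\<And>s. (U has_field_derivative U s / 2 + 2 * exp s * C2 s) (at s)"
    by (rule ycoord_coef_deriv[of i]) (rule that; assumption)
  show "has_triple_derivative (dform (ycoord i) p)
     (tscale (exp s) (tadd (Uop p (dform (ycoord i) p s)) (tscale (- 1 / exp s) (Vform p (dform (ycoord i) p s))))) s"
  proof (rule has_triple_derivative_teq[OF flat_form_scaling[OF p k(2-5)]])
    show "eventually (\<lambda>t. teq (dform (ycoord i) p t) (flat_form p (Coef n (G t) (C1 t) (C2 t) (U t)) (exp t))) (nhds s)"
      using dform_ycoord(1)[OF pW, of i] unfolding k(1) by simp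
    note d = d[unfolded k(1)] and f = f[unfolded k(1)]
    show "teq (tscale (exp s) (tadd (Uop p (flat_form p (Coef n (G s) (C1 s) (C2 s) (U s)) (exp s)))
         (tscale (- 1 / exp s) (Vform p (flat_form p (Coef n (G s) (C1 s) (C2 s) (U s)) (exp s))))))
      (tscale (exp s) (tadd (Uop p (dform (ycoord i) p s)) (tscale (- 1 / exp s) (Vform p (dform (ycoord i) p s)))))"
      unfolding Vform_teq[OF d(1) d(2) f] Uop_def
      by (intro tscale_teq tadd_teq Cop_teq teq_sym[OF d(1)]) (simp add: teq_def)
  qed
qed

section \<open>Independence\<close>

lemma cmean_sum:
  assumes "finite A" "\<And>i. i \<in> A \<Longrightarrow> continuous_on (sphere 0 1) (P i)"
  shows "cmean (\<lambda>z. \<Sum>i\<in>A. c i * P i z) = (\<Sum>i\<in>A. c i * cmean (P i))"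
  using assms
proof (induction A)
  case (insert i A)
  then have "cmean (\<lambda>z. c i * P i z + (\<Sum>i\<in>A. c i * P i z)) = cmean (\<lambda>z. c i * P i z) + cmean (\<lambda>z. \<Sum>i\<in>A. c i * P i z)"
    by (intro cmean_add continuous_intros) auto
  then show ?case using insert by (simp add: cmean_cmult)
qed simp

lemma plus_part_sum:
  assumes "finite A" "\<And>i. i \<in> A \<Longrightarrow> P i analytic_on sphere 0 1" "z \<in> sphere 0 1"
  shows "plus_part (\<lambda>z. \<Sum>i\<in>A. c i * P i z) z = (\<Sum>i\<in>A. c i * plus_part (P i) z)"
  using assms
proof (induction A)
  case empty
  then show ?case by (simp add: plus_part_in[OF extends_in_const])
next
  case (insert i A)
  have "plus_part (\<lambda>z. c i * P i z + 1 * (\<Sum>i\<in>A. c i * P i z)) z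
      = c i * plus_part (P i) z + 1 * plus_part (\<lambda>z. \<Sum>i\<in>A. c i * P i z) z"
    by (rule plus_part_lin) (use insert.prems in \<open>auto intro!: analytic_intros\<close>)
  then show ?case using insert by simp
qed

lemma trunc_form_sum:
  assumes A: "finite A" and P: "\<And>i. i \<in> A \<Longrightarrow> P i analytic_on sphere 0 1"
    and Q: "\<And>i. i \<in> A \<Longrightarrow> Q i analytic_on sphere 0 1"
  shows "teq (tcomb A c (\<lambda>i. trunc_form p (P i) (Q i) (r i)))
    (trunc_form p (\<lambda>z. \<Sum>i\<in>A. c i * P i z) (\<lambda>z. \<Sum>i\<in>A. c i * Q i z) (\<Sum>i\<in>A. c i * r i))"
proof -
  have d: "(\<Sum>i\<in>A. c i * Q i z) - (\<Sum>i\<in>A. c i * P i z) = (\<Sum>i\<in>A. c i * (Q i z - P i z))"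
    "((\<Sum>i\<in>A. c i * Q i z) - (\<Sum>i\<in>A. c i * P i z)) / z = (\<Sum>i\<in>A. c i * ((Q i z - P i z) / z))" for z
    by (simp_all add: sum_subtractf right_diff_distrib sum_divide_distrib diff_divide_distrib)
  have m: "cmean (\<lambda>z. (\<Sum>i\<in>A. c i * Q i z) - (\<Sum>i\<in>A. c i * P i z)) = (\<Sum>i\<in>A. c i * cmean (\<lambda>z. Q i z - P i z))"
    "cmean (\<lambda>z. ((\<Sum>i\<in>A. c i * Q i z) - (\<Sum>i\<in>A. c i * P i z)) / z) = (\<Sum>i\<in>A. c i * cmean (\<lambda>z. (Q i z - P i z) / z))"
    unfolding d(2) unfolding d(1) by (rule cmean_sum[OF A], intro continuous_intros analytic_imp_continuous_sphere P Q; use sphere_nonzero in auto)+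
  show ?thesis
    unfolding teq_def trunc_form_def tcomb_def triple.sel m
    using plus_part_sum[OF A P] plus_part_sum[OF A Q]
    by (auto simp: sum_distrib_left sum.distrib sum_subtractf algebra_simps)
qed

lemma flat_data_sum:
  assumes A: "finite A" and p: "p \<in> MM" and x: "x \<noteq> 0"
    and F: "\<And>i. i \<in> A \<Longrightarrow> flat_data p x (P i) (Q i) (S i) (c1 i) (c2 i)"
  shows "flat_data p x (\<lambda>z. \<Sum>i\<in>A. c i * P i z) (\<lambda>z. \<Sum>i\<in>A. c i * Q i z) (\<lambda>z. \<Sum>i\<in>A. c i * S i z)
    (\<Sum>i\<in>A. c i * c1 i) (\<Sum>i\<in>A. c i * c2 i)"
proof (unfold_locales)
  note F' = F[unfolded flat_data_def]
  show "(\<lambda>z. \<Sum>i\<in>A. c i * P i z) analytic_on sphere 0 1" "(\<lambda>z. \<Sum>i\<in>A. c i * Q i z) analytic_on sphere 0 1"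
    "(\<lambda>z. \<Sum>i\<in>A. c i * S i z) analytic_on sphere 0 1"
    using F' by (auto intro!: analytic_intros)
  fix z :: complex assume z: "z \<in> sphere 0 1"
  have D: "deriv (\<lambda>z. \<Sum>i\<in>A. c i * f i z) z = (\<Sum>i\<in>A. c i * deriv (f i) z)"
    if "\<And>i. i \<in> A \<Longrightarrow> f i analytic_on sphere 0 1" for f
    by (intro DERIV_imp_deriv DERIV_sum DERIV_cmult analytic_derivI[OF that z])
  have "z * deriv (\<lambda>z. \<Sum>i\<in>A. c i * P i z) z = (\<Sum>i\<in>A. c i * (z * deriv (P i) z))"
    using F' by (subst D) (auto simp: sum_distrib_left mult_ac)
  also have "\<dots> = (\<Sum>i\<in>A. c i * (S i z * zwp p z - x * (P i z - c1 i / lam p z) * zlam p z))"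
    by (intro sum.cong refl) (use F' z in auto)
  also have "\<dots> = (\<Sum>i\<in>A. c i * S i z) * zwp p z
      - x * ((\<Sum>i\<in>A. c i * P i z) - (\<Sum>i\<in>A. c i * c1 i) / lam p z) * zlam p z"
    by (simp add: sum_distrib_left sum_distrib_right sum_subtractf sum.distrib sum_divide_distrib algebra_simps)
  finally show "z * deriv (\<lambda>z. \<Sum>i\<in>A. c i * P i z) z = \<dots>" .
  have "z * deriv (\<lambda>z. \<Sum>i\<in>A. c i * Q i z) z = (\<Sum>i\<in>A. c i * (z * deriv (Q i) z))"
    using F' by (subst D) (auto simp: sum_distrib_left mult_ac)
  also have "\<dots> = (\<Sum>i\<in>A. c i * (S i z * zwp p z + x * (Q i z + c2 i / lamb p z) * zlamb p z))"
    by (intro sum.cong refl) (use F' z in auto)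
  also have "\<dots> = (\<Sum>i\<in>A. c i * S i z) * zwp p z
      + x * ((\<Sum>i\<in>A. c i * Q i z) + (\<Sum>i\<in>A. c i * c2 i) / lamb p z) * zlamb p z"
    by (simp add: sum_distrib_left sum_distrib_right sum.distrib sum_divide_distrib algebra_simps)
  finally show "z * deriv (\<lambda>z. \<Sum>i\<in>A. c i * Q i z) z = \<dots>" .
qed (use p x in auto)

text \<open>All terms of the left side of \<open>bracket_eq\<close> contain \<open>\<alpha>\<close>,
  so the bracket vanishes along with it; \<open>alpha_deriv\<close> then leaves
  \<open>S * zwp = 0\<close>, and \<open>zwp\<close> has no zeros on the circle.\<close>

lemma (in flat_data) vanishing:
  assumes "teq \<alpha> tzero" and z: "z \<in> sphere 0 1"
  shows "S z = 0"
proof -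
  have a: "\<And>z. z \<in> sphere 0 1 \<Longrightarrow> fn \<alpha> z = 0" "cv \<alpha> = 0" "cu \<alpha> = 0"
    using assms(1) by (auto simp: teq_def tzero_def)
  have "ltrunc {0<..} (\<lambda>t. zwp p t * fn \<alpha> t) z = ltrunc {0<..} (\<lambda>t. 0) z"
    using ltrunc_cong[of "\<lambda>t. zwp p t * fn \<alpha> t" "\<lambda>t. 0"] a(1) by simp
  also have "\<dots> = 0" by (simp add: ltrunc_def lcoeff_def)
  finally have "bracket z = 0" using bracket_eq[OF z] a z by simp
  moreover have "deriv (fn \<alpha>) z = 0"
    using deriv_eq_sphere[OF alpha_analytic(1), of "\<lambda>z. 0"] a(1) z by simp
  ultimately have "S z * zwp p z = 0" using alpha_deriv[OF z] by simp
  then show ?thesis using MM_deriv_nonzero(2)[OF p z] by simp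
qed

text \<open>A finite connected image would be a single point, and a constant \<open>w\<close>
  contradicts the nonvanishing of its derivative.\<close>

lemma wf_image_infinite:
  assumes "p \<in> MM"
  shows "infinite (wf p ` sphere 0 1)"
proof
  assume fin: "finite (wf p ` sphere 0 1)"
  have w: "wf p analytic_on sphere 0 1" using assms by (simp add: MM_def)
  have conn: "connected (wf p ` sphere 0 1)"
    by (rule connected_continuous_image[OF analytic_imp_continuous_sphere[OF w]]) (simp add: connected_sphere)
  from conn fin obtain c where "wf p ` sphere 0 1 = {c}"
    by (metis connected_finite_iff_sing image_is_empty sphere_eq_empty zero_le_one linorder_not_less)
  then have "deriv (wf p) 1 = deriv (\<lambda>z. c) 1"
    by (intro deriv_eq_sphere[OF w]) auto
  then show False using MM_deriv_nonzero(1)[OF assms, of 1] by simp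
qed

text \<open>For fixed \<open>y\<close> the points \<open>f k\<close> are infinitely many solutions
  of \<open>exp (w * x / 2) = y\<close>. There the relation is polynomial in \<open>w\<close>, so
  \<open>P + Q / y + y * R\<close> vanishes identically for every nonzero \<open>y\<close>.\<close>

lemma exp_polynomial_zero:
  fixes P Q R :: "complex poly" and x :: complex
  assumes x: "x \<noteq> 0" and eq: "\<And>w. poly P w + poly Q w * exp (- w * x / 2) + poly R w * exp (w * x / 2) = 0"
  shows "P = 0" "Q = 0" "R = 0"
proof -
  have lin: "P + smult (1 / y) Q + smult y R = 0" if y: "y \<noteq> 0" for y
  proof (rule ccontr)
    assume "P + smult (1 / y) Q + smult y R \<noteq> 0" (is "?T \<noteq> 0")
    then have fin: "finite {w. poly ?T w = 0}" by (rule poly_roots_finite)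
    define f where "f = (\<lambda>k :: nat. 2 * (Ln y + 2 * of_nat k * of_real pi * \<i>) / x)"
    have "poly ?T (f k) = 0" for k
    proof -
      have "f k * x / 2 = Ln y + 2 * of_nat k * of_real pi * \<i>" using x by (simp add: f_def)
      moreover have "exp (2 * of_nat k * of_real pi * \<i>) = (1 :: complex)" unfolding exp_eq_1
        by (intro conjI exI[of _ "int k"]) simp_all
      ultimately have e: "exp (f k * x / 2) = y" by (simp only: exp_add exp_Ln[OF y] mult_1_right)
      have "exp (- f k * x / 2) = 1 / y" unfolding e[symmetric] by (simp add: exp_minus field_simps)
      then show ?thesis using eq[of "f k"] e by (simp add: mult.commute)
    qed
    then have "range f \<subseteq> {w. poly ?T w = 0}" by auto
    moreover have "inj f" by (rule injI) (use x in \<open>simp add: f_def\<close>)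
    ultimately show False using fin finite_subset range_inj_infinite by blast
  qed
  have c: "coeff P n + coeff Q n / y + y * coeff R n = 0" if "y \<noteq> 0" for y n
    using arg_cong[OF lin[OF that], of "\<lambda>p. coeff p n"] by simp
  have "coeff P n = 0 \<and> coeff Q n = 0 \<and> coeff R n = 0" for n
  proof -
    \<comment> \<open>The values \<open>1\<close> and \<open>-1\<close> of \<open>y\<close> force
      \<open>P = 0\<close> and \<open>Q = - R\<close>; the value \<open>2\<close> then separates
      \<open>Q\<close> from \<open>R\<close>.\<close>
    have 1: "coeff P n + coeff Q n + coeff R n = 0" "coeff P n - coeff Q n - coeff R n = 0"
      "coeff P n + coeff Q n / 2 + 2 * coeff R n = 0"
      using c[of 1 n] c[of "-1" n] c[of 2 n] by simp_all
    from 1(1,2) have P: "coeff P n = 0" "coeff Q n = - coeff R n"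
      by (auto simp: algebra_simps add_eq_0_iff2)
    then show ?thesis using 1(3) by simp
  qed
  then show "P = 0" "Q = 0" "R = 0" by (auto intro: poly_eqI)
qed

text \<open>The identity principle carries the equality from the circle to the punctured disc. There
  the exponential of a simple pole is unbounded along a suitable ray, while an extension would be
  continuous at \<open>0\<close>.\<close>

lemma exp_lamb_not_extends:
  assumes p: "p \<in> MW" and x: "x \<noteq> 0"
  shows "\<not> extends_in (\<lambda>z. exp (lamb p z * x)) a"
proof
  assume "extends_in (\<lambda>z. exp (lamb p z * x)) a"
  then obtain F where F: "F analytic_on cball 0 1" "\<And>z. z \<in> sphere 0 1 \<Longrightarrow> exp (lamb p z * x) = F z"
    by (auto simp: extends_in_def)
  obtain H where H: "H analytic_on cball 0 1" "H 0 = exp (uc p)" "\<And>t. t \<noteq> 0 \<Longrightarrow> norm t \<le> 1 \<Longrightarrow> H t = t * lamb p t"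
    using lamb_chart[OF MWD(1)[OF p]] by blast
  obtain R where R: "1 < R" "F holomorphic_on ball 0 R" using cball_ball_nbhd[OF F(1)] .
  obtain R' where R': "1 < R'" "H holomorphic_on ball 0 R'" using cball_ball_nbhd[OF H(1)] .
  define r where "r = min R R'"
  have r: "1 < r" "F holomorphic_on ball 0 r" "H holomorphic_on ball 0 r"
    using R R' by (auto simp: r_def elim!: holomorphic_on_subset)
  note lim = one_islimpt_unit_circle
  have id: "exp (H z / z * x) - F z = 0" if "z \<in> ball 0 r - {0}" for z
  proof (rule analytic_continuation[where f = "\<lambda>z. exp (H z / z * x) - F z" and U = "sphere 0 1" and S = "ball 0 r - {0}" and \<xi> = 1])
    show "(\<lambda>z. exp (H z / z * x) - F z) holomorphic_on ball 0 r - {0}"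
      by (intro holomorphic_intros holomorphic_on_subset[OF r(2)] holomorphic_on_subset[OF r(3)]) auto
    show "connected (ball (0::complex) r - {0})" by (simp add: connected_open_delete)
    show "exp (H z / z * x) - F z = 0" if "z \<in> sphere 0 1" for z
    proof -
      have "H z / z = lamb p z" using H(3)[of z] that sphere_nonzero[OF that] by simp
      then show ?thesis using F(2)[OF that] by simp
    qed
  qed (use r lim that in auto)
  \<comment> \<open>On the ray \<open>z = c * t\<close> the leading term
    \<open>x * exp u / z\<close> of \<open>lamb * x\<close> equals \<open>1 / t\<close>, which is
    real and tends to plus infinity as \<open>t\<close> decreases to \<open>0\<close>.\<close>
  define c where "c = x * exp (uc p)"
  have c: "c \<noteq> 0" using x by (simp add: c_def)
  have tend: "((\<lambda>t. c * of_real t) \<longlongrightarrow> (0::complex)) (at_right 0)"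
    by (auto intro!: tendsto_eq_intros)
  have ev: "eventually (\<lambda>t. c * of_real t \<in> ball 0 r - {0}) (at_right (0::real))"
  proof -
    have "eventually (\<lambda>t. c * of_real t \<in> ball 0 r) (at_right (0::real))"
      using r(1) by (intro topological_tendstoD[OF tend]) auto
    then show ?thesis using eventually_at_right_less[of "0::real"] by eventually_elim (use c in auto)
  qed
  have cont: "isCont F 0" "isCont H 0"
    using r holomorphic_on_imp_continuous_on[of F "ball 0 r"] holomorphic_on_imp_continuous_on[of H "ball 0 r"]
    by (auto simp: continuous_on_eq_continuous_at)
  have F0: "((\<lambda>t. norm (F (c * of_real t))) \<longlongrightarrow> norm (F 0)) (at_right 0)"
    by (intro tendsto_norm isCont_tendsto_compose[OF cont(1) tend])
  have "((\<lambda>t. Re (H (c * of_real t) / c * x)) \<longlongrightarrow> Re (H 0 / c * x)) (at_right 0)"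
    by (intro tendsto_intros isCont_tendsto_compose[OF cont(2) tend] c)
  also have "H 0 / c * x = 1" using x by (simp add: c_def H(2))
  finally have "filterlim (\<lambda>t. Re (H (c * of_real t) / c * x) * inverse t) at_top (at_right 0)"
    by (intro filterlim_tendsto_pos_mult_at_top[OF _ _ filterlim_inverse_at_top_right]) auto
  then have top: "filterlim (\<lambda>t. exp (Re (H (c * of_real t) / c * x) * inverse t)) at_top (at_right 0)"
    by (rule filterlim_compose[OF exp_at_top])
  have same: "eventually (\<lambda>t. exp (Re (H (c * of_real t) / c * x) * inverse t) = norm (F (c * of_real t))) (at_right 0)"
    using ev
  proof (rule eventually_mono)
    fix t assume t: "c * of_real t \<in> ball 0 r - {0}"
    have re: "Re (H (c * of_real t) / c * x) * inverse t = Re (H (c * of_real t) / (c * of_real t) * x)"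
    proof -
      have "H (c * of_real t) / (c * of_real t) * x = H (c * of_real t) / c * x * of_real (inverse t)"
        by (simp add: field_simps)
      moreover have "Re (a * of_real u) = Re a * u" for a u by simp
      ultimately show ?thesis by metis
    qed
    have "F (c * of_real t) = exp (H (c * of_real t) / (c * of_real t) * x)" using id[OF t] by simp
    then show "exp (Re (H (c * of_real t) / c * x) * inverse t) = norm (F (c * of_real t))"
      by (simp only: re norm_exp_eq_Re)
  qed
  have "filterlim (\<lambda>t. norm (F (c * of_real t))) at_top (at_right 0)"
    using filterlim_cong[OF refl refl same] top by blast
  then show False
    using not_tendsto_and_filterlim_at_infinity[OF trivial_limit_at_right_real F0] filterlim_at_top_imp_at_infinity by blast
qed

text \<open>Both \<open>exp (- lam * x)\<close> and \<open>exp (lamb * x)\<close> are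
  \<open>expo_mid\<close> times an exponential of \<open>w\<close> alone. Dividing by
  \<open>expo_mid\<close> leaves a relation in \<open>w\<close>, which extends from the infinite
  compact set \<open>w(S^1)\<close> to the whole plane.\<close>

lemma flatS_at_independent:
  assumes p: "p \<in> MM" and x: "x \<noteq> 0" and A: "finite A"
    and eq: "\<And>z. z \<in> sphere 0 1 \<Longrightarrow> (\<Sum>i\<in>A. c i * flatS_at p (k i) x z) = 0"
    and inj: "inj_on (\<lambda>i. deg (k i)) {i\<in>A. kG (k i) \<noteq> 0}"
  shows "(\<Sum>i\<in>A. c i * k2 (k i)) = 0" "\<And>i. i \<in> A \<Longrightarrow> kG (k i) \<noteq> 0 \<Longrightarrow> c i = 0"
proof -
  have pW: "p \<in> MW" using p MM_subset_MW by blast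
  \<comment> \<open>\<open>N\<close> bounds all degrees in modulus, so multiplication by
    \<open>w ^ (N + 2)\<close> clears every negative power; the extra \<open>2\<close> accounts for
    the exponent \<open>deg - 2\<close>.\<close>
  define N where "N = (\<Sum>i\<in>A. nat \<bar>deg (k i)\<bar>)"
  define m where "m = (\<lambda>i. nat (deg (k i) + int N))"
  have m: "int (m i) = deg (k i) + int N" if "i \<in> A" for i
  proof -
    have "nat \<bar>deg (k i)\<bar> \<le> N" unfolding N_def by (rule member_le_sum) (use that A in auto)
    then have "0 \<le> deg (k i) + int N" by linarith
    then show ?thesis by (simp add: m_def)
  qed
  define K1 where "K1 = (\<Sum>i\<in>A. c i * k1 (k i))"
  define K2 where "K2 = (\<Sum>i\<in>A. c i * k2 (k i))"
  define n where "n = (\<lambda>i. complex_of_int (deg (k i)) * of_int (deg (k i) - 1))"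
  define P where "P = (\<Sum>i\<in>A. smult (c i * kG (k i)) (smult (n i) (monom 1 (m i)) - smult (x\<^sup>2 / 4) (monom 1 (m i + 2))))"
  define Q where "Q = smult (- K1) (monom 1 N * [:1, x:])"
  define R where "R = smult K2 (monom 1 N * [:-1, x:])"
  define f where "f = (\<lambda>w. poly P w + poly Q w * exp (- w * x / 2) + poly R w * exp (w * x / 2))"
  have f0: "f (wf p z) = 0" if z: "z \<in> sphere 0 1" for z
  proof -
    define w where "w = wf p z"
    define E where "E = expo_mid x (lam p z) (lamb p z)"
    have l: "lam p z + lamb p z = w" and w: "w \<noteq> 0"
      using MWD(6)[OF pW z] lam_add_lamb[OF MWD(1)[OF pW] z] by (auto simp: w_def)
    have e: "exp (- lam p z * x) = E * exp (- w * x / 2)" "exp (lamb p z * x) = E * exp (w * x / 2)"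
      unfolding E_def expo_mid_def exp_add[symmetric] l[symmetric] by (simp_all add: field_simps)
    have pw: "w powi (deg (k i) - 2) * w ^ (N + 2) = w ^ m i" "w powi deg (k i) * w ^ (N + 2) = w ^ (m i + 2)" if "i \<in> A" for i
      unfolding power_int_of_nat[symmetric] power_int_add[OF disjI1[OF w], symmetric] of_nat_add m[OF that] by (simp_all add: add.assoc)
    have alg: "(G * ((n * a - y * b) * E) - c1 * ((x / w + 1 / w\<^sup>2) * (E * u)) + c2 * ((x / w - 1 / w\<^sup>2) * (E * v))) * w ^ (N + 2)
        = E * (G * (n * (a * w ^ (N + 2)) - y * (b * w ^ (N + 2))) - c1 * (w ^ N * (1 + w * x)) * u + c2 * (w ^ N * (w * x - 1)) * v)"
      for G n a y b c1 c2 u v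
      using w by (simp add: field_simps power2_eq_square)
    have t: "flatS_at p (k i) x z * w ^ (N + 2) = E * (kG (k i) * (n i * w ^ m i - x\<^sup>2 / 4 * w ^ (m i + 2))
        - k1 (k i) * (w ^ N * (1 + w * x)) * exp (- w * x / 2) + k2 (k i) * (w ^ N * (w * x - 1)) * exp (w * x / 2))" if "i \<in> A" for i
      unfolding flatS_at_def flatS_def l e E_def[symmetric] alg pw[OF that] n_def by (rule refl)
    have "0 = (\<Sum>i\<in>A. c i * flatS_at p (k i) x z) * w ^ (N + 2)" using eq[OF z] by simp
    also have "\<dots> = (\<Sum>i\<in>A. c i * (flatS_at p (k i) x z * w ^ (N + 2)))" by (simp only: sum_distrib_right mult.assoc)
    also have "\<dots> = (\<Sum>i\<in>A. E * (c i * kG (k i) * (n i * w ^ m i - x\<^sup>2 / 4 * w ^ (m i + 2))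
        - c i * k1 (k i) * (w ^ N * (1 + w * x)) * exp (- w * x / 2) + c i * k2 (k i) * (w ^ N * (w * x - 1)) * exp (w * x / 2)))"
      by (intro sum.cong refl) (simp only: t, simp only: ring_distribs mult_ac)
    also have "\<dots> = E * f w"
    proof -
      have sums: "(\<Sum>i\<in>A. E * (a i - b i * B * u + d i * D * v)) = E * (sum a A - sum b A * B * u + sum d A * D * v)"
        for a b d and B D u v
        by (simp only: sum_distrib_left[symmetric] sum.distrib sum_subtractf sum_distrib_right[symmetric])
      have "poly P w = (\<Sum>i\<in>A. c i * kG (k i) * (n i * w ^ m i - x\<^sup>2 / 4 * w ^ (m i + 2)))"
        unfolding P_def poly_sum by (simp add: poly_monom)
      moreover have "poly Q w = - K1 * (w ^ N * (1 + w * x))" "poly R w = K2 * (w ^ N * (w * x - 1))"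
        by (simp_all add: Q_def R_def poly_monom algebra_simps)
      ultimately show ?thesis unfolding f_def sums K1_def K2_def by simp
    qed
    finally show ?thesis using E_def unfolding w_def by (simp add: expo_mid_def)
  qed
  let ?I = "wf p ` sphere 0 1"
  have "compact ?I"
    by (intro compact_continuous_image analytic_imp_continuous_sphere MWD(1)[OF pW]) simp
  then obtain \<xi> where \<xi>: "\<xi> islimpt ?I" using wf_image_infinite[OF p] unfolding compact_eq_Bolzano_Weierstrass by blast
  have "f w = 0" for w
    by (rule analytic_continuation[where S = UNIV and U = ?I and f = f, OF _ _ _ _ _ \<xi>])
       (use f0 in \<open>auto simp: f_def intro!: holomorphic_intros\<close>)
  note zero = exp_polynomial_zero[OF x this[unfolded f_def]]
  \<comment> \<open>At \<open>w = 2 / x\<close> the factor \<open>w * x - 1\<close> equals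
    \<open>1\<close>, so the value is \<open>K2\<close> times a nonzero power.\<close>
  have "poly R (2 / x) = 0" using zero(3) by simp
  then show "(\<Sum>i\<in>A. c i * k2 (k i)) = 0" using x by (simp add: R_def K2_def poly_monom)
  \<comment> \<open>Take an index of largest degree in \<open>B\<close>. Its monomial of exponent
    \<open>m i + 2\<close>, with factor \<open>- x^2 / 4\<close>, is reached by no other term, since
    all other degrees in \<open>B\<close> are strictly smaller.\<close>
  define B where "B = {i\<in>A. kG (k i) \<noteq> 0 \<and> c i \<noteq> 0}"
  have "B = {}"
  proof (rule ccontr)
    assume ne: "B \<noteq> {}"
    have fB: "finite B" using A by (simp add: B_def)
    have "Max ((\<lambda>i. deg (k i)) ` B) \<in> (\<lambda>i. deg (k i)) ` B" using ne fB by (intro Max_in) auto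
    then obtain i where i: "i \<in> B" and Mx: "Max ((\<lambda>i. deg (k i)) ` B) = deg (k i)" by (elim imageE)
    have iA: "i \<in> A" using i by (simp add: B_def)
    have "coeff P (m i + 2) = (\<Sum>j\<in>A. if j = i then - (c i * kG (k i)) * (x\<^sup>2 / 4) else 0)"
      unfolding P_def coeff_sum
    proof (rule sum.cong[OF refl])
      fix j assume j: "j \<in> A"
      show "coeff (smult (c j * kG (k j)) (smult (n j) (monom 1 (m j)) - smult (x\<^sup>2 / 4) (monom 1 (m j + 2)))) (m i + 2)
        = (if j = i then - (c i * kG (k i)) * (x\<^sup>2 / 4) else 0)"
      proof (cases "j \<in> B")
        case True
        have "deg (k j) \<le> deg (k i)" unfolding Mx[symmetric] using True fB by simp
        moreover have "deg (k j) \<noteq> deg (k i)" if "j \<noteq> i"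
          using inj_onD[OF inj, of j i] True i that by (auto simp: B_def)
        ultimately have "m j \<le> m i" "j \<noteq> i \<Longrightarrow> m j \<noteq> m i" using m[OF j] m[OF iA] by linarith+
        then show ?thesis by auto
      next
        case False
        then show ?thesis using i j by (auto simp: B_def)
      qed
    qed
    also have "\<dots> = - (c i * kG (k i)) * (x\<^sup>2 / 4)" using A iA by simp
    finally show False using zero(1) i x by (simp add: B_def)
  qed
  then show "\<And>i. i \<in> A \<Longrightarrow> kG (k i) \<noteq> 0 \<Longrightarrow> c i = 0" by (auto simp: B_def)
qed

lemma dform_independent:
  assumes p: "p \<in> MM" and A: "finite A" and z: "teq (tcomb A c (\<lambda>i. dform (ycoord i) p s)) tzero" and i: "i \<in> A"
  shows "c i = 0"
proof -
  have pW: "p \<in> MW" using p MM_subset_MW by blast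
  let ?x = "exp s"
  let ?P = "\<lambda>i. flatP_at p (ycoord_coef i s) ?x" and ?Q = "\<lambda>i. flatQ_at p (ycoord_coef i s) ?x" and ?S = "\<lambda>i. flatS_at p (ycoord_coef i s) ?x"
  have "teq (tcomb A c (\<lambda>i. dform (ycoord i) p s)) (tcomb A c (\<lambda>i. trunc_form p (?P i) (?Q i) (k2 (ycoord_coef i s))))"
    using dform_ycoord(1)[OF pW] by (simp add: tcomb_def teq_def flat_form_def)
  from teq_trans[OF teq_sym[OF trunc_form_sum[OF A]] teq_trans[OF teq_sym[OF this] z]]
  have t: "teq (trunc_form p (\<lambda>z. \<Sum>i\<in>A. c i * ?P i z) (\<lambda>z. \<Sum>i\<in>A. c i * ?Q i z) (\<Sum>i\<in>A. c i * k2 (ycoord_coef i s))) tzero"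
    using flat_at_analytic[OF pW] by blast
  have x: "?x \<noteq> 0" by simp
  interpret flat_data p ?x "\<lambda>z. \<Sum>i\<in>A. c i * ?P i z" "\<lambda>z. \<Sum>i\<in>A. c i * ?Q i z" "\<lambda>z. \<Sum>i\<in>A. c i * ?S i z"
      "\<Sum>i\<in>A. c i * k1 (ycoord_coef i s)" "\<Sum>i\<in>A. c i * k2 (ycoord_coef i s)"
    by (rule flat_data_sum[OF A p x flat_at_flat_data[OF p x]])
  have S: "(\<Sum>i\<in>A. c i * ?S i z) = 0" if "z \<in> sphere 0 1" for z
    by (rule vanishing[OF _ that]) (use t in \<open>simp add: \<alpha>_def\<close>)
  have g: "kG (ycoord_coef i s) \<noteq> 0 \<longleftrightarrow> (\<exists>a. i = Ix a)" for i
  proof (cases i)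
    case (Ix a)
    have nz: "complex_of_int a + 1 \<noteq> 0" if "a \<noteq> -1"
      using that by (metis add_eq_0_iff2 of_int_1 of_int_eq_iff of_int_minus)
    have "kG (ycoord_coef (Ix a) s) \<noteq> 0" by (cases "a = -1") (simp_all add: nz)
    then show ?thesis unfolding Ix by blast
  qed simp_all
  have inj: "inj_on (\<lambda>i. deg (ycoord_coef i s)) {i\<in>A. kG (ycoord_coef i s) \<noteq> 0}"
    by (rule inj_onI) (auto simp: g)
  have a: "c (Ix a) = 0" if "Ix a \<in> A" for a
    using flatS_at_independent(2)[OF p x A S inj that] g[of "Ix a"] by blast
  \<comment> \<open>Only \<open>Iv\<close> has a nonzero \<open>k2\<close>, so the vanishing of this
    sum is a statement about \<open>c Iv\<close> alone.\<close>
  have "(\<Sum>i\<in>A. c i * k2 (ycoord_coef i s)) = (\<Sum>i\<in>A. if i = Iv then c Iv * exp (- s / 2) else 0)"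
  proof (rule sum.cong[OF refl])
    show "c i * k2 (ycoord_coef i s) = (if i = Iv then c Iv * exp (- s / 2) else 0)" for i by (cases i) auto
  qed
  then have v: "c Iv = 0" if "Iv \<in> A"
    using flatS_at_independent(1)[OF p x A S inj] that A by simp
  have u: "c Iu = 0" if "Iu \<in> A"
  proof (rule ccontr)
    assume cu: "c Iu \<noteq> 0"
    have s: "(\<Sum>i\<in>A. c i * f i) = c Iu * f Iu" for f
    proof -
      have "c i * f i = (if i = Iu then c Iu * f Iu else 0)" if "i \<in> A" for i
        using a v that by (cases i) auto
      then have "(\<Sum>i\<in>A. c i * f i) = (\<Sum>i\<in>A. if i = Iu then c Iu * f Iu else 0)" by (rule sum.cong[OF refl])
      then show ?thesis using A that by simp
    qed
    let ?q = "\<lambda>z. c Iu * (exp (s / 2) * exp (lamb p z * ?x))"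
    have P0: "(\<lambda>z. \<Sum>i\<in>A. c i * ?P i z) = (\<lambda>z. 0)" and Q0: "(\<lambda>z. \<Sum>i\<in>A. c i * ?Q i z) = ?q"
      unfolding s by (simp_all add: flatP_at_def flatQ_at_def flatP_def flatQ_def)
    \<comment> \<open>With \<open>P = 0\<close> the first component of the form is the part of
      \<open>?q\<close> with negative powers. Its vanishing means that \<open>?q\<close>, hence the
      exponential of \<open>lamb\<close>, extends to the disc.\<close>
    have "plus_part ?q z = ?q z" if "z \<in> sphere 0 1" for z
      using t that unfolding P0 Q0 teq_def trunc_form_def tzero_def triple.sel
      by (auto simp: plus_part_in[OF extends_in_const])
    then have "extends_in ?q (cmean ?q)"
      using extends_in_nonneg_part(1)[OF Q[unfolded Q0]] extends_in_cong by (metis (no_types, lifting))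
    then have "extends_in (\<lambda>z. 1 / (c Iu * exp (s / 2)) * ?q z) (1 / (c Iu * exp (s / 2)) * cmean ?q)"
      by (intro extends_in_mult extends_in_const)
    then show False using exp_lamb_not_extends[OF pW x] cu by simp
  qed
  show ?thesis using a v u i by (cases i) auto
qed

section \<open>The Levelt factorization\<close>

lemma w_curve:
  assumes p: "p \<in> MW" and X: "X \<in> triples"
  obtains W where "{0} \<times> sphere 0 1 \<subseteq> W" "fam W (\<lambda>e. wf p) (\<lambda>e z. 0)" "fam W (\<lambda>e z. e * fn X z) (\<lambda>e z. fn X z)"
    "fam W (\<lambda>e. lw p) (\<lambda>e z. 0)" "\<forall>e z. (e, z) \<in> W \<longrightarrow> norm (e * fn X z) < norm (wf p z)"
proof -
  have "\<exists>R>1. \<forall>f\<in>set [fn X, wf p, lw p]. f holomorphic_on ann R"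
    by (rule common_ann) (use X MWD(1,2)[OF p] in \<open>auto simp: triples_def\<close>)
  then obtain R where R: "1 < R" "fn X holomorphic_on ann R" "wf p holomorphic_on ann R" "lw p holomorphic_on ann R" by auto
  let ?V = "(UNIV :: complex set) \<times> ann R"
  have V: "open ?V" by (auto intro!: open_Times)
  have fx: "fam ?V (\<lambda>e. g) (\<lambda>e z. 0)" if "g holomorphic_on ann R" for g
    by (rule fam_fixed[OF that V]) simp
  have d: "fam ?V (\<lambda>e z. e * fn X z) (\<lambda>e z. fn X z)"
    by (rule fam_deriv_cong[OF fam_mult[OF fam_param[OF DERIV_ident V] fx[OF R(2)]]]) simp
  define W where "W = {(e, z). (e, z) \<in> ?V \<and> norm (e * fn X z) < norm (wf p z)}"
  have W: "open W" "W \<subseteq> ?V" unfolding W_def by (intro fam_open_Collect[OF d fx[OF R(3)]], auto)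
  show ?thesis
    by (rule that[of W]; (intro fam_subset[OF _ W] fx d R)?)
       (use sphere_subset_ann[OF R(1)] MWD(6)[OF p] in \<open>auto simp: W_def\<close>)
qed

text \<open>The formula covers \<open>a = 0\<close> as well: the differential of minus the mean of
  \<open>log (w / z)\<close> is given by \<open>- 1 / w\<close>.\<close>

fun dtcoord :: "pt \<Rightarrow> idx \<Rightarrow> triple" where
  "dtcoord p (Ix a) = Triple (\<lambda>z. - (wf p z powi (- a - 1))) 0 0"
| "dtcoord p Iv = Triple (\<lambda>z. 0) 1 0"
| "dtcoord p Iu = Triple (\<lambda>z. 0) 0 1"

lemma tcoord_differential:
  assumes p: "p \<in> MW"
  shows "is_differential (tcoord i) p (dtcoord p i)"
  unfolding is_differential_def
proof (intro conjI ballI)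
  show "dtcoord p i \<in> triples"
    using MWD(1,6)[OF p] by (cases i) (auto simp: triples_def intro!: analytic_intros)
  fix X assume X: "X \<in> triples"
  show "((\<lambda>\<epsilon>. tcoord i (move p X \<epsilon>)) has_field_derivative pair (dtcoord p i) X) (at 0)"
  proof (cases i)
    case (Ix a)
    obtain W where W: "{0} \<times> sphere 0 1 \<subseteq> W" "fam W (\<lambda>e. wf p) (\<lambda>e z. 0)" "fam W (\<lambda>e z. e * fn X z) (\<lambda>e z. fn X z)"
      "fam W (\<lambda>e. lw p) (\<lambda>e z. 0)" and small': "\<forall>e z. (e, z) \<in> W \<longrightarrow> norm (e * fn X z) < norm (wf p z)"
      using w_curve[OF p X] .
    note small = small'[rule_format]
    show ?thesis
    proof (cases "a = 0")
      case True
      have "((\<lambda>e. - cmean (\<lambda>z. lw p z + Ln (1 + e * fn X z / wf p z))) has_field_derivative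
          - cmean (\<lambda>z. 0 + fn X z / (wf p z + 0 * fn X z))) (at 0)"
        by (intro DERIV_minus fam_cmean[OF fam_add[OF W(4) fam_Ln_ratio[OF W(3,2) small]] W(1)])
      then show ?thesis using True
        by (simp add: Ix move_def pair_def power_int_minus field_simps flip: cmean_uminus)
    next
      case False
      have nz: "wf p z + e * fn X z \<noteq> 0" if "(e, z) \<in> W" for e z
        using small[OF that] by (metis add_eq_0_iff norm_minus_cancel order_less_irrefl)
      have "((\<lambda>e. cmean (\<lambda>z. 1 / of_int a * (wf p z + e * fn X z) powi (- a))) has_field_derivative
          cmean (\<lambda>z. 1 / of_int a * (of_int (- a) * (wf p z + 0 * fn X z) powi (- a - 1) * (0 + fn X z)))) (at 0)"
        by (rule fam_cmean[OF fam_cmult[OF fam_powi[OF fam_add[OF W(2,3)] nz]] W(1)])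
      then show ?thesis using False by (simp add: Ix move_def pair_def)
    qed
  next
    case Iv
    then show ?thesis by (auto simp: move_def pair_def intro!: derivative_eq_intros)
  next
    case Iu
    then show ?thesis by (auto simp: move_def pair_def intro!: derivative_eq_intros)
  qed
qed

lemma sharp_teq: "teq X Y \<Longrightarrow> teq (sharp p X) (sharp p Y)"
  by (simp add: teq_def sharp_def)

lemma grad_tcoord:
  assumes "p \<in> MW"
  shows "teq (grad (tcoord i) p) (sharp p (dtcoord p i))"
  unfolding grad_def by (intro sharp_teq differential_eq(1)[OF tcoord_differential[OF assms]])

lemma sharp_triples: "p \<in> MW \<Longrightarrow> X \<in> triples \<Longrightarrow> sharp p X \<in> triples"
  using zwp_analytic[OF MWD(1)] by (auto simp: triples_def sharp_def intro!: analytic_intros)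

lemma tcomb_triples: "(\<And>i. i \<in> A \<Longrightarrow> F i \<in> triples) \<Longrightarrow> tcomb A c F \<in> triples"
  by (auto simp: triples_def tcomb_def intro!: analytic_intros)

lemma tcomb_teq: "(\<And>i. i \<in> A \<Longrightarrow> teq (F i) (G i)) \<Longrightarrow> teq (tcomb A c F) (tcomb A c G)"
  by (auto simp: teq_def tcomb_def)

lemma tcomb_mono_neutral:
  assumes "finite B" "A \<subseteq> B" "\<And>i. i \<in> B - A \<Longrightarrow> c i = 0"
  shows "tcomb A c F = tcomb B c F"
  unfolding tcomb_def using assms by (auto intro!: sum.mono_neutral_left)

lemma tcomb_sharp: "tcomb A c (\<lambda>i. sharp p (F i)) = sharp p (tcomb A c F)"
  by (simp add: tcomb_def sharp_def sum_distrib_left mult_ac)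

text \<open>After multiplication by a power of \<open>w\<close> the relation is a polynomial
  vanishing on the infinite set \<open>w(S^1)\<close>.\<close>

lemma w_powers_independent:
  assumes p: "p \<in> MM" and A: "finite A" and eq: "\<And>z. z \<in> sphere 0 1 \<Longrightarrow> (\<Sum>n\<in>A. c n * wf p z powi n) = 0" and n: "n \<in> A"
  shows "c n = 0"
proof -
  have pW: "p \<in> MW" using p MM_subset_MW by blast
  define N where "N = (\<Sum>n\<in>A. nat \<bar>n\<bar>)"
  define m where "m = (\<lambda>n. nat (n + int N))"
  have m: "int (m i) = i + int N" if "i \<in> A" for i
  proof -
    have "nat \<bar>i\<bar> \<le> N" unfolding N_def by (rule member_le_sum) (use that A in auto)
    then have "0 \<le> i + int N" by linarith
    then show ?thesis by (simp add: m_def)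
  qed
  define P where "P = (\<Sum>n\<in>A. monom (c n) (m n))"
  have "poly P (wf p z) = 0" if z: "z \<in> sphere 0 1" for z
  proof -
    have w: "wf p z \<noteq> 0" by (rule MWD(6)[OF pW z])
    have "wf p z powi n * wf p z ^ N = wf p z ^ m n" if "n \<in> A" for n
      unfolding power_int_of_nat[symmetric] power_int_add[OF disjI1[OF w], symmetric] m[OF that] ..
    then have "poly P (wf p z) = (\<Sum>n\<in>A. c n * wf p z powi n) * wf p z ^ N"
      by (simp add: P_def poly_sum poly_monom sum_distrib_right mult.assoc)
    then show ?thesis using eq[OF z] by simp
  qed
  then have "wf p ` sphere 0 1 \<subseteq> {w. poly P w = 0}" by auto
  then have "P = 0" using poly_roots_finite[of P] wf_image_infinite[OF p] finite_subset by blast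
  then have "0 = coeff P (m n)" by simp
  also have "\<dots> = (\<Sum>k\<in>A. if k = n then c n else 0)"
    unfolding P_def coeff_sum coeff_monom
  proof (rule sum.cong[OF refl])
    fix k assume "k \<in> A"
    then show "(if m k = m n then c k else 0) = (if k = n then c n else 0)" using m[of k] m[OF n] by auto
  qed
  also have "\<dots> = c n" using A n by simp
  finally show ?thesis by simp
qed

lemma flat_gradients_independent:
  assumes p: "p \<in> MM" and A: "finite A" and z: "teq (tcomb A c (\<lambda>i. grad (tcoord i) p)) tzero" and i: "i \<in> A"
  shows "c i = 0"
proof -
  have pW: "p \<in> MW" using p MM_subset_MW by blast
  have "teq (tcomb A c (\<lambda>i. sharp p (dtcoord p i))) (tcomb A c (\<lambda>i. grad (tcoord i) p))"
    by (intro tcomb_teq teq_sym[OF grad_tcoord[OF pW]])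
  note t = teq_trans[OF this z]
  have pick: "(\<Sum>i\<in>A. c i * f i) = (if k \<in> A then c k else 0)" if "\<And>i. f i = (if i = k then 1 else 0)" for f k
  proof -
    have "(\<Sum>i\<in>A. c i * f i) = (\<Sum>i\<in>A. if i = k then c k else 0)" by (rule sum.cong) (auto simp: that)
    then show ?thesis using A by simp
  qed
  have cv: "cv (sharp p (dtcoord p i)) = (if i = Iu then 1 else 0)" for i by (cases i) (auto simp: sharp_def)
  have cu: "cu (sharp p (dtcoord p i)) = (if i = Iv then 1 else 0)" for i by (cases i) (auto simp: sharp_def)
  have "(\<Sum>i\<in>A. c i * cv (sharp p (dtcoord p i))) = 0" "(\<Sum>i\<in>A. c i * cu (sharp p (dtcoord p i))) = 0"
    using t unfolding teq_def tcomb_def tzero_def triple.sel by blast+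
  then have uv: "Iu \<in> A \<Longrightarrow> c Iu = 0" "Iv \<in> A \<Longrightarrow> c Iv = 0"
    unfolding pick[of "\<lambda>i. cv (sharp p (dtcoord p i))", OF cv] pick[of "\<lambda>i. cu (sharp p (dtcoord p i))", OF cu] by simp_all
  \<comment> \<open>The gradient with index \<open>a\<close> involves the power of \<open>w\<close>
    with exponent \<open>- a - 1\<close>; reindexing by \<open>n = - 1 - a\<close> displays the sum
    as a Laurent polynomial in \<open>w\<close>.\<close>
  define B where "B = {n. Ix (- 1 - n) \<in> A}"
  have inj: "inj_on (\<lambda>n. Ix (- 1 - n)) B" by (rule inj_onI) simp
  have B: "finite B" by (rule finite_imageD[OF finite_subset[OF _ A] inj]) (auto simp: B_def)
  have s: "(\<Sum>n\<in>B. c (Ix (- 1 - n)) * wf p z powi n) = 0" if z: "z \<in> sphere 0 1" for z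
  proof -
    have "0 = (\<Sum>i\<in>A. c i * fn (sharp p (dtcoord p i)) z)"
      using t z unfolding teq_def tcomb_def tzero_def triple.sel by simp
    also have "\<dots> = (\<Sum>i\<in>(\<lambda>n. Ix (- 1 - n)) ` B. c i * fn (sharp p (dtcoord p i)) z)"
    proof (rule sum.mono_neutral_right[OF A])
      show "\<forall>i\<in>A - (\<lambda>n. Ix (- 1 - n)) ` B. c i * fn (sharp p (dtcoord p i)) z = 0"
      proof
        fix i assume i: "i \<in> A - (\<lambda>n. Ix (- 1 - n)) ` B"
        show "c i * fn (sharp p (dtcoord p i)) z = 0"
        proof (cases i)
          case (Ix a)
          then have "- 1 - a \<in> B" "i = Ix (- 1 - (- 1 - a))" using i by (auto simp: B_def)
          then show ?thesis using i by blast
        qed (auto simp: sharp_def)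
      qed
    qed (auto simp: B_def)
    also have "\<dots> = - zwp p z * (\<Sum>n\<in>B. c (Ix (- 1 - n)) * wf p z powi n)"
      unfolding sum.reindex[OF inj] by (simp add: sharp_def sum_distrib_left mult_ac sum_negf)
    finally show ?thesis using MM_deriv_nonzero(2)[OF p z] by simp
  qed
  have "c (Ix a) = 0" if "Ix a \<in> A" for a
    using w_powers_independent[OF p B s, of "- 1 - a"] that by (simp add: B_def)
  with uv i show ?thesis by (cases i) auto
qed

text \<open>Uniqueness of coordinates in the span of the flat gradients makes the coefficient choice
  inside \<open>Theta\<close> unambiguous.\<close>

lemma flatvec_unique:
  assumes p: "p \<in> MM" and f: "finite {i. c i \<noteq> 0}" "finite {i. c' i \<noteq> 0}" and t: "teq (flatvec p c) (flatvec p c')"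
  shows "c = c'"
proof
  fix i
  let ?A = "{i. c i \<noteq> 0} \<union> {i. c' i \<noteq> 0}"
  have A: "finite ?A" using f by simp
  have "flatvec p c = tcomb ?A c (\<lambda>i. grad (tcoord i) p)" "flatvec p c' = tcomb ?A c' (\<lambda>i. grad (tcoord i) p)"
    unfolding flatvec_def by (rule tcomb_mono_neutral[OF A]; auto)+
  with t have "teq (tcomb ?A (\<lambda>i. c i - c' i) (\<lambda>i. grad (tcoord i) p)) tzero"
    by (simp add: teq_def tcomb_def tzero_def left_diff_distrib sum_subtractf)
  from flat_gradients_independent[OF p A this, of i] show "c i = c' i" by (cases "i \<in> ?A") auto
qed

section \<open>The analytic factor of the fundamental matrix\<close>

fun raise_idx :: "idx \<Rightarrow> idx" where
  "raise_idx (Ix a) = Ix (- 1 - a)"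
| "raise_idx Iv = Iu"
| "raise_idx Iu = Iv"

lemma raised_eq: "raised y i = y (raise_idx i)"
  by (cases i) auto

text \<open>The coefficients of \<open>ycoord_coef\<close> after removal of the powers of
  \<open>\<zeta>\<close> and of the logarithmic term.\<close>

fun theta_coef :: "idx \<Rightarrow> coef" where
  "theta_coef (Ix a) = (if a = -1 then Coef 0 (-1) (-1) 0 0 else Coef (a + 1) (- 1 / of_int (a + 1)) 0 0 0)"
| "theta_coef Iv = Coef 0 0 (-1) 1 0"
| "theta_coef Iu = Coef 0 0 0 0 1"

text \<open>Defined by the explicit form and not as a gradient of \<open>theta\<close>: the quotient
  in \<open>theta Iu\<close> is \<open>0\<close> at \<open>\<zeta> = 0\<close> by convention instead
  of its limit, whereas \<open>flatP\<close> and \<open>flatQ\<close> contain no division by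
  \<open>x\<close> and are regular there.\<close>

definition Theta_column :: "pt \<Rightarrow> idx \<Rightarrow> complex \<Rightarrow> triple" where
  "Theta_column p i \<zeta> = sharp p (flat_form p (theta_coef (raise_idx i)) \<zeta>)"

text \<open>Given on the flat gradients and extended linearly through the coordinates of
  \<open>X\<close>; outside their span the chosen coefficients are arbitrary.\<close>

definition Theta :: "pt \<Rightarrow> complex \<Rightarrow> triple \<Rightarrow> triple" where
  "Theta p \<zeta> X = (let c = SOME c. finite {i. c i \<noteq> 0} \<and> teq X (flatvec p c)
     in tcomb {i. c i \<noteq> 0} c (\<lambda>i. Theta_column p i \<zeta>))"

lemma Theta_column_triples: "p \<in> MW \<Longrightarrow> Theta_column p i \<zeta> \<in> triples"
  unfolding Theta_column_def by (intro sharp_triples flat_form_triples)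

lemma Theta_flatvec:
  assumes p: "p \<in> MM" and c: "finite {i. c i \<noteq> 0}" "teq X (flatvec p c)"
  shows "Theta p \<zeta> X = tcomb {i. c i \<noteq> 0} c (\<lambda>i. Theta_column p i \<zeta>)"
proof -
  have "(SOME c. finite {i. c i \<noteq> 0} \<and> teq X (flatvec p c)) = c"
  proof (rule some_equality)
    show "c' = c" if "finite {i. c' i \<noteq> 0} \<and> teq X (flatvec p c')" for c'
      using flatvec_unique[OF p] that c teq_trans teq_sym by blast
  qed (use c in blast)
  then show ?thesis by (simp add: Theta_def Let_def)
qed

lemma Theta_grad:
  assumes p: "p \<in> MM"
  shows "Theta p \<zeta> (grad (tcoord i) p) = Theta_column p i \<zeta>"
proof -
  let ?c = "\<lambda>j. if j = i then 1 else (0 :: complex)"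
  have s: "{j. ?c j \<noteq> 0} = {i}" by auto
  have "flatvec p ?c = grad (tcoord i) p" unfolding flatvec_def s by (simp add: tcomb_def)
  then have "teq (grad (tcoord i) p) (flatvec p ?c)" by (simp add: teq_def)
  from Theta_flatvec[OF p _ this, of \<zeta>] show ?thesis unfolding s by (simp add: tcomb_def)
qed

lemma Theta_linear:
  assumes p: "p \<in> MM"
  shows "linear_on_flat p (Theta p \<zeta>)"
  unfolding linear_on_flat_def Theta_grad[OF p]
proof (intro allI ballI impI)
  have pW: "p \<in> MW" using p MM_subset_MW by blast
  fix c X assume c: "finite {i. c i \<noteq> 0}" "teq X (flatvec p c)"
  show "Theta p \<zeta> X \<in> triples \<and> teq (Theta p \<zeta> X) (tcomb {i. c i \<noteq> 0} c (\<lambda>i. Theta_column p i \<zeta>))"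
    unfolding Theta_flatvec[OF p c] by (intro conjI tcomb_triples Theta_column_triples pW) (simp add: teq_def)
qed

text \<open>At \<open>\<zeta> = 0\<close> the difference \<open>Q - P\<close> is the constant
  \<open>kU\<close>. The two truncations therefore recombine to \<open>P\<close>, the coefficient of
  \<open>z\<close> in \<open>Q - P\<close> vanishes, and the scalar components reduce to
  \<open>kU\<close> and \<open>k2\<close>.\<close>

lemma flat_form_at_0:
  assumes p: "p \<in> MW"
  shows "teq (flat_form p (theta_coef (raise_idx i)) 0) (dtcoord p i)"
proof -
  let ?k = "theta_coef (raise_idx i)"
  have w: "lam p z + lamb p z = wf p z" if "z \<in> sphere 0 1" for z by (rule lam_add_lamb[OF MWD(1)[OF p] that])
  have PQ: "flatP_at p ?k 0 z = fn (dtcoord p i) z" "flatQ_at p ?k 0 z = fn (dtcoord p i) z + cv (dtcoord p i)"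
    if z: "z \<in> sphere 0 1" for z
  proof -
    have "flatP_at p ?k 0 z = fn (dtcoord p i) z \<and> flatQ_at p ?k 0 z = fn (dtcoord p i) z + cv (dtcoord p i)"
    proof (cases i)
      case (Ix a)
      show ?thesis
      proof (cases "a = 0")
        case True
        then have k: "?k = Coef 0 (-1) (-1) 0 0" by (simp add: Ix)
        show ?thesis unfolding k flatP_at_def flatQ_at_def flatP_def flatQ_def coef.sel w[OF z]
          by (simp add: Ix True power_int_minus inverse_eq_divide)
      next
        case False
        then have k: "?k = Coef (- a) (1 / of_int a) 0 0 0" by (simp add: Ix)
        have "complex_of_int a \<noteq> 0" using False by simp
        then show ?thesis unfolding k flatP_at_def flatQ_at_def flatP_def flatQ_def coef.sel w[OF z] expo_mid_def
          by (simp add: Ix)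
      qed
    qed (auto simp: flatP_at_def flatQ_at_def flatP_def flatQ_def expo_mid_def)
    then show "flatP_at p ?k 0 z = fn (dtcoord p i) z" "flatQ_at p ?k 0 z = fn (dtcoord p i) z + cv (dtcoord p i)" by auto
  qed
  have t: "dtcoord p i \<in> triples" using tcoord_differential[OF p] by (simp add: is_differential_def)
  have k2: "k2 ?k = cu (dtcoord p i)" by (cases i) auto
  have m: "cmean (\<lambda>z. c / z) = 0" for c :: complex
  proof -
    have "(\<lambda>z. z) holomorphic_on ball 0 2" by (intro holomorphic_intros)
    from cmean_holomorphic[OF this] have "cmean (\<lambda>z. z) = 0" by simp
    then have "cmean (\<lambda>z. 1 / z) = 0" using cmean_invert[of "\<lambda>z. z"] by (simp add: continuous_on_id)
    then show ?thesis using cmean_cmult[of c "\<lambda>z. 1 / z"] by simp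
  qed
  have "cv (flat_form p ?k 0) = cmean (\<lambda>z. cv (dtcoord p i))" "cmean (\<lambda>z. (flatQ_at p ?k 0 z - flatP_at p ?k 0 z) / z) = cmean (\<lambda>z. cv (dtcoord p i) / z)"
    unfolding flat_form_def trunc_form_def triple.sel by (rule cmean_cong, simp add: PQ)+
  moreover have "fn (flat_form p ?k 0) z = fn (dtcoord p i) z" if z: "z \<in> sphere 0 1" for z
  proof -
    have a: "fn (dtcoord p i) analytic_on sphere 0 1" using t by (simp add: triples_def)
    have "plus_part (\<lambda>z. 1 * fn (dtcoord p i) z + cv (dtcoord p i) * 1) z = 1 * plus_part (fn (dtcoord p i)) z + cv (dtcoord p i) * plus_part (\<lambda>z. 1) z"
      by (rule plus_part_lin[OF a _ z]) (intro analytic_intros)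
    then have "plus_part (\<lambda>z. fn (dtcoord p i) z + cv (dtcoord p i)) z = plus_part (fn (dtcoord p i)) z + cv (dtcoord p i)"
      using plus_part_in[OF extends_in_const z] by simp
    then show ?thesis
      using PQ[OF z] plus_part_cong[of "flatP_at p ?k 0" "fn (dtcoord p i)", OF PQ(1), of z]
        plus_part_cong[of "flatQ_at p ?k 0" "\<lambda>z. fn (dtcoord p i) z + cv (dtcoord p i)", OF PQ(2), of z]
      by (simp add: flat_form_def trunc_form_def)
  qed
  ultimately show ?thesis using k2 m by (simp add: teq_def) (simp add: flat_form_def trunc_form_def)
qed

lemma Theta_column_at_0: "p \<in> MW \<Longrightarrow> teq (Theta_column p i 0) (grad (tcoord i) p)"
  unfolding Theta_column_def by (intro teq_trans[OF sharp_teq[OF flat_form_at_0] teq_sym[OF grad_tcoord]])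

lemma plus_part_holomorphic:
  assumes f: "f holomorphic_on ann R" and r: "1 < r" "r < R"
  shows "plus_part f holomorphic_on ann r"
proof -
  have sub: "sphere 0 r \<subseteq> ann R"
  proof
    fix z :: complex assume "z \<in> sphere 0 r"
    moreover have "1 / R < 1" using r by simp
    then have "1 / R < r" using r(1) by linarith
    ultimately show "z \<in> ann R" using r by (simp add: ann_def)
  qed
  have "cauchy_r r f holomorphic_on ball 0 r"
    by (rule cauchy_r_holomorphic[OF continuous_on_subset[OF holomorphic_on_imp_continuous_on[OF f] sub]]) (use r in simp)
  then have "cauchy_r r f holomorphic_on ann r" by (rule holomorphic_on_subset) (auto simp: ann_def)
  then show ?thesis
    by (rule holomorphic_transform) (use ltrunc_eq_cauchy_r[OF f r] in \<open>auto simp: ann_def\<close>)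
qed

text \<open>The radius \<open>1\<close> is arbitrary, as the columns are entire in
  \<open>\<zeta>\<close>. One annulus \<open>ann r\<close> serves all \<open>\<zeta>\<close>,
  because there the truncations are Cauchy integrals over the fixed circle of radius
  \<open>r\<close>.\<close>

lemma Theta_column_curve:
  assumes p: "p \<in> MW"
  shows "analytic_curve 1 (Theta_column p i)"
proof -
  obtain R where R: "regular_ann p R" and zw: "zwp p holomorphic_on ann R"
    by (rule MW_regular_ann[OF p, of "[zwp p]"]) (use zwp_analytic[OF MWD(1)[OF p]] in auto)
  have R1: "1 < R" using R by (simp add: regular_ann_def)
  then obtain r where r: "1 < r" "r < R" using dense by blast
  let ?k = "theta_coef (raise_idx i)"
  have d: "((\<lambda>e. c) has_field_derivative 0) (at e)" for c e :: complex by simp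
  have P: "\<exists>P'. fam (UNIV \<times> ann R) (\<lambda>e. flatP_at p ?k e) P'" and Q: "\<exists>Q'. fam (UNIV \<times> ann R) (\<lambda>e. flatQ_at p ?k e) Q'"
    using fam_flatP[OF logfam_const[OF R] DERIV_ident d d d d, of "deg ?k" "kG ?k" "k1 ?k" "k2 ?k" "kU ?k"]
      fam_flatQ[OF logfam_const[OF R] DERIV_ident d d d d, of "deg ?k" "kG ?k" "k1 ?k" "k2 ?k" "kU ?k"]
    unfolding coef.collapse flatP_at_def flatQ_at_def by blast+
  then obtain P' Q' where P: "fam (UNIV \<times> ann R) (\<lambda>e. flatP_at p ?k e) P'" and Q: "fam (UNIV \<times> ann R) (\<lambda>e. flatQ_at p ?k e) Q'"
    by blast
  have sph: "{\<zeta>} \<times> sphere 0 1 \<subseteq> UNIV \<times> ann R" for \<zeta> :: complex using sphere_subset_ann[OF R1] by auto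
  have hol: "f holomorphic_on A" if "\<And>\<zeta>. (f has_field_derivative f' \<zeta>) (at \<zeta>)" for f f' A
    using that by (meson holomorphic_onI field_differentiable_def field_differentiable_at_within)
  have PQ: "flatP_at p ?k \<zeta> holomorphic_on ann R" "flatQ_at p ?k \<zeta> holomorphic_on ann R" for \<zeta>
    using famD(5)[OF P, of \<zeta>] famD(5)[OF Q, of \<zeta>] by simp_all
  have sub: "ann r \<subseteq> ann R" using ann_mono[of r R] r by simp
  let ?G = "\<lambda>z \<zeta>. zwp p z * (plus_part (flatP_at p ?k \<zeta>) z + (flatQ_at p ?k \<zeta> z - plus_part (flatQ_at p ?k \<zeta>) z))"
  show ?thesis
    unfolding analytic_curve_def
  proof (intro conjI exI[of _ "ann r"] exI[of _ ?G] ballI)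
    show "sphere 0 1 \<subseteq> ann r" by (rule sphere_subset_ann[OF r(1)])
    show "(\<lambda>z. ?G z \<zeta>) holomorphic_on ann r" for \<zeta>
      by (intro holomorphic_intros plus_part_holomorphic[OF _ r] PQ holomorphic_on_subset[OF zw sub]
          holomorphic_on_subset[OF PQ(2) sub])
    show "fn (Theta_column p i \<zeta>) z = ?G z \<zeta>" for \<zeta> z
      by (simp add: Theta_column_def sharp_def flat_form_def trunc_form_def)
    show "(\<lambda>\<zeta>. ?G z \<zeta>) holomorphic_on ball 0 1" if z: "z \<in> ann r" for z
    proof (rule hol)
      have zr: "norm z < r" using z by (simp add: ann_def)
      have W: "ball \<zeta> 1 \<times> ann R \<subseteq> UNIV \<times> ann R" for \<zeta> :: complex by auto
      show "((\<lambda>\<zeta>. ?G z \<zeta>) has_field_derivative zwp p z * (plus_part (P' \<zeta>) z + (Q' \<zeta> z - plus_part (Q' \<zeta>) z))) (at \<zeta>)" for \<zeta>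
        by (intro DERIV_cmult DERIV_add DERIV_diff fam_ltrunc_ball[OF P W _ r zr] fam_ltrunc_ball[OF Q W _ r zr] famD(4)[OF Q])
           (use z sub in auto)
    qed
    have "((\<lambda>\<zeta>. exp (uc p) * cmean (\<lambda>z. (flatQ_at p ?k \<zeta> z - flatP_at p ?k \<zeta> z) / z) + k2 ?k) has_field_derivative
        exp (uc p) * cmean (\<lambda>z. (Q' \<zeta> z - P' \<zeta> z) / z) + 0) (at \<zeta>)" for \<zeta>
      unfolding lcoeff_1[symmetric]
      by (intro DERIV_add DERIV_cmult DERIV_const fam_lcoeff_1[OF fam_diff[OF Q P] sph])
    from hol[OF this, of "ball 0 1"] show "(\<lambda>\<zeta>. cv (Theta_column p i \<zeta>)) holomorphic_on ball 0 1"
      by (simp add: Theta_column_def sharp_def flat_form_def trunc_form_def)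
    from hol[OF fam_cmean[OF fam_diff[OF Q P] sph], of "ball 0 1"]
    show "(\<lambda>\<zeta>. cu (Theta_column p i \<zeta>)) holomorphic_on ball 0 1"
      by (simp add: Theta_column_def sharp_def flat_form_def trunc_form_def)
  qed auto
qed

text \<open>The only nonzero entry of \<open>R\<close> sends \<open>\<nabla> t\<^sup>u\<close> to \<open>2 \<nabla> t\<^sup>v\<close>; it produces the term \<open>2 log \<zeta> \<theta>\<^sub>u\<close> of \<open>y\<^sub>v\<close>.\<close>

definition R_levelt :: mat where
  "R_levelt = (\<lambda>i j. if i = Iv \<and> j = Iu then 2 else 0)"

lemma R_levelt_cols: "{k. R_levelt k j \<noteq> 0} = (if j = Iu then {Iv} else {})"
  by (auto simp: R_levelt_def)

lemma mpow_R_levelt: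
  "mpow R_levelt (Suc 0) = R_levelt" "mpow R_levelt (Suc (Suc n)) = (\<lambda>i j. 0)"
proof -
  have d: "{k. (if k = j then 1 else (0::complex)) \<noteq> 0} = {j}" for j :: idx by auto
  show 1: "mpow R_levelt (Suc 0) = R_levelt"
    by (simp add: mmul_def d fun_eq_iff)
  have 2: "mmul R_levelt R_levelt = (\<lambda>i j. 0)"
    unfolding mmul_def R_levelt_cols by (auto simp: R_levelt_def fun_eq_iff)
  have 3: "mmul R_levelt (\<lambda>i j. 0) = (\<lambda>i j. 0)" by (simp add: mmul_def)
  show "mpow R_levelt (Suc (Suc n)) = (\<lambda>i j. 0)"
  proof (induction n)
    case 0
    show ?case using 1 2 by simp
  next
    case (Suc n)
    then show ?case using 3 by simp
  qed
qed

lemma zeta_R_levelt: "zeta_R R_levelt s i j = (if i = j then 1 else 0) + s * R_levelt i j"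
proof -
  have "mpow R_levelt n i j = 0" if "n \<notin> {0, 1}" for n
  proof -
    obtain m where "n = Suc (Suc m)" using \<open>n \<notin> {0, 1}\<close> by (cases n; cases "n - 1") auto
    then show ?thesis using mpow_R_levelt(2) by simp
  qed
  then have "zeta_R R_levelt s i j = (\<Sum>n\<in>{0, 1}. s ^ n / fact n * mpow R_levelt n i j)"
    unfolding zeta_R_def by (intro suminf_finite) auto
  then show ?thesis using mpow_R_levelt(1) by simp
qed

lemma zeta_V_R_levelt:
  "mmul (zeta_V s) (zeta_R R_levelt s) i j = exp (s * mu i) * ((if i = j then 1 else 0) + s * R_levelt i j)"
proof -
  let ?B = "zeta_R R_levelt s"
  have "{k. ?B k j \<noteq> 0} \<subseteq> {j, Iv}"
    unfolding zeta_R_levelt by (auto simp: R_levelt_def split: if_splits)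
  then have "finite {k. ?B k j \<noteq> 0}" by (rule finite_subset) simp
  moreover have "mmul (zeta_V s) ?B i j = (\<Sum>k | ?B k j \<noteq> 0. if k = i then exp (s * mu i) * ?B i j else 0)"
    unfolding mmul_def zeta_V_def by (rule sum.cong) auto
  ultimately show ?thesis by (simp add: zeta_R_levelt)
qed

text \<open>Since \<open>mu Iv - mu Iu = 1\<close>, the matrix is homogeneous of degree one and is
  its own component \<open>R_1\<close>, which must be symmetric. Indeed both pairings are nonzero
  only for \<open>i = j = Iu\<close>, with the value \<open>2\<close>.\<close>

lemma admissible_R_levelt: "admissible_R R_levelt"
  unfolding admissible_R_def
proof (intro conjI exI[of _ 2] exI[of _ "\<lambda>k. if k = 1 then R_levelt else (\<lambda>i j. 0)"] allI impI ballI)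
  show "col_finite R_levelt" by (simp add: col_finite_def R_levelt_cols)
  show "mpow R_levelt 2 i j = 0" for i j using mpow_R_levelt(2)[of 0] by (simp add: numeral_2_eq_2)
  fix k :: nat assume k: "1 \<le> k"
  show "col_finite (if k = 1 then R_levelt else (\<lambda>i j. 0))" by (simp add: col_finite_def R_levelt_cols)
next
  fix i j
  show "((\<lambda>k :: nat. (if k = 1 then R_levelt else (\<lambda>i j. 0)) i j) has_sum R_levelt i j) {1..}"
    by (rule has_sum_finite_neutralI[of "{1}"]) auto
next
  fix k :: nat and s assume k: "1 \<le> k"
  have Vr: "{k. zeta_V t k j \<noteq> 0} = {j}" for t j by (auto simp: zeta_V_def)
  have VR: "mmul (zeta_V s) R_levelt = (\<lambda>i j. exp (s * mu i) * R_levelt i j)"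
    unfolding mmul_def R_levelt_cols by (auto simp: zeta_V_def R_levelt_def fun_eq_iff)
  have "exp (s / 2) * exp (s / 2) = exp s" by (simp flip: exp_add)
  then have "mmul (mmul (zeta_V s) R_levelt) (zeta_V (- s)) = (\<lambda>i j. exp s * R_levelt i j)"
    unfolding VR unfolding mmul_def Vr by (auto simp: zeta_V_def R_levelt_def fun_eq_iff)
  moreover have "mmul (mmul (zeta_V s) (\<lambda>i j. 0)) (zeta_V (- s)) = (\<lambda>i j. 0)" by (simp add: mmul_def)
  ultimately show "mmul (mmul (zeta_V s) (if k = 1 then R_levelt else (\<lambda>i j. 0))) (zeta_V (- s))
      = (\<lambda>i j. exp s ^ k * (if k = 1 then R_levelt else (\<lambda>i j. 0)) i j)" by simp
next
  fix k :: nat and p i j assume k: "1 \<le> k" and p: "p \<in> MM"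
  have pW: "p \<in> MW" using p MM_subset_MW by blast
  have c: "cv (grad (tcoord j) p) = (if j = Iu then 1 else 0)" "cu (grad (tcoord j) p) = (if j = Iv then 1 else 0)" for j
    using grad_tcoord[OF pW, of j] by (cases j; auto simp: teq_def sharp_def)+
  have fv: "fn (grad (tcoord Iv) p) z = 0" if "z \<in> sphere 0 1" for z
    using grad_tcoord[OF pW, of Iv] that by (auto simp: teq_def sharp_def)
  have m: "mat_apply p R_levelt i = (if i = Iu then tscale 2 (grad (tcoord Iv) p) else tzero)" for i
    unfolding mat_apply_def flatvec_def R_levelt_cols by (auto simp: tcomb_def tscale_def tzero_def R_levelt_def)
  have m0: "mat_apply p (\<lambda>i j. 0) i = tzero" for i by (simp add: mat_apply_def flatvec_def tcomb_def tzero_def)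
  have z: "metric p tzero Y = 0" "metric p Y tzero = 0" for Y by (simp_all add: metric_def pair_def tzero_def)
  have l: "metric p (tscale 2 (grad (tcoord Iv) p)) Y = 2 * cv Y" for Y
  proof -
    have "cmean (\<lambda>z. 2 * fn (grad (tcoord Iv) p) z / zwp p z * fn Y z) = cmean (\<lambda>z. 0)"
      by (rule cmean_cong) (simp add: fv)
    then show ?thesis by (simp add: metric_def pair_def tscale_def c)
  qed
  have r: "metric p Y (tscale 2 (grad (tcoord Iv) p)) = 2 * cv Y" for Y
  proof -
    have "cmean (\<lambda>z. fn Y z / zwp p z * (2 * fn (grad (tcoord Iv) p) z)) = cmean (\<lambda>z. 0)"
      by (rule cmean_cong) (simp add: fv)
    then show ?thesis by (simp add: metric_def pair_def tscale_def c)
  qed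
  show "metric p (mat_apply p (if k = 1 then R_levelt else (\<lambda>i j. 0)) i) (grad (tcoord j) p)
      = (if odd k then 1 else - 1) * metric p (grad (tcoord i) p) (mat_apply p (if k = 1 then R_levelt else (\<lambda>i j. 0)) j)"
    by (cases "k = 1") (auto simp: m m0 z l r c)
qed

lemma flat_at_scale:
  "flatP_at p (Coef (deg k) (m * kG k) (m * k1 k) (m * k2 k) (m * kU k)) x z = m * flatP_at p k x z"
  "flatQ_at p (Coef (deg k) (m * kG k) (m * k1 k) (m * k2 k) (m * kU k)) x z = m * flatQ_at p k x z"
  by (simp_all only: flatP_at_def flatQ_at_def flatP_def flatQ_def coef.sel distrib_left mult.assoc)

text \<open>Raising the index \<open>a\<close> to \<open>- 1 - a\<close> turns the exponent of
  \<open>y\<close> into \<open>- a - 1 / 2\<close>, which is \<open>mu\<close>. In column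
  \<open>Iu\<close>, which belongs to \<open>y\<^sub>v\<close>, the entry of \<open>R\<close> adds
  \<open>2 * s * exp (s / 2)\<close> times the column of \<open>Iv\<close>, that is the multiple of
  \<open>\<theta>\<^sub>u\<close>.\<close>

lemma factorization:
  assumes p: "p \<in> MM"
  shows "teq (grad (\<lambda>q. raised ycoord j q s) p) (Theta p (exp s) (mat_apply p (mmul (zeta_V s) (zeta_R R_levelt s)) j))"
proof -
  have pW: "p \<in> MW" using p MM_subset_MW by blast
  define c where "c = (\<lambda>i. mmul (zeta_V s) (zeta_R R_levelt s) i j)"
  let ?x = "exp s" and ?k = "\<lambda>i. theta_coef (raise_idx i)"
  define B where "B = {j, Iv}"
  have B: "finite B" "{i. c i \<noteq> 0} \<subseteq> B"
    unfolding B_def c_def zeta_V_R_levelt by (auto simp: R_levelt_def split: if_splits)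
  have fc: "finite {i. c i \<noteq> 0}" by (rule finite_subset[OF B(2,1)])
  have sum_B: "(\<Sum>i\<in>B. c i * f i) = exp (s * mu j) * f j + (if j = Iu then 2 * s * exp (s / 2) * f Iv else 0)" for f
    unfolding B_def c_def zeta_V_R_levelt by (cases "j = Iv") (auto simp: R_levelt_def)
  have "teq (flatvec p c) (flatvec p c)" by (simp add: teq_def)
  from Theta_flatvec[OF p fc this, of ?x]
  have T: "Theta p ?x (mat_apply p (mmul (zeta_V s) (zeta_R R_levelt s)) j) = sharp p (tcomb B c (\<lambda>i. flat_form p (?k i) ?x))"
    unfolding tcomb_mono_neutral[OF B(1,2), of c, simplified] mat_apply_def c_def[symmetric] Theta_column_def tcomb_sharp .
  have e: "exp (s * mu j) = (case j of Ix a \<Rightarrow> exp ((of_int (- 1 - a) + 1 / 2) * s) | Iv \<Rightarrow> exp (s / 2) | Iu \<Rightarrow> exp (- s / 2))"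
  proof (cases j)
    case (Ix a)
    have "s * (- of_int a - 1 / 2) = (of_int (- 1 - a) + 1 / 2) * s" by (simp add: field_simps)
    then show ?thesis unfolding Ix mu.simps idx.case by (rule arg_cong)
  qed simp_all
  have PQ: "(\<Sum>i\<in>B. c i * flatP_at p (?k i) ?x z) = flatP_at p (ycoord_coef (raise_idx j) s) ?x z"
    "(\<Sum>i\<in>B. c i * flatQ_at p (?k i) ?x z) = flatQ_at p (ycoord_coef (raise_idx j) s) ?x z"
    "(\<Sum>i\<in>B. c i * k2 (?k i)) = k2 (ycoord_coef (raise_idx j) s)" for z
  proof -
    have "(\<Sum>i\<in>B. c i * flatP_at p (?k i) ?x z) = flatP_at p (ycoord_coef (raise_idx j) s) ?x z \<and>
      (\<Sum>i\<in>B. c i * flatQ_at p (?k i) ?x z) = flatQ_at p (ycoord_coef (raise_idx j) s) ?x z \<and> (\<Sum>i\<in>B. c i * k2 (?k i)) = k2 (ycoord_coef (raise_idx j) s)"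
    proof (cases j)
      case (Ix a)
      define m where "m = exp (s * mu j)"
      have m: "m = exp ((of_int (- 1 - a) + 1 / 2) * s)" unfolding m_def e unfolding Ix idx.case ..
      have K: "ycoord_coef (raise_idx j) s = Coef (deg (?k j)) (m * kG (?k j)) (m * k1 (?k j)) (m * k2 (?k j)) (m * kU (?k j))"
        unfolding Ix m by (cases "a = 0") simp_all
      have "j \<noteq> Iu" using Ix by simp
      then show ?thesis unfolding sum_B m_def[symmetric] K flat_at_scale coef.sel by (simp only: if_False add_0_right simp_thms)
    next
      case Iv
      then show ?thesis unfolding sum_B e by (simp add: flatP_at_def flatQ_at_def flatP_def flatQ_def)
    next
      case Iu
      show ?thesis using Iu unfolding sum_B e by (simp add: flatP_at_def flatQ_at_def flatP_def flatQ_def algebra_simps)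
    qed
    then show "(\<Sum>i\<in>B. c i * flatP_at p (?k i) ?x z) = flatP_at p (ycoord_coef (raise_idx j) s) ?x z"
      "(\<Sum>i\<in>B. c i * flatQ_at p (?k i) ?x z) = flatQ_at p (ycoord_coef (raise_idx j) s) ?x z" "(\<Sum>i\<in>B. c i * k2 (?k i)) = k2 (ycoord_coef (raise_idx j) s)"
      by blast+
  qed
  have "teq (tcomb B c (\<lambda>i. flat_form p (?k i) ?x)) (flat_form p (ycoord_coef (raise_idx j) s) ?x)"
    using trunc_form_sum[OF B(1), of "\<lambda>i. flatP_at p (?k i) ?x" "\<lambda>i. flatQ_at p (?k i) ?x" c p "\<lambda>i. k2 (?k i)"]
      flat_at_analytic[OF pW] unfolding PQ flat_form_def by blast
  then have "teq (sharp p (flat_form p (ycoord_coef (raise_idx j) s) ?x)) (sharp p (tcomb B c (\<lambda>i. flat_form p (?k i) ?x)))"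
    by (rule sharp_teq[OF teq_sym])
  moreover have "teq (grad (\<lambda>q. raised ycoord j q s) p) (sharp p (flat_form p (ycoord_coef (raise_idx j) s) ?x))"
    unfolding raised_eq grad_def by (intro sharp_teq differential_eq(1)[OF ycoord_differential[OF pW]])
  ultimately show ?thesis unfolding T by (rule teq_trans[rotated])
qed

text \<open>Apart from \<open>Iu\<close> the integrands are entire in \<open>\<zeta>\<close>, and so
  are their means. For \<open>Iu\<close> the statement excludes the point \<open>0\<close> itself,
  where the quotient by \<open>\<zeta>\<close> takes a conventional value.\<close>

lemma theta_analytic:
  assumes p: "p \<in> MW"
  shows "\<exists>g. g analytic_on {0} \<and> (\<forall>\<^sub>F \<zeta> in at 0. theta i p \<zeta> = g \<zeta>)"
proof -
  obtain R where R: "regular_ann p R" using MW_regular_ann[OF p, of "[]"] by auto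
  have R1: "1 < R" using R by (simp add: regular_ann_def)
  have sph: "{\<zeta>} \<times> sphere 0 1 \<subseteq> UNIV \<times> ann R" for \<zeta> :: complex using sphere_subset_ann[OF R1] by auto
  note L = logfam_const[OF R]
  have entire: "(\<lambda>\<zeta>. cmean (F \<zeta>)) analytic_on UNIV" if "fam (UNIV \<times> ann R) F F'" for F F'
    unfolding analytic_on_open[OF open_UNIV]
    using fam_cmean[OF that sph] by (meson holomorphic_onI field_differentiable_def field_differentiable_at_within)
  have fixed: "fam (UNIV \<times> ann R) (\<lambda>e. g) (\<lambda>e z. 0)" if "g holomorphic_on ann R" for g
    by (rule fam_fixed[OF that]) (auto intro!: open_Times)
  note lb1 = fam_log_block1[OF L DERIV_ident, unfolded log_block1_def]
  note lb2 = fam_log_block2[OF L DERIV_ident, unfolded log_block2_def]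
  note mid = fam_expo_mid[OF L DERIV_ident, unfolded expo_mid_def]
  note eb = fam_expb[OF L DERIV_ident]
  have triv: ?thesis if "theta i p analytic_on UNIV"
    using analytic_on_subset[OF that, of "{0}"] by (intro exI[of _ "theta i p"]) auto
  show ?thesis
  proof (cases i)
    case (Ix a)
    show ?thesis
    proof (cases "a = -1")
      case True
      have "(\<lambda>\<zeta>. - cmean (\<lambda>z. exp (- lam p z * \<zeta>) * (log1 p z + Ein (- lam p z * \<zeta>) - 1)
          + exp ((lamb p z - lam p z) / 2 * \<zeta>))) analytic_on UNIV"
        by (intro analytic_on_neg entire[OF fam_add[OF lb1 mid]])
      then have "theta i p analytic_on UNIV" unfolding Ix True theta.simps by (simp add: eta_contract_eq)
      then show ?thesis by (rule triv)
    next
      case False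
      have w: "(\<lambda>z. (lam p z + lamb p z) powi (a + 1) / of_int (a + 1)) holomorphic_on ann R"
        using R by (auto simp: regular_ann_def intro!: holomorphic_intros)
      have "(\<lambda>\<zeta>. - cmean (\<lambda>z. (lam p z + lamb p z) powi (a + 1) / of_int (a + 1) * exp ((lamb p z - lam p z) / 2 * \<zeta>))) analytic_on UNIV"
        by (intro analytic_on_neg entire[OF fam_mult[OF fixed[OF w] mid]])
      then have "theta i p analytic_on UNIV" using False unfolding Ix theta.simps by simp
      then show ?thesis by (rule triv)
    qed
  next
    case Iv
    have "(\<lambda>\<zeta>. cmean (\<lambda>z. - (exp (- lam p z * \<zeta>) * (log1 p z + Ein (- lam p z * \<zeta>) - 1))
          + exp (lamb p z * \<zeta>) * (log2 p z - Ein (lamb p z * \<zeta>) - 1))) analytic_on UNIV"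
      by (rule entire[OF fam_add[OF fam_uminus[OF lb1] lb2]])
    then have "theta i p analytic_on UNIV" unfolding Iv theta.simps by simp
    then show ?thesis by (rule triv)
  next
    case Iu
    let ?h = "\<lambda>\<zeta>. cmean (\<lambda>z. exp (lamb p z * \<zeta>))"
    have h: "?h holomorphic_on UNIV" using entire[OF eb] analytic_on_open[OF open_UNIV] by blast
    \<comment> \<open>The difference quotient at \<open>0\<close> of the entire mean of
      \<open>exp (lamb * \<zeta>)\<close>, completed by the derivative; its subtracted value
      \<open>?h 0\<close> is the mean of \<open>1\<close>.\<close>
    define g where "g = (\<lambda>\<zeta>. if \<zeta> = 0 then deriv ?h 0 else (?h \<zeta> - ?h 0) / (\<zeta> - 0))"
    have "g holomorphic_on UNIV" unfolding g_def by (rule pole_lemma_open[OF h open_UNIV])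
    then have "g analytic_on {0}" by (metis analytic_on_open analytic_on_subset open_UNIV subset_UNIV)
    moreover have "theta i p \<zeta> = g \<zeta>" if "\<zeta> \<noteq> 0" for \<zeta>
    proof -
      have c: "continuous_on (sphere 0 1) (lamb p)"
        by (intro analytic_imp_continuous_sphere lam_analytic MWD(1)[OF p])
      have "cmean (\<lambda>z. 1 / \<zeta> * (exp (lamb p z * \<zeta>) - 1)) = 1 / \<zeta> * (?h \<zeta> - 1)"
        unfolding cmean_cmult
        by (subst cmean_diff) (auto intro!: continuous_intros c)
      then show ?thesis using that by (simp add: Iu g_def)
    qed
    then have "\<forall>\<^sub>F \<zeta> in at 0. theta i p \<zeta> = g \<zeta>" by (simp add: eventually_at_filter)
    ultimately show ?thesis by blast
  qed
qed

theorem mainTheorem2: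
  shows "(\<forall>i. \<forall>p\<in>MM. \<exists>g. g analytic_on {0} \<and> (\<forall>\<^sub>F \<zeta> in at 0. theta i p \<zeta> = g \<zeta>)) \<and>
    levelt_basis ycoord"
proof (intro conjI allI ballI)
  show "\<exists>g. g analytic_on {0} \<and> (\<forall>\<^sub>F \<zeta> in at 0. theta i p \<zeta> = g \<zeta>)" if "p \<in> MM" for i p
    using theta_analytic that MM_subset_MW by blast
  show "levelt_basis ycoord"
    unfolding levelt_basis_def
  proof (intro conjI exI[of _ R_levelt] exI[of _ Theta] ballI allI)
    show "deformed_flat_coordinates ycoord"
      unfolding deformed_flat_coordinates_def using ycoord_deformed_flat dform_independent by blast
    show "admissible_R R_levelt" by (rule admissible_R_levelt)
    fix p assume p: "p \<in> MM"
    then have pW: "p \<in> MW" using MM_subset_MW by blast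
    show "linear_on_flat p (Theta p \<zeta>)" for \<zeta> by (rule Theta_linear[OF p])
    show "\<exists>r>0. \<forall>i. analytic_curve r (\<lambda>\<zeta>. Theta p \<zeta> (grad (tcoord i) p))"
      unfolding Theta_grad[OF p] using Theta_column_curve[OF pW] zero_less_one by blast
    show "teq (Theta p 0 (grad (tcoord i) p)) (grad (tcoord i) p)" for i
      unfolding Theta_grad[OF p] by (rule Theta_column_at_0[OF pW])
    show "teq (grad (\<lambda>q. raised ycoord j q s) p) (Theta p (exp s) (mat_apply p (mmul (zeta_V s) (zeta_R R_levelt s)) j))" for s j
      by (rule factorization[OF p])
  qed
qed

end
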